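(* Let $M\subset\mathbb{R}^n$ be open, let $(\mu,\sigma)$ be an SDE on $M$ driven by an $m$-dimensional Brownian motion, let $\Psi:M\to M'$ be a reduction map, and let $\{Y_1,\dots,Y_k\}$ be a set of reduction vector fields for $\Psi$. Let $C_1,\dots,C_k:M\to so(m)$ be smooth functions such that $(Y_1,C_1,0),\dots,(Y_k,C_k,0)$ are quasi-strong (infinitesimal) symmetries of $(\mu,\sigma)$. If $$\nabla(\Psi)\cdot\sigma\cdot C_i=0\qquad\text{for all } i=1,\dots,k,$$ then there exists a unique SDE $(\mu',\sigma')$ on $M'$ such that $$L(\Psi)=\mu'\circ\Psi,\qquad \nabla(\Psi)\cdot\sigma=\sigma'\circ\Psi,$$ where $L$ is the infinitesimal generator of $(\mu,\sigma)$. Furthermore, if $(X,W)$ is a solution to $(\mu,\sigma)$, then $(\Psi(X),W)$ is a solution to $(\mu',\sigma')$.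
   Context: All functions, matrix-valued functions and vector fields are smooth. $\mathrm{Mat}(n,m)$ denotes real $n\times m$ matrices, $so(m)$ the antisymmetric $m\times m$ matrices. For $\Psi:M\to\mathbb{R}^h$, $(\nabla(\Psi))^i_j=\partial_j\Psi^i$ is the Jacobian matrix. Vector fields are identified with $\mathbb{R}^n$-valued functions and $Y(A)$ denotes entrywise application of the derivation $Y$ to a (vector- or matrix-valued) function $A$. SDE: a pair of smooth functions $\mu:M\to\mathbb{R}^n$, $\sigma:M\to\mathrm{Mat}(n,m)$. A process $(X,W)$, with $X$ a process on $M$ and $W$ an $m$-dimensional Brownian motion, both adapted to a given filtration, solves (in the weak sense) $(\mu,\sigma)$ until the stopping time $\tau$ (taken strictly less than the explosion time) if $X^i_{t\wedge\tau}-X^i_0=\int_0^{t\wedge\tau}\mu^i(X_s)ds+\int_0^{t\wedge\tau}\sum_{\alpha=1}^m\sigma^i_\alpha(X_s)dW^\alpha_s$ for all $t\ge0$ (Ito integrals). Its infinitesimal generator is $L=\frac12\sum_{\alpha=1}^m\sum_{i,j=1}^n\sigma^i_\alpha\sigma^j_\alpha\partial_{ij}+\sum_{i=1}^n\mu^i\partial_i$, applied componentwise to vector-valued functions. Reduction map: a surjective submersion $\Psi:M\to M'$, with $M'$ an open subset of $\mathbb{R}^{n-r}$, having connected level sets. Reduction vector fields for $\Psi$: vector fields $Y_1,\dots,Y_k$ generating an integrable distribution of constant rank $r$ such that $\mathrm{span}\{Y_1(x),\dots,Y_k(x)\}=\ker\nabla(\Psi)(x)$ for all $x\in M$. Infinitesimal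 symmetry: an infinitesimal stochastic transformation is a triad $(Y,C,\tau)$ with $Y$ a vector field on $M$, $C:M\to so(m)$ and $\tau:M\to\mathbb{R}$ smooth. It is quasi-strong if $\tau=0$ and strong if $C=0$ and $\tau=0$. It is a symmetry of $(\mu,\sigma)$ if $$[Y,\sigma]=-\tfrac12\tau\sigma-\sigma\cdot C,\qquad Y(\mu)-L(Y)=-\tau\mu,$$ where $[Y,\sigma]^i_\alpha=\sum_{k=1}^n(Y^k\partial_k\sigma^i_\alpha-\sigma^k_\alpha\partial_kY^i)$. *)

theory Defs
  imports "HOL-Probability.Probability"
begin

section \<open>Smooth maps\<close>

primrec C_k_on :: "nat \<Rightarrow> 'a::real_normed_vector set \<Rightarrow> ('a \<Rightarrow> 'b::real_normed_vector) \<Rightarrow> bool" where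
  "C_k_on 0 S f \<longleftrightarrow> continuous_on S f"
| "C_k_on (Suc k) S f \<longleftrightarrow>
     (\<forall>x\<in>S. f differentiable (at x)) \<and> (\<forall>v. C_k_on k S (\<lambda>x. frechet_derivative f (at x) v))"

text \<open>Only meant for open \<open>S\<close>: the derivatives are taken at \<open>x\<close>, not within \<open>S\<close>.\<close>

definition smooth_on :: "'a::real_normed_vector set \<Rightarrow> ('a \<Rightarrow> 'b::real_normed_vector) \<Rightarrow> bool" where
  "smooth_on S f \<longleftrightarrow> (\<forall>k. C_k_on k S f)"

definition partial :: "'n::finite \<Rightarrow> (real^'n \<Rightarrow> 'b::real_normed_vector) \<Rightarrow> real^'n \<Rightarrow> 'b" where
  "partial i f x = frechet_derivative f (at x) (axis i 1)"

text \<open>\<open>real^'m^'n\<close> is \<open>Mat(n,m)\<close>, with \<open>A $ i $ \<alpha>\<close> the entry in row \<open>i\<close> and column \<open>\<alpha>\<close>. The matrix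
  \<open>\<nabla>(\<Psi>)(x)\<close> is the library's \<open>jacobian \<Psi> (at x)\<close>.\<close>

section \<open>SDEs, generators and infinitesimal symmetries\<close>

definition is_SDE ::
  "(real^'n::finite) set \<Rightarrow> (real^'n \<Rightarrow> real^'n) \<Rightarrow> (real^'n \<Rightarrow> real^'m::finite^'n) \<Rightarrow> bool" where
  "is_SDE M \<mu> \<sigma> \<longleftrightarrow> smooth_on M \<mu> \<and> smooth_on M \<sigma>"

definition generator ::
  "(real^'n::finite \<Rightarrow> real^'n) \<Rightarrow> (real^'n \<Rightarrow> real^'m::finite^'n)
     \<Rightarrow> (real^'n \<Rightarrow> 'b::real_normed_vector) \<Rightarrow> real^'n \<Rightarrow> 'b" where
  "generator \<mu> \<sigma> f x =
     (1/2) *\<^sub>R (\<Sum>\<alpha>\<in>UNIV. \<Sum>i\<in>UNIV. \<Sum>j\<in>UNIV.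
                (\<sigma> x $ i $ \<alpha> * \<sigma> x $ j $ \<alpha>) *\<^sub>R partial i (partial j f) x)
     + (\<Sum>i\<in>UNIV. \<mu> x $ i *\<^sub>R partial i f x)"

definition derivation ::
  "(real^'n::finite \<Rightarrow> real^'n) \<Rightarrow> (real^'n \<Rightarrow> 'b::real_normed_vector) \<Rightarrow> real^'n \<Rightarrow> 'b" where
  "derivation Y A x = (\<Sum>i\<in>UNIV. Y x $ i *\<^sub>R partial i A x)"

definition bracket ::
  "(real^'n::finite \<Rightarrow> real^'n) \<Rightarrow> (real^'n \<Rightarrow> real^'m::finite^'n) \<Rightarrow> real^'n \<Rightarrow> real^'m^'n" where
  "bracket Y \<sigma> x = (\<chi> i \<alpha>. \<Sum>k\<in>UNIV.
     Y x $ k * partial k (\<lambda>y. \<sigma> y $ i $ \<alpha>) x - \<sigma> x $ k $ \<alpha> * partial k (\<lambda>y. Y y $ i) x)"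

definition so :: "(real^'m::finite^'m) set" where
  "so = {A. transpose A = - A}"

definition infinitesimal_transformation ::
  "(real^'n::finite) set \<Rightarrow> (real^'n \<Rightarrow> real^'n) \<Rightarrow> (real^'n \<Rightarrow> real^'m::finite^'m)
     \<Rightarrow> (real^'n \<Rightarrow> real) \<Rightarrow> bool" where
  "infinitesimal_transformation M Y C \<tau> \<longleftrightarrow>
     smooth_on M Y \<and> smooth_on M C \<and> C ` M \<subseteq> so \<and> smooth_on M \<tau>"

definition infinitesimal_symmetry ::
  "(real^'n::finite) set \<Rightarrow> (real^'n \<Rightarrow> real^'n) \<Rightarrow> (real^'n \<Rightarrow> real^'m::finite^'n)
     \<Rightarrow> (real^'n \<Rightarrow> real^'n) \<Rightarrow> (real^'n \<Rightarrow> real^'m^'m) \<Rightarrow> (real^'n \<Rightarrow> real) \<Rightarrow> bool" where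
  "infinitesimal_symmetry M \<mu> \<sigma> Y C \<tau> \<longleftrightarrow>
     infinitesimal_transformation M Y C \<tau> \<and>
     (\<forall>x\<in>M. bracket Y \<sigma> x = - ((1/2 * \<tau> x) *\<^sub>R \<sigma> x) - \<sigma> x ** C x \<and>
            derivation Y \<mu> x - generator \<mu> \<sigma> Y x = - (\<tau> x *\<^sub>R \<mu> x))"

definition quasi_strong_symmetry ::
  "(real^'n::finite) set \<Rightarrow> (real^'n \<Rightarrow> real^'n) \<Rightarrow> (real^'n \<Rightarrow> real^'m::finite^'n)
     \<Rightarrow> (real^'n \<Rightarrow> real^'n) \<Rightarrow> (real^'n \<Rightarrow> real^'m^'m) \<Rightarrow> bool" where
  "quasi_strong_symmetry M \<mu> \<sigma> Y C \<longleftrightarrow> infinitesimal_symmetry M \<mu> \<sigma> Y C (\<lambda>_. 0)"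

section \<open>Reduction maps and reduction vector fields\<close>

definition reduction_map ::
  "(real^'n::finite) set \<Rightarrow> (real^'p::finite) set \<Rightarrow> (real^'n \<Rightarrow> real^'p) \<Rightarrow> bool" where
  "reduction_map M M' \<Psi> \<longleftrightarrow>
     open M' \<and> smooth_on M \<Psi> \<and> \<Psi> ` M = M' \<and>
     (\<forall>x\<in>M. surj (frechet_derivative \<Psi> (at x))) \<and>
     (\<forall>y\<in>M'. connected {x\<in>M. \<Psi> x = y})"

text \<open>A distribution of rank \<open>r\<close> is integrable if every point lies on an integral manifold, here
  given by a local parametrization \<open>\<phi>\<close>. Its parameter domain is open in an \<open>r\<close>-dimensional subspace
  \<open>E\<close>, which plays the role of the Euclidean space of dimension \<open>r\<close>.\<close>

definition integrable_distribution ::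
  "(real^'n::finite) set \<Rightarrow> nat \<Rightarrow> (real^'n \<Rightarrow> (real^'n) set) \<Rightarrow> bool" where
  "integrable_distribution M r D \<longleftrightarrow>
     (\<forall>x\<in>M. subspace (D x) \<and> dim (D x) = r) \<and>
     (\<forall>x\<in>M. \<exists>E U (\<phi> :: real^'n \<Rightarrow> real^'n).
        subspace E \<and> dim E = r \<and> open U \<and> 0 \<in> U \<and> smooth_on U \<phi> \<and> \<phi> 0 = x \<and>
        (\<forall>u\<in>U \<inter> E. \<phi> u \<in> M \<and> inj_on (frechet_derivative \<phi> (at u)) E \<and>
                    frechet_derivative \<phi> (at u) ` E = D (\<phi> u)))"

definition reduction_vector_fields ::
  "(real^'n::finite) set \<Rightarrow> (real^'n \<Rightarrow> real^'p::finite) \<Rightarrow> nat \<Rightarrow> nat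
     \<Rightarrow> (nat \<Rightarrow> real^'n \<Rightarrow> real^'n) \<Rightarrow> bool" where
  "reduction_vector_fields M \<Psi> r k Y \<longleftrightarrow>
     (\<forall>i\<in>{1..k}. smooth_on M (Y i)) \<and>
     integrable_distribution M r (\<lambda>x. span ((\<lambda>i. Y i x) ` {1..k})) \<and>
     (\<forall>x\<in>M. span ((\<lambda>i. Y i x) ` {1..k}) = {v. jacobian \<Psi> (at x) *v v = 0})"

section \<open>Brownian motion and the Ito integral\<close>

text \<open>The time axis is \<open>real\<close>, but only times \<open>t \<ge> 0\<close> matter. A filtration given for \<open>t \<ge> 0\<close> may be
  extended by \<open>F t = F 0\<close> for \<open>t < 0\<close>. The usual conditions are not assumed.\<close>

definition filtered_prob_space :: "'w measure \<Rightarrow> (real \<Rightarrow> 'w measure) \<Rightarrow> bool" where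
  "filtered_prob_space P F \<longleftrightarrow>
     prob_space P \<and> filtration (space P) F \<and> (\<forall>t. subalgebra P (F t))"

definition brownian_motion ::
  "'w measure \<Rightarrow> (real \<Rightarrow> 'w measure) \<Rightarrow> (real \<Rightarrow> 'w \<Rightarrow> real^'m::finite) \<Rightarrow> bool" where
  "brownian_motion P F W \<longleftrightarrow>
     (\<forall>t\<ge>0. W t \<in> borel_measurable (F t)) \<and>
     (AE \<omega> in P. W 0 \<omega> = 0) \<and>
     (AE \<omega> in P. continuous_on {0..} (\<lambda>t. W t \<omega>)) \<and>
     (\<forall>s t. 0 \<le> s \<and> s < t \<longrightarrow>
        distributed P lborel (\<lambda>\<omega>. W t \<omega> - W s \<omega>)
          (\<lambda>x. ennreal (\<Prod>\<alpha>\<in>UNIV. normal_density 0 (sqrt (t - s)) (x $ \<alpha>))) \<and>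
        prob_space.indep_set P (sets (F s))
          {(\<lambda>\<omega>. W t \<omega> - W s \<omega>) -` B \<inter> space P | B. B \<in> sets borel})"

text \<open>Simple processes \<open>\<Sum>k<N. \<xi> k * 1_(t k, t (k+1)]\<close>, given by the data \<open>(N, t, \<xi>)\<close>.\<close>

definition simple_data ::
  "'w measure \<Rightarrow> (real \<Rightarrow> 'w measure) \<Rightarrow> nat \<Rightarrow> (nat \<Rightarrow> real) \<Rightarrow> (nat \<Rightarrow> 'w \<Rightarrow> real) \<Rightarrow> bool" where
  "simple_data P F N t \<xi> \<longleftrightarrow>
     0 \<le> t 0 \<and> (\<forall>k<N. t k \<le> t (Suc k)) \<and>
     (\<forall>k<N. \<xi> k \<in> borel_measurable (F (t k)) \<and> (\<exists>c. \<forall>\<omega>\<in>space P. \<bar>\<xi> k \<omega>\<bar> \<le> c))"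

definition simple_process ::
  "nat \<Rightarrow> (nat \<Rightarrow> real) \<Rightarrow> (nat \<Rightarrow> 'w \<Rightarrow> real) \<Rightarrow> real \<Rightarrow> 'w \<Rightarrow> real" where
  "simple_process N t \<xi> s \<omega> = (\<Sum>k<N. \<xi> k \<omega> * indicator {t k<..t (Suc k)} s)"

definition simple_integral ::
  "nat \<Rightarrow> (nat \<Rightarrow> real) \<Rightarrow> (nat \<Rightarrow> 'w \<Rightarrow> real) \<Rightarrow> (real \<Rightarrow> 'w \<Rightarrow> real) \<Rightarrow> real \<Rightarrow> 'w \<Rightarrow> real" where
  "simple_integral N t \<xi> B s \<omega> =
     (\<Sum>k<N. \<xi> k \<omega> * (B (min (t (Suc k)) s) \<omega> - B (min (t k) s) \<omega>))"

definition progressive ::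
  "(real \<Rightarrow> 'w measure) \<Rightarrow> (real \<Rightarrow> 'w \<Rightarrow> real) \<Rightarrow> bool" where
  "progressive F H \<longleftrightarrow>
     (\<forall>T\<ge>0. (\<lambda>(s, \<omega>). H s \<omega>) \<in> borel_measurable (restrict_space borel {0..T} \<Otimes>\<^sub>M F T))"

text \<open>\<open>has_ito_integral P F B H I\<close>: the process \<open>I\<close> is (a continuous version of)
  \<open>t \<mapsto> \<integral>\<^sub>0\<^sup>t H dB\<close> for a real Brownian motion \<open>B\<close>. The integrand is progressively measurable and
  almost surely locally square integrable, and the integral is the limit in probability of the
  integrals of simple processes approximating \<open>H\<close>. It is unique up to indistinguishability, since
  \<open>I\<close> is almost surely continuous. All events below are measurable by progressive measurability,
  so \<open>measure P\<close> is never applied to a non-measurable set.\<close>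

definition has_ito_integral ::
  "'w measure \<Rightarrow> (real \<Rightarrow> 'w measure) \<Rightarrow> (real \<Rightarrow> 'w \<Rightarrow> real) \<Rightarrow> (real \<Rightarrow> 'w \<Rightarrow> real)
     \<Rightarrow> (real \<Rightarrow> 'w \<Rightarrow> real) \<Rightarrow> bool" where
  "has_ito_integral P F B H I \<longleftrightarrow>
     progressive F H \<and>
     (AE \<omega> in P. \<forall>T\<ge>0. (\<integral>\<^sup>+ s\<in>{0..T}. ennreal ((H s \<omega>)\<^sup>2) \<partial>lborel) < \<infinity>) \<and>
     (\<forall>t\<ge>0. I t \<in> borel_measurable P) \<and>
     (AE \<omega> in P. continuous_on {0..} (\<lambda>t. I t \<omega>)) \<and>
     (\<exists>N t \<xi>. (\<forall>n. simple_data P F (N n) (t n) (\<xi> n)) \<and>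
        (\<forall>T\<ge>0. \<forall>\<epsilon>>0. (\<lambda>n. measure P {\<omega>\<in>space P. ennreal \<epsilon> <
             (\<integral>\<^sup>+ s\<in>{0..T}. ennreal ((simple_process (N n) (t n) (\<xi> n) s \<omega> - H s \<omega>)\<^sup>2) \<partial>lborel)})
           \<longlonglongrightarrow> 0) \<and>
        (\<forall>T\<ge>0. \<forall>\<epsilon>>0. (\<lambda>n. measure P {\<omega>\<in>space P.
             \<epsilon> < \<bar>simple_integral (N n) (t n) (\<xi> n) B T \<omega> - I T \<omega>\<bar>}) \<longlonglongrightarrow> 0))"

section \<open>Solutions\<close>

text \<open>A process on \<open>M\<close> takes values in \<open>M\<close> until its explosion time and equals the cemetery state
  \<open>None\<close> from then on.\<close>

definition explosion_time :: "(real \<Rightarrow> 'w \<Rightarrow> 'a option) \<Rightarrow> 'w \<Rightarrow> ereal" where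
  "explosion_time X \<omega> = Inf {ereal t | t. 0 \<le> t \<and> X t \<omega> = None}"

definition process_on ::
  "'w measure \<Rightarrow> 'a::topological_space set \<Rightarrow> (real \<Rightarrow> 'w \<Rightarrow> 'a option) \<Rightarrow> bool" where
  "process_on P M X \<longleftrightarrow>
     (\<forall>\<omega>\<in>space P.
        (\<forall>t\<ge>0. X t \<omega> = None \<longleftrightarrow> explosion_time X \<omega> \<le> ereal t) \<and>
        (\<forall>t\<ge>0. \<forall>x. X t \<omega> = Some x \<longrightarrow> x \<in> M) \<and>
        continuous_on {t. 0 \<le> t \<and> ereal t < explosion_time X \<omega>} (\<lambda>t. the (X t \<omega>)))"

definition adapted_to ::
  "'w measure \<Rightarrow> (real \<Rightarrow> 'w measure) \<Rightarrow> (real \<Rightarrow> 'w \<Rightarrow> 'a::topological_space option) \<Rightarrow> bool" where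
  "adapted_to P F X \<longleftrightarrow>
     (\<forall>t\<ge>0. \<forall>B\<in>sets borel. {\<omega>\<in>space P. X t \<omega> \<in> Some ` B} \<in> sets (F t))"

text \<open>The stochastic integral up to \<open>t \<and> \<tau>\<close> is the integral up to \<open>t\<close> of the integrand multiplied by
  the indicator of \<open>{s. s \<le> \<tau>}\<close>.\<close>

definition solves_SDE_until ::
  "(real^'n::finite) set \<Rightarrow> (real^'n \<Rightarrow> real^'n) \<Rightarrow> (real^'n \<Rightarrow> real^'m::finite^'n)
     \<Rightarrow> 'w measure \<Rightarrow> (real \<Rightarrow> 'w measure) \<Rightarrow> (real \<Rightarrow> 'w \<Rightarrow> (real^'n) option)
     \<Rightarrow> (real \<Rightarrow> 'w \<Rightarrow> real^'m) \<Rightarrow> ('w \<Rightarrow> real) \<Rightarrow> bool" where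
  "solves_SDE_until M \<mu> \<sigma> P F X W \<tau> \<longleftrightarrow>
     filtered_prob_space P F \<and> process_on P M X \<and> adapted_to P F X \<and> brownian_motion P F W \<and>
     stopping_time F \<tau> \<and> (\<forall>\<omega>\<in>space P. 0 \<le> \<tau> \<omega> \<and> ereal (\<tau> \<omega>) < explosion_time X \<omega>) \<and>
     (\<exists>J.
        (\<forall>i \<alpha>. has_ito_integral P F (\<lambda>t \<omega>. W t \<omega> $ \<alpha>)
                 (\<lambda>s \<omega>. if s \<le> \<tau> \<omega> then \<sigma> (the (X s \<omega>)) $ i $ \<alpha> else 0) (J i \<alpha>)) \<and>
        (AE \<omega> in P. \<forall>t\<ge>0. \<forall>i.
           the (X (min t (\<tau> \<omega>)) \<omega>) $ i - the (X 0 \<omega>) $ i =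
             (LBINT s:{0..min t (\<tau> \<omega>)}. \<mu> (the (X s \<omega>)) $ i) + (\<Sum>\<alpha>\<in>UNIV. J i \<alpha> t \<omega>)))"

definition map_process :: "('a \<Rightarrow> 'b) \<Rightarrow> (real \<Rightarrow> 'w \<Rightarrow> 'a option) \<Rightarrow> real \<Rightarrow> 'w \<Rightarrow> 'b option" where
  "map_process \<Psi> X t \<omega> = map_option \<Psi> (X t \<omega>)"

section \<open>Reduced SDEs\<close>

definition reduced_SDE ::
  "(real^'n::finite) set \<Rightarrow> (real^'p::finite) set \<Rightarrow> (real^'n \<Rightarrow> real^'p)
     \<Rightarrow> (real^'n \<Rightarrow> real^'n) \<Rightarrow> (real^'n \<Rightarrow> real^'m::finite^'n)
     \<Rightarrow> (real^'p \<Rightarrow> real^'p) \<Rightarrow> (real^'p \<Rightarrow> real^'m^'p) \<Rightarrow> bool" where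
  "reduced_SDE M M' \<Psi> \<mu> \<sigma> \<mu>' \<sigma>' \<longleftrightarrow>
     is_SDE M' \<mu>' \<sigma>' \<and>
     (\<forall>x\<in>M. generator \<mu> \<sigma> \<Psi> x = \<mu>' (\<Psi> x)) \<and>
     (\<forall>x\<in>M. jacobian \<Psi> (at x) ** \<sigma> x = \<sigma>' (\<Psi> x))"

end

theory Submission
  imports Defs "HOL-Real_Asymp.Real_Asymp"
begin

text \<open>
  Since the \<open>C\<^sub>i\<close> are antisymmetric, they drop out of \<open>\<sigma> \<sigma>\<^sup>T\<close>, so each \<open>Y\<^sub>i\<close> commutes with \<open>L\<close> on
  functions that it annihilates; hence \<open>Y\<^sub>i (L \<Psi>) = 0\<close>. Likewise \<open>Y\<^sub>i (\<nabla>\<Psi> \<sigma>) = - \<nabla>\<Psi> \<sigma> C\<^sub>i = 0\<close>. Both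
  functions are therefore locally constant on the level sets of the submersion \<open>\<Psi>\<close>. The level sets
  are connected, so both factor through \<open>\<Psi>\<close>, smoothly because \<open>\<Psi>\<close> has local sections.

  That \<open>\<Psi>(X)\<close> solves the reduced equation is Ito's formula, obtained by Taylor expansion along the
  Euler scheme of the stopped process on equidistant grids: the quadratic terms are compared with
  their conditional expectations, and the first-order terms converge to Ito integrals. A maximal
  inequality for elementary integrals, with the integrand stopped once its energy is large, gives
  existence of these integrals and their independence of the approximating integrands.
\<close>

section \<open>Calculus of smooth maps\<close>

text \<open>The Ito integral is given only through the predicate \<open>has_ito_integral\<close>, a
  limit in probability at each fixed time, so neither its existence nor any uniformity in time is at
  hand; and the coefficients are merely smooth on \<open>M\<close>, hence possibly unbounded.
  Expanding \<Psi> along the increments of X itself would produce quadratic terms in integrals over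
  single cells. The scheme used instead freezes the coefficients at grid times along the true
  solution: its steps are explicit in the Brownian increments, the weight of a step is independent
  of the increment that follows, and the integrated equation alone shows that it is close to X,
  without a Gronwall argument. Since the scheme may leave \<open>M\<close> and weights must be
  bounded, they are set to zero off \<open>M\<close> and truncated at levels that grow with the
  number of cells, slowly enough for the second-moment bounds. The probabilistic input to the
  expansion is a finite family of sequences vanishing in probability; along one subsequence all of
  them vanish almost surely, and the expansion becomes deterministic, path by path.\<close>

lemma C_k_on_SucD:
  "C_k_on (Suc k) S f \<Longrightarrow> x \<in> S \<Longrightarrow> (f has_derivative frechet_derivative f (at x)) (at x)"
  by (simp add: frechet_derivative_works[symmetric])

text \<open>Openness matters: the derivative at a point of \<open>S\<close> depends only on values
  close to that point, hence inside \<open>S\<close>, although \<open>frechet_derivative\<close> is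
  taken of the total function.\<close>

lemma C_k_on_cong:
  assumes "open S" "\<And>x. x \<in> S \<Longrightarrow> f x = g x"
  shows "C_k_on k S f \<longleftrightarrow> C_k_on k S g"
  using assms(2)
proof (induction k arbitrary: f g)
  case 0
  then show ?case by (simp cong: continuous_on_cong)
next
  case (Suc k)
  have *: "C_k_on (Suc k) S g" if f: "C_k_on (Suc k) S f" and eq: "\<And>x. x \<in> S \<Longrightarrow> f x = g x" for f g :: "'a \<Rightarrow> 'b"
  proof -
    have d: "(g has_derivative frechet_derivative f (at x)) (at x)" if "x \<in> S" for x
      using has_derivative_transform_within_open[OF C_k_on_SucD[OF f that] assms(1) that eq] .
    then have fd: "frechet_derivative g (at x) = frechet_derivative f (at x)" if "x \<in> S" for x
      using frechet_derivative_at[OF d[OF that]] by simp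
    have "C_k_on k S (\<lambda>x. frechet_derivative g (at x) v)" for v
      using Suc.IH[of "\<lambda>x. frechet_derivative g (at x) v" "\<lambda>x. frechet_derivative f (at x) v"] f fd by simp
    then show ?thesis using d unfolding C_k_on.simps differentiable_def by blast
  qed
  show ?case
    using *[of f g, OF _ Suc.prems] *[of g f, OF _ Suc.prems[symmetric]] by blast
qed

text \<open>Admits any explicit formula \<open>D\<close> for the derivative in place of the chosen
  one: uniqueness identifies the two at each point, and \<open>C_k_on_cong\<close> passes this on to
  the higher derivatives.\<close>

lemma C_k_on_SucI:
  assumes "open S" "\<And>x. x \<in> S \<Longrightarrow> (f has_derivative D x) (at x)"
    "\<And>v. C_k_on k S (\<lambda>x. D x v)"
  shows "C_k_on (Suc k) S f"
proof -
  have "frechet_derivative f (at x) = D x" if "x \<in> S" for x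
    using frechet_derivative_at[OF assms(2)[OF that]] by simp
  then have "C_k_on k S (\<lambda>x. frechet_derivative f (at x) v)" for v
    using C_k_on_cong[OF assms(1), of "\<lambda>x. frechet_derivative f (at x) v" "\<lambda>x. D x v"] assms(3) by simp
  then show ?thesis using assms(2) unfolding C_k_on.simps differentiable_def by blast
qed

lemma C_k_on_Suc_imp: "C_k_on (Suc k) S f \<Longrightarrow> C_k_on k S f"
proof (induction k arbitrary: f)
  case 0
  then show ?case
    by (auto intro!: continuous_at_imp_continuous_on differentiable_imp_continuous_within)
next
  case (Suc k)
  then have "\<And>v. C_k_on k S (\<lambda>x. frechet_derivative f (at x) v)"
    by (intro Suc.IH) simp
  with Suc.prems show ?case by simp
qed

lemma C_k_on_imp_continuous_on: "C_k_on k S f \<Longrightarrow> continuous_on S f"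
proof (induction k)
  case (Suc k)
  then show ?case using C_k_on_Suc_imp by blast
qed simp

lemma C_k_on_subset: "C_k_on k S f \<Longrightarrow> T \<subseteq> S \<Longrightarrow> C_k_on k T f"
  by (induction k arbitrary: f) (auto intro: continuous_on_subset)

text \<open>Serves for the factored map \<open>h'\<close> on \<open>M'\<close>, for which a smooth
  formula exists only near each point.\<close>

lemma C_k_on_local:
  assumes "\<And>x. x \<in> S \<Longrightarrow> \<exists>U. open U \<and> x \<in> U \<and> C_k_on k U f"
  shows "C_k_on k S f"
  using assms
proof (induction k arbitrary: f)
  case 0
  show ?case unfolding C_k_on.simps
  proof (intro continuous_at_imp_continuous_on ballI)
    fix x assume "x \<in> S"
    then obtain U where "open U" "x \<in> U" "continuous_on U f" using 0 by auto
    then show "isCont f x" by (simp add: continuous_on_eq_continuous_at)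
  qed
next
  case (Suc k)
  have "C_k_on k S (\<lambda>x. frechet_derivative f (at x) v)" for v
    by (rule Suc.IH) (use Suc.prems in force)
  moreover have "f differentiable (at x)" if "x \<in> S" for x
    using Suc.prems[OF that] by auto
  ultimately show ?case by simp
qed

lemma C_k_on_const: "C_k_on k S (\<lambda>x. c)"
proof (induction k arbitrary: c)
  case (Suc k)
  then show ?case by (simp add: frechet_derivative_const)
qed simp

lemma C_k_on_add:
  assumes "open S" "C_k_on k S f" "C_k_on k S g"
  shows "C_k_on k S (\<lambda>x. f x + g x)"
  using assms(2,3)
proof (induction k arbitrary: f g)
  case 0
  then show ?case by (auto intro: continuous_on_add)
next
  case (Suc k)
  show ?case
  proof (rule C_k_on_SucI[OF assms(1)])
    show "((\<lambda>x. f x + g x) has_derivative (\<lambda>v. frechet_derivative f (at x) v + frechet_derivative g (at x) v)) (at x)"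
      if "x \<in> S" for x
      using that by (intro has_derivative_add C_k_on_SucD[OF Suc.prems(1)] C_k_on_SucD[OF Suc.prems(2)])
    show "C_k_on k S (\<lambda>x. frechet_derivative f (at x) v + frechet_derivative g (at x) v)" for v
      by (rule Suc.IH; use Suc.prems in simp)
  qed
qed

lemma C_k_on_bounded_linear:
  assumes "open S" "bounded_linear L" "C_k_on k S f"
  shows "C_k_on k S (\<lambda>x. L (f x))"
  using assms(3)
proof (induction k arbitrary: f)
  case 0
  then show ?case using bounded_linear.continuous_on[OF assms(2)] by auto
next
  case (Suc k)
  show ?case
  proof (rule C_k_on_SucI[OF assms(1)])
    show "((\<lambda>x. L (f x)) has_derivative (\<lambda>v. L (frechet_derivative f (at x) v))) (at x)" if "x \<in> S" for x
      using that by (intro bounded_linear.has_derivative[OF assms(2)] C_k_on_SucD[OF Suc.prems])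
    show "C_k_on k S (\<lambda>x. L (frechet_derivative f (at x) v))" for v
      by (rule Suc.IH; use Suc.prems in simp)
  qed
qed

lemma C_k_on_bilinear:
  assumes "open S" "bounded_bilinear B" "C_k_on k S f" "C_k_on k S g"
  shows "C_k_on k S (\<lambda>x. B (f x) (g x))"
  using assms(3,4)
proof (induction k arbitrary: f g)
  case 0
  then show ?case using bounded_bilinear.continuous_on[OF assms(2)] by auto
next
  case (Suc k)
  show ?case
  proof (rule C_k_on_SucI[OF assms(1)])
    show "((\<lambda>x. B (f x) (g x)) has_derivative
        (\<lambda>v. B (f x) (frechet_derivative g (at x) v) + B (frechet_derivative f (at x) v) (g x))) (at x)"
      if "x \<in> S" for x
      using that by (intro bounded_bilinear.FDERIV[OF assms(2)] C_k_on_SucD[OF Suc.prems(1)] C_k_on_SucD[OF Suc.prems(2)])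
    have "C_k_on k S f" "C_k_on k S g" using Suc.prems C_k_on_Suc_imp by blast+
    then show "C_k_on k S (\<lambda>x. B (f x) (frechet_derivative g (at x) v) + B (frechet_derivative f (at x) v) (g x))" for v
      using Suc.prems by (intro C_k_on_add[OF assms(1)] Suc.IH) auto
  qed
qed

lemmas C_k_on_mult = C_k_on_bilinear[OF _ bounded_bilinear_mult]
lemmas C_k_on_scaleR = C_k_on_bilinear[OF _ bounded_bilinear_scaleR]

lemma C_k_on_sum:
  assumes "open S" "\<And>i. i \<in> I \<Longrightarrow> C_k_on k S (f i)"
  shows "C_k_on k S (\<lambda>x. \<Sum>i\<in>I. f i x)"
  using assms(2)
  by (induction I rule: infinite_finite_induct) (auto intro: C_k_on_const C_k_on_add assms(1))

lemma C_k_on_prod: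
  fixes f :: "'i \<Rightarrow> 'a::real_normed_vector \<Rightarrow> real"
  assumes "open S" "\<And>i. i \<in> I \<Longrightarrow> C_k_on k S (f i)"
  shows "C_k_on k S (\<lambda>x. \<Prod>i\<in>I. f i x)"
  using assms(2)
  by (induction I rule: infinite_finite_induct) (auto intro: C_k_on_const C_k_on_mult assms(1))

lemma C_k_on_linear:
  assumes "open S" "bounded_linear L"
  shows "C_k_on k S L"
proof (cases k)
  case 0
  then show ?thesis using assms by (simp add: linear_continuous_on)
next
  case (Suc m)
  show ?thesis unfolding Suc
    by (rule C_k_on_SucI[OF assms(1) bounded_linear_imp_has_derivative[OF assms(2)] C_k_on_const])
qed

text \<open>The definition controls derivatives in fixed directions only, whereas the chain rule
  differentiates \<open>f\<close> in the direction \<open>frechet_derivative g (at x) v\<close>,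
  which moves with \<open>x\<close>. Expanding it in \<open>Basis\<close> leaves finitely many fixed
  directions, and the induction hypothesis applies to the derivative of \<open>f\<close> in each of
  them.\<close>

lemma C_k_on_compose:
  fixes f :: "'a::euclidean_space \<Rightarrow> 'c::real_normed_vector" and g :: "'b::real_normed_vector \<Rightarrow> 'a"
  assumes "open S" "open T" "g ` S \<subseteq> T" "C_k_on k T f" "C_k_on k S g"
  shows "C_k_on k S (\<lambda>x. f (g x))"
  using assms(4,5)
proof (induction k arbitrary: f)
  case 0
  then show ?case using continuous_on_compose2[OF _ _ assms(3)] by auto
next
  case (Suc k)
  have gk: "C_k_on k S g" by (rule C_k_on_Suc_imp) fact
  have D: "((\<lambda>x. f (g x)) has_derivative
      (\<lambda>v. \<Sum>b\<in>Basis. (frechet_derivative g (at x) v \<bullet> b) *\<^sub>R frechet_derivative f (at (g x)) b)) (at x)"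
    if x: "x \<in> S" for x
  proof -
    have gx: "g x \<in> T" using assms(3) x by auto
    have df: "(f has_derivative frechet_derivative f (at (g x))) (at (g x))"
      by (rule C_k_on_SucD[OF _ gx]) fact
    have "((\<lambda>x. f (g x)) has_derivative (\<lambda>v. frechet_derivative f (at (g x)) (frechet_derivative g (at x) v))) (at x)"
      by (rule has_derivative_compose[OF C_k_on_SucD[OF Suc.prems(2) x] df])
    moreover have "frechet_derivative f (at (g x)) (frechet_derivative g (at x) v) =
       (\<Sum>b\<in>Basis. (frechet_derivative g (at x) v \<bullet> b) *\<^sub>R frechet_derivative f (at (g x)) b)" for v
      using linear_sum[OF has_derivative_linear[OF df], of "\<lambda>b. (frechet_derivative g (at x) v \<bullet> b) *\<^sub>R b" Basis]
        linear_cmul[OF has_derivative_linear[OF df]]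
      by (simp add: euclidean_representation)
    ultimately show ?thesis by simp
  qed
  show ?case
  proof (rule C_k_on_SucI[OF assms(1) D])
    fix v
    have "C_k_on k S (\<lambda>x. frechet_derivative g (at x) v)" using Suc.prems by simp
    then have 1: "C_k_on k S (\<lambda>x. frechet_derivative g (at x) v \<bullet> b)" for b
      by (rule C_k_on_bounded_linear[OF assms(1) bounded_linear_inner_left])
    have 2: "C_k_on k S (\<lambda>x. frechet_derivative f (at (g x)) b)" for b
      by (rule Suc.IH[of "\<lambda>y. frechet_derivative f (at y) b"]) (use Suc.prems gk in auto)
    show "C_k_on k S (\<lambda>x. \<Sum>b\<in>Basis. (frechet_derivative g (at x) v \<bullet> b) *\<^sub>R frechet_derivative f (at (g x)) b)"
      by (intro C_k_on_sum C_k_on_scaleR assms(1) 1 2)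
  qed auto
qed

lemma C_k_on_inverse_real: "C_k_on k (- {0}) (inverse :: real \<Rightarrow> real)"
proof (induction k)
  case 0
  show ?case by (auto intro!: continuous_on_inverse continuous_on_id)
next
  case (Suc k)
  have o: "open (- {0::real})" by auto
  show ?case
  proof (rule C_k_on_SucI[OF o])
    show "(inverse has_derivative (\<lambda>v. - v * (inverse x * inverse x))) (at x)" if "x \<in> - {0}" for x :: real
      using that by (auto intro!: derivative_eq_intros simp: field_simps)
    show "C_k_on k (- {0}) (\<lambda>x. - v * (inverse x * inverse x))" for v :: real
      by (intro C_k_on_mult o C_k_on_const Suc.IH)
  qed
qed

lemma C_k_on_divide_real:
  fixes f g :: "'a::real_normed_vector \<Rightarrow> real"
  assumes "open S" "C_k_on k S f" "C_k_on k S g" "\<And>x. x \<in> S \<Longrightarrow> g x \<noteq> 0"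
  shows "C_k_on k S (\<lambda>x. f x / g x)"
proof -
  have "C_k_on k S (\<lambda>x. inverse (g x))"
    by (rule C_k_on_compose[where T="- {0}" and f=inverse, OF assms(1) _ _ C_k_on_inverse_real assms(3)])
      (use assms(4) in auto)
  then show ?thesis unfolding divide_inverse by (rule C_k_on_mult[OF assms(1,2)])
qed

text \<open>The Leibniz expansion is a polynomial in the entries. This feeds Cramer's rule in
  \<open>smooth_on_inverse\<close>.\<close>

lemma C_k_on_det:
  fixes A :: "'a::real_normed_vector \<Rightarrow> real^'n^'n"
  assumes "open S" "\<And>i j. C_k_on k S (\<lambda>x. A x $ i $ j)"
  shows "C_k_on k S (\<lambda>x. det (A x))"
  unfolding det_def
  by (intro C_k_on_sum C_k_on_mult C_k_on_const C_k_on_prod assms)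

lemma C_k_on_vec_lambda:
  fixes f :: "'a::real_normed_vector \<Rightarrow> 'b::euclidean_space^'n"
  assumes "open S" "\<And>i. C_k_on k S (\<lambda>x. f x $ i)"
  shows "C_k_on k S f"
proof -
  have "f = (\<lambda>x. \<Sum>i\<in>UNIV. axis i (f x $ i))"
    by (auto simp: vec_eq_iff axis_def if_distrib cong: if_cong)
  moreover have "bounded_linear (axis i :: 'b \<Rightarrow> 'b^'n)" for i
    by (intro linear_conv_bounded_linear[THEN iffD1] linearI)
      (auto simp: axis_def vec_eq_iff)
  then have "C_k_on k S (\<lambda>x. \<Sum>i\<in>UNIV. axis i (f x $ i))"
    by (intro C_k_on_sum assms C_k_on_bounded_linear[OF assms(1), of "axis _"])
  ultimately show ?thesis by simp
qed

lemma C_k_on_vec_nth: "open S \<Longrightarrow> C_k_on k S f \<Longrightarrow> C_k_on k S (\<lambda>x. f x $ i)"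
  by (rule C_k_on_bounded_linear[OF _ bounded_linear_vec_nth])

section \<open>Closure properties of smooth maps\<close>

lemma smooth_on_frechet_derivative:
  "smooth_on S f \<Longrightarrow> smooth_on S (\<lambda>x. frechet_derivative f (at x) v)"
  unfolding smooth_on_def
proof
  fix k assume "\<forall>k. C_k_on k S f"
  then have "C_k_on (Suc k) S f" by blast
  then show "C_k_on k S (\<lambda>x. frechet_derivative f (at x) v)" by simp
qed

lemma smooth_on_partial: "smooth_on S f \<Longrightarrow> smooth_on S (partial i f)"
  using smooth_on_frechet_derivative[of S f "axis i 1"] by (simp add: partial_def[abs_def])

lemma smooth_on_differentiable: "smooth_on S f \<Longrightarrow> x \<in> S \<Longrightarrow> f differentiable (at x)"
  unfolding smooth_on_def using C_k_on.simps(2) by blast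

lemma smooth_on_continuous_on: "smooth_on S f \<Longrightarrow> continuous_on S f"
  unfolding smooth_on_def using C_k_on_imp_continuous_on by blast

lemma smooth_on_const: "smooth_on S (\<lambda>x. c)"
  by (simp add: smooth_on_def C_k_on_const)

lemma smooth_on_add: "open S \<Longrightarrow> smooth_on S f \<Longrightarrow> smooth_on S g \<Longrightarrow> smooth_on S (\<lambda>x. f x + g x)"
  by (simp add: smooth_on_def C_k_on_add)

lemma smooth_on_mult:
  fixes f g :: "'a::real_normed_vector \<Rightarrow> real"
  shows "open S \<Longrightarrow> smooth_on S f \<Longrightarrow> smooth_on S g \<Longrightarrow> smooth_on S (\<lambda>x. f x * g x)"
  by (simp add: smooth_on_def C_k_on_mult)

lemma smooth_on_sum:
  "open S \<Longrightarrow> (\<And>i. i \<in> I \<Longrightarrow> smooth_on S (f i)) \<Longrightarrow> smooth_on S (\<lambda>x. \<Sum>i\<in>I. f i x)"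
  by (simp add: smooth_on_def C_k_on_sum)

lemma smooth_on_bounded_linear:
  "open S \<Longrightarrow> bounded_linear L \<Longrightarrow> smooth_on S f \<Longrightarrow> smooth_on S (\<lambda>x. L (f x))"
  by (simp add: smooth_on_def C_k_on_bounded_linear)

lemma smooth_on_vec_nth: "open S \<Longrightarrow> smooth_on S f \<Longrightarrow> smooth_on S (\<lambda>x. f x $ i)"
  by (simp add: smooth_on_def C_k_on_vec_nth)

lemma smooth_on_vec_lambda:
  fixes f :: "'a::real_normed_vector \<Rightarrow> 'b::euclidean_space^'n"
  shows "open S \<Longrightarrow> (\<And>i. smooth_on S (\<lambda>x. f x $ i)) \<Longrightarrow> smooth_on S f"
  by (simp add: smooth_on_def C_k_on_vec_lambda)

lemma smooth_on_compose:
  fixes f :: "'a::euclidean_space \<Rightarrow> 'c::real_normed_vector" and g :: "'b::real_normed_vector \<Rightarrow> 'a"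
  shows "open S \<Longrightarrow> open T \<Longrightarrow> g ` S \<subseteq> T \<Longrightarrow> smooth_on T f \<Longrightarrow> smooth_on S g \<Longrightarrow> smooth_on S (\<lambda>x. f (g x))"
  unfolding smooth_on_def using C_k_on_compose by blast

lemma smooth_on_cong:
  "open S \<Longrightarrow> (\<And>x. x \<in> S \<Longrightarrow> f x = g x) \<Longrightarrow> smooth_on S f \<longleftrightarrow> smooth_on S g"
  unfolding smooth_on_def using C_k_on_cong by blast

lemma smooth_on_subset: "smooth_on S f \<Longrightarrow> T \<subseteq> S \<Longrightarrow> smooth_on T f"
  unfolding smooth_on_def using C_k_on_subset by blast

lemma smooth_on_local:
  assumes "\<And>x. x \<in> S \<Longrightarrow> \<exists>U. open U \<and> x \<in> U \<and> smooth_on U f"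
  shows "smooth_on S f"
  using assms unfolding smooth_on_def by (meson C_k_on_local)

section \<open>Rules for partial derivatives\<close>

lemma linear_partial_expansion:
  fixes L :: "real^'n \<Rightarrow> 'b::real_normed_vector"
  assumes "linear L"
  shows "L v = (\<Sum>i\<in>UNIV. v $ i *\<^sub>R L (axis i 1))"
proof -
  have "v = (\<Sum>i\<in>UNIV. v $ i *\<^sub>R axis i 1)"
    using basis_expansion[of v] by (simp add: scalar_mult_eq_scaleR)
  then have "L v = L (\<Sum>i\<in>UNIV. v $ i *\<^sub>R axis i 1)" by simp
  then show ?thesis by (simp add: linear_sum[OF assms] linear_cmul[OF assms])
qed

lemma frechet_derivative_partial:
  fixes f :: "real^'n \<Rightarrow> 'b::real_normed_vector"
  assumes "f differentiable (at x)"
  shows "frechet_derivative f (at x) v = (\<Sum>i\<in>UNIV. v $ i *\<^sub>R partial i f x)"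
  unfolding partial_def
  by (rule linear_partial_expansion[OF linear_frechet_derivative[OF assms]])

lemma partial_vec_nth:
  assumes "f differentiable (at x)"
  shows "partial i (\<lambda>y. f y $ a) x = partial i f x $ a"
proof -
  have "((\<lambda>y. f y $ a) has_derivative (\<lambda>v. frechet_derivative f (at x) v $ a)) (at x)"
    by (rule bounded_linear.has_derivative[OF bounded_linear_vec_nth])
      (use assms in \<open>simp add: frechet_derivative_works[symmetric]\<close>)
  from fun_cong[OF frechet_derivative_at[OF this]] show ?thesis unfolding partial_def by simp
qed

lemma partial_cong:
  assumes "open S" "x \<in> S" "\<And>y. y \<in> S \<Longrightarrow> f y = g y" "f differentiable (at x)"
  shows "partial i f x = partial i g x"
proof -
  have "(g has_derivative frechet_derivative f (at x)) (at x)"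
    by (rule has_derivative_transform_within_open[OF _ assms(1-3)])
      (use assms(4) in \<open>simp add: frechet_derivative_works[symmetric]\<close>)
  from frechet_derivative_at[OF this] show ?thesis by (simp add: partial_def)
qed

lemma partial_const: "partial i (\<lambda>_. c) x = 0"
  by (simp add: partial_def frechet_derivative_const)

lemma partial_mult:
  fixes f g :: "real^'n \<Rightarrow> real"
  assumes "f differentiable (at x)" "g differentiable (at x)"
  shows "partial i (\<lambda>y. f y * g y) x = f x * partial i g x + partial i f x * g x"
proof -
  have "((\<lambda>y. f y * g y) has_derivative (\<lambda>h. f x * frechet_derivative g (at x) h + frechet_derivative f (at x) h * g x)) (at x)"
    by (rule has_derivative_mult) (use assms in \<open>simp add: frechet_derivative_works[symmetric]\<close>)+
  from frechet_derivative_at[OF this, symmetric] show ?thesis by (simp add: partial_def)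
qed

lemma partial_add:
  assumes "f differentiable (at x)" "g differentiable (at x)"
  shows "partial i (\<lambda>y. f y + g y) x = partial i f x + partial i g x"
proof -
  have "((\<lambda>y. f y + g y) has_derivative (\<lambda>h. frechet_derivative f (at x) h + frechet_derivative g (at x) h)) (at x)"
    by (rule has_derivative_add) (use assms in \<open>simp add: frechet_derivative_works[symmetric]\<close>)+
  from frechet_derivative_at[OF this, symmetric] show ?thesis by (simp add: partial_def)
qed

lemma partial_sum:
  assumes "\<And>j. j \<in> J \<Longrightarrow> f j differentiable (at x)"
  shows "partial i (\<lambda>y. \<Sum>j\<in>J. f j y) x = (\<Sum>j\<in>J. partial i (f j) x)"
proof -
  have "((\<lambda>y. \<Sum>j\<in>J. f j y) has_derivative (\<lambda>h. \<Sum>j\<in>J. frechet_derivative (f j) (at x) h)) (at x)"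
    by (rule has_derivative_sum) (use assms in \<open>simp add: frechet_derivative_works[symmetric]\<close>)
  from frechet_derivative_at[OF this, symmetric] show ?thesis by (simp add: partial_def)
qed

section \<open>Symmetry of second derivatives and Taylor's formula\<close>

lemma DERIV_along_axis:
  fixes f :: "real^'n \<Rightarrow> real"
  assumes "f differentiable (at (a + s *\<^sub>R v))"
  shows "((\<lambda>s. f (a + s *\<^sub>R v)) has_real_derivative (\<Sum>i\<in>UNIV. v $ i * partial i f (a + s *\<^sub>R v))) (at s)"
proof -
  have "((\<lambda>s. a + s *\<^sub>R v) has_derivative (\<lambda>h. h *\<^sub>R v)) (at s)"
    by (auto intro!: derivative_eq_intros)
  moreover have "(f has_derivative frechet_derivative f (at (a + s *\<^sub>R v))) (at (a + s *\<^sub>R v))"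
    using assms by (simp add: frechet_derivative_works[symmetric])
  ultimately have "((\<lambda>s. f (a + s *\<^sub>R v)) has_derivative (\<lambda>h. frechet_derivative f (at (a + s *\<^sub>R v)) (h *\<^sub>R v))) (at s)"
    by (rule has_derivative_compose)
  then show ?thesis
    unfolding has_field_derivative_def frechet_derivative_partial[OF assms]
    by (rule has_derivative_eq_rhs) (auto simp: sum_distrib_left sum_distrib_right mult_ac fun_eq_iff)
qed

lemma DERIV_along_axis1:
  fixes f :: "real^'n \<Rightarrow> real"
  assumes "f differentiable (at (a + s *\<^sub>R axis i 1))"
  shows "((\<lambda>s. f (a + s *\<^sub>R axis i 1)) has_real_derivative partial i f (a + s *\<^sub>R axis i 1)) (at s)"
proof -
  have "(\<Sum>k\<in>UNIV. (axis i 1 :: real^'n) $ k * partial k f (a + s *\<^sub>R axis i 1)) = partial i f (a + s *\<^sub>R axis i 1)"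
    by (simp add: axis_def if_distrib if_distribR cong: if_cong)
  with DERIV_along_axis[OF assms] show ?thesis by simp
qed

text \<open>Two applications of the mean value theorem, in direction \<open>i\<close> to the
  difference in direction \<open>j\<close> and then in direction \<open>j\<close>. The left-hand
  side is symmetric in \<open>i\<close> and \<open>j\<close>, which is what
  \<open>partial_commute\<close> exploits.\<close>

lemma second_difference:
  fixes f :: "real^'n \<Rightarrow> real"
  assumes sm: "smooth_on S f" and ball: "ball x e \<subseteq> S" and h: "0 < h" "2 * h < e"
  shows "\<exists>s t. 0 < s \<and> s < h \<and> 0 < t \<and> t < h \<and>
    f (x + h *\<^sub>R axis i 1 + h *\<^sub>R axis j 1) - f (x + h *\<^sub>R axis i 1) - f (x + h *\<^sub>R axis j 1) + f x
      = h * (h * partial j (partial i f) (x + s *\<^sub>R axis i 1 + t *\<^sub>R axis j 1))"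
proof -
  let ?u = "axis i 1 :: real^'n" and ?v = "axis j 1 :: real^'n"
  have inS: "x + s *\<^sub>R ?u + t *\<^sub>R ?v \<in> S" if "0 \<le> s" "s \<le> h" "0 \<le> t" "t \<le> h" for s t
  proof -
    have "norm (s *\<^sub>R ?u + t *\<^sub>R ?v) \<le> s + t"
      using that norm_triangle_ineq[of "s *\<^sub>R ?u" "t *\<^sub>R ?v"] by simp
    also have "\<dots> < e" using that h by simp
    finally have "x + s *\<^sub>R ?u + t *\<^sub>R ?v \<in> ball x e"
      by (metis add.assoc add_diff_cancel_left' dist_commute dist_norm mem_ball)
    then show ?thesis using ball by auto
  qed
  have df: "f differentiable (at z)" "partial k f differentiable (at z)" if "z \<in> S" for z k
    using that smooth_on_differentiable[OF sm] smooth_on_differentiable[OF smooth_on_partial[OF sm]] by auto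
  define \<phi> where "\<phi> s = f (x + s *\<^sub>R ?u + h *\<^sub>R ?v) - f (x + s *\<^sub>R ?u)" for s
  have "\<exists>s>0. s < h \<and> \<phi> h - \<phi> 0 = (h - 0) * (partial i f (x + s *\<^sub>R ?u + h *\<^sub>R ?v) - partial i f (x + s *\<^sub>R ?u))"
  proof (rule MVT2)
    fix s assume s: "0 \<le> s" "s \<le> h"
    have eq: "x + s *\<^sub>R ?u + h *\<^sub>R ?v = (x + h *\<^sub>R ?v) + s *\<^sub>R ?u" for s by simp
    have "((\<lambda>s. f ((x + h *\<^sub>R ?v) + s *\<^sub>R ?u)) has_real_derivative partial i f ((x + h *\<^sub>R ?v) + s *\<^sub>R ?u)) (at s)"
      using inS[of s h] s h by (intro DERIV_along_axis1 df) (simp add: eq)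
    moreover have "((\<lambda>s. f (x + s *\<^sub>R ?u)) has_real_derivative partial i f (x + s *\<^sub>R ?u)) (at s)"
      using inS[of s 0] s h by (intro DERIV_along_axis1 df) simp
    ultimately show "(\<phi> has_real_derivative (partial i f (x + s *\<^sub>R ?u + h *\<^sub>R ?v) - partial i f (x + s *\<^sub>R ?u))) (at s)"
      unfolding \<phi>_def eq by (rule DERIV_diff)
  qed (use h in auto)
  then obtain s where s: "0 < s" "s < h"
    "\<phi> h - \<phi> 0 = h * (partial i f (x + s *\<^sub>R ?u + h *\<^sub>R ?v) - partial i f (x + s *\<^sub>R ?u))" by auto
  have "\<exists>t>0. t < h \<and> partial i f (x + s *\<^sub>R ?u + h *\<^sub>R ?v) - partial i f (x + s *\<^sub>R ?u + 0 *\<^sub>R ?v)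
      = (h - 0) * partial j (partial i f) (x + s *\<^sub>R ?u + t *\<^sub>R ?v)"
  proof (rule MVT2)
    fix t assume t: "0 \<le> t" "t \<le> h"
    show "((\<lambda>t. partial i f (x + s *\<^sub>R ?u + t *\<^sub>R ?v)) has_real_derivative partial j (partial i f) (x + s *\<^sub>R ?u + t *\<^sub>R ?v)) (at t)"
      using inS[of s t] s t h by (intro DERIV_along_axis1 df) simp
  qed (use h in auto)
  then obtain t where t: "0 < t" "t < h"
    "partial i f (x + s *\<^sub>R ?u + h *\<^sub>R ?v) - partial i f (x + s *\<^sub>R ?u)
      = h * partial j (partial i f) (x + s *\<^sub>R ?u + t *\<^sub>R ?v)" by auto
  have "\<phi> h - \<phi> 0 = f (x + h *\<^sub>R ?u + h *\<^sub>R ?v) - f (x + h *\<^sub>R ?u) - f (x + h *\<^sub>R ?v) + f x"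
    by (simp add: \<phi>_def)
  then show ?thesis using s t by metis
qed

text \<open>The symmetric second difference equals \<open>h * h\<close> times either mixed
  derivative at some point near \<open>x\<close>; continuity of both at \<open>x\<close> then
  excludes different values there.\<close>

lemma partial_commute:
  fixes f :: "real^'n \<Rightarrow> real"
  assumes "open S" "smooth_on S f" "x \<in> S"
  shows "partial i (partial j f) x = partial j (partial i f) x"
proof (rule ccontr)
  assume ne: "\<not> ?thesis"
  \<comment> \<open>Half the supposed gap: no number lies strictly within this distance of both
    mixed derivatives.\<close>
  define \<epsilon> where "\<epsilon> = \<bar>partial i (partial j f) x - partial j (partial i f) x\<bar> / 2"
  have e: "\<epsilon> > 0" using ne by (simp add: \<epsilon>_def)
  obtain e0 where e0: "e0 > 0" "ball x e0 \<subseteq> S" using assms(1,3) open_contains_ball by blast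
  have "isCont (partial k (partial l f)) x" for k l
    using smooth_on_continuous_on[OF smooth_on_partial[OF smooth_on_partial[OF assms(2)]]] assms(1,3)
    by (simp add: continuous_on_eq_continuous_at)
  then have "\<exists>d>0. \<forall>y. dist y x < d \<longrightarrow> dist (partial k (partial l f) y) (partial k (partial l f) x) < \<epsilon>" for k l
    using e unfolding continuous_at_eps_delta by blast
  then obtain d where d: "\<And>k l. d k l > 0"
    "\<And>k l y. dist y x < d k l \<Longrightarrow> dist (partial k (partial l f) y) (partial k (partial l f) x) < \<epsilon>"
    by metis
  \<comment> \<open>The mean value points lie within \<open>2 * h\<close> of \<open>x\<close>, so a
    quarter of the smallest radius keeps them inside all three balls.\<close>
  define h where "h = Min {e0, d i j, d j i} / 4"
  have h: "0 < h" "2 * h < e0" "2 * h < d i j" "2 * h < d j i"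
    using d(1)[of i j] d(1)[of j i] e0(1) unfolding h_def by (auto simp: min_def)
  have near: "dist (x + s *\<^sub>R axis k 1 + t *\<^sub>R axis l 1) x < 2 * h" if "0 < s" "s < h" "0 < t" "t < h" for s t :: real and k l
  proof -
    have "norm (s *\<^sub>R (axis k 1 :: real^'n) + t *\<^sub>R axis l 1) \<le> s + t"
      using that norm_triangle_ineq[of "s *\<^sub>R (axis k 1 :: real^'n)" "t *\<^sub>R axis l 1"] by simp
    also have "\<dots> < 2 * h" using that by simp
    finally show ?thesis by (metis add.assoc add_diff_cancel_left' dist_norm)
  qed
  obtain s t where st: "0 < s" "s < h" "0 < t" "t < h" and
    1: "f (x + h *\<^sub>R axis i 1 + h *\<^sub>R axis j 1) - f (x + h *\<^sub>R axis i 1) - f (x + h *\<^sub>R axis j 1) + f x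
      = h * (h * partial j (partial i f) (x + s *\<^sub>R axis i 1 + t *\<^sub>R axis j 1))"
    using second_difference[OF assms(2) e0(2) h(1,2)] by metis
  obtain s' t' where st': "0 < s'" "s' < h" "0 < t'" "t' < h" and
    2: "f (x + h *\<^sub>R axis j 1 + h *\<^sub>R axis i 1) - f (x + h *\<^sub>R axis j 1) - f (x + h *\<^sub>R axis i 1) + f x
      = h * (h * partial i (partial j f) (x + s' *\<^sub>R axis j 1 + t' *\<^sub>R axis i 1))"
    using second_difference[OF assms(2) e0(2) h(1,2)] by metis
  have comm: "x + h *\<^sub>R axis j 1 + h *\<^sub>R axis i 1 = x + h *\<^sub>R axis i 1 + h *\<^sub>R axis j 1"
    by (simp add: add_ac)
  from 1 2[unfolded comm] have "h * (h * partial j (partial i f) (x + s *\<^sub>R axis i 1 + t *\<^sub>R axis j 1))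
      = h * (h * partial i (partial j f) (x + s' *\<^sub>R axis j 1 + t' *\<^sub>R axis i 1))" by linarith
  with h(1) have eq: "partial j (partial i f) (x + s *\<^sub>R axis i 1 + t *\<^sub>R axis j 1)
      = partial i (partial j f) (x + s' *\<^sub>R axis j 1 + t' *\<^sub>R axis i 1)" by simp
  have "dist (partial j (partial i f) (x + s *\<^sub>R axis i 1 + t *\<^sub>R axis j 1)) (partial j (partial i f) x) < \<epsilon>"
    "dist (partial i (partial j f) (x + s' *\<^sub>R axis j 1 + t' *\<^sub>R axis i 1)) (partial i (partial j f) x) < \<epsilon>"
    using near[OF st] near[OF st'] h d(2) by (meson less_trans)+
  moreover have False if "dist c a < e" "dist c b < e" "e = \<bar>b - a\<bar> / 2" for a b c e :: real
    using that by (auto simp: dist_real_def abs_if split: if_splits)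
  ultimately show False using eq \<epsilon>_def by metis
qed

text \<open>The error is measured by the oscillation \<epsilon> of the second derivatives along the
  segment. Along the scheme the squared steps have bounded sums and \<epsilon> becomes arbitrarily
  small, so second order suffices.\<close>

lemma taylor_second_order:
  fixes f :: "real^'n \<Rightarrow> real"
  assumes sm: "smooth_on S f" and seg: "\<And>t. 0 \<le> t \<Longrightarrow> t \<le> 1 \<Longrightarrow> y + t *\<^sub>R d \<in> S"
    and osc: "\<And>t i j. 0 \<le> t \<Longrightarrow> t \<le> 1 \<Longrightarrow> \<bar>partial i (partial j f) (y + t *\<^sub>R d) - partial i (partial j f) y\<bar> \<le> \<epsilon>"
  shows "\<bar>f (y + d) - f y - (\<Sum>i\<in>UNIV. d $ i * partial i f y)
     - 1/2 * (\<Sum>i\<in>UNIV. \<Sum>j\<in>UNIV. d $ i * d $ j * partial i (partial j f) y)\<bar>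
     \<le> 1/2 * \<epsilon> * (\<Sum>i\<in>UNIV. \<bar>d $ i\<bar>)\<^sup>2"
proof -
  \<comment> \<open>The derivative of order \<open>m\<close> of \<open>f\<close> along the segment,
    in the format that \<open>Taylor\<close> expects; every \<open>m\<close> above 1 is given the
    second derivative, since only \<open>m\<close> up to 2 is used.\<close>
  define D where "D m t = (if m = 0 then f (y + t *\<^sub>R d)
     else if m = 1 then (\<Sum>j\<in>UNIV. d $ j * partial j f (y + t *\<^sub>R d))
     else (\<Sum>j\<in>UNIV. d $ j * (\<Sum>i\<in>UNIV. d $ i * partial i (partial j f) (y + t *\<^sub>R d))))" for m :: nat and t
  have df: "f differentiable (at z)" "partial k f differentiable (at z)" if "z \<in> S" for z k
    using that smooth_on_differentiable[OF sm] smooth_on_differentiable[OF smooth_on_partial[OF sm]] by auto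
  have "(D m has_real_derivative D (Suc m) t) (at t)" if "m < 2" "0 \<le> t" "t \<le> 1" for m t
  proof (cases "m = 0")
    case True
    then show ?thesis unfolding D_def using DERIV_along_axis[OF df(1)[OF seg[OF that(2,3)]]] by simp
  next
    case False
    then have m: "m = 1" using that by simp
    have "((\<lambda>t. \<Sum>j\<in>UNIV. d $ j * partial j f (y + t *\<^sub>R d)) has_real_derivative
      (\<Sum>j\<in>UNIV. d $ j * (\<Sum>i\<in>UNIV. d $ i * partial i (partial j f) (y + t *\<^sub>R d)))) (at t)"
      by (intro DERIV_sum DERIV_cmult DERIV_along_axis df seg that)
    then show ?thesis unfolding D_def m by simp
  qed
  then have "\<forall>m t. m < 2 \<and> 0 \<le> t \<and> t \<le> 1 \<longrightarrow> DERIV (D m) t :> D (Suc m) t" by blast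
  moreover have "D 0 = (\<lambda>t. f (y + t *\<^sub>R d))" by (simp add: D_def fun_eq_iff)
  ultimately have "\<exists>t. (if (1::real) < 0 then 1 < t \<and> t < 0 else 0 < t \<and> t < 1) \<and>
      f (y + 1 *\<^sub>R d) = (\<Sum>m<2. D m 0 / fact m * (1 - 0) ^ m) + D 2 t / fact 2 * (1 - 0)^2"
    using Taylor[of 2 D "\<lambda>t. f (y + t *\<^sub>R d)" 0 1 0 1] by simp
  then obtain t where t: "0 < t" "t < 1" and e: "f (y + 1 *\<^sub>R d) = (\<Sum>m<2. D m 0 / fact m * (1 - 0) ^ m) + D 2 t / fact 2 * (1 - 0)^2"
    by auto
  have E: "f (y + d) = f y + (\<Sum>j\<in>UNIV. d $ j * partial j f y) + 1/2 * D 2 t"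
    using e by (simp add: D_def numeral_2_eq_2)
  have D2: "D 2 s = (\<Sum>i\<in>UNIV. \<Sum>j\<in>UNIV. d $ i * d $ j * partial i (partial j f) (y + s *\<^sub>R d))" for s
    unfolding D_def by (simp add: sum_distrib_left, subst sum.swap) (simp add: mult_ac)
  have osc2: "\<bar>D 2 t - D 2 0\<bar> \<le> \<epsilon> * (\<Sum>i\<in>UNIV. \<bar>d $ i\<bar>)\<^sup>2"
  proof -
    have "\<bar>D 2 t - D 2 0\<bar> = \<bar>\<Sum>i\<in>UNIV. \<Sum>j\<in>UNIV. d $ i * d $ j * (partial i (partial j f) (y + t *\<^sub>R d) - partial i (partial j f) y)\<bar>"
      unfolding D2 by (simp add: sum_subtractf[symmetric] right_diff_distrib)
    also have "\<dots> \<le> (\<Sum>i\<in>UNIV. \<Sum>j\<in>UNIV. \<bar>d $ i\<bar> * \<bar>d $ j\<bar> * \<epsilon>)"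
    proof (intro order_trans[OF sum_abs] sum_mono)
      fix i j
      show "\<bar>d $ i * d $ j * (partial i (partial j f) (y + t *\<^sub>R d) - partial i (partial j f) y)\<bar> \<le> \<bar>d $ i\<bar> * \<bar>d $ j\<bar> * \<epsilon>"
        unfolding abs_mult using osc[of t i j] t by (intro mult_mono) auto
    qed
    also have "\<dots> = \<epsilon> * (\<Sum>i\<in>UNIV. \<bar>d $ i\<bar>)\<^sup>2"
      by (simp add: power2_eq_square sum_product sum_distrib_left mult_ac)
    finally show ?thesis .
  qed
  have D20: "(\<Sum>i\<in>UNIV. \<Sum>j\<in>UNIV. d $ i * d $ j * partial i (partial j f) y) = D 2 0"
    unfolding D2 by simp
  have *: "\<bar>a + b + 1/2 * p - a - b - 1/2 * q\<bar> \<le> 1/2 * e * r" if "\<bar>p - q\<bar> \<le> e * r" for a b p q e r :: real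
  proof -
    have "a + b + 1/2 * p - a - b - 1/2 * q = (p - q) / 2" by (simp add: field_simps)
    then show ?thesis using that by (auto simp: abs_if split: if_splits)
  qed
  show ?thesis unfolding E D20 by (rule *[OF osc2])
qed

section \<open>Submersions and functions constant on their level sets\<close>

text \<open>Bootstrapping: the derivative of \<open>g\<close> at \<open>y\<close> solves a linear
  system whose matrix is the derivative of \<Phi> at \<open>g y\<close>. By Cramer's rule its
  solution is a quotient of determinants in those entries, so if \<open>g\<close> is of class
  \<open>k\<close>, its derivative is of class \<open>k\<close> as well and \<open>g\<close> is of
  class \<open>Suc k\<close>.\<close>

lemma smooth_on_inverse:
  fixes \<Phi> g :: "real^'n \<Rightarrow> real^'n"
  assumes U: "open U" "open V" and hom: "homeomorphism U V \<Phi> g" and sm: "smooth_on U \<Phi>"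
    and dg: "\<And>y. y \<in> V \<Longrightarrow> (g has_derivative g' y) (at y)"
    and inv: "\<And>y v. y \<in> V \<Longrightarrow> frechet_derivative \<Phi> (at (g y)) (g' y v) = v"
  shows "smooth_on V g"
  unfolding smooth_on_def
proof
  fix k
  have gV: "g ` V \<subseteq> U" using hom by (simp add: homeomorphism_def)
  show "C_k_on k V g"
  proof (induction k)
    case 0
    then show ?case using hom by (simp add: homeomorphism_def)
  next
    case (Suc k)
    define A where "A y = matrix (frechet_derivative \<Phi> (at (g y)))" for y
    have lin: "linear (frechet_derivative \<Phi> (at (g y)))" if "y \<in> V" for y
      using smooth_on_differentiable[OF sm] gV that by (intro linear_frechet_derivative) auto
    have Av: "A y *v g' y v = v" if "y \<in> V" for y v
      unfolding A_def using inv[OF that] matrix_vector_mul(2)[OF lin[OF that]] by metis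
    have det: "det (A y) \<noteq> 0" if "y \<in> V" for y
    proof -
      have "surj (\<lambda>v. A y *v v)" using Av[OF that] by (metis surjI)
      then obtain B where "A y ** B = mat 1" using matrix_right_invertible_surjective by blast
      then have "invertible (A y)" using matrix_left_right_inverse invertible_def by blast
      then show ?thesis by (simp add: invertible_det_nz)
    qed
    have A: "C_k_on k V (\<lambda>y. A y $ i $ j)" for i j
    proof -
      have "C_k_on k U (\<lambda>x. frechet_derivative \<Phi> (at x) (axis j 1) $ i)"
        using smooth_on_vec_nth[OF U(1) smooth_on_frechet_derivative[OF sm]] by (simp add: smooth_on_def)
      from C_k_on_compose[OF U(2,1) gV this Suc.IH]
      show ?thesis by (simp add: A_def matrix_def)
    qed
    show ?case
    proof (rule C_k_on_SucI[OF U(2) dg])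
      fix v
      have eq: "g' y v = (\<chi> l. det (\<chi> i j. if j = l then v $ i else A y $ i $ j) / det (A y))" if "y \<in> V" for y
        using Av[OF that] cramer[OF det[OF that]] by blast
      have "C_k_on k V (\<lambda>y. (\<chi> l. det (\<chi> i j. if j = l then v $ i else A y $ i $ j) / det (A y)) :: real^'n)"
      proof (rule C_k_on_vec_lambda[OF U(2)])
        fix l
        have "C_k_on k V (\<lambda>y. (\<chi> i j. if j = l then v $ i else A y $ i $ j) $ i $ j)" for i j
          using A[of i j] C_k_on_const by (cases "j = l") simp_all
        from C_k_on_divide_real[OF U(2) C_k_on_det[OF U(2) this] C_k_on_det[OF U(2) A] det]
        show "C_k_on k V (\<lambda>y. (\<chi> l. det (\<chi> i j. if j = l then v $ i else A y $ i $ j) / det (A y)) $ l)" by simp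
      qed
      then show "C_k_on k V (\<lambda>y. g' y v)"
        using C_k_on_cong[OF U(2), of "\<lambda>y. g' y v", OF eq] by blast
    qed
  qed
qed

text \<open>Local normal form of a submersion: in the chart \<Phi> the map \<Psi> becomes the linear
  surjection \<open>D\<close>, with linear right inverse \<open>A\<close>. Level sets become slices
  of affine subspaces, and affine translates of \<open>A\<close> become local sections.\<close>

lemma submersion_straightening:
  fixes \<Psi> :: "real^'n \<Rightarrow> real^'p"
  assumes M: "open M" and sm: "smooth_on M \<Psi>" and x0: "x0 \<in> M" and sj: "surj (frechet_derivative \<Psi> (at x0))"
  obtains U and V :: "(real^'n) set" and \<Phi> g A D where "open U" "x0 \<in> U" "U \<subseteq> M" "open V" "homeomorphism U V \<Phi> g" "smooth_on V g"
    "linear A" "linear D" "\<And>y. D (A y) = y" "\<And>z. z \<in> V \<Longrightarrow> \<Psi> (g z) = D z"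
proof -
  define D where "D = frechet_derivative \<Psi> (at x0)"
  have linD: "linear D" unfolding D_def
    by (rule linear_frechet_derivative[OF smooth_on_differentiable[OF sm x0]])
  obtain A where linA: "linear A" and "D \<circ> A = id"
    using linear_surjective_right_inverse[OF linD] sj unfolding D_def by blast
  then have DA: "D (A y) = y" for y by (metis comp_apply id_apply)
  \<comment> \<open>The second summand is the projection onto the kernel of \<open>D\<close> along
    the range of \<open>A\<close>. Replacing \<Psi> by its derivative \<open>D\<close> at
    \<open>x0\<close> turns the whole expression into the identity, so \<Phi> is invertible near
    \<open>x0\<close>; and \<open>D\<close> applied to it returns \<Psi> because \<open>D\<close>
    inverts \<open>A\<close> from the left.\<close>
  define \<Phi> where "\<Phi> x = A (\<Psi> x) + (x - A (D x))" for x
  have blA: "bounded_linear A" and blD: "bounded_linear D"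
    using linA linD linear_conv_bounded_linear by blast+
  note bl = blA blD bounded_linear_sub[OF bounded_linear_ident bounded_linear_compose[OF blA blD]]
  have sm\<Phi>: "smooth_on M \<Phi>"
  proof -
    have "smooth_on M (\<lambda>x. x - A (D x))"
      by (simp add: smooth_on_def C_k_on_linear[OF M bl(3)])
    then show ?thesis unfolding \<Phi>_def
      by (intro smooth_on_add[OF M] smooth_on_bounded_linear[OF M bl(1) sm])
  qed
  have D\<Phi>: "(\<Phi> has_derivative frechet_derivative \<Phi> (at x)) (at x)" if "x \<in> M" for x
    using smooth_on_differentiable[OF sm\<Phi> that] by (simp add: frechet_derivative_works[symmetric])
  then have blD: "bounded_linear (frechet_derivative \<Phi> (at x))" if "x \<in> M" for x
    using that has_derivative_bounded_linear by blast
  \<comment> \<open>The inverse function theorem asks for a continuous operator-valued derivative;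
    \<open>Blinfun\<close> packages the derivative as one, meaningfully on \<open>M\<close> only,
    which is why the coercion \<open>F\<close> below is restricted to \<open>M\<close>.\<close>
  define F where "F x = Blinfun (frechet_derivative \<Phi> (at x))" for x
  have F: "blinfun_apply (F x) = frechet_derivative \<Phi> (at x)" if "x \<in> M" for x
    unfolding F_def using blD[OF that] by (rule bounded_linear_Blinfun_apply)
  have contF: "continuous_on M F"
  proof (rule continuous_on_blinfun_componentwise)
    fix i :: "real^'n"
    have "continuous_on M (\<lambda>x. frechet_derivative \<Phi> (at x) i)"
      by (rule smooth_on_continuous_on[OF smooth_on_frechet_derivative[OF sm\<Phi>]])
    then show "continuous_on M (\<lambda>x. blinfun_apply (F x) i)"
      by (rule continuous_on_eq) (simp add: F)
  qed
  have "(\<Phi> has_derivative (\<lambda>v. A (D v) + (v - A (D v)))) (at x0)"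
    unfolding \<Phi>_def
    by (intro has_derivative_add bounded_linear.has_derivative[OF bl(1)] bounded_linear_imp_has_derivative[OF bl(3)])
      (use smooth_on_differentiable[OF sm x0] in \<open>simp add: frechet_derivative_works[symmetric] D_def\<close>)
  from frechet_derivative_at[OF this] have "frechet_derivative \<Phi> (at x0) = id" by (simp add: id_def)
  then have "F x0 = id_blinfun" by (intro blinfun_eqI) (simp add: F[OF x0])
  then have "id_blinfun o\<^sub>L F x0 = id_blinfun" by (intro blinfun_eqI) simp
  from inverse_function_theorem[OF M _ contF x0 this, of \<Phi>]
  obtain U V g g' where U: "open U" "U \<subseteq> M" "x0 \<in> U" "open V" "\<Phi> x0 \<in> V" "homeomorphism U V \<Phi> g"
    and g': "\<And>y. y \<in> V \<Longrightarrow> (g has_derivative g' y) (at y)"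
      "\<And>y. y \<in> V \<Longrightarrow> g' y = inv (blinfun_apply (F (g y)))"
      "\<And>y. y \<in> V \<Longrightarrow> bij (blinfun_apply (F (g y)))"
    using F D\<Phi> by metis
  have gU: "g y \<in> U" "\<Phi> (g y) = y" if "y \<in> V" for y
    using U(6) that by (auto simp: homeomorphism_def)
  have "smooth_on V g"
  proof (rule smooth_on_inverse[OF U(1,4,6) smooth_on_subset[OF sm\<Phi> U(2)] g'(1)])
    fix y v assume y: "y \<in> V"
    show "frechet_derivative \<Phi> (at (g y)) (g' y v) = v"
      using g'(2,3)[OF y] F[of "g y"] gU(1)[OF y] U(2) by (simp add: bij_is_surj surj_f_inv_f subset_iff)
  qed
  moreover have "\<Psi> (g z) = D z" if "z \<in> V" for z
  proof -
    have "D z = D (\<Phi> (g z))" using gU[OF that] by simp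
    also have "\<dots> = \<Psi> (g z)" unfolding \<Phi>_def
      by (simp add: linear_add[OF linD] linear_diff[OF linD] DA)
    finally show ?thesis by simp
  qed
  ultimately show ?thesis using that[OF U(1,3,2,4,6) _ linA linD DA] by blast
qed

text \<open>By connectedness of the fibre, local constancy is enough. In a straightening chart two
  nearby points of the fibre are joined by a straight segment with direction in the kernel of
  \<open>D\<close>; its image is tangent to the fibres, where the derivative of \<open>h\<close>
  vanishes.\<close>

lemma constant_on_fibres:
  fixes \<Psi> :: "real^'n \<Rightarrow> real^'p" and h :: "real^'n \<Rightarrow> 'b::real_normed_vector"
  assumes M: "open M" and sm: "smooth_on M \<Psi>" and sj: "\<And>x. x \<in> M \<Longrightarrow> surj (frechet_derivative \<Psi> (at x))"
    and conn: "connected {x \<in> M. \<Psi> x = y}"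
    and h: "smooth_on M h"
    and ker: "\<And>x v. x \<in> M \<Longrightarrow> frechet_derivative \<Psi> (at x) v = 0 \<Longrightarrow> frechet_derivative h (at x) v = 0"
    and x: "x \<in> M" "x' \<in> M" "\<Psi> x = y" "\<Psi> x' = y"
  shows "h x = h x'"
proof (rule connected_local_const[OF conn])
  show "x \<in> {x \<in> M. \<Psi> x = y}" "x' \<in> {x \<in> M. \<Psi> x = y}" using x by auto
  show "\<forall>a\<in>{x \<in> M. \<Psi> x = y}. eventually (\<lambda>b. h a = h b) (at a within {x \<in> M. \<Psi> x = y})"
  proof
    fix a assume a: "a \<in> {x \<in> M. \<Psi> x = y}"
    then have aM: "a \<in> M" by simp
    obtain U and V :: "(real^'n) set" and \<Phi> g A D where U: "open U" "a \<in> U" "U \<subseteq> M" "open V" "homeomorphism U V \<Phi> g" "smooth_on V g"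
      "linear A" "linear D" "\<And>y. D (A y) = y" and \<Psi>g: "\<And>z. z \<in> V \<Longrightarrow> \<Psi> (g z) = D z"
      by (rule submersion_straightening[OF M sm aM sj[OF aM]]) blast
    have hom: "\<Phi> ` U = V" "continuous_on U \<Phi>" "\<And>x. x \<in> U \<Longrightarrow> g (\<Phi> x) = x" "\<And>z. z \<in> V \<Longrightarrow> g z \<in> U"
      using U(5) by (auto simp: homeomorphism_def)
    \<comment> \<open>A ball is convex, so segments between its points stay in the domain
      \<open>V\<close> of the inverse chart.\<close>
    obtain e where e: "e > 0" "ball (\<Phi> a) e \<subseteq> V" using U(2,4) hom(1) open_contains_ball by blast
    have "open (U \<inter> \<Phi> -` ball (\<Phi> a) e)"
      by (rule continuous_open_preimage[OF hom(2) U(1)]) simp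
    moreover have "a \<in> U \<inter> \<Phi> -` ball (\<Phi> a) e" using U(2) e(1) by simp
    moreover have "h a = h b" if b: "b \<in> U \<inter> \<Phi> -` ball (\<Phi> a) e" "\<Psi> b = y" for b
    proof -
      define w where "w = \<Phi> b - \<Phi> a"
      have seg: "\<Phi> a + t *\<^sub>R w \<in> V" if "t \<in> {0..1}" for t
      proof -
        have "\<Phi> a + t *\<^sub>R w = (1 - t) *\<^sub>R \<Phi> a + t *\<^sub>R \<Phi> b" by (simp add: w_def algebra_simps)
        also have "\<dots> \<in> ball (\<Phi> a) e"
          using that b e by (intro convexD[OF convex_ball]) auto
        finally show ?thesis using e by auto
      qed
      have Vab: "\<Phi> a \<in> V" "\<Phi> b \<in> V" using U(2) b hom(1) by auto
      then have "D (\<Phi> a) = D (\<Phi> b)" using \<Psi>g a b hom(3) U(2) by (metis (mono_tags, lifting) IntD1 mem_Collect_eq)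
      then have Dw: "D w = 0" unfolding w_def by (simp add: linear_diff[OF U(8)])
      have "\<exists>c. \<forall>t\<in>{0..1}. h (g (\<Phi> a + t *\<^sub>R w)) = c"
      proof (rule has_derivative_zero_constant)
        fix t :: real assume t: "t \<in> {0..1}"
        let ?z = "\<Phi> a + t *\<^sub>R w"
        let ?G = "frechet_derivative g (at ?z)"
        have z: "?z \<in> V" "g ?z \<in> M" using seg[OF t] hom(4) U(3) by auto
        have dg: "(g has_derivative ?G) (at ?z)"
          using smooth_on_differentiable[OF U(6) z(1)] by (simp add: frechet_derivative_works[symmetric])
        have dline: "((\<lambda>t. \<Phi> a + t *\<^sub>R w) has_derivative (\<lambda>s. s *\<^sub>R w)) (at t within {0..1})"
          by (auto intro!: derivative_eq_intros)
        \<comment> \<open>The derivative of \<Psi> composed with \<open>g\<close> is computed twice,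
          by the chain rule and by linearity in the chart. Comparison shows that the derivative of
          \<open>g\<close> maps the kernel of \<open>D\<close> into the kernel of the derivative of
          \<Psi>.\<close>
        have "((\<lambda>z. \<Psi> (g z)) has_derivative (\<lambda>v. frechet_derivative \<Psi> (at (g ?z)) (?G v))) (at ?z)"
          using smooth_on_differentiable[OF sm z(2)]
          by (intro has_derivative_compose[OF dg]) (simp add: frechet_derivative_works[symmetric])
        moreover have "((\<lambda>z. \<Psi> (g z)) has_derivative D) (at ?z)"
          by (rule has_derivative_transform_within_open[OF linear_imp_has_derivative[OF U(8)] U(4) z(1)])
            (simp add: \<Psi>g)
        ultimately have "(\<lambda>v. frechet_derivative \<Psi> (at (g ?z)) (?G v)) = D"
          by (rule has_derivative_unique)
        then have "frechet_derivative \<Psi> (at (g ?z)) (?G v) = D v" for v by metis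
        then have "frechet_derivative h (at (g ?z)) (?G w) = 0" using ker[OF z(2)] Dw by simp
        moreover have "((\<lambda>t. h (g (\<Phi> a + t *\<^sub>R w))) has_derivative (\<lambda>s. frechet_derivative h (at (g ?z)) (?G (s *\<^sub>R w)))) (at t within {0..1})"
          using smooth_on_differentiable[OF h z(2)]
          by (intro has_derivative_compose[OF has_derivative_compose[OF dline dg]]) (simp add: frechet_derivative_works[symmetric])
        moreover have "linear (frechet_derivative h (at (g ?z)))"
          by (rule linear_frechet_derivative[OF smooth_on_differentiable[OF h z(2)]])
        ultimately show "((\<lambda>t. h (g (\<Phi> a + t *\<^sub>R w))) has_derivative (\<lambda>s. 0)) (at t within {0..1})"
          by (simp add: linear_cmul[OF has_derivative_linear[OF dg]] linear_cmul)
      qed simp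
      then obtain c where "\<And>t. t \<in> {0..1} \<Longrightarrow> h (g (\<Phi> a + t *\<^sub>R w)) = c" by blast
      from this[of 0] this[of 1] have "h (g (\<Phi> a + 0 *\<^sub>R w)) = h (g (\<Phi> a + 1 *\<^sub>R w))" by simp
      then show ?thesis using hom(3) U(2) b by (simp add: w_def)
    qed
    ultimately show "eventually (\<lambda>b. h a = h b) (at a within {x \<in> M. \<Psi> x = y})"
      unfolding eventually_at_topological by blast
  qed
qed

text \<open>Constancy on fibres makes the choice of a preimage immaterial, and near each point the
  arbitrary choice may be replaced by a smooth local section of \<Psi>.\<close>

lemma smooth_factorization:
  fixes \<Psi> :: "real^'n \<Rightarrow> real^'p" and h :: "real^'n \<Rightarrow> 'b::real_normed_vector"
  assumes M: "open M" and red: "reduction_map M M' \<Psi>" and h: "smooth_on M h"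
    and ker: "\<And>x v. x \<in> M \<Longrightarrow> frechet_derivative \<Psi> (at x) v = 0 \<Longrightarrow> frechet_derivative h (at x) v = 0"
  obtains h' where "smooth_on M' h'" "\<And>x. x \<in> M \<Longrightarrow> h x = h' (\<Psi> x)"
proof -
  have sm: "smooth_on M \<Psi>" and im: "\<Psi> ` M = M'" and sj: "\<And>x. x \<in> M \<Longrightarrow> surj (frechet_derivative \<Psi> (at x))"
    and conn: "\<And>y. y \<in> M' \<Longrightarrow> connected {x \<in> M. \<Psi> x = y}"
    using red by (auto simp: reduction_map_def)
  have const: "h x = h x'" if "x \<in> M" "x' \<in> M" "\<Psi> x = \<Psi> x'" for x x'
    by (rule constant_on_fibres[OF M sm sj conn h ker, of "\<Psi> x'"]) (use that im in auto)
  define h' where "h' y = h (SOME x. x \<in> M \<and> \<Psi> x = y)" for y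
  have h': "h x = h' (\<Psi> x)" if "x \<in> M" for x
  proof -
    have "(SOME z. z \<in> M \<and> \<Psi> z = \<Psi> x) \<in> M \<and> \<Psi> (SOME z. z \<in> M \<and> \<Psi> z = \<Psi> x) = \<Psi> x"
      by (rule someI_ex) (use that in auto)
    then show ?thesis unfolding h'_def using const that by metis
  qed
  have "smooth_on M' h'"
  proof (rule smooth_on_local)
    fix y0 assume "y0 \<in> M'"
    then obtain a where a: "a \<in> M" "\<Psi> a = y0" using im by auto
    obtain U and V :: "(real^'n) set" and \<Phi> g A D where U: "open U" "a \<in> U" "U \<subseteq> M" "open V" "homeomorphism U V \<Phi> g" "smooth_on V g"
      "linear A" "linear D" "\<And>y. D (A y) = y" and \<Psi>g: "\<And>z. z \<in> V \<Longrightarrow> \<Psi> (g z) = D z"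
      by (rule submersion_straightening[OF M sm a(1) sj[OF a(1)]]) blast
    have hom: "\<Phi> ` U = V" "\<And>x. x \<in> U \<Longrightarrow> g (\<Phi> x) = x" "\<And>z. z \<in> V \<Longrightarrow> g z \<in> U"
      using U(5) by (auto simp: homeomorphism_def)
    have blA: "bounded_linear A" using U(7) linear_conv_bounded_linear by blast
    \<comment> \<open>This offset makes the affine section pass through \<Phi> a over
      \<open>y0\<close>. It lies in the kernel of \<open>D\<close>, so adding it does not change the
      value of \<Psi>.\<close>
    define c where "c = \<Phi> a - A y0"
    define W where "W = (\<lambda>y. A y + c) -` V"
    have W: "open W" unfolding W_def
      using U(4) linear_continuous_on[OF blA] by (intro open_vimage continuous_intros) auto
    have yW: "y0 \<in> W" using hom(1) U(2) by (auto simp: W_def c_def)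
    have sl: "smooth_on W (\<lambda>y. A y + c)"
      by (intro smooth_on_add[OF W] smooth_on_const) (simp add: smooth_on_def C_k_on_linear[OF W blA])
    have sg: "smooth_on W (\<lambda>y. g (A y + c))"
      by (rule smooth_on_compose[OF W U(4) _ U(6) sl]) (auto simp: W_def)
    have "smooth_on W (\<lambda>y. h (g (A y + c)))"
      by (rule smooth_on_compose[OF W M _ h sg]) (use hom(3) U(3) in \<open>auto simp: W_def\<close>)
    moreover have "h (g (A y + c)) = h' y" if "y \<in> W" for y
    proof -
      have z: "A y + c \<in> V" using that by (simp add: W_def)
      have "\<Phi> a \<in> V" using hom(1) U(2) by auto
      then have "D (\<Phi> a) = y0" using \<Psi>g[of "\<Phi> a"] hom(2)[OF U(2)] a by simp
      then have "\<Psi> (g (A y + c)) = y"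
        using \<Psi>g[OF z] by (simp add: c_def linear_add[OF U(8)] linear_diff[OF U(8)] U(9))
      then show ?thesis using h'[of "g (A y + c)"] hom(3)[OF z] U(3) by auto
    qed
    ultimately have "smooth_on W h'"
      using smooth_on_cong[OF W, of "\<lambda>y. h (g (A y + c))" h'] by blast
    then show "\<exists>U. open U \<and> y0 \<in> U \<and> smooth_on U h'" using W yW by blast
  qed
  then show ?thesis using that h' by blast
qed

section \<open>Invariance of the reduced coefficients\<close>

lemma generator_vec_nth:
  fixes f :: "real^'n \<Rightarrow> real^'p"
  assumes "open M" "smooth_on M f" "x \<in> M"
  shows "generator \<mu> \<sigma> f x $ a = generator \<mu> \<sigma> (\<lambda>y. f y $ a) x"
proof -
  have 1: "partial i (\<lambda>y. f y $ a) z = partial i f z $ a" if "z \<in> M" for i z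
    by (rule partial_vec_nth[OF smooth_on_differentiable[OF assms(2) that]])
  have "partial i (partial j (\<lambda>y. f y $ a)) x = partial i (partial j f) x $ a" for i j
  proof -
    have "partial i (partial j (\<lambda>y. f y $ a)) x = partial i (\<lambda>y. partial j f y $ a) x"
    proof (rule partial_cong[OF assms(1,3)])
      show "partial j (\<lambda>y. f y $ a) differentiable (at x)"
        by (rule smooth_on_differentiable[OF smooth_on_partial[OF smooth_on_vec_nth[OF assms(1,2)]] assms(3)])
    qed (rule 1)
    also have "\<dots> = partial i (partial j f) x $ a"
      by (rule partial_vec_nth[OF smooth_on_differentiable[OF smooth_on_partial[OF assms(2)] assms(3)]])
    finally show ?thesis .
  qed
  then show ?thesis using 1[OF assms(3)] by (simp add: generator_def)
qed

lemma derivation_vec_nth: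
  assumes "f differentiable (at x)"
  shows "derivation Y f x $ a = derivation Y (\<lambda>y. f y $ a) x"
  using partial_vec_nth[OF assms] by (simp add: derivation_def)

lemma jacobian_nth:
  fixes f :: "real^'n \<Rightarrow> real^'p"
  shows "jacobian f (at x) $ a $ i = partial i f x $ a"
  by (simp add: jacobian_def matrix_def partial_def)

lemma smooth_on_generator:
  fixes f :: "real^'n \<Rightarrow> real"
  assumes "open M" "smooth_on M \<mu>" "smooth_on M \<sigma>" "smooth_on M f"
  shows "smooth_on M (generator \<mu> \<sigma> f)"
  unfolding generator_def[abs_def] real_scaleR_def
  by (intro smooth_on_add[OF assms(1)] smooth_on_mult[OF assms(1)] smooth_on_const smooth_on_sum[OF assms(1)]
    smooth_on_partial smooth_on_vec_nth[OF assms(1)] assms)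

text \<open>The pointwise content of \<open>[Y, L] = 0\<close>: the letters stand for the values at one point of \<open>Y\<close>, of its
  first and second derivatives \<open>y1\<close>, \<open>y2\<close>, of \<open>\<sigma>\<close>, \<open>\<mu>\<close> and \<open>f\<close> and their derivatives. Applying \<open>\<partial>\<^sub>i\<close> and
  \<open>\<partial>\<^sub>i\<partial>\<^sub>j\<close> to \<open>Y f = 0\<close> gives \<open>E1\<close> and \<open>E2\<close>. The bracket condition leaves a remainder
  in \<open>\<sigma> C \<sigma>\<^sup>T\<close>, which vanishes because \<open>C\<close> is antisymmetric.\<close>

lemma commutator_algebra:
  fixes y :: "'n::finite \<Rightarrow> real" and s :: "'n \<Rightarrow> 'm::finite \<Rightarrow> real"
  assumes E1: "\<And>i. (\<Sum>l\<in>UNIV. y1 i l * f1 l + y l * f2 i l) = 0"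
    and E2: "\<And>i j. (\<Sum>l\<in>UNIV. y2 i j l * f1 l + y1 j l * f2 i l + y1 i l * f2 j l + y l * f3 l i j) = 0"
    and B: "\<And>i \<alpha>. (\<Sum>l\<in>UNIV. y l * s1 l i \<alpha>) = (\<Sum>l\<in>UNIV. s l \<alpha> * y1 l i) - (\<Sum>\<beta>\<in>UNIV. s i \<beta> * c \<beta> \<alpha>)"
    and Dr: "\<And>i. (\<Sum>l\<in>UNIV. y l * m1 l i) = 1/2 * (\<Sum>\<alpha>\<in>UNIV. \<Sum>p\<in>UNIV. \<Sum>q\<in>UNIV. s p \<alpha> * s q \<alpha> * y2 p q i) + (\<Sum>p\<in>UNIV. m p * y1 p i)"
    and sym: "\<And>i j. f2 i j = f2 j i" and anti: "\<And>\<alpha> \<beta>. c \<alpha> \<beta> = - c \<beta> \<alpha>"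
  shows "1/2 * (\<Sum>\<alpha>\<in>UNIV. \<Sum>i\<in>UNIV. \<Sum>j\<in>UNIV. \<Sum>l\<in>UNIV. y l * ((s1 l i \<alpha> * s j \<alpha> + s i \<alpha> * s1 l j \<alpha>) * f2 i j + s i \<alpha> * s j \<alpha> * f3 l i j))
    + (\<Sum>i\<in>UNIV. \<Sum>l\<in>UNIV. y l * (m1 l i * f1 i + m i * f2 l i)) = 0"
proof -
  \<comment> \<open>\<open>Dr\<close> replaces the derivative of the drift along Y and
    \<open>E1\<close> the term with \<open>f2\<close>; the two contributions of the form
    \<open>m * y1 * f1\<close> cancel and only second derivatives of Y survive.\<close>
  have drift: "(\<Sum>i\<in>UNIV. \<Sum>l\<in>UNIV. y l * (m1 l i * f1 i + m i * f2 l i))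
    = 1/2 * (\<Sum>\<alpha>\<in>UNIV. \<Sum>i\<in>UNIV. \<Sum>j\<in>UNIV. s i \<alpha> * s j \<alpha> * (\<Sum>l\<in>UNIV. y2 i j l * f1 l))"
  proof -
    have E1': "(\<Sum>l\<in>UNIV. y l * f2 l i) = - (\<Sum>l\<in>UNIV. y1 i l * f1 l)" for i
      using E1[of i] by (simp add: sum.distrib sym[of i])
    have "(\<Sum>i\<in>UNIV. \<Sum>l\<in>UNIV. y l * (m1 l i * f1 i + m i * f2 l i))
      = (\<Sum>i\<in>UNIV. f1 i * (\<Sum>l\<in>UNIV. y l * m1 l i)) + (\<Sum>i\<in>UNIV. m i * (\<Sum>l\<in>UNIV. y l * f2 l i))"
      by (simp add: sum.distrib[symmetric] sum_distrib_left algebra_simps)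
    also have "\<dots> = (\<Sum>i\<in>UNIV. f1 i * (1/2 * (\<Sum>\<alpha>\<in>UNIV. \<Sum>p\<in>UNIV. \<Sum>q\<in>UNIV. s p \<alpha> * s q \<alpha> * y2 p q i)))
        + (\<Sum>i\<in>UNIV. \<Sum>p\<in>UNIV. f1 i * (m p * y1 p i)) - (\<Sum>i\<in>UNIV. \<Sum>l\<in>UNIV. m i * (y1 i l * f1 l))"
      unfolding E1' Dr by (simp add: distrib_left sum.distrib sum_distrib_left sum_negf)
    also have "(\<Sum>i\<in>UNIV. \<Sum>l\<in>UNIV. m i * (y1 i l * f1 l)) = (\<Sum>i\<in>UNIV. \<Sum>p\<in>UNIV. f1 i * (m p * y1 p i))"
      by (subst sum.swap) (simp add: mult_ac)
    also have "(\<Sum>i\<in>UNIV. f1 i * (1/2 * (\<Sum>\<alpha>\<in>UNIV. \<Sum>p\<in>UNIV. \<Sum>q\<in>UNIV. s p \<alpha> * s q \<alpha> * y2 p q i)))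
      = 1/2 * (\<Sum>i\<in>UNIV. \<Sum>\<alpha>\<in>UNIV. \<Sum>p\<in>UNIV. \<Sum>q\<in>UNIV. s p \<alpha> * s q \<alpha> * (y2 p q i * f1 i))"
      by (simp add: sum_distrib_left mult_ac)
    also have "(\<Sum>i\<in>UNIV. \<Sum>\<alpha>\<in>UNIV. \<Sum>p\<in>UNIV. \<Sum>q\<in>UNIV. s p \<alpha> * s q \<alpha> * (y2 p q i * f1 i))
      = (\<Sum>\<alpha>\<in>UNIV. \<Sum>p\<in>UNIV. \<Sum>q\<in>UNIV. \<Sum>i\<in>UNIV. s p \<alpha> * s q \<alpha> * (y2 p q i * f1 i))"
      by (subst sum.swap, rule sum.cong[OF refl], subst sum.swap, rule sum.cong[OF refl], rule sum.swap)
    finally show ?thesis by (simp add: sum_distrib_left)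
  qed
  \<comment> \<open>\<open>E2\<close> trades the third derivatives of \<open>f\<close>, together
    with the surviving \<open>y2\<close>, for first derivatives of Y times second derivatives of
    \<open>f\<close>. The outcome splits into \<open>R\<close> and its transpose in \<open>i\<close>
    and \<open>j\<close>, so the double sum of \<open>R\<close> alone decides.\<close>
  define R where "R \<alpha> i j = (\<Sum>l\<in>UNIV. y l * s1 l i \<alpha>) * s j \<alpha> * f2 i j - s i \<alpha> * s j \<alpha> * (\<Sum>l\<in>UNIV. y1 i l * f2 j l)" for \<alpha> i j
  have inner: "(\<Sum>l\<in>UNIV. y l * ((s1 l i \<alpha> * s j \<alpha> + s i \<alpha> * s1 l j \<alpha>) * f2 i j + s i \<alpha> * s j \<alpha> * f3 l i j))
      + s i \<alpha> * s j \<alpha> * (\<Sum>l\<in>UNIV. y2 i j l * f1 l) = R \<alpha> i j + R \<alpha> j i" for i j \<alpha>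
  proof -
    have E2': "(\<Sum>l\<in>UNIV. y l * f3 l i j) + (\<Sum>l\<in>UNIV. y2 i j l * f1 l)
       = - (\<Sum>l\<in>UNIV. y1 j l * f2 i l) - (\<Sum>l\<in>UNIV. y1 i l * f2 j l)"
      using E2[of i j] by (simp add: sum.distrib)
    have "(\<Sum>l\<in>UNIV. y l * ((s1 l i \<alpha> * s j \<alpha> + s i \<alpha> * s1 l j \<alpha>) * f2 i j + s i \<alpha> * s j \<alpha> * f3 l i j))
       = (\<Sum>l\<in>UNIV. y l * s1 l i \<alpha>) * s j \<alpha> * f2 i j + (\<Sum>l\<in>UNIV. y l * s1 l j \<alpha>) * s i \<alpha> * f2 i j
        + s i \<alpha> * s j \<alpha> * (\<Sum>l\<in>UNIV. y l * f3 l i j)"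
      by (simp add: sum_distrib_left sum_distrib_right sum.distrib[symmetric] algebra_simps)
    then have "(\<Sum>l\<in>UNIV. y l * ((s1 l i \<alpha> * s j \<alpha> + s i \<alpha> * s1 l j \<alpha>) * f2 i j + s i \<alpha> * s j \<alpha> * f3 l i j))
      + s i \<alpha> * s j \<alpha> * (\<Sum>l\<in>UNIV. y2 i j l * f1 l)
      = (\<Sum>l\<in>UNIV. y l * s1 l i \<alpha>) * s j \<alpha> * f2 i j + (\<Sum>l\<in>UNIV. y l * s1 l j \<alpha>) * s i \<alpha> * f2 i j
        + s i \<alpha> * s j \<alpha> * ((\<Sum>l\<in>UNIV. y l * f3 l i j) + (\<Sum>l\<in>UNIV. y2 i j l * f1 l))"
      by (simp add: algebra_simps)
    then show ?thesis unfolding E2' R_def by (simp add: algebra_simps sym[of j i])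
  qed
  \<comment> \<open>After substituting the bracket condition \<open>B\<close>, the terms with
    \<open>y1\<close> cancel by renaming summation indices and symmetry of \<open>f2\<close>; the
    term in \<sigma> C \<sigma> remains.\<close>
  have Rsum: "(\<Sum>i\<in>UNIV. \<Sum>j\<in>UNIV. R \<alpha> i j) = - (\<Sum>i\<in>UNIV. \<Sum>j\<in>UNIV. \<Sum>\<beta>\<in>UNIV. s i \<beta> * c \<beta> \<alpha> * s j \<alpha> * f2 i j)" for \<alpha>
  proof -
    have "(\<Sum>i\<in>UNIV. \<Sum>j\<in>UNIV. R \<alpha> i j) = (\<Sum>i\<in>UNIV. \<Sum>j\<in>UNIV. \<Sum>l\<in>UNIV. s l \<alpha> * y1 l i * s j \<alpha> * f2 i j)
       - (\<Sum>i\<in>UNIV. \<Sum>j\<in>UNIV. \<Sum>\<beta>\<in>UNIV. s i \<beta> * c \<beta> \<alpha> * s j \<alpha> * f2 i j)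
       - (\<Sum>i\<in>UNIV. \<Sum>j\<in>UNIV. \<Sum>l\<in>UNIV. s i \<alpha> * s j \<alpha> * y1 i l * f2 j l)"
      unfolding R_def B by (simp add: left_diff_distrib sum_distrib_left sum_distrib_right sum_subtractf mult.assoc)
    also have "(\<Sum>i\<in>UNIV. \<Sum>j\<in>UNIV. \<Sum>l\<in>UNIV. s l \<alpha> * y1 l i * s j \<alpha> * f2 i j)
      = (\<Sum>j\<in>UNIV. \<Sum>l\<in>UNIV. \<Sum>i\<in>UNIV. s l \<alpha> * y1 l i * s j \<alpha> * f2 i j)"
      by (subst sum.swap, rule sum.cong[OF refl], rule sum.swap)
    also have "\<dots> = (\<Sum>i\<in>UNIV. \<Sum>j\<in>UNIV. \<Sum>l\<in>UNIV. s i \<alpha> * s j \<alpha> * y1 i l * f2 j l)"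
      by (subst sum.swap) (simp add: mult_ac sym)
    finally show ?thesis by simp
  qed
  \<comment> \<open>Exchanging \<open>i\<close> with \<open>j\<close> and \<alpha> with \<beta> at
    once preserves the product of the \<open>s\<close> factors and \<open>f2\<close> but reverses
    the sign of \<open>c\<close>, so the sum equals its own negative.\<close>
  have skew: "(\<Sum>\<alpha>\<in>UNIV. \<Sum>i\<in>UNIV. \<Sum>j\<in>UNIV. R \<alpha> i j) = 0"
  proof -
    define Q where "Q = (\<Sum>\<alpha>\<in>UNIV. \<Sum>i\<in>UNIV. \<Sum>j\<in>UNIV. \<Sum>\<beta>\<in>UNIV. s i \<beta> * c \<beta> \<alpha> * s j \<alpha> * f2 i j)"
    have "Q = (\<Sum>i\<in>UNIV. \<Sum>\<alpha>\<in>UNIV. \<Sum>j\<in>UNIV. \<Sum>\<beta>\<in>UNIV. s i \<beta> * c \<beta> \<alpha> * s j \<alpha> * f2 i j)"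
      unfolding Q_def by (rule sum.swap)
    also have "\<dots> = (\<Sum>i\<in>UNIV. \<Sum>j\<in>UNIV. \<Sum>\<alpha>\<in>UNIV. \<Sum>\<beta>\<in>UNIV. s i \<beta> * c \<beta> \<alpha> * s j \<alpha> * f2 i j)"
      by (rule sum.cong[OF refl], rule sum.swap)
    finally have Q: "Q = (\<Sum>i\<in>UNIV. \<Sum>j\<in>UNIV. \<Sum>\<alpha>\<in>UNIV. \<Sum>\<beta>\<in>UNIV. s i \<beta> * c \<beta> \<alpha> * s j \<alpha> * f2 i j)" .
    also have "\<dots> = (\<Sum>j\<in>UNIV. \<Sum>i\<in>UNIV. \<Sum>\<beta>\<in>UNIV. \<Sum>\<alpha>\<in>UNIV. s i \<beta> * c \<beta> \<alpha> * s j \<alpha> * f2 i j)"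
      by (subst sum.swap) (intro sum.cong refl sum.swap)
    also have "\<dots> = (\<Sum>i\<in>UNIV. \<Sum>j\<in>UNIV. \<Sum>\<alpha>\<in>UNIV. \<Sum>\<beta>\<in>UNIV. - (s i \<beta> * c \<beta> \<alpha> * s j \<alpha> * f2 i j))"
    proof (intro sum.cong refl)
      fix i j \<alpha> \<beta>
      show "s j \<alpha> * c \<alpha> \<beta> * s i \<beta> * f2 j i = - (s i \<beta> * c \<beta> \<alpha> * s j \<alpha> * f2 i j)"
        by (subst anti, subst sym) simp
    qed
    also have "\<dots> = - Q" unfolding Q by (simp add: sum_negf)
    finally have "Q = 0" by simp
    then show ?thesis unfolding Rsum by (simp add: sum_negf Q_def)
  qed
  have "1/2 * (\<Sum>\<alpha>\<in>UNIV. \<Sum>i\<in>UNIV. \<Sum>j\<in>UNIV. \<Sum>l\<in>UNIV. y l * ((s1 l i \<alpha> * s j \<alpha> + s i \<alpha> * s1 l j \<alpha>) * f2 i j + s i \<alpha> * s j \<alpha> * f3 l i j))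
    + (\<Sum>i\<in>UNIV. \<Sum>l\<in>UNIV. y l * (m1 l i * f1 i + m i * f2 l i))
    = 1/2 * (\<Sum>\<alpha>\<in>UNIV. \<Sum>i\<in>UNIV. \<Sum>j\<in>UNIV. (R \<alpha> i j + R \<alpha> j i))"
    unfolding drift inner[symmetric] distrib_left[symmetric] sum.distrib[symmetric] by (rule refl)
  also have "(\<Sum>\<alpha>\<in>UNIV. \<Sum>i\<in>UNIV. \<Sum>j\<in>UNIV. (R \<alpha> i j + R \<alpha> j i))
    = (\<Sum>\<alpha>\<in>UNIV. \<Sum>i\<in>UNIV. \<Sum>j\<in>UNIV. R \<alpha> i j) + (\<Sum>\<alpha>\<in>UNIV. \<Sum>i\<in>UNIV. \<Sum>j\<in>UNIV. R \<alpha> j i)"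
    by (simp add: sum.distrib)
  also have "(\<Sum>\<alpha>\<in>UNIV. \<Sum>i\<in>UNIV. \<Sum>j\<in>UNIV. R \<alpha> j i) = (\<Sum>\<alpha>\<in>UNIV. \<Sum>i\<in>UNIV. \<Sum>j\<in>UNIV. R \<alpha> i j)"
    by (rule sum.cong[OF refl], rule sum.swap)
  finally show ?thesis using skew by simp
qed

section \<open>A symmetry field acting on an invariant function\<close>

context
  fixes M :: "(real^'n) set" and \<mu> :: "real^'n \<Rightarrow> real^'n" and \<sigma> :: "real^'n \<Rightarrow> real^'m^'n"
    and Y :: "real^'n \<Rightarrow> real^'n" and C :: "real^'n \<Rightarrow> real^'m^'m" and f :: "real^'n \<Rightarrow> real"
  assumes M: "open M" and sde: "is_SDE M \<mu> \<sigma>" and symm: "quasi_strong_symmetry M \<mu> \<sigma> Y C"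
    and f: "smooth_on M f" and Yf: "\<And>x. x \<in> M \<Longrightarrow> derivation Y f x = 0"
begin

lemma smooth_data: "smooth_on M \<mu>" "smooth_on M \<sigma>" "smooth_on M Y"
  using sde symm
  by (auto simp: is_SDE_def quasi_strong_symmetry_def infinitesimal_symmetry_def infinitesimal_transformation_def)

lemma smooth_components:
  "smooth_on M (\<lambda>x. \<mu> x $ i)" "smooth_on M (\<lambda>x. \<sigma> x $ i $ \<alpha>)" "smooth_on M (\<lambda>x. Y x $ i)"
  by (intro smooth_on_vec_nth[OF M] smooth_data)+

lemma derivation_first_order:
  assumes x: "x \<in> M"
  shows "(\<Sum>l\<in>UNIV. partial i (\<lambda>z. Y z $ l) x * partial l f x + Y x $ l * partial i (partial l f) x) = 0"
proof -
  have d: "(\<lambda>z. Y z $ l) differentiable at x" "partial l f differentiable at x" for l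
    by (intro smooth_on_differentiable[OF smooth_components(3) x] smooth_on_differentiable[OF smooth_on_partial[OF f] x])+
  have "partial i (derivation Y f) x = partial i (\<lambda>_. 0) x"
    by (rule partial_cong[OF M x Yf]) (auto simp: derivation_def[abs_def] intro!: d differentiable_sum differentiable_mult)
  moreover have "partial i (derivation Y f) x = (\<Sum>l\<in>UNIV. partial i (\<lambda>z. Y z $ l * partial l f z) x)"
    unfolding derivation_def[abs_def] real_scaleR_def by (rule partial_sum) (intro d differentiable_mult)
  ultimately show ?thesis using d by (simp add: partial_mult partial_const add.commute)
qed

text \<open>Differentiates \<open>derivation_first_order\<close> once more. The third-order term is
  rearranged by symmetry of derivatives to have \<open>partial l\<close> outermost, the form in
  which it occurs when Y acts on \<open>generator \<mu> \<sigma> f\<close>.\<close>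

lemma derivation_second_order:
  assumes x: "x \<in> M"
  shows "(\<Sum>l\<in>UNIV. partial i (partial j (\<lambda>z. Y z $ l)) x * partial l f x
      + partial j (\<lambda>z. Y z $ l) x * partial i (partial l f) x
      + partial i (\<lambda>z. Y z $ l) x * partial j (partial l f) x
      + Y x $ l * partial l (partial i (partial j f)) x) = 0"
proof -
  have d: "(\<lambda>z. Y z $ l) differentiable at x" "partial l f differentiable at x"
    "partial j (\<lambda>z. Y z $ l) differentiable at x" "partial k (partial l f) differentiable at x" for l k
    by (intro smooth_on_differentiable[OF _ x] smooth_on_partial smooth_components f)+
  have "partial i (\<lambda>x. \<Sum>l\<in>UNIV. partial j (\<lambda>z. Y z $ l) x * partial l f x + Y x $ l * partial j (partial l f) x) x
      = partial i (\<lambda>_. 0) x"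
    by (rule partial_cong[OF M x derivation_first_order])
      (auto intro!: d differentiable_sum differentiable_mult differentiable_add)
  moreover have "partial i (\<lambda>x. \<Sum>l\<in>UNIV. partial j (\<lambda>z. Y z $ l) x * partial l f x + Y x $ l * partial j (partial l f) x) x
    = (\<Sum>l\<in>UNIV. partial i (\<lambda>x. partial j (\<lambda>z. Y z $ l) x * partial l f x + Y x $ l * partial j (partial l f) x) x)"
    by (rule partial_sum) (intro d differentiable_mult differentiable_add)
  moreover have "partial i (\<lambda>x. partial j (\<lambda>z. Y z $ l) x * partial l f x + Y x $ l * partial j (partial l f) x) x
    = partial i (partial j (\<lambda>z. Y z $ l)) x * partial l f x + partial j (\<lambda>z. Y z $ l) x * partial i (partial l f) x
      + partial i (\<lambda>z. Y z $ l) x * partial j (partial l f) x + Y x $ l * partial i (partial j (partial l f)) x" for l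
    by (subst partial_add) (auto simp: partial_mult d intro!: d differentiable_mult)
  moreover have "partial i (partial j (partial l f)) x = partial l (partial i (partial j f)) x" for l
  proof -
    have "partial i (partial j (partial l f)) x = partial i (partial l (partial j f)) x"
      by (rule partial_cong[OF M x partial_commute[OF M f] d(4)])
    then show ?thesis using partial_commute[OF M smooth_on_partial[OF f] x] by simp
  qed
  ultimately show ?thesis by (simp add: partial_const)
qed

lemma bracket_condition:
  assumes x: "x \<in> M"
  shows "(\<Sum>l\<in>UNIV. Y x $ l * partial l (\<lambda>z. \<sigma> z $ i $ \<alpha>) x)
    = (\<Sum>l\<in>UNIV. \<sigma> x $ l $ \<alpha> * partial l (\<lambda>z. Y z $ i) x) - (\<Sum>\<beta>\<in>UNIV. \<sigma> x $ i $ \<beta> * C x $ \<beta> $ \<alpha>)"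
proof -
  have "bracket Y \<sigma> x = - (\<sigma> x ** C x)"
    using symm x by (auto simp: quasi_strong_symmetry_def infinitesimal_symmetry_def)
  then have "bracket Y \<sigma> x $ i $ \<alpha> = - (\<Sum>\<beta>\<in>UNIV. \<sigma> x $ i $ \<beta> * C x $ \<beta> $ \<alpha>)"
    by (simp add: matrix_matrix_mult_def)
  then show ?thesis by (simp add: bracket_def sum_subtractf)
qed

lemma drift_condition:
  assumes x: "x \<in> M"
  shows "(\<Sum>l\<in>UNIV. Y x $ l * partial l (\<lambda>z. \<mu> z $ i) x)
    = 1/2 * (\<Sum>\<alpha>\<in>UNIV. \<Sum>p\<in>UNIV. \<Sum>q\<in>UNIV. \<sigma> x $ p $ \<alpha> * \<sigma> x $ q $ \<alpha> * partial p (partial q (\<lambda>z. Y z $ i)) x)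
      + (\<Sum>p\<in>UNIV. \<mu> x $ p * partial p (\<lambda>z. Y z $ i) x)"
proof -
  have "derivation Y \<mu> x = generator \<mu> \<sigma> Y x"
    using symm x by (auto simp: quasi_strong_symmetry_def infinitesimal_symmetry_def)
  then have "derivation Y (\<lambda>z. \<mu> z $ i) x = generator \<mu> \<sigma> (\<lambda>z. Y z $ i) x"
    using derivation_vec_nth[OF smooth_on_differentiable[OF smooth_data(1) x], of Y i]
      generator_vec_nth[OF M smooth_data(3) x] by metis
  then show ?thesis by (simp add: derivation_def generator_def)
qed

lemma antisymmetric:
  assumes x: "x \<in> M"
  shows "C x $ \<alpha> $ \<beta> = - C x $ \<beta> $ \<alpha>"
proof -
  have "transpose (C x) = - C x"
    using symm x by (auto simp: quasi_strong_symmetry_def infinitesimal_symmetry_def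
      infinitesimal_transformation_def so_def)
  then have "transpose (C x) $ \<beta> $ \<alpha> = (- C x) $ \<beta> $ \<alpha>" by simp
  then show ?thesis by (simp add: transpose_def)
qed

lemma derivation_generator_eq_0:
  assumes x: "x \<in> M"
  shows "derivation Y (generator \<mu> \<sigma> f) x = 0"
proof -
  have d: "(\<lambda>z. \<mu> z $ i) differentiable at x" "(\<lambda>z. \<sigma> z $ i $ \<alpha>) differentiable at x"
    "partial i f differentiable at x" "partial i (partial j f) differentiable at x" for i j \<alpha>
    by (intro smooth_on_differentiable[OF _ x] smooth_on_partial smooth_components f)+
  have p: "partial l (generator \<mu> \<sigma> f) x =
    1/2 * (\<Sum>\<alpha>\<in>UNIV. \<Sum>i\<in>UNIV. \<Sum>j\<in>UNIV.
      (partial l (\<lambda>z. \<sigma> z $ i $ \<alpha>) x * \<sigma> x $ j $ \<alpha> + \<sigma> x $ i $ \<alpha> * partial l (\<lambda>z. \<sigma> z $ j $ \<alpha>) x) * partial i (partial j f) x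
      + \<sigma> x $ i $ \<alpha> * \<sigma> x $ j $ \<alpha> * partial l (partial i (partial j f)) x)
    + (\<Sum>i\<in>UNIV. partial l (\<lambda>z. \<mu> z $ i) x * partial i f x + \<mu> x $ i * partial l (partial i f) x)" for l
  proof -
    have "partial l (generator \<mu> \<sigma> f) x =
      1/2 * partial l (\<lambda>x. \<Sum>\<alpha>\<in>UNIV. \<Sum>i\<in>UNIV. \<Sum>j\<in>UNIV. \<sigma> x $ i $ \<alpha> * \<sigma> x $ j $ \<alpha> * partial i (partial j f) x) x
      + partial l (\<lambda>x. \<Sum>i\<in>UNIV. \<mu> x $ i * partial i f x) x"
      unfolding generator_def[abs_def] real_scaleR_def
      by (subst partial_add, (intro differentiable_mult differentiable_sum differentiable_const d finite ballI)+)
        (subst partial_mult, (intro differentiable_mult differentiable_sum differentiable_const d finite ballI)+,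
          simp add: partial_const)
    then show ?thesis
      by (simp add: partial_mult partial_sum d differentiable_mult differentiable_sum algebra_simps)
  qed
  have "derivation Y (generator \<mu> \<sigma> f) x =
    1/2 * (\<Sum>\<alpha>\<in>UNIV. \<Sum>i\<in>UNIV. \<Sum>j\<in>UNIV. \<Sum>l\<in>UNIV. Y x $ l *
      ((partial l (\<lambda>z. \<sigma> z $ i $ \<alpha>) x * \<sigma> x $ j $ \<alpha> + \<sigma> x $ i $ \<alpha> * partial l (\<lambda>z. \<sigma> z $ j $ \<alpha>) x) * partial i (partial j f) x
      + \<sigma> x $ i $ \<alpha> * \<sigma> x $ j $ \<alpha> * partial l (partial i (partial j f)) x))
    + (\<Sum>i\<in>UNIV. \<Sum>l\<in>UNIV. Y x $ l * (partial l (\<lambda>z. \<mu> z $ i) x * partial i f x + \<mu> x $ i * partial l (partial i f) x))"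
    (is "_ = 1/2 * ?A + ?B")
  proof -
    have "derivation Y (generator \<mu> \<sigma> f) x = (\<Sum>l\<in>UNIV. 1/2 * (\<Sum>\<alpha>\<in>UNIV. \<Sum>i\<in>UNIV. \<Sum>j\<in>UNIV. Y x $ l *
      ((partial l (\<lambda>z. \<sigma> z $ i $ \<alpha>) x * \<sigma> x $ j $ \<alpha> + \<sigma> x $ i $ \<alpha> * partial l (\<lambda>z. \<sigma> z $ j $ \<alpha>) x) * partial i (partial j f) x
      + \<sigma> x $ i $ \<alpha> * \<sigma> x $ j $ \<alpha> * partial l (partial i (partial j f)) x)))
    + (\<Sum>l\<in>UNIV. \<Sum>i\<in>UNIV. Y x $ l * (partial l (\<lambda>z. \<mu> z $ i) x * partial i f x + \<mu> x $ i * partial l (partial i f) x))"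
      unfolding derivation_def p real_scaleR_def distrib_left sum.distrib[symmetric] sum_distrib_left
      by (simp add: mult.left_commute)
    also have "(\<Sum>l\<in>UNIV. \<Sum>i\<in>UNIV. Y x $ l * (partial l (\<lambda>z. \<mu> z $ i) x * partial i f x + \<mu> x $ i * partial l (partial i f) x)) = ?B"
      by (rule sum.swap)
    also have "(\<Sum>l\<in>UNIV. 1/2 * (\<Sum>\<alpha>\<in>UNIV. \<Sum>i\<in>UNIV. \<Sum>j\<in>UNIV. Y x $ l *
      ((partial l (\<lambda>z. \<sigma> z $ i $ \<alpha>) x * \<sigma> x $ j $ \<alpha> + \<sigma> x $ i $ \<alpha> * partial l (\<lambda>z. \<sigma> z $ j $ \<alpha>) x) * partial i (partial j f) x
      + \<sigma> x $ i $ \<alpha> * \<sigma> x $ j $ \<alpha> * partial l (partial i (partial j f)) x))) = 1/2 * ?A"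
      unfolding sum_distrib_left[where r="1/2", symmetric]
      by (rule arg_cong[where f="\<lambda>z. 1/2 * z"])
        (subst sum.swap, rule sum.cong[OF refl], subst sum.swap, rule sum.cong[OF refl], rule sum.swap)
    finally show ?thesis .
  qed
  also have "\<dots> = 0"
    by (rule commutator_algebra[where c="\<lambda>\<alpha> \<beta>. C x $ \<alpha> $ \<beta>",
        OF derivation_first_order[OF x] derivation_second_order[OF x] bracket_condition[OF x] drift_condition[OF x]
          partial_commute[OF M f x] antisymmetric[OF x]])
  finally show ?thesis .
qed

text \<open>By the product rule Y acts on \<sigma> and on the gradient of \<open>f\<close>. The
  first contribution is rewritten by the bracket condition, the second by differentiating Y f = 0;
  the terms with derivatives of Y cancel, and the remaining one is the gradient times \<sigma> C,
  which vanishes by \<open>deg\<close>.\<close>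

lemma derivation_diffusion_eq_0:
  assumes x: "x \<in> M"
    and deg: "(\<Sum>i\<in>UNIV. partial i f x * (\<Sum>\<beta>\<in>UNIV. \<sigma> x $ i $ \<beta> * C x $ \<beta> $ \<alpha>)) = 0"
  shows "derivation Y (\<lambda>x. \<Sum>i\<in>UNIV. partial i f x * \<sigma> x $ i $ \<alpha>) x = 0"
proof -
  have d: "(\<lambda>z. \<sigma> z $ i $ \<alpha>) differentiable at x" "partial i f differentiable at x" for i
    by (intro smooth_on_differentiable[OF _ x] smooth_on_partial smooth_components f)+
  have "derivation Y (\<lambda>x. \<Sum>i\<in>UNIV. partial i f x * \<sigma> x $ i $ \<alpha>) x
    = (\<Sum>l\<in>UNIV. \<Sum>i\<in>UNIV. Y x $ l * (partial i f x * partial l (\<lambda>z. \<sigma> z $ i $ \<alpha>) x + partial l (partial i f) x * \<sigma> x $ i $ \<alpha>))"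
    unfolding derivation_def by (simp add: partial_sum partial_mult d differentiable_mult sum_distrib_left)
  also have "\<dots> = (\<Sum>i\<in>UNIV. \<Sum>l\<in>UNIV. Y x $ l * (partial i f x * partial l (\<lambda>z. \<sigma> z $ i $ \<alpha>) x + partial l (partial i f) x * \<sigma> x $ i $ \<alpha>))"
    by (rule sum.swap)
  also have "\<dots> = (\<Sum>i\<in>UNIV. partial i f x * (\<Sum>l\<in>UNIV. Y x $ l * partial l (\<lambda>z. \<sigma> z $ i $ \<alpha>) x))
     + (\<Sum>i\<in>UNIV. \<sigma> x $ i $ \<alpha> * (\<Sum>l\<in>UNIV. Y x $ l * partial i (partial l f) x))"
    by (simp add: sum.distrib[symmetric] sum_distrib_left algebra_simps partial_commute[OF M f x])
  also have "(\<Sum>i\<in>UNIV. \<sigma> x $ i $ \<alpha> * (\<Sum>l\<in>UNIV. Y x $ l * partial i (partial l f) x))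
    = (\<Sum>i\<in>UNIV. \<sigma> x $ i $ \<alpha> * - (\<Sum>l\<in>UNIV. partial i (\<lambda>z. Y z $ l) x * partial l f x))"
  proof (intro sum.cong refl arg_cong2[where f=times])
    fix i
    show "(\<Sum>l\<in>UNIV. Y x $ l * partial i (partial l f) x) = - (\<Sum>l\<in>UNIV. partial i (\<lambda>z. Y z $ l) x * partial l f x)"
      using derivation_first_order[OF x, of i] by (simp add: sum.distrib)
  qed
  also have "(\<Sum>i\<in>UNIV. partial i f x * (\<Sum>l\<in>UNIV. Y x $ l * partial l (\<lambda>z. \<sigma> z $ i $ \<alpha>) x))
    = (\<Sum>i\<in>UNIV. partial i f x * (\<Sum>l\<in>UNIV. \<sigma> x $ l $ \<alpha> * partial l (\<lambda>z. Y z $ i) x))"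
    unfolding bracket_condition[OF x] using deg by (simp add: right_diff_distrib sum_subtractf)
  also have "\<dots> = (\<Sum>i\<in>UNIV. \<Sum>l\<in>UNIV. partial i f x * (\<sigma> x $ l $ \<alpha> * partial l (\<lambda>z. Y z $ i) x))"
    by (simp add: sum_distrib_left)
  also have "\<dots> = (\<Sum>l\<in>UNIV. \<Sum>i\<in>UNIV. partial i f x * (\<sigma> x $ l $ \<alpha> * partial l (\<lambda>z. Y z $ i) x))"
    by (rule sum.swap)
  finally show ?thesis by (simp add: sum_distrib_left sum_negf mult_ac)
qed

end

section \<open>Brownian increments\<close>

lemma nn_integral_lborel_vec_prod:
  fixes f :: "'m::finite \<Rightarrow> real \<Rightarrow> ennreal"
  assumes [measurable]: "\<And>\<alpha>. f \<alpha> \<in> borel_measurable borel"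
  shows "(\<integral>\<^sup>+ x. (\<Prod>\<alpha>\<in>UNIV. f \<alpha> (x $ \<alpha>)) \<partial>(lborel :: (real^'m) measure)) = (\<Prod>\<alpha>\<in>UNIV. \<integral>\<^sup>+ x. f \<alpha> x \<partial>lborel)"
proof -
  define e where "e \<alpha> = (axis \<alpha> 1 :: real^'m)" for \<alpha>
  have inj: "inj e" by (auto simp: inj_on_def e_def axis_eq_axis)
  have Basis: "(Basis :: (real^'m) set) = range e" by (auto simp: Basis_vec_def e_def)
  have "(\<integral>\<^sup>+ x. (\<Prod>b\<in>Basis. f (inv e b) (x \<bullet> b)) \<partial>(lborel :: (real^'m) measure))
    = (\<Prod>b\<in>(Basis :: (real^'m) set). \<integral>\<^sup>+ x. f (inv e b) x \<partial>lborel)"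
    by (rule nn_integral_lborel_prod) auto
  moreover have "x \<bullet> e \<alpha> = x $ \<alpha>" for x \<alpha> by (simp add: e_def inner_axis)
  ultimately show ?thesis unfolding Basis using inj by (simp add: prod.reindex)
qed

text \<open>The centred density is even. Applied to positive and negative parts, this gives the
  vanishing of the mean and of the mixed moments.\<close>

lemma nn_integral_normal_reflect:
  fixes f :: "real \<Rightarrow> real"
  assumes [measurable]: "f \<in> borel_measurable borel"
  shows "(\<integral>\<^sup>+ x. ennreal (normal_density 0 s x) * ennreal (f (- x)) \<partial>lborel)
    = (\<integral>\<^sup>+ x. ennreal (normal_density 0 s x) * ennreal (f x) \<partial>lborel)"
proof -
  have "(\<integral>\<^sup>+ x. ennreal (normal_density 0 s x) * ennreal (f x) \<partial>lborel)
     = ennreal \<bar>- 1\<bar> * (\<integral>\<^sup>+ x. ennreal (normal_density 0 s (0 + (-1) * x)) * ennreal (f (0 + (-1) * x)) \<partial>lborel)"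
    by (rule nn_integral_real_affine) auto
  then show ?thesis by (simp add: normal_density_def)
qed

lemma nn_integral_normal_even_moment:
  assumes "0 < s"
  shows "(\<integral>\<^sup>+ x. ennreal (normal_density 0 s x) * ennreal (x ^ (2 * k)) \<partial>lborel) = ennreal (fact (2 * k) / ((2 / s\<^sup>2)^k * fact k))"
proof -
  note h = normal_moment_even[OF assms, of 0 k]
  have "(\<integral>\<^sup>+ x. ennreal (normal_density 0 s x * (x - 0) ^ (2 * k)) \<partial>lborel) = ennreal (fact (2 * k) / ((2 / s\<^sup>2)^k * fact k))"
    using nn_integral_eq_integral[OF integrable.intros[OF h]] has_bochner_integral_integral_eq[OF h] by auto
  then show ?thesis by (simp add: ennreal_mult)
qed

lemma partition_mono:
  fixes p :: "nat \<Rightarrow> real"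
  assumes "\<And>j. j < N \<Longrightarrow> p j < p (Suc j)" "i \<le> j" "j \<le> N"
  shows "p i \<le> p j"
  using assms(2,3)
proof (induction j rule: dec_induct)
  case (step n)
  then show ?case using assms(1)[of n] by simp
qed simp

section \<open>Moments, independence and orthogonality of increments\<close>

locale brownian_space = prob_space P
  for P :: "'w measure" and F :: "real \<Rightarrow> 'w measure" and W :: "real \<Rightarrow> 'w \<Rightarrow> real^'m::finite" +
  assumes filtered: "filtered_prob_space P F" and brownian: "brownian_motion P F W"
begin

lemma space_F [simp]: "space (F t) = space P"
  using filtered by (auto simp: filtered_prob_space_def filtration_def)

lemma sets_F_mono: "s \<le> t \<Longrightarrow> sets (F s) \<subseteq> sets (F t)"
  using filtered by (auto simp: filtered_prob_space_def filtration_def)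

lemma sets_F_P: "sets (F t) \<subseteq> sets P"
  using filtered by (auto simp: filtered_prob_space_def subalgebra_def)

lemma measurable_F_mono: "f \<in> measurable (F s) N \<Longrightarrow> s \<le> t \<Longrightarrow> f \<in> measurable (F t) N"
  using sets_F_mono[of s t] by (auto simp: measurable_def)

lemma measurable_F_P: "f \<in> measurable (F s) N \<Longrightarrow> f \<in> measurable P N"
  using sets_F_P[of s] by (auto simp: measurable_def)

lemma W_measurable: "0 \<le> t \<Longrightarrow> W t \<in> borel_measurable (F t)"
  using brownian by (auto simp: brownian_motion_def)

lemma W_measurable_P: "0 \<le> t \<Longrightarrow> W t \<in> borel_measurable P"
  using W_measurable measurable_F_P by blast

lemma W_component_measurable: "0 \<le> s \<Longrightarrow> s \<le> t \<Longrightarrow> (\<lambda>\<omega>. W s \<omega> $ \<alpha>) \<in> borel_measurable (F t)"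
  by (rule measurable_compose[OF measurable_F_mono[OF W_measurable] borel_measurable_nth[of \<alpha>]])

lemma W_component_measurable_P: "0 \<le> s \<Longrightarrow> (\<lambda>\<omega>. W s \<omega> $ \<alpha>) \<in> borel_measurable P"
  using W_component_measurable[of s s] measurable_F_P by blast

lemma W_continuous: "AE \<omega> in P. continuous_on {0..} (\<lambda>t. W t \<omega>)"
  using brownian by (auto simp: brownian_motion_def)

text \<open>The joint density of an increment is a product, so Tonelli separates the components. The
  nonnegative form asks for no integrability; through \<open>ennreal\<close> a negative value of
  \<open>f \<alpha>\<close> counts as 0.\<close>

lemma nn_integral_increment_prod:
  assumes "0 \<le> s" "s < t" and [measurable]: "\<And>\<alpha>. f \<alpha> \<in> borel_measurable borel"
  shows "(\<integral>\<^sup>+ \<omega>. (\<Prod>\<alpha>\<in>UNIV. ennreal (f \<alpha> ((W t \<omega> - W s \<omega>) $ \<alpha>))) \<partial>P)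
    = (\<Prod>\<alpha>\<in>UNIV. \<integral>\<^sup>+ x. ennreal (normal_density 0 (sqrt (t - s)) x) * ennreal (f \<alpha> x) \<partial>lborel)"
proof -
  have D: "distributed P lborel (\<lambda>\<omega>. W t \<omega> - W s \<omega>)
          (\<lambda>x. ennreal (\<Prod>\<alpha>\<in>UNIV. normal_density 0 (sqrt (t - s)) (x $ \<alpha>)))"
    using brownian assms by (auto simp: brownian_motion_def)
  have "(\<integral>\<^sup>+ \<omega>. (\<Prod>\<alpha>\<in>UNIV. ennreal (f \<alpha> ((W t \<omega> - W s \<omega>) $ \<alpha>))) \<partial>P)
    = (\<integral>\<^sup>+ x. ennreal (\<Prod>\<alpha>\<in>UNIV. normal_density 0 (sqrt (t - s)) (x $ \<alpha>)) * (\<Prod>\<alpha>\<in>UNIV. ennreal (f \<alpha> (x $ \<alpha>))) \<partial>lborel)"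
    by (rule distributed_nn_integral[OF D, symmetric]) measurable
  also have "\<dots> = (\<integral>\<^sup>+ x. (\<Prod>\<alpha>\<in>UNIV. ennreal (normal_density 0 (sqrt (t - s)) (x $ \<alpha>)) * ennreal (f \<alpha> (x $ \<alpha>))) \<partial>lborel)"
    by (simp add: prod.distrib prod_ennreal)
  also have "\<dots> = (\<Prod>\<alpha>\<in>UNIV. \<integral>\<^sup>+ x. ennreal (normal_density 0 (sqrt (t - s)) x) * ennreal (f \<alpha> x) \<partial>lborel)"
    by (rule nn_integral_lborel_vec_prod) measurable
  finally show ?thesis .
qed

lemma nn_integral_increment_single:
  assumes "0 \<le> s" "s < t" and [measurable]: "f \<in> borel_measurable borel"
  shows "(\<integral>\<^sup>+ \<omega>. ennreal (f ((W t \<omega> - W s \<omega>) $ \<alpha>)) \<partial>P)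
    = (\<integral>\<^sup>+ x. ennreal (normal_density 0 (sqrt (t - s)) x) * ennreal (f x) \<partial>lborel)"
proof -
  have n1: "(\<integral>\<^sup>+ x. ennreal (normal_density 0 (sqrt (t - s)) x) * ennreal 1 \<partial>lborel) = 1"
    using nn_integral_normal_even_moment[of "sqrt (t - s)" 0] assms by simp
  \<comment> \<open>The other components carry the constant function 1, whose integral against the
    density is 1.\<close>
  have eq: "(\<Prod>\<beta>\<in>UNIV. ennreal ((if \<beta> = \<alpha> then f else (\<lambda>_. 1)) (g \<beta>))) = ennreal (f (g \<alpha>))" for g :: "'m \<Rightarrow> real"
  proof -
    have "(\<Prod>\<beta>\<in>UNIV. ennreal ((if \<beta> = \<alpha> then f else (\<lambda>_. 1)) (g \<beta>))) = (\<Prod>\<beta>\<in>UNIV. if \<beta> = \<alpha> then ennreal (f (g \<beta>)) else 1)"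
      by (intro prod.cong) auto
    then show ?thesis by simp
  qed
  have "(\<integral>\<^sup>+ \<omega>. ennreal (f ((W t \<omega> - W s \<omega>) $ \<alpha>)) \<partial>P)
    = (\<integral>\<^sup>+ \<omega>. (\<Prod>\<beta>\<in>UNIV. ennreal ((if \<beta> = \<alpha> then f else (\<lambda>_. 1)) ((W t \<omega> - W s \<omega>) $ \<beta>))) \<partial>P)"
    unfolding eq ..
  also have "\<dots> = (\<Prod>\<beta>\<in>UNIV. \<integral>\<^sup>+ x. ennreal (normal_density 0 (sqrt (t - s)) x) * ennreal ((if \<beta> = \<alpha> then f else (\<lambda>_. 1)) x) \<partial>lborel)"
    by (rule nn_integral_increment_prod[OF assms(1,2)]) auto
  also have "\<dots> = (\<Prod>\<beta>\<in>UNIV. if \<beta> = \<alpha> then (\<integral>\<^sup>+ x. ennreal (normal_density 0 (sqrt (t - s)) x) * ennreal (f x) \<partial>lborel) else 1)"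
    using n1 by (intro prod.cong) auto
  finally show ?thesis by simp
qed

lemma increment_measurable:
  "0 \<le> s \<Longrightarrow> s \<le> t \<Longrightarrow> (\<lambda>\<omega>. (W t \<omega> - W s \<omega>) $ \<alpha>) \<in> borel_measurable P"
  using W_component_measurable_P[of t \<alpha>] W_component_measurable_P[of s \<alpha>] by simp

lemma increment_even_moment:
  assumes "0 \<le> s" "s < t"
  shows "integrable P (\<lambda>\<omega>. ((W t \<omega> - W s \<omega>) $ \<alpha>) ^ (2 * k))" (is ?A)
    and "expectation (\<lambda>\<omega>. ((W t \<omega> - W s \<omega>) $ \<alpha>) ^ (2 * k)) = fact (2 * k) / ((2 / (t - s))^k * fact k)" (is ?B)
proof -
  have "(\<integral>\<^sup>+ \<omega>. ennreal (((W t \<omega> - W s \<omega>) $ \<alpha>) ^ (2 * k)) \<partial>P) = ennreal (fact (2 * k) / ((2 / (t - s))^k * fact k))"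
    by (subst nn_integral_increment_single[OF assms]) (use nn_integral_normal_even_moment[of "sqrt (t - s)" k] assms in auto)
  moreover have m: "(\<lambda>\<omega>. ((W t \<omega> - W s \<omega>) $ \<alpha>) ^ (2 * k)) \<in> borel_measurable P"
    using increment_measurable[of s t] assms by (intro borel_measurable_power) auto
  ultimately have "has_bochner_integral P (\<lambda>\<omega>. ((W t \<omega> - W s \<omega>) $ \<alpha>) ^ (2 * k)) (fact (2 * k) / ((2 / (t - s))^k * fact k))"
    using assms by (intro has_bochner_integral_nn_integral) (auto simp: zero_le_even_power)
  then show ?A ?B by (auto intro: integrable.intros has_bochner_integral_integral_eq)
qed

lemma increment_second_moment:
  assumes "0 \<le> s" "s < t"
  shows "integrable P (\<lambda>\<omega>. ((W t \<omega> - W s \<omega>) $ \<alpha>)\<^sup>2)" "expectation (\<lambda>\<omega>. ((W t \<omega> - W s \<omega>) $ \<alpha>)\<^sup>2) = t - s"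
  using increment_even_moment[OF assms, of \<alpha> 1] assms by auto

lemma increment_fourth_moment:
  assumes "0 \<le> s" "s < t"
  shows "integrable P (\<lambda>\<omega>. ((W t \<omega> - W s \<omega>) $ \<alpha>) ^ 4)" "expectation (\<lambda>\<omega>. ((W t \<omega> - W s \<omega>) $ \<alpha>) ^ 4) = 3 * (t - s)\<^sup>2"
proof -
  have "fact 4 / ((2 / (t - s))^2 * fact 2) = 3 * (t - s)\<^sup>2"
    using assms by (simp add: power_divide fact_numeral field_simps)
  then show "integrable P (\<lambda>\<omega>. ((W t \<omega> - W s \<omega>) $ \<alpha>) ^ 4)" "expectation (\<lambda>\<omega>. ((W t \<omega> - W s \<omega>) $ \<alpha>) ^ 4) = 3 * (t - s)\<^sup>2"
    using increment_even_moment[OF assms, of \<alpha> 2] by auto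
qed

lemma increment_integrable:
  assumes "0 \<le> s" "s < t"
  shows "integrable P (\<lambda>\<omega>. (W t \<omega> - W s \<omega>) $ \<alpha>)" "integrable P (\<lambda>\<omega>. (W t \<omega> - W s \<omega>) $ \<alpha> * (W t \<omega> - W s \<omega>) $ \<beta>)"
    "integrable P (\<lambda>\<omega>. ((W t \<omega> - W s \<omega>) $ \<alpha> * (W t \<omega> - W s \<omega>) $ \<beta>)\<^sup>2)"
proof -
  have m [measurable]: "(\<lambda>\<omega>. (W t \<omega> - W s \<omega>) $ \<alpha>) \<in> borel_measurable P" for \<alpha>
    using increment_measurable[of s t] assms by auto
  note sm = increment_second_moment(1)[OF assms] increment_fourth_moment(1)[OF assms]
  show "integrable P (\<lambda>\<omega>. (W t \<omega> - W s \<omega>) $ \<alpha>)"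
    by (rule square_integrable_imp_integrable[OF m sm(1)])
  have b: "\<bar>a * b\<bar> \<le> a\<^sup>2 + b\<^sup>2" for a b :: real
  proof -
    have "2 * \<bar>a\<bar> * \<bar>b\<bar> \<le> a\<^sup>2 + b\<^sup>2" using sum_squares_bound[of "\<bar>a\<bar>" "\<bar>b\<bar>"] by simp
    moreover have "0 \<le> \<bar>a\<bar> * \<bar>b\<bar>" by simp
    ultimately show ?thesis unfolding abs_mult by linarith
  qed
  show "integrable P (\<lambda>\<omega>. (W t \<omega> - W s \<omega>) $ \<alpha> * (W t \<omega> - W s \<omega>) $ \<beta>)"
    by (rule Bochner_Integration.integrable_bound[OF Bochner_Integration.integrable_add[OF sm(1)[of \<alpha>] sm(1)[of \<beta>]]])
      (rule borel_measurable_times[OF m m], use b in \<open>auto simp del: vector_minus_component\<close>)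
  have b4: "(a * b)\<^sup>2 \<le> a ^ 4 + b ^ 4" for a b :: real
    using b[of "a\<^sup>2" "b\<^sup>2"] by (simp add: power_mult_distrib flip: power_mult)
  show "integrable P (\<lambda>\<omega>. ((W t \<omega> - W s \<omega>) $ \<alpha> * (W t \<omega> - W s \<omega>) $ \<beta>)\<^sup>2)"
    by (rule Bochner_Integration.integrable_bound[OF Bochner_Integration.integrable_add[OF sm(2)[of \<alpha>] sm(2)[of \<beta>]]])
      (rule borel_measurable_power[OF borel_measurable_times[OF m m]], rule AE_I2, use b4 in \<open>auto intro: order_trans[OF _ abs_ge_self] simp del: vector_minus_component\<close>)
qed

lemma has_bochner_integral_parts:
  fixes f :: "'w \<Rightarrow> real"
  assumes f: "integrable P f" and eq: "(\<integral>\<^sup>+ \<omega>. ennreal (f \<omega>) \<partial>P) = (\<integral>\<^sup>+ \<omega>. ennreal (- f \<omega>) \<partial>P)"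
  shows "expectation f = 0"
  using real_lebesgue_integral_def[OF f] eq by simp

lemma increment_mean:
  assumes "0 \<le> s" "s < t"
  shows "expectation (\<lambda>\<omega>. (W t \<omega> - W s \<omega>) $ \<alpha>) = 0"
proof (rule has_bochner_integral_parts[OF increment_integrable(1)[OF assms]])
  have "(\<integral>\<^sup>+ \<omega>. ennreal (- (W t \<omega> - W s \<omega>) $ \<alpha>) \<partial>P) = (\<integral>\<^sup>+ x. ennreal (normal_density 0 (sqrt (t - s)) x) * ennreal (- x) \<partial>lborel)"
    using nn_integral_increment_single[OF assms, of "\<lambda>x. - x"] by simp
  also have "\<dots> = (\<integral>\<^sup>+ x. ennreal (normal_density 0 (sqrt (t - s)) x) * ennreal x \<partial>lborel)"
    using nn_integral_normal_reflect[of "\<lambda>x. x"] by simp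
  also have "\<dots> = (\<integral>\<^sup>+ \<omega>. ennreal ((W t \<omega> - W s \<omega>) $ \<alpha>) \<partial>P)"
    using nn_integral_increment_single[OF assms, of "\<lambda>x. x"] by simp
  finally show "(\<integral>\<^sup>+ \<omega>. ennreal ((W t \<omega> - W s \<omega>) $ \<alpha>) \<partial>P) = (\<integral>\<^sup>+ \<omega>. ennreal (- (W t \<omega> - W s \<omega>) $ \<alpha>) \<partial>P)" ..
qed

text \<open>Positive and negative parts of the product are sums of products of nonnegative functions of single
  components, and reflecting one component exchanges them.\<close>

lemma increment_covariance:
  assumes "0 \<le> s" "s < t" "\<alpha> \<noteq> \<beta>"
  shows "expectation (\<lambda>\<omega>. (W t \<omega> - W s \<omega>) $ \<alpha> * (W t \<omega> - W s \<omega>) $ \<beta>) = 0"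
proof (rule has_bochner_integral_parts[OF increment_integrable(2)[OF assms(1,2)]])
  define n where "n f = (\<integral>\<^sup>+ x. ennreal (normal_density 0 (sqrt (t - s)) x) * ennreal (f x) \<partial>lborel)" for f :: "real \<Rightarrow> real"
  define h where "h f g \<gamma> = (if \<gamma> = \<alpha> then f else if \<gamma> = \<beta> then g else (\<lambda>_. 1))" for f g :: "real \<Rightarrow> real" and \<gamma>
  have two: "(\<Prod>\<gamma>\<in>UNIV. if \<gamma> = \<alpha> then a else if \<gamma> = \<beta> then b else 1) = a * b" for a b :: ennreal
  proof -
    have "(\<Prod>\<gamma>\<in>UNIV. if \<gamma> = \<alpha> then a else if \<gamma> = \<beta> then b else 1) = (\<Prod>\<gamma>\<in>UNIV. (if \<gamma> = \<alpha> then a else 1) * (if \<gamma> = \<beta> then b else 1))"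
      using assms(3) by (intro prod.cong) auto
    then show ?thesis by (simp add: prod.distrib)
  qed
  have n1: "n (\<lambda>_. 1) = 1"
    unfolding n_def using nn_integral_normal_even_moment[of "sqrt (t - s)" 0] assms by simp
  have prod_eq: "(\<integral>\<^sup>+ \<omega>. ennreal (f ((W t \<omega> - W s \<omega>) $ \<alpha>)) * ennreal (g ((W t \<omega> - W s \<omega>) $ \<beta>)) \<partial>P) = n f * n g"
    if [measurable]: "f \<in> borel_measurable borel" "g \<in> borel_measurable borel" for f g
  proof -
    have "(\<Prod>\<gamma>\<in>UNIV. ennreal (h f g \<gamma> (x \<gamma>))) = ennreal (f (x \<alpha>)) * ennreal (g (x \<beta>))" for x :: "'m \<Rightarrow> real"
      unfolding two[symmetric] by (intro prod.cong) (auto simp: h_def)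
    moreover have "(\<Prod>\<gamma>\<in>UNIV. n (h f g \<gamma>)) = n f * n g"
      unfolding two[symmetric] using n1 by (intro prod.cong) (auto simp: h_def)
    moreover have "h f g \<gamma> \<in> borel_measurable borel" for \<gamma> by (auto simp: h_def)
    ultimately show ?thesis
      using nn_integral_increment_prod[OF assms(1,2), of "h f g"] by (simp add: n_def)
  qed
  define p where "p = (\<lambda>x :: real. max 0 x)"
  define q where "q = (\<lambda>x :: real. max 0 (- x))"
  have [measurable]: "p \<in> borel_measurable borel" "q \<in> borel_measurable borel" by (auto simp: p_def q_def)
  have npq: "n p = n q"
    unfolding n_def q_def using nn_integral_normal_reflect[of p "sqrt (t - s)"] by (simp add: p_def)
  have split: "ennreal (a * b) = ennreal (p a) * ennreal (p b) + ennreal (q a) * ennreal (q b)"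
    "ennreal (- (a * b)) = ennreal (p a) * ennreal (q b) + ennreal (q a) * ennreal (p b)" for a b
  proof -
    have "ennreal (p a) * ennreal (p b) + ennreal (q a) * ennreal (q b) = ennreal (p a * p b + q a * q b)"
      "ennreal (p a) * ennreal (q b) + ennreal (q a) * ennreal (p b) = ennreal (p a * q b + q a * p b)"
      by (simp_all add: p_def q_def ennreal_mult ennreal_plus)
    moreover have "p a * p b + q a * q b = max 0 (a * b)" "p a * q b + q a * p b = max 0 (- (a * b))"
    proof -
      consider "0 \<le> a" "0 \<le> b" | "0 \<le> a" "b \<le> 0" | "a \<le> 0" "0 \<le> b" | "a \<le> 0" "b \<le> 0" by linarith
      then have "p a * p b + q a * q b = max 0 (a * b) \<and> p a * q b + q a * p b = max 0 (- (a * b))"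
      proof cases
        case 1
        then show ?thesis using mult_nonneg_nonneg[of a b] by (simp add: p_def q_def)
      next
        case 2
        then show ?thesis using mult_nonneg_nonpos[of a b] by (simp add: p_def q_def)
      next
        case 3
        then show ?thesis using mult_nonpos_nonneg[of a b] by (simp add: p_def q_def)
      next
        case 4
        then show ?thesis using mult_nonpos_nonpos[of a b] by (simp add: p_def q_def)
      qed
      then show "p a * p b + q a * q b = max 0 (a * b)" "p a * q b + q a * p b = max 0 (- (a * b))" by auto
    qed
    moreover have "ennreal (max 0 x) = ennreal x" for x by (simp add: max_def ennreal_neg)
    ultimately show "ennreal (a * b) = ennreal (p a) * ennreal (p b) + ennreal (q a) * ennreal (q b)"
      "ennreal (- (a * b)) = ennreal (p a) * ennreal (q b) + ennreal (q a) * ennreal (p b)" by simp_all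
  qed
  have [measurable]: "(\<lambda>\<omega>. (W t \<omega> - W s \<omega>) $ \<alpha>) \<in> borel_measurable P" for \<alpha>
    using increment_measurable[of s t] assms by auto
  show "(\<integral>\<^sup>+ \<omega>. ennreal ((W t \<omega> - W s \<omega>) $ \<alpha> * (W t \<omega> - W s \<omega>) $ \<beta>) \<partial>P)
    = (\<integral>\<^sup>+ \<omega>. ennreal (- ((W t \<omega> - W s \<omega>) $ \<alpha> * (W t \<omega> - W s \<omega>) $ \<beta>)) \<partial>P)"
    unfolding split by (simp add: nn_integral_add prod_eq npq del: vector_minus_component)
qed

text \<open>\<open>brownian_motion\<close> provides independence of set families; this is the
  version for random variables. The function \<open>q\<close> is arbitrary Borel, since increments
  as well as their compensated products are needed.\<close>

lemma indep_increment:
  fixes q :: "real^'m \<Rightarrow> real" and G :: "'w \<Rightarrow> real"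
  assumes st: "0 \<le> s" "s < t" and G: "G \<in> borel_measurable (F s)" and q [measurable]: "q \<in> borel_measurable borel"
  shows "indep_var borel G borel (\<lambda>\<omega>. q (W t \<omega> - W s \<omega>))"
proof -
  let ?D = "\<lambda>\<omega>. W t \<omega> - W s \<omega>"
  have D [measurable]: "?D \<in> borel_measurable P" using W_measurable_P[of t] W_measurable_P[of s] st by simp
  have ind: "indep_set (sets (F s)) {?D -` B \<inter> space P | B. B \<in> sets borel}"
    using brownian st by (auto simp: brownian_motion_def)
  have sG: "sigma_sets (space P) {G -` A \<inter> space P | A. A \<in> sets borel} \<subseteq> sets (F s)"
    using sets.sigma_sets_subset[of "{G -` A \<inter> space P | A. A \<in> sets borel}" "F s"] measurable_sets[OF G] by auto
  have sD: "sigma_sets (space P) {(\<lambda>\<omega>. q (?D \<omega>)) -` A \<inter> space P | A. A \<in> sets borel} \<subseteq> {?D -` B \<inter> space P | B. B \<in> sets borel}"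
  proof -
    \<comment> \<open>The preimages under \<open>?D\<close> already form a sigma-algebra, so the one
      generated by \<open>q\<close> of the increment stays inside the family that is known to be
      independent.\<close>
    have eq: "{?D -` B \<inter> space P | B. B \<in> sets borel} = sets (vimage_algebra (space P) ?D borel)"
      by (rule sets_vimage_algebra2[symmetric]) simp
    have "{(\<lambda>\<omega>. q (?D \<omega>)) -` A \<inter> space P | A. A \<in> sets borel} \<subseteq> {?D -` B \<inter> space P | B. B \<in> sets borel}"
    proof safe
      fix A :: "real set" assume "A \<in> sets borel"
      then have "q -` A \<in> sets borel" using measurable_sets[OF q] by simp
      then show "\<exists>B. (\<lambda>\<omega>. q (?D \<omega>)) -` A \<inter> space P = ?D -` B \<inter> space P \<and> B \<in> sets borel"
        by (intro exI[of _ "q -` A"]) auto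
    qed
    then show ?thesis unfolding eq
      using sets.sigma_sets_subset[of _ "vimage_algebra (space P) ?D borel"] by simp
  qed
  show ?thesis unfolding indep_var_eq
  proof (intro conjI indep_setI)
    show "random_variable borel G" using G measurable_F_P by blast
    show "sigma_sets (space P) {G -` A \<inter> space P | A. A \<in> sets borel} \<subseteq> events" using sG sets_F_P by blast
    show "sigma_sets (space P) {(\<lambda>\<omega>. q (?D \<omega>)) -` A \<inter> space P | A. A \<in> sets borel} \<subseteq> events"
      using sD measurable_sets[OF D] by blast
    fix a b assume "a \<in> sigma_sets (space P) {G -` A \<inter> space P | A. A \<in> sets borel}"
      "b \<in> sigma_sets (space P) {(\<lambda>\<omega>. q (?D \<omega>)) -` A \<inter> space P | A. A \<in> sets borel}"
    then show "prob (a \<inter> b) = prob a * prob b" using sG sD indep_setD[OF ind] by blast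
  qed simp
qed

text \<open>The sum over earlier steps times \<open>g N\<close> is measurable at time
  \<open>p N\<close>, hence independent of the last increment, whose function \<open>q N\<close> has
  mean zero: cross terms vanish. Independence also factorises the diagonal terms. With linear
  \<open>q\<close> this is the Ito isometry for elementary integrals, with quadratic
  \<open>q\<close> it controls quadratic variation.\<close>

lemma orthogonal_sum:
  fixes q :: "nat \<Rightarrow> real^'m \<Rightarrow> real" and g :: "nat \<Rightarrow> 'w \<Rightarrow> real"
  assumes p: "0 \<le> p 0" "\<And>j. j < N \<Longrightarrow> p j < p (Suc j)"
    and g: "\<And>j. j < N \<Longrightarrow> g j \<in> borel_measurable (F (p j))" "\<And>j \<omega>. j < N \<Longrightarrow> \<omega> \<in> space P \<Longrightarrow> \<bar>g j \<omega>\<bar> \<le> c"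
    and q: "\<And>j. j < N \<Longrightarrow> q j \<in> borel_measurable borel"
      "\<And>j. j < N \<Longrightarrow> expectation (\<lambda>\<omega>. q j (W (p (Suc j)) \<omega> - W (p j) \<omega>)) = 0"
      "\<And>j. j < N \<Longrightarrow> integrable P (\<lambda>\<omega>. (q j (W (p (Suc j)) \<omega> - W (p j) \<omega>))\<^sup>2)"
  shows "integrable P (\<lambda>\<omega>. (\<Sum>j<N. g j \<omega> * q j (W (p (Suc j)) \<omega> - W (p j) \<omega>))\<^sup>2) \<and>
    expectation (\<lambda>\<omega>. (\<Sum>j<N. g j \<omega> * q j (W (p (Suc j)) \<omega> - W (p j) \<omega>))\<^sup>2)
      = (\<Sum>j<N. expectation (\<lambda>\<omega>. (g j \<omega>)\<^sup>2) * expectation (\<lambda>\<omega>. (q j (W (p (Suc j)) \<omega> - W (p j) \<omega>))\<^sup>2))"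
  using p(2) g q
proof (induction N)
  case (Suc N)
  let ?D = "\<lambda>j \<omega>. q j (W (p (Suc j)) \<omega> - W (p j) \<omega>)"
  let ?M = "\<lambda>\<omega>. \<Sum>j<N. g j \<omega> * ?D j \<omega>"
  have pj: "0 \<le> p j \<and> p j \<le> p N" if "j \<le> N" for j
  proof -
    have "p i \<le> p j" if "i \<le> j" "j \<le> N" for i j
      by (rule partition_mono[of "Suc N"]) (use that Suc.prems(1) in auto)
    from this[of 0 j] this[of j N] that p(1) show ?thesis by auto
  qed
  have IH: "integrable P (\<lambda>\<omega>. (?M \<omega>)\<^sup>2)"
    "expectation (\<lambda>\<omega>. (?M \<omega>)\<^sup>2) = (\<Sum>j<N. expectation (\<lambda>\<omega>. (g j \<omega>)\<^sup>2) * expectation (\<lambda>\<omega>. (?D j \<omega>)\<^sup>2))"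
    using Suc.IH Suc.prems by auto
  have mD: "?D j \<in> borel_measurable (F (p N))" if "j < N" for j
  proof -
    have "(\<lambda>\<omega>. W (p (Suc j)) \<omega> - W (p j) \<omega>) \<in> borel_measurable (F (p N))"
      using pj[of j] pj[of "Suc j"] that by (intro borel_measurable_diff measurable_F_mono[OF W_measurable]) auto
    from measurable_compose[OF this Suc.prems(4)] that show ?thesis by simp
  qed
  have mM: "?M \<in> borel_measurable (F (p N))"
  proof (intro borel_measurable_sum borel_measurable_times)
    fix j assume "j \<in> {..<N}"
    then have j: "j < N" "j < Suc N" "j \<le> N" by auto
    show "g j \<in> borel_measurable (F (p N))"
      by (rule measurable_F_mono[OF Suc.prems(2)[OF j(2)]]) (use pj[OF j(3)] in blast)
    show "?D j \<in> borel_measurable (F (p N))" by (rule mD[OF j(1)])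
  qed
  have gN: "g N \<in> borel_measurable (F (p N))" using Suc.prems(2) by simp
  have mDN: "?D N \<in> borel_measurable P"
    using Suc.prems(1)[of N] pj[of N]
    by (intro measurable_compose[OF _ Suc.prems(4)[of N]] borel_measurable_diff W_measurable_P) auto
  have s: "0 \<le> p N" "p N < p (Suc N)" using pj[of N] Suc.prems(1) by auto
  have sqb: "(g N \<omega>)\<^sup>2 \<le> c\<^sup>2" if "\<omega> \<in> space P" for \<omega>
    using Suc.prems(3)[of N \<omega>] that abs_le_square_iff[of "g N \<omega>" c] by force
  have gP [measurable]: "g N \<in> borel_measurable P" "?M \<in> borel_measurable P" using gN mM measurable_F_P by blast+
  have iMg: "integrable P (\<lambda>\<omega>. ?M \<omega> * g N \<omega>)"
  proof (rule Bochner_Integration.integrable_bound[where f="\<lambda>\<omega>. \<bar>c\<bar> * \<bar>?M \<omega>\<bar>"])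
    show "integrable P (\<lambda>\<omega>. \<bar>c\<bar> * \<bar>?M \<omega>\<bar>)"
      by (intro integrable_mult_right integrable_abs square_integrable_imp_integrable[OF gP(2) IH(1)])
    show "AE \<omega> in P. norm (?M \<omega> * g N \<omega>) \<le> norm (\<bar>c\<bar> * \<bar>?M \<omega>\<bar>)"
      proof (rule AE_I2)
      fix \<omega> assume "\<omega> \<in> space P"
      then have "\<bar>g N \<omega>\<bar> \<le> \<bar>c\<bar>" using Suc.prems(3)[of N \<omega>] by simp
      then show "norm (?M \<omega> * g N \<omega>) \<le> norm (\<bar>c\<bar> * \<bar>?M \<omega>\<bar>)"
        by (simp add: abs_mult mult.commute mult_right_mono)
    qed
  qed measurable
  have ig2: "integrable P (\<lambda>\<omega>. (g N \<omega>)\<^sup>2)"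
    by (rule Bochner_Integration.integrable_bound[where f="\<lambda>_. c\<^sup>2"]) (use sqb in \<open>auto intro!: AE_I2\<close>)
  have iD2: "integrable P (\<lambda>\<omega>. (?D N \<omega>)\<^sup>2)" using Suc.prems(6) by simp
  have iD: "integrable P (?D N)" by (rule square_integrable_imp_integrable[OF mDN iD2])
  have ind1: "indep_var borel (\<lambda>\<omega>. ?M \<omega> * g N \<omega>) borel (?D N)"
    by (rule indep_increment[OF s]) (use gN mM Suc.prems(4) in auto)
  have ind2: "indep_var borel (\<lambda>\<omega>. (g N \<omega>)\<^sup>2) borel (\<lambda>\<omega>. (?D N \<omega>)\<^sup>2)"
    by (rule indep_increment[OF s, of _ "\<lambda>x. (q N x)\<^sup>2"]) (use gN Suc.prems(4) in auto)
  have c1: "expectation (\<lambda>\<omega>. ?M \<omega> * g N \<omega> * ?D N \<omega>) = 0" "integrable P (\<lambda>\<omega>. ?M \<omega> * g N \<omega> * ?D N \<omega>)"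
    using indep_var_lebesgue_integral[OF ind1 iMg iD] indep_var_integrable[OF ind1 iMg iD] Suc.prems(5)[of N] by auto
  have c2: "expectation (\<lambda>\<omega>. (g N \<omega>)\<^sup>2 * (?D N \<omega>)\<^sup>2) = expectation (\<lambda>\<omega>. (g N \<omega>)\<^sup>2) * expectation (\<lambda>\<omega>. (?D N \<omega>)\<^sup>2)"
    "integrable P (\<lambda>\<omega>. (g N \<omega>)\<^sup>2 * (?D N \<omega>)\<^sup>2)"
    using indep_var_lebesgue_integral[OF ind2 ig2 iD2] indep_var_integrable[OF ind2 ig2 iD2] by auto
  have eq: "(\<Sum>j<Suc N. g j \<omega> * ?D j \<omega>)\<^sup>2 = (?M \<omega>)\<^sup>2 + (2 * (?M \<omega> * g N \<omega> * ?D N \<omega>) + (g N \<omega>)\<^sup>2 * (?D N \<omega>)\<^sup>2)" for \<omega>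
    by (simp add: power2_eq_square algebra_simps)
  show ?case unfolding eq using IH c1 c2 by simp
qed simp

lemma orthogonal_sum_linear:
  assumes p: "0 \<le> p 0" "\<And>j. j < N \<Longrightarrow> p j < p (Suc j)"
    and g: "\<And>j. j < N \<Longrightarrow> g j \<in> borel_measurable (F (p j))" "\<And>j \<omega>. j < N \<Longrightarrow> \<omega> \<in> space P \<Longrightarrow> \<bar>g j \<omega>\<bar> \<le> c"
  shows "integrable P (\<lambda>\<omega>. (\<Sum>j<N. g j \<omega> * (W (p (Suc j)) \<omega> $ \<alpha> - W (p j) \<omega> $ \<alpha>))\<^sup>2)"
    "expectation (\<lambda>\<omega>. (\<Sum>j<N. g j \<omega> * (W (p (Suc j)) \<omega> $ \<alpha> - W (p j) \<omega> $ \<alpha>))\<^sup>2)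
      = (\<Sum>j<N. expectation (\<lambda>\<omega>. (g j \<omega>)\<^sup>2) * (p (Suc j) - p j))"
proof -
  have pj: "0 \<le> p j" if "j \<le> N" for j
    using partition_mono[of N p 0 j, OF p(2)] p(1) that by simp
  have "integrable P (\<lambda>\<omega>. (\<Sum>j<N. g j \<omega> * (\<lambda>x. x $ \<alpha>) (W (p (Suc j)) \<omega> - W (p j) \<omega>))\<^sup>2) \<and>
    expectation (\<lambda>\<omega>. (\<Sum>j<N. g j \<omega> * (\<lambda>x. x $ \<alpha>) (W (p (Suc j)) \<omega> - W (p j) \<omega>))\<^sup>2)
      = (\<Sum>j<N. expectation (\<lambda>\<omega>. (g j \<omega>)\<^sup>2) * expectation (\<lambda>\<omega>. ((\<lambda>x. x $ \<alpha>) (W (p (Suc j)) \<omega> - W (p j) \<omega>))\<^sup>2))"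
    by (rule orthogonal_sum[OF p g])
      (use increment_mean increment_second_moment(1) pj p in \<open>auto simp del: vector_minus_component\<close>)
  moreover have "expectation (\<lambda>\<omega>. ((W (p (Suc j)) \<omega> - W (p j) \<omega>) $ \<alpha>)\<^sup>2) = p (Suc j) - p j" if "j < N" for j
    using increment_second_moment(2)[of "p j" "p (Suc j)" \<alpha>] pj[of j] p(2)[OF that] that by auto
  ultimately show "integrable P (\<lambda>\<omega>. (\<Sum>j<N. g j \<omega> * (W (p (Suc j)) \<omega> $ \<alpha> - W (p j) \<omega> $ \<alpha>))\<^sup>2)"
    "expectation (\<lambda>\<omega>. (\<Sum>j<N. g j \<omega> * (W (p (Suc j)) \<omega> $ \<alpha> - W (p j) \<omega> $ \<alpha>))\<^sup>2)
      = (\<Sum>j<N. expectation (\<lambda>\<omega>. (g j \<omega>)\<^sup>2) * (p (Suc j) - p j))"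
    by simp_all
qed

text \<open>Multiplying the integrand by the indicator of "the energy is still at most \<open>\<delta>\<close> and the sum has not yet
  exceeded \<open>\<epsilon>\<close>" stops the martingale at its first crossing, so Chebyshev's inequality for the stopped sum
  gives the maximal inequality.\<close>

lemma maximal_inequality:
  fixes g :: "nat \<Rightarrow> 'w \<Rightarrow> real"
  assumes p: "0 \<le> p 0" "\<And>j. j < N \<Longrightarrow> p j < p (Suc j)"
    and g: "\<And>j. j < N \<Longrightarrow> g j \<in> borel_measurable (F (p j))" "\<And>j \<omega>. j < N \<Longrightarrow> \<omega> \<in> space P \<Longrightarrow> \<bar>g j \<omega>\<bar> \<le> c"
    and \<epsilon>: "0 < \<epsilon>" and \<delta>: "0 \<le> \<delta>"
  shows "prob {\<omega>\<in>space P. (\<exists>j\<le>N. \<epsilon> < \<bar>\<Sum>l<j. g l \<omega> * (W (p (Suc l)) \<omega> $ \<alpha> - W (p l) \<omega> $ \<alpha>)\<bar>) \<and>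
      (\<Sum>l<N. (g l \<omega>)\<^sup>2 * (p (Suc l) - p l)) \<le> \<delta>} \<le> \<delta> / \<epsilon>\<^sup>2"
proof -
  define D where "D l \<omega> = W (p (Suc l)) \<omega> $ \<alpha> - W (p l) \<omega> $ \<alpha>" for l \<omega>
  define M where "M j \<omega> = (\<Sum>l<j. g l \<omega> * D l \<omega>)" for j \<omega>
  define E where "E j \<omega> = (\<Sum>l<j. (g l \<omega>)\<^sup>2 * (p (Suc l) - p l))" for j \<omega>
  \<comment> \<open>Predictable: \<open>E (Suc l)\<close> involves \<open>g\<close> only up to index
    \<open>l\<close>, and \<open>M i\<close> with \<open>i\<close> at most \<open>l\<close> only
    increments that end by time \<open>p l\<close>. Hence \<open>h l\<close> is still measurable at
    time \<open>p l\<close>.\<close>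
  define good where "good l \<omega> \<longleftrightarrow> E (Suc l) \<omega> \<le> \<delta> \<and> (\<forall>i\<le>l. \<bar>M i \<omega>\<bar> \<le> \<epsilon>)" for l \<omega>
  define h where "h l \<omega> = (if good l \<omega> then g l \<omega> else 0)" for l \<omega>
  have pmono: "p i \<le> p j" if "i \<le> j" "j \<le> N" for i j
    using partition_mono[of N p i j, OF p(2)] that by simp
  have p0: "0 \<le> p j" if "j \<le> N" for j using pmono[of 0 j] p(1) that by simp
  have gm: "g i \<in> borel_measurable (F (p l))" if "i \<le> l" "l < N" for i l
    using measurable_F_mono[OF g(1)[of i] pmono[of i l]] that by auto
  have Dm: "D i \<in> borel_measurable (F (p l))" if "i < l" "l \<le> N" for i l
    unfolding D_def using that p0 pmono by (intro borel_measurable_diff W_component_measurable) auto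
  have hm: "h l \<in> borel_measurable (F (p l))" if l: "l < N" for l
  proof -
    have Mi: "M i \<in> borel_measurable (F (p l))" if "i \<le> l" for i
      unfolding M_def using that l by (intro borel_measurable_sum borel_measurable_times gm Dm) auto
    have "E (Suc l) \<in> borel_measurable (F (p l))"
      unfolding E_def using l by (intro borel_measurable_sum borel_measurable_times borel_measurable_power gm) auto
    then have "Measurable.pred (F (p l)) (good l)"
      unfolding good_def[abs_def] using Mi by measurable
    then show ?thesis unfolding h_def[abs_def] using gm[OF order_refl l] by measurable
  qed
  have c: "0 \<le> c" if "N > 0" using g(2)[of 0] that not_empty by (metis abs_ge_zero all_not_in_conv order_trans)
  have hb: "\<bar>h l \<omega>\<bar> \<le> c" if "l < N" "\<omega> \<in> space P" for l \<omega>
    using g(2)[OF that] c that by (auto simp: h_def)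
  \<comment> \<open>The stopped energy is bounded for every path, not only in the mean: at a good
    index the whole unstopped energy including that index is at most \<delta>, and a bad index adds
    nothing.\<close>
  have energy: "(\<Sum>l<n. (h l \<omega>)\<^sup>2 * (p (Suc l) - p l)) \<le> \<delta>" if "n \<le> N" for n \<omega>
    using that
  proof (induction n)
    case (Suc n)
    show ?case
    proof (cases "good n \<omega>")
      case True
      have "(\<Sum>l<Suc n. (h l \<omega>)\<^sup>2 * (p (Suc l) - p l)) \<le> E (Suc n) \<omega>"
        unfolding E_def using p(2) Suc.prems by (intro sum_mono mult_right_mono) (auto simp: h_def less_imp_le)
      then show ?thesis using True by (simp add: good_def)
    next
      case False
      then show ?thesis using Suc by (simp add: h_def)
    qed
  qed (use \<delta> in simp)
  define S where "S \<omega> = (\<Sum>l<N. h l \<omega> * D l \<omega>)" for \<omega>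
  have iS: "integrable P (\<lambda>\<omega>. (S \<omega>)\<^sup>2)"
    and eS: "expectation (\<lambda>\<omega>. (S \<omega>)\<^sup>2) = (\<Sum>l<N. expectation (\<lambda>\<omega>. (h l \<omega>)\<^sup>2) * (p (Suc l) - p l))"
    unfolding S_def D_def using orthogonal_sum_linear[OF p hm hb] by auto
  have hmP: "h l \<in> borel_measurable P" if "l < N" for l using hm[OF that] measurable_F_P by blast
  have ih: "integrable P (\<lambda>\<omega>. (h l \<omega>)\<^sup>2)" if "l < N" for l
  proof (rule Bochner_Integration.integrable_bound[where f="\<lambda>_. c\<^sup>2"])
    show "AE \<omega> in P. norm ((h l \<omega>)\<^sup>2) \<le> norm (c\<^sup>2)"
      using hb[OF that] by (auto intro!: AE_I2 simp: abs_le_square_iff[symmetric] intro: order_trans[OF _ abs_ge_self])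
  qed (use hmP[OF that] in auto)
  have "expectation (\<lambda>\<omega>. (S \<omega>)\<^sup>2) = expectation (\<lambda>\<omega>. \<Sum>l<N. (h l \<omega>)\<^sup>2 * (p (Suc l) - p l))"
    unfolding eS using ih by (subst Bochner_Integration.integral_sum) auto
  also have "\<dots> \<le> expectation (\<lambda>\<omega>. \<delta>)"
    by (rule integral_mono) (use ih energy in \<open>auto intro!: Bochner_Integration.integrable_sum\<close>)
  finally have ES: "expectation (\<lambda>\<omega>. (S \<omega>)\<^sup>2) \<le> \<delta>" by (simp add: prob_space)
  have Sm [measurable]: "S \<in> borel_measurable P"
    unfolding S_def D_def using hmP p0
    by (intro borel_measurable_sum borel_measurable_times borel_measurable_diff W_component_measurable_P) auto
  have sub: "{\<omega>\<in>space P. (\<exists>j\<le>N. \<epsilon> < \<bar>M j \<omega>\<bar>) \<and> E N \<omega> \<le> \<delta>} \<subseteq> {\<omega>\<in>space P. \<epsilon> \<le> \<bar>S \<omega>\<bar>}"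
  proof safe
    fix \<omega> j assume \<omega>: "\<omega> \<in> space P" and "j \<le> N" "\<epsilon> < \<bar>M j \<omega>\<bar>" and EN: "E N \<omega> \<le> \<delta>"
    \<comment> \<open>At the first crossing \<open>k\<close>, and with total energy at most
      \<delta>, the good indices are exactly those below \<open>k\<close>; so the stopped sum ends
      with the value \<open>M k\<close>, which exceeds \<epsilon>.\<close>
    define k where "k = (LEAST j. \<epsilon> < \<bar>M j \<omega>\<bar>)"
    have k: "\<epsilon> < \<bar>M k \<omega>\<bar>" unfolding k_def by (rule LeastI) fact
    have kj: "k \<le> j" unfolding k_def by (rule Least_le) fact
    have before: "\<bar>M i \<omega>\<bar> \<le> \<epsilon>" if "i < k" for i using not_less_Least[of i] that unfolding k_def by force
    have "S \<omega> = (\<Sum>l<N. if l < k then g l \<omega> * D l \<omega> else 0)"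
      unfolding S_def
    proof (rule sum.cong)
      fix l assume l: "l \<in> {..<N}"
      have "E (Suc l) \<omega> \<le> E N \<omega>"
        unfolding E_def using l p(2) by (intro sum_mono2) (auto intro!: mult_nonneg_nonneg simp: less_imp_le)
      then have "good l \<omega>" if "l < k" using that before EN by (auto simp: good_def)
      moreover have "\<not> good l \<omega>" if "\<not> l < k" using k that by (auto simp: good_def intro!: exI[of _ k])
      ultimately show "h l \<omega> * D l \<omega> = (if l < k then g l \<omega> * D l \<omega> else 0)" by (auto simp: h_def)
    qed simp
    also have "\<dots> = M k \<omega>"
      unfolding M_def using kj \<open>j \<le> N\<close> by (intro sum.mono_neutral_cong_right) auto
    finally show "\<epsilon> \<le> \<bar>S \<omega>\<bar>" using k by simp
  qed
  have "prob {\<omega>\<in>space P. (\<exists>j\<le>N. \<epsilon> < \<bar>M j \<omega>\<bar>) \<and> E N \<omega> \<le> \<delta>} \<le> prob {\<omega>\<in>space P. \<epsilon> \<le> \<bar>S \<omega>\<bar>}"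
    by (rule finite_measure_mono[OF sub]) measurable
  also have "\<dots> \<le> expectation (\<lambda>\<omega>. (S \<omega>)\<^sup>2) / \<epsilon>\<^sup>2"
    by (rule second_moment_method[OF Sm iS \<epsilon>])
  also have "\<dots> \<le> \<delta> / \<epsilon>\<^sup>2" using ES by (simp add: divide_right_mono)
  finally show ?thesis by (simp add: M_def D_def E_def)
qed

end

section \<open>Simple processes\<close>

lemma finite_set_partition:
  fixes A :: "real set"
  assumes "finite A" "A \<noteq> {}"
  obtains n p where "\<And>j. j < n \<Longrightarrow> p j < p (Suc j)" "p ` {..n} = A" "p 0 = Min A" "p n = Max A"
proof -
  define L where "L = sorted_list_of_set A"
  have L: "set L = A" "length L = card A" "sorted_wrt (<) L" using assms by (auto simp: L_def)
  define n where "n = card A - 1"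
  have n: "card A = Suc n" using assms by (simp add: n_def card_gt_0_iff)
  have im: "(!) L ` {..n} = A"
    using L n by (auto simp: set_conv_nth image_def less_Suc_eq_le)
  have lt: "L ! i < L ! j" if "i < j" "j \<le> n" for i j
    using sorted_wrt_nth_less[OF L(3), of i j] that L n by simp
  have le: "L ! i \<le> L ! j" if "i \<le> j" "j \<le> n" for i j
    using lt[of i j] that by (cases "i = j") auto
  have "L ! 0 = Min A" "L ! n = Max A"
    using im le assms by (auto intro!: Min_eqI[symmetric] Max_eqI[symmetric])
  then show ?thesis using that[of n "(!) L"] im lt by simp
qed

text \<open>Only the breakpoints up to the horizon \<open>p n\<close> have to be nodes, because a
  simple process may go on jumping afterwards.\<close>

definition partitions :: "nat \<Rightarrow> (nat \<Rightarrow> real) \<Rightarrow> real set \<Rightarrow> bool" where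
  "partitions n p A \<longleftrightarrow> (\<forall>j<n. p j < p (Suc j)) \<and> p 0 = 0 \<and> (\<forall>u\<in>A. u \<le> p n \<longrightarrow> u \<in> p ` {..n})"

text \<open>No breakpoint lies inside a cell, so its comparison with \<open>s\<close> is the same
  throughout the cell, left end excluded and right end included.\<close>

lemma partitionsD:
  assumes "partitions n p A" "u \<in> A" "l < n" "p l < s" "s \<le> p (Suc l)"
  shows "u < s \<longleftrightarrow> u \<le> p l"
proof
  have mono: "\<And>j. j < n \<Longrightarrow> p j < p (Suc j)" using assms by (auto simp: partitions_def)
  assume us: "u < s"
  have "p (Suc l) \<le> p n" using partition_mono[of n p "Suc l" n, OF mono] assms(3) by simp
  then obtain i where i: "i \<le> n" "u = p i" using assms us by (force simp: partitions_def)
  have "\<not> Suc l \<le> i" using partition_mono[of n p "Suc l" i, OF mono] i us assms(5) by force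
  then have "i \<le> l" by simp
  then show "u \<le> p l" using partition_mono[of n p i l, OF mono] i assms(3) by simp
qed (use assms in auto)

text \<open>Truncating a breakpoint at a node gives a node again; the index \<open>i\<close> marks
  the cell from which the indicator of an interval starting or ending at \<open>u\<close>
  changes.\<close>

lemma partitions_min:
  assumes p: "partitions n p A" and u: "u \<in> A" "j \<le> n"
  obtains i where "i \<le> j" "min u (p j) = p i" "\<And>l. l < j \<Longrightarrow> u < p (Suc l) \<longleftrightarrow> i \<le> l"
proof -
  have mono: "\<And>j. j < n \<Longrightarrow> p j < p (Suc j)" using p by (auto simp: partitions_def)
  have le: "p i \<le> p l" if "i \<le> l" "l \<le> n" for i l using partition_mono[of n p i l, OF mono] that by simp
  have lt: "p i < p l" if "i < l" "l \<le> n" for i l using mono[of i] le[of "Suc i" l] that by simp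
  show ?thesis
  proof (cases "u < p j")
    case True
    then have "u \<le> p n" using le[of j n] u by simp
    then obtain i where i: "i \<le> n" "u = p i" using p u by (auto simp: partitions_def)
    have ij: "i < j" using True i le[of j i] by force
    show ?thesis
    proof (rule that[of i])
      show "u < p (Suc l) \<longleftrightarrow> i \<le> l" if "l < j" for l
        using lt[of i "Suc l"] le[of "Suc l" i] i that u by (auto simp: not_le[symmetric] Suc_le_eq)
    qed (use ij True i in auto)
  next
    case False
    show ?thesis
    proof (rule that[of j])
      show "u < p (Suc l) \<longleftrightarrow> j \<le> l" if "l < j" for l
        using le[of "Suc l" j] that u False by auto
    qed (use False in auto)
  qed
qed

lemma simple_process_cell:
  assumes p: "partitions n p (t ` {..N})" and l: "l < n" "p l < s" "s \<le> p (Suc l)"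
  shows "simple_process N t \<xi> s \<omega> = simple_process N t \<xi> (p (Suc l)) \<omega>"
  unfolding simple_process_def
proof (intro sum.cong refl arg_cong2[where f=times])
  fix k assume "k \<in> {..<N}"
  then have "t k \<in> t ` {..N}" "t (Suc k) \<in> t ` {..N}" by auto
  from this[THEN partitionsD[OF p _ l(1)]] show "indicator {t k<..t (Suc k)} s = (indicator {t k<..t (Suc k)} (p (Suc l)) :: real)"
    using l by (auto simp: indicator_def not_less[symmetric] simp del: not_less)
qed

text \<open>On a grid refining the breakpoints the increment over each original interval telescopes
  into increments over cells. The integrand is read at the right end of a cell because its intervals
  are open on the left.\<close>

lemma simple_integral_grid:
  assumes p: "partitions n p (t ` {..N})" and t: "\<And>k. k < N \<Longrightarrow> t k \<le> t (Suc k)" and j: "j \<le> n"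
  shows "simple_integral N t \<xi> B (p j) \<omega> = (\<Sum>l<j. simple_process N t \<xi> (p (Suc l)) \<omega> * (B (p (Suc l)) \<omega> - B (p l) \<omega>))"
proof -
  have mono: "\<And>j. j < n \<Longrightarrow> p j < p (Suc j)" using p by (auto simp: partitions_def)
  have *: "B (min (t (Suc k)) (p j)) \<omega> - B (min (t k) (p j)) \<omega>
    = (\<Sum>l<j. indicator {t k<..t (Suc k)} (p (Suc l)) * (B (p (Suc l)) \<omega> - B (p l) \<omega>))" if k: "k < N" for k
  proof -
    have A: "t k \<in> t ` {..N}" "t (Suc k) \<in> t ` {..N}" using k by auto
    obtain a where a: "a \<le> j" "min (t k) (p j) = p a" "\<And>l. l < j \<Longrightarrow> t k < p (Suc l) \<longleftrightarrow> a \<le> l"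
      using partitions_min[OF p A(1) j] by metis
    obtain b where b: "b \<le> j" "min (t (Suc k)) (p j) = p b" "\<And>l. l < j \<Longrightarrow> t (Suc k) < p (Suc l) \<longleftrightarrow> b \<le> l"
      using partitions_min[OF p A(2) j] by metis
    have ab: "a \<le> b"
    proof (rule ccontr)
      assume "\<not> a \<le> b"
      then have "p b < p a" using mono[of b] partition_mono[of n p "Suc b" a, OF mono] a(1) j by simp
      then show False using t[OF k] a(2) b(2) by (simp add: min_def split: if_splits)
    qed
    have ind: "indicator {t k<..t (Suc k)} (p (Suc l)) = (if a \<le> l \<and> l < b then 1 else 0 :: real)" if "l < j" for l
    proof -
      have "p (Suc l) \<le> t (Suc k) \<longleftrightarrow> l < b" using b(3)[OF that] by (meson not_le)
      then show ?thesis using a(3)[OF that] by (simp add: indicator_def)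
    qed
    have "(\<Sum>l<j. indicator {t k<..t (Suc k)} (p (Suc l)) * (B (p (Suc l)) \<omega> - B (p l) \<omega>))
      = (\<Sum>l\<in>{a..<b}. B (p (Suc l)) \<omega> - B (p l) \<omega>)"
    proof (rule sum.mono_neutral_cong_right)
      show "\<forall>l\<in>{..<j} - {a..<b}. indicator {t k<..t (Suc k)} (p (Suc l)) * (B (p (Suc l)) \<omega> - B (p l) \<omega>) = 0"
        using ind by auto
      show "indicator {t k<..t (Suc k)} (p (Suc l)) * (B (p (Suc l)) \<omega> - B (p l) \<omega>) = B (p (Suc l)) \<omega> - B (p l) \<omega>"
        if "l \<in> {a..<b}" for l
        using ind[of l] b(1) that by auto
    qed (use b(1) in auto)
    also have "\<dots> = B (p b) \<omega> - B (p a) \<omega>"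
      by (rule sum_Suc_diff'[OF ab, of "\<lambda>l. B (p l) \<omega>"])
    finally show ?thesis using a(2) b(2) by simp
  qed
  have "simple_integral N t \<xi> B (p j) \<omega>
    = (\<Sum>k<N. \<Sum>l<j. \<xi> k \<omega> * indicator {t k<..t (Suc k)} (p (Suc l)) * (B (p (Suc l)) \<omega> - B (p l) \<omega>))"
    unfolding simple_integral_def mult.assoc sum_distrib_left[symmetric]
    by (intro sum.cong arg_cong2[where f=times] *) auto
  also have "\<dots> = (\<Sum>l<j. \<Sum>k<N. \<xi> k \<omega> * indicator {t k<..t (Suc k)} (p (Suc l)) * (B (p (Suc l)) \<omega> - B (p l) \<omega>))"
    by (rule sum.swap)
  finally show ?thesis by (simp only: simple_process_def sum_distrib_right)
qed

text \<open>The cells are disjoint, so at each time at most one summand is nonzero. This connects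
  the energy of grid values in \<open>maximal_inequality\<close> with the integral in
  \<open>energy\<close>.\<close>

lemma sum_squares_le_nn_integral:
  fixes f :: "real \<Rightarrow> real"
  assumes p: "p 0 = 0" "\<And>j. j < n \<Longrightarrow> p j < p (Suc j)"
    and cell: "\<And>l s. l < n \<Longrightarrow> p l < s \<Longrightarrow> s \<le> p (Suc l) \<Longrightarrow> f s = g l"
  shows "ennreal (\<Sum>l<n. (g l)\<^sup>2 * (p (Suc l) - p l)) \<le> (\<integral>\<^sup>+ s\<in>{0..p n}. ennreal ((f s)\<^sup>2) \<partial>lborel)"
proof -
  have "ennreal (\<Sum>l<n. (g l)\<^sup>2 * (p (Suc l) - p l)) = (\<Sum>l<n. ennreal ((g l)\<^sup>2) * emeasure lborel {p l<..p (Suc l)})"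
    using p(2) by (subst sum_ennreal[symmetric]) (auto simp: ennreal_mult less_imp_le intro!: sum.cong mult_nonneg_nonneg)
  also have "\<dots> = (\<integral>\<^sup>+ s. (\<Sum>l<n. ennreal ((g l)\<^sup>2) * indicator {p l<..p (Suc l)} s) \<partial>lborel)"
    by (subst nn_integral_sum) (auto simp: nn_integral_cmult_indicator)
  also have "\<dots> \<le> (\<integral>\<^sup>+ s. ennreal ((f s)\<^sup>2) * indicator {0..p n} s \<partial>lborel)"
  proof (rule nn_integral_mono)
    fix s :: real
    show "(\<Sum>l<n. ennreal ((g l)\<^sup>2) * indicator {p l<..p (Suc l)} s) \<le> ennreal ((f s)\<^sup>2) * indicator {0..p n} s"
    proof (cases "\<exists>l<n. p l < s \<and> s \<le> p (Suc l)")
      case True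
      then obtain l where l: "l < n" "p l < s" "s \<le> p (Suc l)" by auto
      have other: "\<not> (p k < s \<and> s \<le> p (Suc k))" if "k < n" "k \<noteq> l" for k
        using partition_mono[of n p "Suc k" l, OF p(2)] partition_mono[of n p "Suc l" k, OF p(2)] that l
        by (cases "k < l") force+
      have "(\<Sum>k<n. ennreal ((g k)\<^sup>2) * indicator {p k<..p (Suc k)} s) = (\<Sum>k<n. if k = l then ennreal ((g l)\<^sup>2) else 0)"
        using l other by (intro sum.cong) (auto simp: indicator_def)
      also have "\<dots> = ennreal ((f s)\<^sup>2)" using l cell[of l s] by simp
      also have "s \<in> {0..p n}"
        using partition_mono[of n p 0 l, OF p(2)] partition_mono[of n p "Suc l" n, OF p(2)] l p(1) by simp
      then have "ennreal ((f s)\<^sup>2) = ennreal ((f s)\<^sup>2) * indicator {0..p n} s" by simp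
      finally show ?thesis by simp
    next
      case False
      then have "(\<Sum>l<n. ennreal ((g l)\<^sup>2) * indicator {p l<..p (Suc l)} s) = 0"
        by (intro sum.neutral) (auto simp: indicator_def)
      then show ?thesis by simp
    qed
  qed
  finally show ?thesis .
qed

text \<open>Squared distance of two paths in L2 over \<open>{0..T}\<close>, extended-valued so that
  it exists before finiteness is known; with a simple process as \<open>H\<close> it is the quantity
  occurring in \<open>has_ito_integral\<close>.\<close>

definition energy :: "real \<Rightarrow> (real \<Rightarrow> 'w \<Rightarrow> real) \<Rightarrow> (real \<Rightarrow> 'w \<Rightarrow> real) \<Rightarrow> 'w \<Rightarrow> ennreal" where
  "energy T H K \<omega> = (\<integral>\<^sup>+ s\<in>{0..T}. ennreal ((H s \<omega> - K s \<omega>)\<^sup>2) \<partial>lborel)"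

section \<open>Simple processes and energies on the filtered space\<close>

context brownian_space
begin

lemma simple_data_measurable:
  assumes "simple_data P F N t \<xi>" "k < N"
  shows "t k \<le> s \<Longrightarrow> \<xi> k \<in> borel_measurable (F s)" "\<xi> k \<in> borel_measurable P"
proof -
  have "\<xi> k \<in> borel_measurable (F (t k))" using assms by (simp add: simple_data_def)
  then show "t k \<le> s \<Longrightarrow> \<xi> k \<in> borel_measurable (F s)" "\<xi> k \<in> borel_measurable P"
    using measurable_F_mono measurable_F_P by blast+
qed

text \<open>Although the value on a cell is read at the right end, it is known at the left end: an
  interval containing the right end must have begun by \<open>p l\<close>.\<close>

lemma simple_process_adapted:
  assumes sd: "simple_data P F N t \<xi>" and p: "partitions n p (t ` {..N})" and l: "l < n"
  shows "simple_process N t \<xi> (p (Suc l)) \<in> borel_measurable (F (p l))"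
proof -
  have lt: "p l < p (Suc l)" using p l by (auto simp: partitions_def)
  have "(\<lambda>\<omega>. \<xi> k \<omega> * indicator {t k<..t (Suc k)} (p (Suc l))) \<in> borel_measurable (F (p l))" if k: "k < N" for k
  proof (cases "t k < p (Suc l)")
    case True
    then have "t k \<le> p l" using partitionsD[OF p _ l lt, of "t k"] k by auto
    then have "\<xi> k \<in> borel_measurable (F (p l))" by (rule simple_data_measurable(1)[OF sd k])
    then show ?thesis by simp
  next
    case False
    then show ?thesis by (simp add: indicator_def)
  qed
  then show ?thesis unfolding simple_process_def[abs_def] by (intro borel_measurable_sum) auto
qed

lemma simple_process_bounded:
  assumes sd: "simple_data P F N t \<xi>"
  obtains c where "\<And>s \<omega>. \<omega> \<in> space P \<Longrightarrow> \<bar>simple_process N t \<xi> s \<omega>\<bar> \<le> c"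
proof -
  obtain c where c: "\<And>k \<omega>. k < N \<Longrightarrow> \<omega> \<in> space P \<Longrightarrow> \<bar>\<xi> k \<omega>\<bar> \<le> c k"
    using sd unfolding simple_data_def by metis
  have "\<bar>simple_process N t \<xi> s \<omega>\<bar> \<le> (\<Sum>k<N. c k)" if "\<omega> \<in> space P" for s \<omega>
    unfolding simple_process_def
  proof (rule order_trans[OF sum_abs sum_mono])
    fix k assume "k \<in> {..<N}"
    then show "\<bar>\<xi> k \<omega> * indicator {t k<..t (Suc k)} s\<bar> \<le> c k"
      using c[of k \<omega>] that by (auto simp: indicator_def)
  qed
  then show ?thesis using that by blast
qed

lemma simple_data_times:
  assumes "simple_data P F N t \<xi>" "k \<le> N"
  shows "0 \<le> t k"
  using assms(2)
proof (induction k)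
  case 0
  then show ?case using assms(1) by (simp add: simple_data_def)
next
  case (Suc k)
  then have "t k \<le> t (Suc k)" using assms(1) by (simp add: simple_data_def)
  then show ?case using Suc by simp
qed

lemma simple_integral_measurable:
  assumes sd: "simple_data P F N t \<xi>" and s: "0 \<le> s"
  shows "simple_integral N t \<xi> (\<lambda>t \<omega>. W t \<omega> $ \<alpha>) s \<in> borel_measurable P"
  unfolding simple_integral_def[abs_def]
proof (intro borel_measurable_sum borel_measurable_times borel_measurable_diff W_component_measurable_P)
  fix k assume "k \<in> {..<N}"
  then show "\<xi> k \<in> borel_measurable P" "0 \<le> min (t (Suc k)) s" "0 \<le> min (t k) s"
    using s simple_data_times[OF sd] simple_data_measurable(2)[OF sd] by auto
qed

lemma simple_integral_continuous:
  assumes sd: "simple_data P F N t \<xi>" and W: "continuous_on {0..} (\<lambda>t. W t \<omega>)"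
  shows "continuous_on {0..} (\<lambda>s. simple_integral N t \<xi> (\<lambda>t \<omega>. W t \<omega> $ \<alpha>) s \<omega>)"
  unfolding simple_integral_def
proof (intro continuous_on_sum continuous_on_mult continuous_on_diff continuous_on_const)
  fix k assume k: "k \<in> {..<N}"
  have "continuous_on {0..} (\<lambda>s. W (min u s) \<omega> $ \<alpha>)" if "0 \<le> u" for u
    by (rule bounded_linear.continuous_on[OF bounded_linear_vec_nth], rule continuous_on_compose2[OF W])
      (use that in \<open>auto intro!: continuous_intros\<close>)
  then show "continuous_on {0..} (\<lambda>s. W (min (t (Suc k)) s) \<omega> $ \<alpha>)" "continuous_on {0..} (\<lambda>s. W (min (t k) s) \<omega> $ \<alpha>)"
    using simple_data_times[OF sd] k by auto
qed

lemma progressive_simple: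
  assumes sd: "simple_data P F N t \<xi>"
  shows "progressive F (simple_process N t \<xi>)"
  unfolding progressive_def
proof (intro allI impI)
  fix T :: real assume T: "0 \<le> T"
  let ?X = "restrict_space borel {0..T} \<Otimes>\<^sub>M F T"
  have "(\<lambda>x. \<xi> k (snd x) * indicator {t k<..t (Suc k)} (fst x)) \<in> borel_measurable ?X" if k: "k < N" for k
  proof (cases "t k \<le> T")
    case True
    then have [measurable]: "\<xi> k \<in> borel_measurable (F T)" by (rule simple_data_measurable(1)[OF sd k])
    have [measurable]: "fst \<in> borel_measurable ?X"
      by (rule measurable_compose[OF measurable_fst]) (rule measurable_restrict_space1, simp)
    show ?thesis by measurable
  next
    \<comment> \<open>An interval that begins after \<open>T\<close> contributes zero on
      \<open>{0..T}\<close>; its coefficient \<open>\<xi> k\<close> may fail to be measurable for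
      \<open>F T\<close>.\<close>
    case False
    then have "(\<lambda>x. \<xi> k (snd x) * indicator {t k<..t (Suc k)} (fst x)) \<in> borel_measurable ?X \<longleftrightarrow> (\<lambda>x. 0 :: real) \<in> borel_measurable ?X"
      by (intro measurable_cong) (auto simp: space_pair_measure space_restrict_space indicator_def)
    then show ?thesis by simp
  qed
  then show "(\<lambda>(s, \<omega>). simple_process N t \<xi> s \<omega>) \<in> borel_measurable ?X"
    unfolding simple_process_def case_prod_beta by (intro borel_measurable_sum) auto
qed

text \<open>Freezing time outside \<open>{0..T}\<close> turns progressive measurability into joint
  measurability over the whole line, as needed for integrating over time.\<close>

lemma progressive_extend:
  assumes H: "progressive F H" and T: "0 \<le> T"
  shows "(\<lambda>x. H (max 0 (min (fst x) T)) (snd x)) \<in> borel_measurable (lborel \<Otimes>\<^sub>M P)"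
proof -
  have P: "(\<lambda>(s, \<omega>). H s \<omega>) \<in> borel_measurable (restrict_space borel {0..T} \<Otimes>\<^sub>M F T)"
    using H T by (auto simp: progressive_def)
  have 1: "(\<lambda>x. max 0 (min (fst x) T)) \<in> measurable (lborel \<Otimes>\<^sub>M P) (restrict_space borel {0..T})"
    by (rule measurable_restrict_space2) (use T in \<open>auto\<close>)
  have "(\<lambda>x. x) \<in> measurable P (F T)" using sets_F_P[of T] by (auto simp: measurable_def)
  then have "(\<lambda>x. (max 0 (min (fst x) T), snd x)) \<in> measurable (lborel \<Otimes>\<^sub>M P) (restrict_space borel {0..T} \<Otimes>\<^sub>M F T)"
    using 1 by (intro measurable_Pair measurable_compose[OF measurable_snd]) auto
  from measurable_compose[OF this P] show ?thesis by (simp add: case_prod_beta)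
qed

lemma progressive_path:
  assumes H: "progressive F H" and T: "0 \<le> T" and \<omega>: "\<omega> \<in> space P"
  shows "(\<lambda>s. H (max 0 (min s T)) \<omega>) \<in> borel_measurable borel"
proof -
  have "(\<lambda>s. (s, \<omega>)) \<in> measurable borel (lborel \<Otimes>\<^sub>M P)" using \<omega> by simp
  from measurable_compose[OF this progressive_extend[OF H T]] show ?thesis by simp
qed

lemma energy_measurable:
  assumes H: "progressive F H" and K: "progressive F K" and T: "0 \<le> T"
  shows "energy T H K \<in> borel_measurable P"
proof -
  note [measurable] = progressive_extend[OF H T] progressive_extend[OF K T]
  have "(\<lambda>x. ennreal ((H (max 0 (min (fst x) T)) (snd x) - K (max 0 (min (fst x) T)) (snd x))\<^sup>2) * indicator {0..T} (fst x))
    \<in> borel_measurable (lborel \<Otimes>\<^sub>M P)" by measurable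
  from measurable_compose[OF measurable_pair_swap' this]
  have "(\<lambda>(\<omega>, s). ennreal ((H (max 0 (min s T)) \<omega> - K (max 0 (min s T)) \<omega>)\<^sup>2) * indicator {0..T} s)
    \<in> borel_measurable (P \<Otimes>\<^sub>M lborel)" by (simp add: case_prod_beta)
  then have "(\<lambda>\<omega>. \<integral>\<^sup>+ s. ennreal ((H (max 0 (min s T)) \<omega> - K (max 0 (min s T)) \<omega>)\<^sup>2) * indicator {0..T} s \<partial>lborel) \<in> borel_measurable P"
    by (rule lborel.borel_measurable_nn_integral)
  moreover have "energy T H K = (\<lambda>\<omega>. \<integral>\<^sup>+ s. ennreal ((H (max 0 (min s T)) \<omega> - K (max 0 (min s T)) \<omega>)\<^sup>2) * indicator {0..T} s \<partial>lborel)"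
    unfolding energy_def fun_eq_iff by (intro allI nn_integral_cong) (auto simp: indicator_def)
  ultimately show ?thesis by simp
qed

text \<open>The factors 2 come from the parallelogram-type bound for squares; progressive
  measurability allows the integral of the sum to be split.\<close>

lemma energy_triangle:
  assumes H: "progressive F H" and K: "progressive F K" and L: "progressive F L" and T: "0 \<le> T" and \<omega>: "\<omega> \<in> space P"
  shows "energy T H K \<omega> \<le> 2 * energy T H L \<omega> + 2 * energy T K L \<omega>"
proof -
  let ?c = "\<lambda>s. max 0 (min s T)"
  note [measurable] = progressive_path[OF H T \<omega>] progressive_path[OF K T \<omega>] progressive_path[OF L T \<omega>]
  have e: "energy T A B \<omega> = (\<integral>\<^sup>+ s. ennreal ((A (?c s) \<omega> - B (?c s) \<omega>)\<^sup>2) * indicator {0..T} s \<partial>lborel)" for A B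
    unfolding energy_def by (intro nn_integral_cong) (auto simp: indicator_def)
  have ineq: "(a - b)\<^sup>2 \<le> 2 * (a - c)\<^sup>2 + 2 * (b - c)\<^sup>2" for a b c :: real
    using sum_squares_bound[of "a - c" "- (b - c)"] by (simp add: power2_eq_square algebra_simps)
  have "energy T H K \<omega> \<le> (\<integral>\<^sup>+ s. 2 * (ennreal ((H (?c s) \<omega> - L (?c s) \<omega>)\<^sup>2) * indicator {0..T} s)
      + 2 * (ennreal ((K (?c s) \<omega> - L (?c s) \<omega>)\<^sup>2) * indicator {0..T} s) \<partial>lborel)"
    unfolding e
  proof (rule nn_integral_mono)
    fix s :: real
    have "ennreal ((H (?c s) \<omega> - K (?c s) \<omega>)\<^sup>2)
       \<le> ennreal (2 * (H (?c s) \<omega> - L (?c s) \<omega>)\<^sup>2 + 2 * (K (?c s) \<omega> - L (?c s) \<omega>)\<^sup>2)"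
      by (rule ennreal_leI[OF ineq])
    also have "\<dots> = 2 * ennreal ((H (?c s) \<omega> - L (?c s) \<omega>)\<^sup>2) + 2 * ennreal ((K (?c s) \<omega> - L (?c s) \<omega>)\<^sup>2)"
      by (simp add: ennreal_plus ennreal_mult)
    finally show "ennreal ((H (?c s) \<omega> - K (?c s) \<omega>)\<^sup>2) * indicator {0..T} s
      \<le> 2 * (ennreal ((H (?c s) \<omega> - L (?c s) \<omega>)\<^sup>2) * indicator {0..T} s)
      + 2 * (ennreal ((K (?c s) \<omega> - L (?c s) \<omega>)\<^sup>2) * indicator {0..T} s)"
      by (auto simp: indicator_def)
  qed
  also have "\<dots> = 2 * energy T H L \<omega> + 2 * energy T K L \<omega>"
    unfolding e by (simp add: nn_integral_add nn_integral_cmult)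
  finally show ?thesis .
qed

text \<open>On a grid containing the breakpoints of both processes and all of \<open>D\<close>, the
  difference of the integrals is a single elementary sum. The bound does not depend on
  \<open>D\<close>, which later permits growing and even countable sets of times.\<close>

lemma simple_maximal_inequality:
  assumes sd: "simple_data P F N t \<xi>" "simple_data P F N' t' \<xi>'" and T: "0 \<le> T"
    and D: "finite D" "D \<subseteq> {0..T}" and \<epsilon>: "0 < \<epsilon>" and \<delta>: "0 \<le> \<delta>"
  shows "prob {\<omega>\<in>space P. (\<exists>s\<in>D. \<epsilon> < \<bar>simple_integral N t \<xi> (\<lambda>t \<omega>. W t \<omega> $ \<alpha>) s \<omega> - simple_integral N' t' \<xi>' (\<lambda>t \<omega>. W t \<omega> $ \<alpha>) s \<omega>\<bar>) \<and>
      energy T (simple_process N t \<xi>) (simple_process N' t' \<xi>') \<omega> \<le> ennreal \<delta>} \<le> \<delta> / \<epsilon>\<^sup>2" (is "prob ?E \<le> _")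
proof -
  \<comment> \<open>0 and \<open>T\<close> are added so that the sorted set is a partition of the
    whole interval.\<close>
  define A where "A = {0, T} \<union> D \<union> (t ` {..N} \<inter> {0..T}) \<union> (t' ` {..N'} \<inter> {0..T})"
  have A: "finite A" "A \<noteq> {}" "A \<subseteq> {0..T}" using D T by (auto simp: A_def)
  obtain n p where p: "\<And>j. j < n \<Longrightarrow> p j < p (Suc j)" "p ` {..n} = A" "p 0 = Min A" "p n = Max A"
    using finite_set_partition[OF A(1,2)] by metis
  have "0 \<in> A" "T \<in> A" by (auto simp: A_def)
  then have "Min A = 0" "Max A = T" using A by (auto intro!: Min_eqI Max_eqI)
  then have p0: "p 0 = 0" and pn: "p n = T" using p by auto
  have part: "partitions n p (t ` {..N})" "partitions n p (t' ` {..N'})"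
    unfolding partitions_def using p(1,2) p0 pn simple_data_times[OF sd(1)] simple_data_times[OF sd(2)]
    by (auto simp: A_def)
  have mono: "\<And>k. k < N \<Longrightarrow> t k \<le> t (Suc k)" "\<And>k. k < N' \<Longrightarrow> t' k \<le> t' (Suc k)"
    using sd by (auto simp: simple_data_def)
  define g where "g l \<omega> = simple_process N t \<xi> (p (Suc l)) \<omega> - simple_process N' t' \<xi>' (p (Suc l)) \<omega>" for l \<omega>
  obtain c c' where c: "\<And>s \<omega>. \<omega> \<in> space P \<Longrightarrow> \<bar>simple_process N t \<xi> s \<omega>\<bar> \<le> c"
    "\<And>s \<omega>. \<omega> \<in> space P \<Longrightarrow> \<bar>simple_process N' t' \<xi>' s \<omega>\<bar> \<le> c'"
    using simple_process_bounded[OF sd(1)] simple_process_bounded[OF sd(2)] by metis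
  have gm: "g l \<in> borel_measurable (F (p l))" if "l < n" for l
    unfolding g_def[abs_def] using simple_process_adapted[OF sd(1) part(1) that] simple_process_adapted[OF sd(2) part(2) that] by simp
  have gb: "\<bar>g l \<omega>\<bar> \<le> c + c'" if "\<omega> \<in> space P" for l \<omega>
    using c[OF that, of "p (Suc l)"] by (simp add: g_def)
  let ?M = "\<lambda>j \<omega>. \<Sum>l<j. g l \<omega> * (W (p (Suc l)) \<omega> $ \<alpha> - W (p l) \<omega> $ \<alpha>)"
  let ?G = "{\<omega>\<in>space P. (\<exists>j\<le>n. \<epsilon> < \<bar>?M j \<omega>\<bar>) \<and> (\<Sum>l<n. (g l \<omega>)\<^sup>2 * (p (Suc l) - p l)) \<le> \<delta>}"
  have pos: "0 \<le> p l" if "l \<le> n" for l using p(2) A(3) that by auto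
  have "?E \<subseteq> ?G"
  proof safe
    fix \<omega> s assume \<omega>: "\<omega> \<in> space P" and s: "s \<in> D"
      and big: "\<epsilon> < \<bar>simple_integral N t \<xi> (\<lambda>t \<omega>. W t \<omega> $ \<alpha>) s \<omega> - simple_integral N' t' \<xi>' (\<lambda>t \<omega>. W t \<omega> $ \<alpha>) s \<omega>\<bar>"
      and en: "energy T (simple_process N t \<xi>) (simple_process N' t' \<xi>') \<omega> \<le> ennreal \<delta>"
    have "s \<in> p ` {..n}" using s p(2) by (auto simp: A_def)
    then obtain j where j: "j \<le> n" "s = p j" by auto
    have "simple_integral N t \<xi> (\<lambda>t \<omega>. W t \<omega> $ \<alpha>) s \<omega> - simple_integral N' t' \<xi>' (\<lambda>t \<omega>. W t \<omega> $ \<alpha>) s \<omega> = ?M j \<omega>"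
    proof -
      have "simple_integral N t \<xi> (\<lambda>t \<omega>. W t \<omega> $ \<alpha>) s \<omega> = (\<Sum>l<j. simple_process N t \<xi> (p (Suc l)) \<omega> * (W (p (Suc l)) \<omega> $ \<alpha> - W (p l) \<omega> $ \<alpha>))"
        unfolding j(2) by (rule simple_integral_grid[OF part(1) mono(1) j(1)])
      moreover have "simple_integral N' t' \<xi>' (\<lambda>t \<omega>. W t \<omega> $ \<alpha>) s \<omega> = (\<Sum>l<j. simple_process N' t' \<xi>' (p (Suc l)) \<omega> * (W (p (Suc l)) \<omega> $ \<alpha> - W (p l) \<omega> $ \<alpha>))"
        unfolding j(2) by (rule simple_integral_grid[OF part(2) mono(2) j(1)])
      ultimately show ?thesis by (simp only: g_def sum_subtractf left_diff_distrib)
    qed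
    then show "\<exists>j\<le>n. \<epsilon> < \<bar>?M j \<omega>\<bar>" using big j(1) by auto
    have "ennreal (\<Sum>l<n. (g l \<omega>)\<^sup>2 * (p (Suc l) - p l)) \<le> energy T (simple_process N t \<xi>) (simple_process N' t' \<xi>') \<omega>"
      unfolding energy_def pn[symmetric]
    proof (rule sum_squares_le_nn_integral[OF p0 p(1)])
      fix l s assume l: "l < n" "p l < s" "s \<le> p (Suc l)"
      show "simple_process N t \<xi> s \<omega> - simple_process N' t' \<xi>' s \<omega> = g l \<omega>"
        unfolding g_def simple_process_cell[OF part(1) l] simple_process_cell[OF part(2) l] by simp
    qed
    from order_trans[OF this en] show "(\<Sum>l<n. (g l \<omega>)\<^sup>2 * (p (Suc l) - p l)) \<le> \<delta>"
      using ennreal_le_iff[OF \<delta>] by blast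
  qed
  moreover have "?G \<in> sets P"
  proof -
    have [measurable]: "g l \<in> borel_measurable P" if "l < n" for l using gm[OF that] measurable_F_P by blast
    have "?M j \<in> borel_measurable P" if "j \<le> n" for j
      using that pos by (intro borel_measurable_sum borel_measurable_times borel_measurable_diff W_component_measurable_P) auto
    moreover have "(\<lambda>\<omega>. \<Sum>l<n. (g l \<omega>)\<^sup>2 * (p (Suc l) - p l)) \<in> borel_measurable P"
      by (intro borel_measurable_sum borel_measurable_times borel_measurable_power) auto
    ultimately show ?thesis by measurable
  qed
  ultimately have "prob ?E \<le> prob ?G" by (rule finite_measure_mono)
  also have "\<dots> \<le> \<delta> / \<epsilon>\<^sup>2"
    by (rule maximal_inequality[where c="c + c'" and p=p and N=n and g=g, OF _ p(1) gm gb \<epsilon> \<delta>]) (use p0 in auto)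
  finally show ?thesis .
qed

end

section \<open>Ito integrals\<close>

lemma (in prob_space) prob_tendsto_0_of_AE:
  assumes [measurable]: "\<And>n. A n \<in> events" and ae: "AE \<omega> in M. eventually (\<lambda>n. \<omega> \<notin> A n) sequentially"
  shows "(\<lambda>n. prob (A n)) \<longlonglongrightarrow> 0"
proof -
  have "(\<lambda>n. expectation (\<lambda>\<omega>. indicator (A n) \<omega> :: real)) \<longlonglongrightarrow> expectation (\<lambda>\<omega>. 0)"
  proof (rule integral_dominated_convergence[where w="\<lambda>_. 1"])
    show "AE \<omega> in M. (\<lambda>n. indicator (A n) \<omega> :: real) \<longlonglongrightarrow> 0"
      using ae by eventually_elim (auto intro!: tendsto_eventually elim!: eventually_mono)
  qed (auto simp: indicator_def)
  then show ?thesis by simp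
qed

text \<open>Truncation at 1 turns convergence in probability into convergence in L1, which has an
  almost surely convergent subsequence. Along it the truncation is eventually inactive, since the
  limit is 0.\<close>

lemma (in prob_space) AE_subsequence_of_prob:
  fixes X :: "nat \<Rightarrow> 'a \<Rightarrow> real"
  assumes [measurable]: "\<And>n. X n \<in> borel_measurable M" and nn: "\<And>n \<omega>. 0 \<le> X n \<omega>"
    and lim: "\<And>\<epsilon>. 0 < \<epsilon> \<Longrightarrow> (\<lambda>n. prob {\<omega>\<in>space M. \<epsilon> < X n \<omega>}) \<longlonglongrightarrow> 0"
  obtains r where "strict_mono r" "AE \<omega> in M. (\<lambda>n. X (r n) \<omega>) \<longlonglongrightarrow> 0"
proof -
  have i: "integrable M (\<lambda>\<omega>. min 1 (X n \<omega>))" for n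
    by (rule integrable_const_bound[where B=1]) (use nn in auto)
  have bound: "expectation (\<lambda>\<omega>. min 1 (X n \<omega>)) \<le> \<epsilon> + prob {\<omega>\<in>space M. \<epsilon> < X n \<omega>}" if "0 < \<epsilon>" for n \<epsilon>
  proof -
    have ig: "integrable M (indicator {\<omega>\<in>space M. \<epsilon> < X n \<omega>} :: 'a \<Rightarrow> real)"
      by (rule integrable_real_indicator) (auto simp: less_top[symmetric])
    have "expectation (\<lambda>\<omega>. min 1 (X n \<omega>)) \<le> expectation (\<lambda>\<omega>. \<epsilon> + indicator {\<omega>\<in>space M. \<epsilon> < X n \<omega>} \<omega>)"
      by (rule integral_mono[OF i Bochner_Integration.integrable_add[OF integrable_const ig]])
        (use that in \<open>auto simp: indicator_def\<close>)
    also have "\<dots> = \<epsilon> + prob {\<omega>\<in>space M. \<epsilon> < X n \<omega>}"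
      using Bochner_Integration.integral_add[OF integrable_const[of \<epsilon>] ig] by (simp add: prob_space)
    finally show ?thesis .
  qed
  have "(\<lambda>n. expectation (\<lambda>\<omega>. norm (min 1 (X n \<omega>)))) \<longlonglongrightarrow> 0"
  proof (rule LIMSEQ_I)
    fix e :: real assume e: "0 < e"
    have "eventually (\<lambda>n. prob {\<omega>\<in>space M. e/2 < X n \<omega>} < e/2) sequentially"
      by (rule order_tendstoD(2)[OF lim]) (use e in auto)
    then obtain n0 where n0: "\<And>n. n \<ge> n0 \<Longrightarrow> prob {\<omega>\<in>space M. e/2 < X n \<omega>} < e/2"
      by (auto simp: eventually_sequentially)
    have "norm (expectation (\<lambda>\<omega>. norm (min 1 (X n \<omega>))) - 0) < e" if "n \<ge> n0" for n
    proof -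
      have "norm (min 1 (X n \<omega>)) = min 1 (X n \<omega>)" for \<omega> using nn[of n \<omega>] by (auto simp: min_def)
      moreover have "0 \<le> expectation (\<lambda>\<omega>. min 1 (X n \<omega>))" by (rule integral_nonneg_AE) (use nn in auto)
      ultimately show ?thesis using bound[of "e/2" n] n0[OF that] e by simp
    qed
    then show "\<exists>no. \<forall>n\<ge>no. norm (expectation (\<lambda>\<omega>. norm (min 1 (X n \<omega>))) - 0) < e" by blast
  qed
  from tendsto_L1_AE_subseq[OF i this]
  obtain r where r: "strict_mono r" "AE \<omega> in M. (\<lambda>n. min 1 (X (r n) \<omega>)) \<longlonglongrightarrow> 0" by auto
  have "(\<lambda>n. X (r n) \<omega>) \<longlonglongrightarrow> 0" if "(\<lambda>n. min 1 (X (r n) \<omega>)) \<longlonglongrightarrow> 0" for \<omega>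
  proof -
    have "eventually (\<lambda>n. min 1 (X (r n) \<omega>) < 1) sequentially"
      using order_tendstoD(2)[OF that] by simp
    then have "eventually (\<lambda>n. min 1 (X (r n) \<omega>) = X (r n) \<omega>) sequentially"
      by (rule eventually_mono) auto
    then show ?thesis using that by (rule Lim_transform_eventually[rotated])
  qed
  with r(2) have "AE \<omega> in M. (\<lambda>n. X (r n) \<omega>) \<longlonglongrightarrow> 0" by (auto elim: AE_mp)
  then show ?thesis by (rule that[OF r(1)])
qed

lemma (in prob_space) prob_le_add:
  assumes "A \<subseteq> B \<union> C" "B \<in> events" "C \<in> events"
  shows "prob A \<le> prob B + prob C"
  using order_trans[OF finite_measure_mono[OF assms(1)] measure_Un_le[OF assms(2,3)]] assms by auto

lemma continuous_on_atLeast_0I: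
  fixes f :: "real \<Rightarrow> 'b::topological_space"
  assumes "\<And>T. 0 \<le> T \<Longrightarrow> continuous_on {0..T} f"
  shows "continuous_on {0..} f"
  unfolding continuous_on_eq_continuous_within
proof
  fix x :: real assume x: "x \<in> {0..}"
  then have "continuous (at x within {0..x+1}) f"
    using assms[of "x + 1"] by (simp add: continuous_on_eq_continuous_within)
  moreover have "at x within {0..x+1} = at x within {0..}"
    by (rule at_within_nhd[of _ "{..<x+1}"]) auto
  ultimately show "continuous (at x within {0..}) f" by (simp add: continuous_within)
qed

text \<open>The rationals approach \<open>s\<close> from the right. Hence \<open>s = 0\<close> is
  covered although only positive \<open>u\<close> are assumed, and \<open>s\<close> has to be
  strictly below \<open>b\<close>.\<close>

lemma le_on_rationals_imp_le:
  fixes f :: "real \<Rightarrow> real"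
  assumes f: "continuous_on {0..} f" and le: "\<And>u. u \<in> \<rat> \<Longrightarrow> 0 < u \<Longrightarrow> u \<le> b \<Longrightarrow> f u \<le> c"
    and s: "0 \<le> s" "s < b"
  shows "f s \<le> c"
proof (rule ccontr)
  assume "\<not> f s \<le> c"
  then have pos: "0 < f s - c" by simp
  obtain d where d: "d > 0" "\<And>u. 0 \<le> u \<Longrightarrow> dist u s < d \<Longrightarrow> dist (f u) (f s) < f s - c"
    using f s(1) pos unfolding continuous_on_iff by (metis atLeast_iff)
  obtain u where u: "u \<in> \<rat>" "s < u" "u < min (s + d) b"
    using Rats_dense_in_real[of s "min (s + d) b"] d s by auto
  have "dist (f u) (f s) < f s - c" using d(2)[of u] u s by (auto simp: dist_real_def)
  moreover have "f u \<le> c" using le[of u] u s by auto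
  ultimately show False by (auto simp: dist_real_def)
qed

section \<open>Uniqueness and existence of the Ito integral\<close>

context brownian_space
begin

text \<open>Two simple processes, each within energy \<open>\<delta>/4\<close> of \<open>H\<close>,
  are within \<open>2 * (\<delta>/4) + 2 * (\<delta>/4) = \<delta>\<close> of each other; outside
  the two exceptional events the maximal inequality applies.\<close>

lemma simple_difference_bound:
  assumes H: "progressive F H" and sd: "simple_data P F N t \<xi>" "simple_data P F N' t' \<xi>'" and T: "0 \<le> T"
    and D: "finite D" "D \<subseteq> {0..T}" and \<epsilon>: "0 < \<epsilon>" and \<delta>: "0 \<le> \<delta>"
  shows "prob {\<omega>\<in>space P. \<exists>s\<in>D. \<epsilon> < \<bar>simple_integral N t \<xi> (\<lambda>t \<omega>. W t \<omega> $ \<alpha>) s \<omega> - simple_integral N' t' \<xi>' (\<lambda>t \<omega>. W t \<omega> $ \<alpha>) s \<omega>\<bar>}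
     \<le> prob {\<omega>\<in>space P. ennreal (\<delta>/4) < energy T (simple_process N t \<xi>) H \<omega>}
      + prob {\<omega>\<in>space P. ennreal (\<delta>/4) < energy T (simple_process N' t' \<xi>') H \<omega>} + \<delta> / \<epsilon>\<^sup>2"
proof -
  let ?B = "\<lambda>N t \<xi>. {\<omega>\<in>space P. ennreal (\<delta>/4) < energy T (simple_process N t \<xi>) H \<omega>}"
  let ?I = "\<lambda>N t \<xi>. simple_integral N t \<xi> (\<lambda>t \<omega>. W t \<omega> $ \<alpha>)"
  let ?G = "{\<omega>\<in>space P. (\<exists>s\<in>D. \<epsilon> < \<bar>?I N t \<xi> s \<omega> - ?I N' t' \<xi>' s \<omega>\<bar>) \<and>
      energy T (simple_process N t \<xi>) (simple_process N' t' \<xi>') \<omega> \<le> ennreal \<delta>}"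
  let ?A = "{\<omega>\<in>space P. \<exists>s\<in>D. \<epsilon> < \<bar>?I N t \<xi> s \<omega> - ?I N' t' \<xi>' s \<omega>\<bar>}"
  note pr = progressive_simple[OF sd(1)] progressive_simple[OF sd(2)]
  note [measurable] = energy_measurable[OF pr(1) H T] energy_measurable[OF pr(2) H T] energy_measurable[OF pr T]
  have [measurable]: "?I N t \<xi> s \<in> borel_measurable P" "?I N' t' \<xi>' s \<in> borel_measurable P" if "s \<in> D" for s
    using simple_integral_measurable[OF sd(1)] simple_integral_measurable[OF sd(2)] that D(2) by auto
  have [measurable]: "?A \<in> sets P" using D(1) by measurable
  have G: "?G \<in> sets P"
  proof -
    have "?G = ?A \<inter> {\<omega>\<in>space P. energy T (simple_process N t \<xi>) (simple_process N' t' \<xi>') \<omega> \<le> ennreal \<delta>}" by auto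
    also have "\<dots> \<in> sets P" by measurable
    finally show ?thesis .
  qed
  have "?A \<subseteq> (?B N t \<xi> \<union> ?B N' t' \<xi>') \<union> ?G"
  proof
    fix \<omega> assume a: "\<omega> \<in> ?A"
    show "\<omega> \<in> (?B N t \<xi> \<union> ?B N' t' \<xi>') \<union> ?G"
    proof (cases "\<omega> \<in> ?B N t \<xi> \<union> ?B N' t' \<xi>'")
      case False
      then have le: "energy T (simple_process N t \<xi>) H \<omega> \<le> ennreal (\<delta>/4)" "energy T (simple_process N' t' \<xi>') H \<omega> \<le> ennreal (\<delta>/4)"
        using a by auto
      have "energy T (simple_process N t \<xi>) (simple_process N' t' \<xi>') \<omega>
        \<le> 2 * energy T (simple_process N t \<xi>) H \<omega> + 2 * energy T (simple_process N' t' \<xi>') H \<omega>"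
        using energy_triangle[OF pr H T] a by auto
      also have "\<dots> \<le> 2 * ennreal (\<delta>/4) + 2 * ennreal (\<delta>/4)"
        using le by (intro add_mono mult_left_mono) auto
      also have "\<dots> = ennreal (2 * (\<delta>/4) + 2 * (\<delta>/4))"
        using \<delta> by (simp only: ennreal_plus ennreal_mult ennreal_numeral mult_nonneg_nonneg divide_nonneg_nonneg zero_le_numeral)
      finally show ?thesis using a by auto
    qed simp
  qed
  then have "prob ?A \<le> prob (?B N t \<xi> \<union> ?B N' t' \<xi>') + prob ?G"
    by (rule prob_le_add) (use G in auto)
  also have "prob (?B N t \<xi> \<union> ?B N' t' \<xi>') \<le> prob (?B N t \<xi>) + prob (?B N' t' \<xi>')"
    by (rule measure_Un_le) measurable
  also have "prob ?G \<le> \<delta> / \<epsilon>\<^sup>2" by (rule simple_maximal_inequality[OF sd T D \<epsilon> \<delta>])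
  finally show ?thesis by simp
qed

text \<open>Any simple processes approximating \<open>H\<close> may replace those in the definition
  of \<open>I\<close>, even simultaneously at finite sets of times that grow with \<open>n\<close>.
  The witnesses of the definition converge only at fixed times; so for each fixed \<open>n\<close> a
  witness \<open>m\<close> is taken far enough to be close to \<open>I\<close> on all of
  \<open>D n\<close>, and the maximal inequality compares it with the given process.\<close>

lemma ito_integral_approximation:
  assumes I: "has_ito_integral P F (\<lambda>t \<omega>. W t \<omega> $ \<alpha>) H I"
    and sd: "\<And>n. simple_data P F (N n) (t n) (\<xi> n)" and T: "0 \<le> T"
    and en: "\<And>\<epsilon>. 0 < \<epsilon> \<Longrightarrow> (\<lambda>n. prob {\<omega>\<in>space P. ennreal \<epsilon> < energy T (simple_process (N n) (t n) (\<xi> n)) H \<omega>}) \<longlonglongrightarrow> 0"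
    and D: "\<And>n. finite (D n)" "\<And>n. D n \<subseteq> {0..T}" and \<epsilon>: "0 < \<epsilon>"
  shows "(\<lambda>n. prob {\<omega>\<in>space P. \<exists>s\<in>D n. \<epsilon> < \<bar>simple_integral (N n) (t n) (\<xi> n) (\<lambda>t \<omega>. W t \<omega> $ \<alpha>) s \<omega> - I s \<omega>\<bar>}) \<longlonglongrightarrow> 0"
proof (rule LIMSEQ_I)
  fix e :: real assume "0 < e"
  \<comment> \<open>Four errors of size \<eta> arise: the energies of both processes, the maximal
    inequality, and the distance of the witness from \<open>I\<close>. A fifth of \<open>e\<close>
    leaves their sum strictly below \<open>e\<close>.\<close>
  define \<eta> where "\<eta> = e / 5"
  have \<eta>: "0 < \<eta>" "4 * \<eta> < e" using \<open>0 < e\<close> by (auto simp: \<eta>_def)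
  \<comment> \<open>Chosen so that the maximal inequality at level \<open>\<epsilon>/2\<close>
    contributes exactly \<eta>.\<close>
  define \<delta> where "\<delta> = \<eta> * (\<epsilon>/2)\<^sup>2"
  have \<delta>: "0 < \<delta>" "\<delta> / (\<epsilon>/2)\<^sup>2 = \<eta>" using \<eta> \<epsilon> by (auto simp: \<delta>_def)
  have "\<exists>N t \<xi>. (\<forall>n. simple_data P F (N n) (t n) (\<xi> n)) \<and>
        (\<forall>T\<ge>0. \<forall>\<epsilon>>0. (\<lambda>n. prob {\<omega>\<in>space P. ennreal \<epsilon> < energy T (simple_process (N n) (t n) (\<xi> n)) H \<omega>}) \<longlonglongrightarrow> 0) \<and>
        (\<forall>T\<ge>0. \<forall>\<epsilon>>0. (\<lambda>n. prob {\<omega>\<in>space P.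
             \<epsilon> < \<bar>simple_integral (N n) (t n) (\<xi> n) (\<lambda>t \<omega>. W t \<omega> $ \<alpha>) T \<omega> - I T \<omega>\<bar>}) \<longlonglongrightarrow> 0)"
    using I unfolding has_ito_integral_def energy_def by (elim conjE)
  then obtain N' t' \<xi>' where sd': "\<And>n. simple_data P F (N' n) (t' n) (\<xi>' n)"
    and en': "\<And>T \<epsilon>. 0 \<le> T \<Longrightarrow> 0 < \<epsilon> \<Longrightarrow> (\<lambda>n. prob {\<omega>\<in>space P. ennreal \<epsilon> < energy T (simple_process (N' n) (t' n) (\<xi>' n)) H \<omega>}) \<longlonglongrightarrow> 0"
    and lim': "\<And>T \<epsilon>. 0 \<le> T \<Longrightarrow> 0 < \<epsilon> \<Longrightarrow> (\<lambda>n. prob {\<omega>\<in>space P. \<epsilon> < \<bar>simple_integral (N' n) (t' n) (\<xi>' n) (\<lambda>t \<omega>. W t \<omega> $ \<alpha>) T \<omega> - I T \<omega>\<bar>}) \<longlonglongrightarrow> 0"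
    by (elim exE conjE) blast
  have H: "progressive F H" and Im: "\<And>t. 0 \<le> t \<Longrightarrow> I t \<in> borel_measurable P"
    using I by (auto simp: has_ito_integral_def)
  let ?J = "\<lambda>n. simple_integral (N n) (t n) (\<xi> n) (\<lambda>t \<omega>. W t \<omega> $ \<alpha>)"
  let ?J' = "\<lambda>n. simple_integral (N' n) (t' n) (\<xi>' n) (\<lambda>t \<omega>. W t \<omega> $ \<alpha>)"
  have "eventually (\<lambda>n. prob {\<omega>\<in>space P. ennreal (\<delta>/4) < energy T (simple_process (N n) (t n) (\<xi> n)) H \<omega>} < \<eta>) sequentially"
    using order_tendstoD(2)[OF en[of "\<delta>/4"]] \<delta>(1) \<eta>(1) by simp
  then obtain n0 where n0: "\<And>n. n \<ge> n0 \<Longrightarrow> prob {\<omega>\<in>space P. ennreal (\<delta>/4) < energy T (simple_process (N n) (t n) (\<xi> n)) H \<omega>} < \<eta>"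
    by (auto simp: eventually_sequentially)
  have "prob {\<omega>\<in>space P. \<exists>s\<in>D n. \<epsilon> < \<bar>?J n s \<omega> - I s \<omega>\<bar>} < e" if n: "n \<ge> n0" for n
  proof -
    have "(\<lambda>m. \<Sum>s\<in>D n. prob {\<omega>\<in>space P. \<epsilon>/2 < \<bar>?J' m s \<omega> - I s \<omega>\<bar>}) \<longlonglongrightarrow> (\<Sum>s\<in>D n. 0)"
      using D(2)[of n] \<epsilon> by (intro tendsto_sum lim') auto
    then have "eventually (\<lambda>m. (\<Sum>s\<in>D n. prob {\<omega>\<in>space P. \<epsilon>/2 < \<bar>?J' m s \<omega> - I s \<omega>\<bar>}) < \<eta>) sequentially"
      using order_tendstoD(2) \<eta>(1) by simp
    moreover have "eventually (\<lambda>m. prob {\<omega>\<in>space P. ennreal (\<delta>/4) < energy T (simple_process (N' m) (t' m) (\<xi>' m)) H \<omega>} < \<eta>) sequentially"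
      using order_tendstoD(2)[OF en'[OF T, of "\<delta>/4"]] \<delta>(1) \<eta>(1) by simp
    ultimately obtain m where m: "(\<Sum>s\<in>D n. prob {\<omega>\<in>space P. \<epsilon>/2 < \<bar>?J' m s \<omega> - I s \<omega>\<bar>}) < \<eta>"
      "prob {\<omega>\<in>space P. ennreal (\<delta>/4) < energy T (simple_process (N' m) (t' m) (\<xi>' m)) H \<omega>} < \<eta>"
      using eventually_happens'[OF sequentially_bot eventually_conj] by blast
    have [measurable]: "?J n s \<in> borel_measurable P" "?J' m s \<in> borel_measurable P" "I s \<in> borel_measurable P" if "s \<in> D n" for s
      using that D(2)[of n] simple_integral_measurable[OF sd, of s n] simple_integral_measurable[OF sd', of s m] Im[of s] by auto
    let ?A = "{\<omega>\<in>space P. \<exists>s\<in>D n. \<epsilon>/2 < \<bar>?J n s \<omega> - ?J' m s \<omega>\<bar>}"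
    let ?B = "\<Union>s\<in>D n. {\<omega>\<in>space P. \<epsilon>/2 < \<bar>?J' m s \<omega> - I s \<omega>\<bar>}"
    have "{\<omega>\<in>space P. \<exists>s\<in>D n. \<epsilon> < \<bar>?J n s \<omega> - I s \<omega>\<bar>} \<subseteq> ?A \<union> ?B"
    proof safe
      fix \<omega> s assume s: "s \<in> D n" "\<epsilon> < \<bar>?J n s \<omega> - I s \<omega>\<bar>" and \<omega>: "\<omega> \<notin> ?B" "\<omega> \<in> space P"
      have "\<epsilon>/2 < \<bar>a - b\<bar>" if "\<epsilon> < \<bar>a - c\<bar>" "\<not> \<epsilon>/2 < \<bar>b - c\<bar>" for a b c :: real
        using that by (auto simp: abs_if split: if_splits)
      moreover have "\<not> \<epsilon>/2 < \<bar>?J' m s \<omega> - I s \<omega>\<bar>" using s(1) \<omega> by blast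
      ultimately show "\<exists>s\<in>D n. \<epsilon>/2 < \<bar>?J n s \<omega> - ?J' m s \<omega>\<bar>" using s by blast
    qed
    moreover have "?A \<in> sets P" using D(1)[of n] by measurable
    moreover have Bs: "{\<omega>\<in>space P. \<epsilon>/2 < \<bar>?J' m s \<omega> - I s \<omega>\<bar>} \<in> sets P" if "s \<in> D n" for s using that by measurable
    moreover have "?B \<in> sets P" using Bs D(1)[of n] by (intro sets.finite_UN) auto
    ultimately have "prob {\<omega>\<in>space P. \<exists>s\<in>D n. \<epsilon> < \<bar>?J n s \<omega> - I s \<omega>\<bar>} \<le> prob ?A + prob ?B"
      by (intro prob_le_add) auto
    also have "prob ?B \<le> (\<Sum>s\<in>D n. prob {\<omega>\<in>space P. \<epsilon>/2 < \<bar>?J' m s \<omega> - I s \<omega>\<bar>})"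
      by (rule finite_measure_subadditive_finite) (use D(1) Bs in auto)
    also have "\<dots> < \<eta>" by (rule m)
    also have "prob ?A \<le> prob {\<omega>\<in>space P. ennreal (\<delta>/4) < energy T (simple_process (N n) (t n) (\<xi> n)) H \<omega>}
      + prob {\<omega>\<in>space P. ennreal (\<delta>/4) < energy T (simple_process (N' m) (t' m) (\<xi>' m)) H \<omega>} + \<delta> / (\<epsilon>/2)\<^sup>2"
      by (rule simple_difference_bound[OF H sd sd' T D]) (use \<epsilon> \<delta> in auto)
    finally show ?thesis using n0[OF n] m(2) \<delta>(2) \<eta>(2) by linarith
  qed
  then show "\<exists>no. \<forall>n\<ge>no. norm (prob {\<omega>\<in>space P. \<exists>s\<in>D n. \<epsilon> < \<bar>?J n s \<omega> - I s \<omega>\<bar>} - 0) < e"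
    by (intro exI[of _ n0]) (simp add: measure_nonneg)
qed

text \<open>Along a fast subsequence the energies up to time \<open>j\<close> are at most
  \<open>(1/8)^j/4\<close> outside events of probability \<open>(1/2)^j\<close>. By
  \<open>simple_difference_bound\<close> consecutive integrals then differ by more than
  \<open>(1/2)^j\<close> somewhere before time \<open>j\<close> with probability at most
  \<open>3 * (1/2)^j\<close>, because \<open>(1/8)^j\<close> divided by the square of
  \<open>(1/2)^j\<close> is \<open>(1/2)^j\<close>. Borel-Cantelli gives locally uniform convergence
  almost surely, hence a continuous limit.\<close>

lemma ito_integral_exists:
  assumes H: "progressive F H"
    and fin: "AE \<omega> in P. \<forall>T\<ge>0. (\<integral>\<^sup>+ s\<in>{0..T}. ennreal ((H s \<omega>)\<^sup>2) \<partial>lborel) < \<infinity>"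
    and sd: "\<And>n. simple_data P F (N n) (t n) (\<xi> n)"
    and en: "\<And>T \<epsilon>. 0 \<le> T \<Longrightarrow> 0 < \<epsilon> \<Longrightarrow> (\<lambda>n. prob {\<omega>\<in>space P. ennreal \<epsilon> < energy T (simple_process (N n) (t n) (\<xi> n)) H \<omega>}) \<longlonglongrightarrow> 0"
  shows "\<exists>I. has_ito_integral P F (\<lambda>t \<omega>. W t \<omega> $ \<alpha>) H I"
proof -
  let ?S = "\<lambda>n. simple_process (N n) (t n) (\<xi> n)"
  let ?J = "\<lambda>n. simple_integral (N n) (t n) (\<xi> n) (\<lambda>t \<omega>. W t \<omega> $ \<alpha>)"
  have "\<exists>r. \<forall>n\<ge>r. prob {\<omega>\<in>space P. ennreal ((1/8)^j/4) < energy (real j) (?S n) H \<omega>} < (1/2)^j" for j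
    using order_tendstoD(2)[OF en[of "real j" "(1/8)^j/4"], of "(1/2)^j"] by (auto simp: eventually_sequentially)
  then obtain r where r: "\<And>j n. r j \<le> n \<Longrightarrow> prob {\<omega>\<in>space P. ennreal ((1/8)^j/4) < energy (real j) (?S n) H \<omega>} < (1/2)^j"
    by metis
  \<comment> \<open>The partial sums of \<open>r\<close> put both \<open>q j\<close> and
    \<open>q (Suc j)\<close> beyond the threshold \<open>r j\<close>; the summand \<open>j\<close>
    makes the sequence tend to infinity.\<close>
  define q where "q j = (\<Sum>i\<le>j. r i) + j" for j
  have q: "r j \<le> q j" "r j \<le> q (Suc j)" "j \<le> q j" for j
    using member_le_sum[of j "{..j}" r] by (auto simp: q_def)
  have qlim: "filterlim q at_top sequentially"
    by (rule filterlim_at_top_mono[OF filterlim_ident]) (use q(3) in auto)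
  define \<Delta> where "\<Delta> j s \<omega> = ?J (q (Suc j)) s \<omega> - ?J (q j) s \<omega>" for j s \<omega>
  have Jm: "?J n s \<in> borel_measurable P" if "0 \<le> s" for n s
    by (rule simple_integral_measurable[OF sd that])
  have \<Delta>m: "\<Delta> j s \<in> borel_measurable P" if "0 \<le> s" for j s
    unfolding \<Delta>_def using Jm[OF that] by simp
  have fin_bound: "prob {\<omega>\<in>space P. \<exists>s\<in>D. (1/2)^j < \<bar>\<Delta> j s \<omega>\<bar>} \<le> 3 * (1/2)^j"
    if D: "finite D" "D \<subseteq> {0..real j}" for D j
  proof -
    have "prob {\<omega>\<in>space P. \<exists>s\<in>D. (1/2)^j < \<bar>\<Delta> j s \<omega>\<bar>}
      \<le> prob {\<omega>\<in>space P. ennreal ((1/8)^j/4) < energy (real j) (?S (q (Suc j))) H \<omega>}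
       + prob {\<omega>\<in>space P. ennreal ((1/8)^j/4) < energy (real j) (?S (q j)) H \<omega>} + (1/8)^j / ((1/2)^j)\<^sup>2"
      unfolding \<Delta>_def by (rule simple_difference_bound[OF H sd sd _ D]) auto
    also have "(1/8)^j / ((1/2)^j)\<^sup>2 = (1/2 :: real)^j"
      by (simp add: power2_eq_square field_simps flip: power_mult_distrib)
    finally show ?thesis using r[OF q(1), of j] r[OF q(2), of j] by simp
  qed
  define Q where "Q = \<rat> \<inter> {0::real..}"
  have Q: "countable Q" "Q \<noteq> {}" using countable_rat by (auto simp: Q_def intro!: exI[of _ 0])
  \<comment> \<open>Increasing finite sets that exhaust the nonnegative rationals up to
    \<open>j\<close>: the bound, uniform over finite sets, passes to all of these rationals by
    continuity of the measure from below.\<close>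
  define Dk where "Dk j k = {s\<in>from_nat_into Q ` {..k}. s \<le> real j}" for j k :: nat
  have Dk: "finite (Dk j k)" "Dk j k \<subseteq> {0..real j}" "Dk j k \<subseteq> Q" for j k
    using from_nat_into[OF Q(2)] by (auto simp: Dk_def Q_def)
  have UDk: "(\<Union>k. Dk j k) = {s\<in>Q. s \<le> real j}" for j
  proof -
    have "(\<Union>k. Dk j k) = {s\<in>range (from_nat_into Q). s \<le> real j}" by (auto simp: Dk_def)
    then show ?thesis by (simp only: range_from_nat_into[OF Q(2,1)])
  qed
  define B where "B j = {\<omega>\<in>space P. \<exists>s\<in>{s\<in>Q. s \<le> real j}. (1/2)^j < \<bar>\<Delta> j s \<omega>\<bar>}" for j
  define A where "A j k = {\<omega>\<in>space P. \<exists>s\<in>Dk j k. (1/2)^j < \<bar>\<Delta> j s \<omega>\<bar>}" for j k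
  have Am: "A j k \<in> sets P" for j k
  proof -
    have [measurable]: "\<Delta> j s \<in> borel_measurable P" if "s \<in> Dk j k" for s using \<Delta>m Dk(2) that by force
    show ?thesis unfolding A_def using Dk(1) by measurable
  qed
  have BA: "B j = (\<Union>k. A j k)" for j
    unfolding B_def A_def UDk[symmetric] by auto
  have Bm: "B j \<in> sets P" for j unfolding BA using Am by auto
  have PB: "prob (B j) \<le> 3 * (1/2)^j" for j
  proof (rule LIMSEQ_le_const2)
    have "incseq (A j)" unfolding incseq_def A_def Dk_def by force
    then show "(\<lambda>k. prob (A j k)) \<longlonglongrightarrow> prob (B j)"
      unfolding BA using finite_Lim_measure_incseq[of "A j"] Am by auto
    show "\<exists>N. \<forall>k\<ge>N. prob (A j k) \<le> 3 * (1/2)^j"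
      unfolding A_def using fin_bound[OF Dk(1,2)] by blast
  qed
  have "summable (\<lambda>j. prob (B j))"
    by (rule summable_comparison_test'[where g="\<lambda>j. 3 * (1/2 :: real)^j" and N=0])
      (use PB in \<open>auto intro!: summable_mult summable_geometric\<close>)
  then have bc: "AE \<omega> in P. eventually (\<lambda>j. \<omega> \<in> space P - B j) sequentially"
    by (intro borel_cantelli_AE1 Bm) (auto simp: emeasure_eq_measure)
  \<comment> \<open>Using \<open>lim\<close> at every \<omega> makes \<open>I s\<close> measurable
    outright, with no modification on a null set; where the sequence diverges the value is
    arbitrary.\<close>
  define I where "I s \<omega> = lim (\<lambda>j. ?J (q j) s \<omega>)" for s \<omega>
  have uniform: "AE \<omega> in P. \<forall>T\<ge>0. uniform_limit {0..T} (\<lambda>j s. ?J (q j) s \<omega>) (\<lambda>s. I s \<omega>) sequentially \<and> continuous_on {0..T} (\<lambda>s. I s \<omega>)"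
    using bc W_continuous
  proof eventually_elim
    case (elim \<omega>)
    have cJ: "continuous_on {0..} (\<lambda>s. ?J n s \<omega>)" for n
      by (rule simple_integral_continuous[OF sd elim(2)])
    obtain j0 where j0: "\<And>j. j \<ge> j0 \<Longrightarrow> \<omega> \<in> space P - B j" using elim(1) by (auto simp: eventually_sequentially)
    have small: "\<bar>\<Delta> j s \<omega>\<bar> \<le> (1/2)^j" if "j \<ge> j0" "0 \<le> s" "s < real j" for j s
    proof (rule le_on_rationals_imp_le[of "\<lambda>s. \<bar>\<Delta> j s \<omega>\<bar>" "real j"])
      show "continuous_on {0..} (\<lambda>s. \<bar>\<Delta> j s \<omega>\<bar>)" unfolding \<Delta>_def by (intro continuous_intros cJ)
      show "\<bar>\<Delta> j u \<omega>\<bar> \<le> (1/2)^j" if "u \<in> \<rat>" "0 < u" "u \<le> real j" for u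
        using j0[OF \<open>j \<ge> j0\<close>] that by (auto simp: B_def Q_def not_less)
    qed (use that in auto)
    show ?case
    proof (intro allI impI)
      fix T :: real assume T: "0 \<le> T"
      define M where "M = (\<lambda>j. (1/2 :: real)^j)"
      have "eventually (\<lambda>j. \<forall>s\<in>{0..T}. norm (\<Delta> j s \<omega>) \<le> M j) sequentially"
      proof (rule eventually_sequentiallyI)
        fix j assume j: "max j0 (nat \<lceil>T\<rceil> + 1) \<le> j"
        then have "T < real j" by linarith
        then show "\<forall>s\<in>{0..T}. norm (\<Delta> j s \<omega>) \<le> M j" using small j by (auto simp: M_def)
      qed
      moreover have "summable M" unfolding M_def by (simp add: summable_geometric)
      \<comment> \<open>The integrals are a telescoping series with geometrically bounded terms, so
        the Weierstrass test applies.\<close>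
      ultimately have "uniform_limit {0..T} (\<lambda>n s. \<Sum>i<n. \<Delta> i s \<omega>) (\<lambda>s. \<Sum>i. \<Delta> i s \<omega>) sequentially"
        by (rule Weierstrass_m_test_ev)
      then have "uniform_limit {0..T} (\<lambda>n s. ?J (q 0) s \<omega> + (\<Sum>i<n. \<Delta> i s \<omega>)) (\<lambda>s. ?J (q 0) s \<omega> + (\<Sum>i. \<Delta> i s \<omega>)) sequentially"
        by (intro uniform_limit_add uniform_limit_const)
      moreover have "?J (q 0) s \<omega> + (\<Sum>i<n. \<Delta> i s \<omega>) = ?J (q n) s \<omega>" for n s
        unfolding \<Delta>_def using sum_lessThan_telescope[of "\<lambda>i. ?J (q i) s \<omega>" n] by simp
      ultimately have u: "uniform_limit {0..T} (\<lambda>n s. ?J (q n) s \<omega>) (\<lambda>s. ?J (q 0) s \<omega> + (\<Sum>i. \<Delta> i s \<omega>)) sequentially"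
        by simp
      have eq: "?J (q 0) s \<omega> + (\<Sum>i. \<Delta> i s \<omega>) = I s \<omega>" if "s \<in> {0..T}" for s
        unfolding I_def using tendsto_uniform_limitI[OF u that] by (rule limI[symmetric])
      have u': "uniform_limit {0..T} (\<lambda>n s. ?J (q n) s \<omega>) (\<lambda>s. I s \<omega>) sequentially"
        using u by (rule uniform_limit_cong'[THEN iffD1, rotated 2]) (use eq in auto)
      moreover have "continuous_on {0..T} (\<lambda>s. I s \<omega>)"
        by (rule uniform_limit_theorem[OF _ u'])
          (auto intro!: always_eventually continuous_on_subset[OF cJ])
      ultimately show "uniform_limit {0..T} (\<lambda>j s. ?J (q j) s \<omega>) (\<lambda>s. I s \<omega>) sequentially \<and> continuous_on {0..T} (\<lambda>s. I s \<omega>)"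
        by blast
    qed
  qed
  have Im: "I s \<in> borel_measurable P" if "0 \<le> s" for s
    unfolding I_def by (rule borel_measurable_lim_metric[OF Jm[OF that]])
  have "has_ito_integral P F (\<lambda>t \<omega>. W t \<omega> $ \<alpha>) H I"
    unfolding has_ito_integral_def
  proof (intro conjI allI impI H fin Im)
    show "AE \<omega> in P. continuous_on {0..} (\<lambda>t. I t \<omega>)"
      using uniform by eventually_elim (auto intro: continuous_on_atLeast_0I)
    show "\<exists>N t \<xi>. (\<forall>n. simple_data P F (N n) (t n) (\<xi> n)) \<and>
        (\<forall>T\<ge>0. \<forall>\<epsilon>>0. (\<lambda>n. prob {\<omega>\<in>space P. ennreal \<epsilon> <
             (\<integral>\<^sup>+ s\<in>{0..T}. ennreal ((simple_process (N n) (t n) (\<xi> n) s \<omega> - H s \<omega>)\<^sup>2) \<partial>lborel)}) \<longlonglongrightarrow> 0) \<and>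
        (\<forall>T\<ge>0. \<forall>\<epsilon>>0. (\<lambda>n. prob {\<omega>\<in>space P.
             \<epsilon> < \<bar>simple_integral (N n) (t n) (\<xi> n) (\<lambda>t \<omega>. W t \<omega> $ \<alpha>) T \<omega> - I T \<omega>\<bar>}) \<longlonglongrightarrow> 0)"
    proof (intro exI conjI allI impI)
      show "simple_data P F (N (q n)) (t (q n)) (\<xi> (q n))" for n by (rule sd)
      show "(\<lambda>n. prob {\<omega>\<in>space P. ennreal \<epsilon> <
             (\<integral>\<^sup>+ s\<in>{0..T}. ennreal ((?S (q n) s \<omega> - H s \<omega>)\<^sup>2) \<partial>lborel)}) \<longlonglongrightarrow> 0" if "0 \<le> T" "0 < \<epsilon>" for T \<epsilon>
        using filterlim_compose[OF en[OF that] qlim] by (simp add: energy_def)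
      show "(\<lambda>n. prob {\<omega>\<in>space P. \<epsilon> < \<bar>?J (q n) T \<omega> - I T \<omega>\<bar>}) \<longlonglongrightarrow> 0" if T: "0 \<le> T" and \<epsilon>: "0 < \<epsilon>" for T \<epsilon>
      proof (rule prob_tendsto_0_of_AE)
        show "{\<omega>\<in>space P. \<epsilon> < \<bar>?J (q n) T \<omega> - I T \<omega>\<bar>} \<in> events" for n
          using Jm[OF T] Im[OF T] by measurable
        show "AE \<omega> in P. eventually (\<lambda>n. \<omega> \<notin> {\<omega>\<in>space P. \<epsilon> < \<bar>?J (q n) T \<omega> - I T \<omega>\<bar>}) sequentially"
          using uniform
        proof eventually_elim
          case (elim \<omega>)
          then have "uniform_limit {0..T} (\<lambda>j s. ?J (q j) s \<omega>) (\<lambda>s. I s \<omega>) sequentially" using T by blast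
          then have "(\<lambda>n. ?J (q n) T \<omega>) \<longlonglongrightarrow> I T \<omega>"
            by (rule tendsto_uniform_limitI) (use T in auto)
          then have "eventually (\<lambda>n. dist (?J (q n) T \<omega>) (I T \<omega>) < \<epsilon>) sequentially" using \<epsilon> by (rule tendstoD)
          then show ?case by (rule eventually_mono) (auto simp: dist_real_def)
        qed
      qed
    qed
  qed
  then show ?thesis by blast
qed

end

section \<open>Riemann sums over equidistant grids\<close>

text \<open>Index of the grid cell, open on the left and closed on the right, that contains
  \<open>s\<close>; hence the ceiling minus one. The cut-off in \<open>nat\<close> takes effect only
  for \<open>s\<close> at most 0.\<close>

definition gidx :: "real \<Rightarrow> real \<Rightarrow> nat" where
  "gidx \<delta> s = nat (\<lceil>s / \<delta>\<rceil> - 1)"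

definition step_fun :: "nat \<Rightarrow> real \<Rightarrow> (nat \<Rightarrow> real) \<Rightarrow> real \<Rightarrow> real" where
  "step_fun N \<delta> a s = (\<Sum>k<N. a k * indicator {real k * \<delta><..real (Suc k) * \<delta>} s)"

lemma simple_process_eq_step_fun:
  "simple_process N (\<lambda>k. real k * \<delta>) \<xi> s \<omega> = step_fun N \<delta> (\<lambda>k. \<xi> k \<omega>) s"
  by (simp add: simple_process_def step_fun_def)

lemma gidx_bounds:
  assumes "0 < \<delta>" "0 < s"
  shows "real (gidx \<delta> s) * \<delta> < s" "s \<le> real (Suc (gidx \<delta> s)) * \<delta>"
proof -
  have c: "1 \<le> \<lceil>s / \<delta>\<rceil>" using assms by (simp add: one_le_ceiling)
  then have r: "real (gidx \<delta> s) = of_int \<lceil>s / \<delta>\<rceil> - 1" by (simp add: gidx_def)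
  have "of_int \<lceil>s / \<delta>\<rceil> - 1 < s / \<delta>" "s / \<delta> \<le> of_int \<lceil>s / \<delta>\<rceil>" by linarith+
  then have "(of_int \<lceil>s / \<delta>\<rceil> - 1) * \<delta> < s" "s \<le> of_int \<lceil>s / \<delta>\<rceil> * \<delta>"
    unfolding pos_less_divide_eq[OF assms(1)] pos_divide_le_eq[OF assms(1)] .
  then show "real (gidx \<delta> s) * \<delta> < s" "s \<le> real (Suc (gidx \<delta> s)) * \<delta>"
    using r by simp_all
qed

lemma step_fun_gidx:
  assumes "0 < \<delta>" "0 < s" "s \<le> real N * \<delta>"
  shows "step_fun N \<delta> a s = a (gidx \<delta> s)" "gidx \<delta> s < N"
proof -
  note b = gidx_bounds[OF assms(1,2)]
  have "real (gidx \<delta> s) * \<delta> < real N * \<delta>" using b(1) assms(3) by simp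
  then show lt: "gidx \<delta> s < N" using assms(1) by simp
  have "indicator {real k * \<delta><..real (Suc k) * \<delta>} s = (if k = gidx \<delta> s then 1 else 0 :: real)" for k
  proof (cases "k = gidx \<delta> s")
    case False
    have "\<not> (real k * \<delta> < s \<and> s \<le> real (Suc k) * \<delta>)"
    proof (cases "k < gidx \<delta> s")
      case True
      then have "real (Suc k) * \<delta> \<le> real (gidx \<delta> s) * \<delta>" using assms(1) by (intro mult_right_mono) auto
      then show ?thesis using b(1) by linarith
    next
      case False
      then have "real (Suc (gidx \<delta> s)) * \<delta> \<le> real k * \<delta>" using \<open>k \<noteq> gidx \<delta> s\<close> assms(1) by (intro mult_right_mono) auto
      then show ?thesis using b(2) by linarith
    qed
    then show ?thesis using False by (auto simp: indicator_def)
  qed (use b in auto)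
  then have "step_fun N \<delta> a s = (\<Sum>k<N. if k = gidx \<delta> s then a k else 0)"
    unfolding step_fun_def by (intro sum.cong) auto
  then show "step_fun N \<delta> a s = a (gidx \<delta> s)" using lt by simp
qed

lemma mesh_tendsto_0: "(\<lambda>n. 1 / real (Suc n)) \<longlonglongrightarrow> 0"
  using LIMSEQ_inverse_real_of_nat by (simp only: inverse_eq_divide)

text \<open>The cells are open on the left, so the left node stays strictly before \<open>s\<close>,
  within one mesh width. Left limits of a path therefore determine the limits of its grid
  values.\<close>

lemma gidx_at_left:
  assumes "\<And>n. 0 < \<delta> n" "\<delta> \<longlonglongrightarrow> 0" "0 < s"
  shows "filterlim (\<lambda>n. real (gidx (\<delta> n) s) * \<delta> n) (at_left s) sequentially"
  unfolding filterlim_at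
proof
  show "eventually (\<lambda>n. real (gidx (\<delta> n) s) * \<delta> n \<in> {..<s} \<and> real (gidx (\<delta> n) s) * \<delta> n \<noteq> s) sequentially"
    using gidx_bounds(1)[OF assms(1,3)] by (auto intro!: always_eventually simp: less_imp_neq)
  have "s - \<delta> n \<le> real (gidx (\<delta> n) s) * \<delta> n" for n
    using gidx_bounds(2)[OF assms(1)[of n] assms(3)] by (simp add: algebra_simps)
  then have lower: "eventually (\<lambda>n. s - \<delta> n \<le> real (gidx (\<delta> n) s) * \<delta> n) sequentially" by simp
  have upper: "eventually (\<lambda>n. real (gidx (\<delta> n) s) * \<delta> n \<le> s) sequentially"
    using gidx_bounds(1)[OF assms(1,3)] by (simp add: less_imp_le)
  have "(\<lambda>n. s - \<delta> n) \<longlonglongrightarrow> s" using tendsto_diff[OF tendsto_const assms(2), of s] by simp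
  then show "(\<lambda>n. real (gidx (\<delta> n) s) * \<delta> n) \<longlonglongrightarrow> s"
    by (rule tendsto_sandwich[OF lower upper _ tendsto_const])
qed

lemma step_fun_measurable [measurable]: "step_fun N \<delta> a \<in> borel_measurable borel"
  unfolding step_fun_def[abs_def] by measurable

lemma step_fun_integral:
  assumes "0 < \<delta>" "k \<le> N"
  shows "set_integrable lborel {0..real k * \<delta>} (step_fun N \<delta> a)"
    "(LBINT s:{0..real k * \<delta>}. step_fun N \<delta> a s) = (\<Sum>l<k. a l * \<delta>)"
proof -
  have eq: "indicator {0..real k * \<delta>} s *\<^sub>R step_fun N \<delta> a s = (\<Sum>l<k. a l * indicator {real l * \<delta><..real (Suc l) * \<delta>} s)" for s
  proof (cases "s \<in> {0..real k * \<delta>}")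
    case True
    have "(\<Sum>l<N. a l * indicator {real l * \<delta><..real (Suc l) * \<delta>} s) = (\<Sum>l<k. a l * indicator {real l * \<delta><..real (Suc l) * \<delta>} s)"
    proof (rule sum.mono_neutral_right)
      show "\<forall>l\<in>{..<N} - {..<k}. a l * indicator {real l * \<delta><..real (Suc l) * \<delta>} s = 0"
      proof
        fix l assume "l \<in> {..<N} - {..<k}"
        then have "real k * \<delta> \<le> real l * \<delta>" using assms(1) by (intro mult_right_mono) auto
        then show "a l * indicator {real l * \<delta><..real (Suc l) * \<delta>} s = 0" using True by (auto simp: indicator_def)
      qed
    qed (use assms in auto)
    then show ?thesis using True by (simp add: step_fun_def)
  next
    case False
    have "(\<Sum>l<k. a l * indicator {real l * \<delta><..real (Suc l) * \<delta>} s) = 0"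
    proof (rule sum.neutral, rule ballI)
      fix l assume "l \<in> {..<k}"
      then have "real (Suc l) * \<delta> \<le> real k * \<delta>" using assms(1) by (intro mult_right_mono) auto
      moreover have "0 \<le> real l * \<delta>" using assms(1) by simp
      ultimately
      show "a l * indicator {real l * \<delta><..real (Suc l) * \<delta>} s = 0" using False by (auto simp: indicator_def)
    qed
    then show ?thesis using False by simp
  qed
  have i: "integrable lborel (\<lambda>s. a l * indicator {real l * \<delta><..real (Suc l) * \<delta>} s)" for l
  proof (intro integrable_mult_right integrable_real_indicator)
    have "real l * \<delta> \<le> real (Suc l) * \<delta>" using assms(1) by (intro mult_right_mono) auto
    then show "emeasure lborel {real l * \<delta><..real (Suc l) * \<delta>} < \<infinity>" by (simp only: emeasure_lborel_Ioc) simp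
  qed simp
  show "set_integrable lborel {0..real k * \<delta>} (step_fun N \<delta> a)"
    unfolding set_integrable_def eq using i by (intro Bochner_Integration.integrable_sum)
  have "(LBINT s:{0..real k * \<delta>}. step_fun N \<delta> a s) = (\<Sum>l<k. integral\<^sup>L lborel (\<lambda>s. a l * indicator {real l * \<delta><..real (Suc l) * \<delta>} s))"
    unfolding set_lebesgue_integral_def eq using i by (rule Bochner_Integration.integral_sum)
  also have "\<dots> = (\<Sum>l<k. a l * \<delta>)"
  proof (rule sum.cong)
    fix l
    have "real l * \<delta> \<le> real (Suc l) * \<delta>" using assms(1) by (intro mult_right_mono) auto
    then have "measure lborel {real l * \<delta><..real (Suc l) * \<delta>} = \<delta>" by (simp add: algebra_simps)
    then show "integral\<^sup>L lborel (\<lambda>s. a l * indicator {real l * \<delta><..real (Suc l) * \<delta>} s) = a l * \<delta>" by simp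
  qed simp
  finally show "(LBINT s:{0..real k * \<delta>}. step_fun N \<delta> a s) = (\<Sum>l<k. a l * \<delta>)" .
qed

section \<open>Convergence of step functions in L2 and L1\<close>

context
  fixes T c :: real and N :: "nat \<Rightarrow> nat" and \<delta> :: "nat \<Rightarrow> real" and a :: "nat \<Rightarrow> nat \<Rightarrow> real" and h :: "real \<Rightarrow> real"
  assumes \<delta>: "\<And>n. 0 < \<delta> n" "\<delta> \<longlonglongrightarrow> 0" and N: "eventually (\<lambda>n. T \<le> real (N n) * \<delta> n) sequentially"
    and lim: "\<And>s. 0 < s \<Longrightarrow> s \<le> T \<Longrightarrow> (\<lambda>n. a n (gidx (\<delta> n) s)) \<longlonglongrightarrow> h s"
    and bound: "eventually (\<lambda>n. \<forall>k<N n. real k * \<delta> n < T \<longrightarrow> \<bar>a n k\<bar> \<le> c) sequentially"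
    and h_bound: "\<And>s. 0 < s \<Longrightarrow> s \<le> T \<Longrightarrow> \<bar>h s\<bar> \<le> c"
    and h_meas: "(\<lambda>s. h s * indicator {0..T} s) \<in> borel_measurable borel"
begin

lemma step_fun_error:
  assumes "0 < s" "s \<le> T"
  shows "(\<lambda>n. step_fun (N n) (\<delta> n) (a n) s - h s) \<longlonglongrightarrow> 0"
proof -
  have "eventually (\<lambda>n. a n (gidx (\<delta> n) s) = step_fun (N n) (\<delta> n) (a n) s) sequentially"
    using N
  proof eventually_elim
    case (elim n)
    have "s \<le> real (N n) * \<delta> n" using elim assms by linarith
    then show ?case by (rule step_fun_gidx(1)[OF \<delta>(1) assms(1), symmetric])
  qed
  then have "(\<lambda>n. step_fun (N n) (\<delta> n) (a n) s) \<longlonglongrightarrow> h s"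
    by (rule Lim_transform_eventually[OF lim[OF assms]])
  from tendsto_diff[OF this tendsto_const, of "h s"] show ?thesis by simp
qed

lemma step_fun_error_bound:
  "eventually (\<lambda>n. \<forall>s. 0 < s \<and> s \<le> T \<longrightarrow> \<bar>step_fun (N n) (\<delta> n) (a n) s - h s\<bar> \<le> 2 * c) sequentially"
  using N bound
proof eventually_elim
  case (elim n)
  show ?case
  proof (intro allI impI)
    fix s assume s: "0 < s \<and> s \<le> T"
    then have "s \<le> real (N n) * \<delta> n" using elim by simp
    note g = step_fun_gidx[OF \<delta>(1)[of n] _ this]
    have "\<bar>a n (gidx (\<delta> n) s)\<bar> \<le> c" using elim(2) g(2) s gidx_bounds(1)[OF \<delta>(1)[of n], of s] by auto
    then show "\<bar>step_fun (N n) (\<delta> n) (a n) s - h s\<bar> \<le> 2 * c" using g(1)[of "a n"] h_bound[of s] s by auto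
  qed
qed

lemma step_fun_error_measurable: "(\<lambda>s. (step_fun (N n) (\<delta> n) (a n) s - h s) * indicator {0..T} s) \<in> borel_measurable borel"
proof -
  have "(\<lambda>s. (step_fun (N n) (\<delta> n) (a n) s - h s) * indicator {0..T} s)
     = (\<lambda>s. step_fun (N n) (\<delta> n) (a n) s * indicator {0..T} s - h s * indicator {0..T} s)"
    by (simp add: left_diff_distrib)
  then show ?thesis using h_meas by simp
qed

text \<open>The origin lies in no cell, so the step function is 0 there whatever \<open>h\<close>
  is; the estimates below leave out this null set.\<close>

lemma AE_pos: "AE s in lborel. s \<noteq> (0::real)"
  by (rule AE_lborel_singleton)

lemma step_fun_tendsto_L2:
  "(\<lambda>n. \<integral>\<^sup>+ s\<in>{0..T}. ennreal ((step_fun (N n) (\<delta> n) (a n) s - h s)\<^sup>2) \<partial>lborel) \<longlonglongrightarrow> 0"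
proof -
  obtain n0 where n0: "\<And>n s. n \<ge> n0 \<Longrightarrow> 0 < s \<Longrightarrow> s \<le> T \<Longrightarrow> \<bar>step_fun (N n) (\<delta> n) (a n) s - h s\<bar> \<le> 2 * c"
    using step_fun_error_bound unfolding eventually_sequentially by blast
  let ?u = "\<lambda>n s. ennreal (((step_fun (N n) (\<delta> n) (a n) s - h s) * indicator {0..T} s)\<^sup>2)"
  have "(\<lambda>n. \<integral>\<^sup>+ s. ?u (n + n0) s \<partial>lborel) \<longlonglongrightarrow> (\<integral>\<^sup>+ s. 0 \<partial>(lborel :: real measure))"
  proof (rule nn_integral_dominated_convergence[where w="\<lambda>s. ennreal ((2 * c)\<^sup>2) * indicator {0..T} s"])
    show "?u (n + n0) \<in> borel_measurable lborel" for n using step_fun_error_measurable[of "n + n0"] by measurable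
    show "AE s in lborel. ?u (n + n0) s \<le> ennreal ((2 * c)\<^sup>2) * indicator {0..T} s" for n
      using AE_pos
    proof eventually_elim
      case (elim s)
      show ?case
      proof (cases "s \<in> {0..T}")
        case True
        then have "\<bar>step_fun (N (n + n0)) (\<delta> (n + n0)) (a (n + n0)) s - h s\<bar> \<le> 2 * c" using n0[of "n + n0" s] elim by auto
        then have "\<bar>step_fun (N (n + n0)) (\<delta> (n + n0)) (a (n + n0)) s - h s\<bar>\<^sup>2 \<le> (2 * c)\<^sup>2" by (intro power_mono) auto
        then show ?thesis using True by (auto intro!: ennreal_leI)
      qed simp
    qed
    show "(\<integral>\<^sup>+ s. ennreal ((2 * c)\<^sup>2) * indicator {0..T} s \<partial>lborel) < \<infinity>"
      by (subst nn_integral_cmult_indicator) (auto simp: emeasure_lborel_Icc_eq ennreal_mult_less_top)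
    show "AE s in lborel. (\<lambda>n. ?u (n + n0) s) \<longlonglongrightarrow> 0"
      using AE_pos
    proof eventually_elim
      case (elim s)
      show ?case
      proof (cases "s \<in> {0..T}")
        case True
        then have "(\<lambda>n. ((step_fun (N n) (\<delta> n) (a n) s - h s) * indicator {0..T} s)\<^sup>2) \<longlonglongrightarrow> 0"
          using tendsto_power[OF step_fun_error[of s], of 2] elim by simp
        from tendsto_ennrealI[OF LIMSEQ_ignore_initial_segment[OF this, of n0]] show ?thesis by simp
      qed simp
    qed
  qed auto
  then have "(\<lambda>n. \<integral>\<^sup>+ s. ?u (n + n0) s \<partial>lborel) \<longlonglongrightarrow> 0" by simp
  from LIMSEQ_offset[OF this] have "(\<lambda>n. \<integral>\<^sup>+ s. ?u n s \<partial>lborel) \<longlonglongrightarrow> 0" .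
  moreover have "(\<integral>\<^sup>+ s. ?u n s \<partial>lborel) = (\<integral>\<^sup>+ s\<in>{0..T}. ennreal ((step_fun (N n) (\<delta> n) (a n) s - h s)\<^sup>2) \<partial>lborel)" for n
    by (rule nn_integral_cong) (auto simp: indicator_def)
  ultimately show ?thesis by simp
qed

lemma set_integrable_limit: "set_integrable lborel {0..T} h"
  unfolding set_integrable_def real_scaleR_def
proof (rule Bochner_Integration.integrable_bound[where f="\<lambda>s. c * indicator {0..T} s"])
  show "integrable lborel (\<lambda>s. c * indicator {0..T} s)"
    by (intro integrable_mult_right integrable_real_indicator) (auto simp: emeasure_lborel_Icc_eq)
  show "(\<lambda>s. indicator {0..T} s * h s) \<in> borel_measurable lborel" using h_meas by (simp add: mult.commute)
  show "AE s in lborel. norm (indicator {0..T} s * h s) \<le> norm (c * indicator {0..T} s)"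
    using AE_pos by eventually_elim (use h_bound in \<open>auto simp: indicator_def intro: order_trans[OF _ abs_ge_self]\<close>)
qed

lemma step_fun_tendsto_L1:
  "(\<lambda>n. LBINT s:{0..T}. \<bar>step_fun (N n) (\<delta> n) (a n) s - h s\<bar>) \<longlonglongrightarrow> 0"
proof -
  obtain n0 where n0: "\<And>n s. n \<ge> n0 \<Longrightarrow> 0 < s \<Longrightarrow> s \<le> T \<Longrightarrow> \<bar>step_fun (N n) (\<delta> n) (a n) s - h s\<bar> \<le> 2 * c"
    using step_fun_error_bound unfolding eventually_sequentially by blast
  let ?u = "\<lambda>n s. \<bar>(step_fun (N n) (\<delta> n) (a n) s - h s) * indicator {0..T} s\<bar>"
  have "(\<lambda>n. integral\<^sup>L lborel (?u (n + n0))) \<longlonglongrightarrow> integral\<^sup>L lborel (\<lambda>s :: real. 0 :: real)"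
  proof (rule integral_dominated_convergence[where w="\<lambda>s. 2 * c * indicator {0..T} s"])
    show "?u (n + n0) \<in> borel_measurable lborel" for n using step_fun_error_measurable[of "n + n0"] by measurable
    show "integrable lborel (\<lambda>s. 2 * c * indicator {0..T} s)"
      by (intro integrable_mult_right integrable_real_indicator) (auto simp: emeasure_lborel_Icc_eq)
    show "AE s in lborel. norm (?u (n + n0) s) \<le> 2 * c * indicator {0..T} s" for n
      using AE_pos by eventually_elim (use n0[of "n + n0"] in \<open>auto simp: indicator_def\<close>)
    show "AE s in lborel. (\<lambda>n. ?u (n + n0) s) \<longlonglongrightarrow> 0"
      using AE_pos
    proof eventually_elim
      case (elim s)
      show ?case
      proof (cases "s \<in> {0..T}")
        case True
        then have "(\<lambda>n. ?u n s) \<longlonglongrightarrow> 0"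
          using tendsto_rabs[OF step_fun_error[of s]] elim by simp
        from LIMSEQ_ignore_initial_segment[OF this, of n0] show ?thesis by simp
      qed simp
    qed
  qed auto
  then have "(\<lambda>n. integral\<^sup>L lborel (?u (n + n0))) \<longlonglongrightarrow> 0" by simp
  from LIMSEQ_offset[OF this] have "(\<lambda>n. integral\<^sup>L lborel (?u n)) \<longlonglongrightarrow> 0" .
  moreover have "integral\<^sup>L lborel (?u n) = (LBINT s:{0..T}. \<bar>step_fun (N n) (\<delta> n) (a n) s - h s\<bar>)" for n
    unfolding set_lebesgue_integral_def by (intro Bochner_Integration.integral_cong) (auto simp: indicator_def)
  ultimately show ?thesis by simp
qed

text \<open>Both sides of the difference are integrals over \<open>{0..real k * \<delta> n}\<close>;
  enlarging this interval to \<open>{0..T}\<close> makes the bound uniform in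
  \<open>k\<close>.\<close>

lemma riemann_sum_error:
  assumes T: "T = real (N n) * \<delta> n" and k: "k \<le> N n"
  shows "\<bar>(\<Sum>l<k. a n l * \<delta> n) - (LBINT s:{0..real k * \<delta> n}. h s)\<bar> \<le> (LBINT s:{0..T}. \<bar>step_fun (N n) (\<delta> n) (a n) s - h s\<bar>)"
proof -
  have sub: "{0..real k * \<delta> n} \<subseteq> {0..T}" using k \<delta>(1)[of n] by (auto simp: T intro: order_trans mult_right_mono)
  note sk = step_fun_integral[OF \<delta>(1)[of n] k, where a="a n"]
  have sT: "set_integrable lborel {0..T} (step_fun (N n) (\<delta> n) (a n))"
    unfolding T by (rule step_fun_integral(1)[OF \<delta>(1)]) simp
  have hk: "set_integrable lborel {0..real k * \<delta> n} h"
    by (rule set_integrable_subset[OF set_integrable_limit _ sub]) simp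
  have dT: "set_integrable lborel {0..T} (\<lambda>s. \<bar>step_fun (N n) (\<delta> n) (a n) s - h s\<bar>)"
    by (rule set_integrable_abs[OF set_integral_diff(1)[OF sT set_integrable_limit]])
  have "(\<Sum>l<k. a n l * \<delta> n) - (LBINT s:{0..real k * \<delta> n}. h s) = (LBINT s:{0..real k * \<delta> n}. step_fun (N n) (\<delta> n) (a n) s - h s)"
    using set_integral_diff(2)[OF sk(1) hk] sk(2) by simp
  also have "\<bar>\<dots>\<bar> \<le> (LBINT s:{0..real k * \<delta> n}. \<bar>step_fun (N n) (\<delta> n) (a n) s - h s\<bar>)"
    using set_integral_norm_bound[OF set_integral_diff(1)[OF sk(1) hk]] by simp
  also have "\<dots> \<le> (LBINT s:{0..T}. \<bar>step_fun (N n) (\<delta> n) (a n) s - h s\<bar>)"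
    unfolding set_lebesgue_integral_def
  proof (rule integral_mono)
    show "integrable lborel (\<lambda>s. indicator {0..real k * \<delta> n} s *\<^sub>R \<bar>step_fun (N n) (\<delta> n) (a n) s - h s\<bar>)"
      using set_integrable_subset[OF dT _ sub] by (simp add: set_integrable_def)
    show "integrable lborel (\<lambda>s. indicator {0..T} s *\<^sub>R \<bar>step_fun (N n) (\<delta> n) (a n) s - h s\<bar>)"
      using dT by (simp add: set_integrable_def)
  qed (use sub in \<open>auto simp: indicator_def\<close>)
  finally show ?thesis .
qed

end

text \<open>\<open>simple_data\<close> demands bounded coefficients, while values of the
  coefficients along a path are bounded only path by path. Truncating at a level that tends to
  infinity meets the demand without changing pathwise limits.\<close>

definition clip :: "real \<Rightarrow> real \<Rightarrow> real" where
  "clip c x = max (- c) (min c x)"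

lemma clip_eq: "\<bar>x\<bar> \<le> c \<Longrightarrow> clip c x = x"
  by (auto simp: clip_def)

lemma clip_bound: "0 \<le> c \<Longrightarrow> \<bar>clip c x\<bar> \<le> c"
  by (auto simp: clip_def)

lemma clip_le: "0 \<le> c \<Longrightarrow> \<bar>clip c x\<bar> \<le> \<bar>x\<bar>"
  by (auto simp: clip_def)

lemma clip_measurable [measurable]: "clip c \<in> borel_measurable borel"
  unfolding clip_def[abs_def] by measurable

lemma tendsto_clip:
  assumes "x \<longlonglongrightarrow> l" "filterlim c at_top sequentially"
  shows "(\<lambda>n. clip (c n) (x n)) \<longlonglongrightarrow> l"
proof -
  have "eventually (\<lambda>n. \<bar>x n\<bar> < \<bar>l\<bar> + 1) sequentially"
    using order_tendstoD(2)[OF tendsto_rabs[OF assms(1)]] by simp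
  moreover have "eventually (\<lambda>n. \<bar>l\<bar> + 1 \<le> c n) sequentially"
    using assms(2) by (auto simp: filterlim_at_top)
  ultimately have "eventually (\<lambda>n. x n = clip (c n) (x n)) sequentially"
    by eventually_elim (simp add: clip_eq)
  then show ?thesis by (rule Lim_transform_eventually[OF assms(1)])
qed

section \<open>Integrals of left-continuous processes\<close>

text \<open>Adapted, left-continuous at positive times and pathwise bounded on bounded intervals.
  Under these conditions the truncated left-endpoint step processes converge at every positive time
  for every \<omega>, not just almost surely.\<close>

definition regular_process :: "'w measure \<Rightarrow> (real \<Rightarrow> 'w measure) \<Rightarrow> (real \<Rightarrow> 'w \<Rightarrow> real) \<Rightarrow> bool" where
  "regular_process P F H \<longleftrightarrow> (\<forall>s\<ge>0. H s \<in> borel_measurable (F s)) \<and>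
     (\<forall>\<omega>\<in>space P. (\<forall>s>0. ((\<lambda>u. H u \<omega>) \<longlongrightarrow> H s \<omega>) (at_left s)) \<and>
        (\<forall>T. \<exists>c. \<forall>s\<in>{0..T}. \<bar>H s \<omega>\<bar> \<le> c))"

context brownian_space
begin

context
  fixes H :: "real \<Rightarrow> 'w \<Rightarrow> real" and N :: "nat \<Rightarrow> nat" and \<delta> :: "nat \<Rightarrow> real"
  assumes H: "regular_process P F H" and \<delta>: "\<And>n. 0 < \<delta> n" "\<delta> \<longlonglongrightarrow> 0"
begin

lemma regular_simple_data: "simple_data P F (N n) (\<lambda>k. real k * \<delta> n) (\<lambda>k \<omega>. clip (real n) (H (real k * \<delta> n) \<omega>))"
  unfolding simple_data_def
proof (intro conjI allI impI)
  fix k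
  show "real k * \<delta> n \<le> real (Suc k) * \<delta> n" using \<delta>(1)[of n] by (simp add: algebra_simps less_imp_le)
  have "H (real k * \<delta> n) \<in> borel_measurable (F (real k * \<delta> n))"
    using H \<delta>(1)[of n] by (auto simp: regular_process_def)
  then show "(\<lambda>\<omega>. clip (real n) (H (real k * \<delta> n) \<omega>)) \<in> borel_measurable (F (real k * \<delta> n))" by measurable
  show "\<exists>c. \<forall>\<omega>\<in>space P. \<bar>clip (real n) (H (real k * \<delta> n) \<omega>)\<bar> \<le> c" using clip_bound[of "real n"] by auto
qed simp

lemma regular_left_limit:
  assumes "\<omega> \<in> space P" "0 < s"
  shows "(\<lambda>n. clip (real n) (H (real (gidx (\<delta> n) s) * \<delta> n) \<omega>)) \<longlonglongrightarrow> H s \<omega>"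
  using H assms filterlim_compose[OF _ gidx_at_left[OF \<delta> assms(2)], of "\<lambda>u. H u \<omega>"]
  by (intro tendsto_clip filterlim_real_sequentially) (auto simp: regular_process_def)

end

text \<open>A pointwise limit of simple processes is progressive. They vanish at time 0, which
  belongs to no cell, so the initial value \<open>H 0\<close> is added separately.\<close>

lemma regular_progressive:
  assumes H: "regular_process P F H"
  shows "progressive F H"
  unfolding progressive_def
proof (intro allI impI)
  fix T :: real assume T: "0 \<le> T"
  let ?X = "restrict_space borel {0..T} \<Otimes>\<^sub>M F T"
  define \<delta> where "\<delta> n = 1 / real (Suc n)" for n
  \<comment> \<open>With mesh \<open>1 / real (Suc n)\<close> the grid reaches up to time
    \<open>Suc n\<close>, so every fixed time is eventually covered.\<close>
  define N where "N n = Suc n * Suc n" for n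
  have \<delta>: "\<And>n. 0 < \<delta> n" "\<delta> \<longlonglongrightarrow> 0" using mesh_tendsto_0 by (simp_all add: \<delta>_def[abs_def])
  let ?S = "\<lambda>n. simple_process (N n) (\<lambda>k. real k * \<delta> n) (\<lambda>k \<omega>. clip (real n) (H (real k * \<delta> n) \<omega>))"
  have [measurable]: "(\<lambda>x. ?S n (fst x) (snd x)) \<in> borel_measurable ?X" for n
    using progressive_simple[OF regular_simple_data[OF H \<delta>, of N n]] T by (auto simp: progressive_def case_prod_beta)
  have [measurable]: "H 0 \<in> borel_measurable (F T)"
    using H measurable_F_mono[OF _ T] by (auto simp: regular_process_def)
  have [measurable]: "fst \<in> borel_measurable ?X"
    by (rule measurable_compose[OF measurable_fst]) (rule measurable_restrict_space1, simp)
  show "(\<lambda>(s, \<omega>). H s \<omega>) \<in> borel_measurable ?X"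
    unfolding case_prod_beta
  proof (rule borel_measurable_LIMSEQ_metric)
    show "(\<lambda>x. H 0 (snd x) * indicator {0} (fst x) + ?S n (fst x) (snd x)) \<in> borel_measurable ?X" for n by measurable
    fix x assume "x \<in> space ?X"
    then obtain s \<omega> where x: "x = (s, \<omega>)" "0 \<le> s" "s \<le> T" "\<omega> \<in> space P"
      by (auto simp: space_pair_measure space_restrict_space)
    show "(\<lambda>n. H 0 (snd x) * indicator {0} (fst x) + ?S n (fst x) (snd x)) \<longlonglongrightarrow> H (fst x) (snd x)"
    proof (cases "s = 0")
      case True
      then have "?S n s \<omega> = 0" for n using \<delta>(1)[of n] by (auto simp: simple_process_def indicator_def mult_less_0_iff intro!: sum.neutral)
      then show ?thesis using True x by simp
    next
      case False
      then have s: "0 < s" using x by simp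
      obtain n0 where n0: "s < real n0" using reals_Archimedean2 by blast
      have "eventually (\<lambda>n. clip (real n) (H (real (gidx (\<delta> n) s) * \<delta> n) \<omega>) = ?S n s \<omega>) sequentially"
      proof (rule eventually_sequentiallyI)
        fix n assume "n0 \<le> n"
        moreover have "real (N n) * \<delta> n = real (Suc n)" by (simp add: N_def \<delta>_def del: of_nat_Suc mult_Suc mult_Suc_right)
        ultimately have "s \<le> real (N n) * \<delta> n" using n0 by simp
        from step_fun_gidx(1)[OF \<delta>(1) s this]
        show "clip (real n) (H (real (gidx (\<delta> n) s) * \<delta> n) \<omega>) = ?S n s \<omega>" by (simp add: simple_process_eq_step_fun)
      qed
      from Lim_transform_eventually[OF regular_left_limit[OF H \<delta> x(4) s] this]
      show ?thesis using False x by simp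
    qed
  qed
qed

lemma regular_path_measurable:
  assumes H: "regular_process P F H" and "\<omega> \<in> space P"
  shows "(\<lambda>s. H s \<omega> * indicator {0..T} s) \<in> borel_measurable borel"
proof (cases "0 \<le> T")
  case True
  have "(\<lambda>s. H s \<omega> * indicator {0..T} s) = (\<lambda>s. H (max 0 (min s T)) \<omega> * indicator {0..T} s)"
    by (auto simp: fun_eq_iff indicator_def)
  then show ?thesis using progressive_path[OF regular_progressive[OF H] True assms(2)] by simp
next
  case False
  then have "{0..T} = {}" by simp
  then show ?thesis by simp
qed

text \<open>The energy tends to 0 on every path by dominated convergence. The path's own bound
  dominates, since \<open>clip\<close> never increases absolute values.\<close>

lemma regular_energy_tendsto:
  assumes H: "regular_process P F H" and \<delta>: "\<And>n. 0 < \<delta> n" "\<delta> \<longlonglongrightarrow> 0"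
    and T: "0 \<le> T" and N: "eventually (\<lambda>n. T \<le> real (N n) * \<delta> n) sequentially" and \<epsilon>: "0 < \<epsilon>"
  shows "(\<lambda>n. prob {\<omega>\<in>space P. ennreal \<epsilon> < energy T (simple_process (N n) (\<lambda>k. real k * \<delta> n) (\<lambda>k \<omega>. clip (real n) (H (real k * \<delta> n) \<omega>))) H \<omega>}) \<longlonglongrightarrow> 0"
proof (rule prob_tendsto_0_of_AE)
  let ?S = "\<lambda>n. simple_process (N n) (\<lambda>k. real k * \<delta> n) (\<lambda>k \<omega>. clip (real n) (H (real k * \<delta> n) \<omega>))"
  show "{\<omega>\<in>space P. ennreal \<epsilon> < energy T (?S n) H \<omega>} \<in> events" for n
    using energy_measurable[OF progressive_simple[OF regular_simple_data[OF H \<delta>, of N n]] regular_progressive[OF H] T] by measurable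
  show "AE \<omega> in P. eventually (\<lambda>n. \<omega> \<notin> {\<omega>\<in>space P. ennreal \<epsilon> < energy T (?S n) H \<omega>}) sequentially"
  proof (rule AE_I2)
    fix \<omega> assume \<omega>: "\<omega> \<in> space P"
    obtain c where c: "\<And>s. s \<in> {0..T} \<Longrightarrow> \<bar>H s \<omega>\<bar> \<le> c" using H \<omega> unfolding regular_process_def by blast
    have "(\<lambda>n. \<integral>\<^sup>+ s\<in>{0..T}. ennreal ((step_fun (N n) (\<delta> n) (\<lambda>k. clip (real n) (H (real k * \<delta> n) \<omega>)) s - H s \<omega>)\<^sup>2) \<partial>lborel) \<longlonglongrightarrow> 0"
    proof (rule step_fun_tendsto_L2[OF \<delta> N, where c=c])
      show "(\<lambda>n. clip (real n) (H (real (gidx (\<delta> n) s) * \<delta> n) \<omega>)) \<longlonglongrightarrow> H s \<omega>" if "0 < s" for s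
        by (rule regular_left_limit[OF H \<delta> \<omega> that])
      show "eventually (\<lambda>n. \<forall>k<N n. real k * \<delta> n < T \<longrightarrow> \<bar>clip (real n) (H (real k * \<delta> n) \<omega>)\<bar> \<le> c) sequentially"
      proof (intro always_eventually allI impI)
        fix n k assume "real k * \<delta> n < T"
        then have "\<bar>H (real k * \<delta> n) \<omega>\<bar> \<le> c" using \<delta>(1)[of n] by (intro c) auto
        then show "\<bar>clip (real n) (H (real k * \<delta> n) \<omega>)\<bar> \<le> c" using clip_le[of "real n" "H (real k * \<delta> n) \<omega>"] by simp
      qed
    qed (use c regular_path_measurable[OF H \<omega>] in auto)
    then have "(\<lambda>n. energy T (?S n) H \<omega>) \<longlonglongrightarrow> 0" by (simp add: energy_def simple_process_eq_step_fun)
    then have "eventually (\<lambda>n. energy T (?S n) H \<omega> < ennreal \<epsilon>) sequentially"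
      using \<epsilon> by (intro order_tendstoD(2)) auto
    then show "eventually (\<lambda>n. \<omega> \<notin> {\<omega>\<in>space P. ennreal \<epsilon> < energy T (?S n) H \<omega>}) sequentially"
      by (rule eventually_mono) auto
  qed
qed

lemma regular_ito_integral_exists:
  assumes H: "regular_process P F H"
  shows "\<exists>I. has_ito_integral P F (\<lambda>t \<omega>. W t \<omega> $ \<alpha>) H I"
proof -
  define \<delta> where "\<delta> n = 1 / real (Suc n)" for n
  define N where "N n = Suc n * Suc n" for n
  have \<delta>: "\<And>n. 0 < \<delta> n" "\<delta> \<longlonglongrightarrow> 0" using mesh_tendsto_0 by (simp_all add: \<delta>_def[abs_def])
  have N: "eventually (\<lambda>n. T \<le> real (N n) * \<delta> n) sequentially" for T
  proof -
    obtain n0 where n0: "T < real n0" using reals_Archimedean2 by blast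
    have "real (N n) * \<delta> n = real (Suc n)" for n by (simp add: N_def \<delta>_def del: of_nat_Suc mult_Suc mult_Suc_right)
    then show ?thesis
      by (intro eventually_sequentiallyI[of n0]) (use n0 in simp)
  qed
  show ?thesis
  proof (rule ito_integral_exists[where N=N and t="\<lambda>n k. real k * \<delta> n" and \<xi>="\<lambda>n k \<omega>. clip (real n) (H (real k * \<delta> n) \<omega>)"])
    show "progressive F H" by (rule regular_progressive[OF H])
    show "simple_data P F (N n) (\<lambda>k. real k * \<delta> n) (\<lambda>k \<omega>. clip (real n) (H (real k * \<delta> n) \<omega>))" for n
      by (rule regular_simple_data[OF H \<delta>])
    show "(\<lambda>n. prob {\<omega>\<in>space P. ennreal \<epsilon> < energy T (simple_process (N n) (\<lambda>k. real k * \<delta> n)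
        (\<lambda>k \<omega>. clip (real n) (H (real k * \<delta> n) \<omega>))) H \<omega>}) \<longlonglongrightarrow> 0" if "0 \<le> T" "0 < \<epsilon>" for T \<epsilon>
      by (rule regular_energy_tendsto[OF H \<delta> that(1) N that(2)])
    show "AE \<omega> in P. \<forall>T\<ge>0. (\<integral>\<^sup>+ s\<in>{0..T}. ennreal ((H s \<omega>)\<^sup>2) \<partial>lborel) < \<infinity>"
    proof (intro AE_I2 allI impI)
      fix \<omega> and T :: real assume \<omega>: "\<omega> \<in> space P"
      obtain c where c: "\<And>s. s \<in> {0..T} \<Longrightarrow> \<bar>H s \<omega>\<bar> \<le> c" using H \<omega> unfolding regular_process_def by blast
      have "(\<integral>\<^sup>+ s\<in>{0..T}. ennreal ((H s \<omega>)\<^sup>2) \<partial>lborel) \<le> (\<integral>\<^sup>+ s. ennreal (c\<^sup>2) * indicator {0..T} s \<partial>lborel)"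
        by (rule nn_integral_mono)
          (use c in \<open>auto simp: indicator_def abs_le_square_iff[symmetric] intro!: ennreal_leI intro: order_trans[OF _ abs_ge_self]\<close>)
      also have "\<dots> < \<infinity>"
        by (subst nn_integral_cmult_indicator) (auto simp: emeasure_lborel_Icc_eq ennreal_mult_less_top)
      finally show "(\<integral>\<^sup>+ s\<in>{0..T}. ennreal ((H s \<omega>)\<^sup>2) \<partial>lborel) < \<infinity>" .
    qed
  qed
qed

end

section \<open>Pathwise convergence of the Euler scheme\<close>

text \<open>The situation for one fixed \<omega>: \<open>z\<close> is the stopped solution,
  \<open>b\<close> and \<open>H\<close> are its drift and diffusion coefficients as functions of
  time, \<open>J\<close> the Ito integrals, \<open>dw\<close> the Brownian increments and
  \<open>Z\<close> the scheme. The coefficients in \<open>Z_eq\<close> are evaluated along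
  \<open>z\<close>, not along \<open>Z\<close>. Probability enters only through
  \<open>martingale\<close> and \<open>quadratic\<close>.\<close>

locale euler_path =
  fixes M :: "(real^'n) set" and f :: "real^'n \<Rightarrow> real" and T c :: real and N :: "nat \<Rightarrow> nat" and \<delta> :: "nat \<Rightarrow> real"
    and z :: "real \<Rightarrow> real^'n" and b :: "'n \<Rightarrow> real \<Rightarrow> real" and H :: "'n \<Rightarrow> 'm::finite \<Rightarrow> real \<Rightarrow> real"
    and J :: "'n \<Rightarrow> 'm \<Rightarrow> real \<Rightarrow> real" and dw :: "nat \<Rightarrow> nat \<Rightarrow> 'm \<Rightarrow> real" and Z :: "nat \<Rightarrow> nat \<Rightarrow> real^'n"
  assumes M: "open M" and f: "smooth_on M f" and T: "0 < T"
    and \<delta>: "\<And>j. 0 < \<delta> j" "\<delta> \<longlonglongrightarrow> 0" and N: "\<And>j. real (N j) * \<delta> j = T"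
    and z: "continuous_on {0..T} z" "\<And>s. 0 \<le> s \<Longrightarrow> s \<le> T \<Longrightarrow> z s \<in> M"
    and z_eq: "\<And>s i. 0 \<le> s \<Longrightarrow> s \<le> T \<Longrightarrow> z s $ i = z 0 $ i + (LBINT u:{0..s}. b i u) + (\<Sum>\<alpha>\<in>UNIV. J i \<alpha> s)"
    and b: "\<And>i s. 0 < s \<Longrightarrow> s \<le> T \<Longrightarrow> (b i \<longlongrightarrow> b i s) (at_left s)" "\<And>i s. 0 \<le> s \<Longrightarrow> s \<le> T \<Longrightarrow> \<bar>b i s\<bar> \<le> c"
      "\<And>i. (\<lambda>s. b i s * indicator {0..T} s) \<in> borel_measurable borel"
    and H: "\<And>i \<alpha> s. 0 < s \<Longrightarrow> s \<le> T \<Longrightarrow> (H i \<alpha> \<longlongrightarrow> H i \<alpha> s) (at_left s)" "\<And>i \<alpha> s. 0 \<le> s \<Longrightarrow> s \<le> T \<Longrightarrow> \<bar>H i \<alpha> s\<bar> \<le> c"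
      "\<And>i \<alpha>. (\<lambda>s. H i \<alpha> s * indicator {0..T} s) \<in> borel_measurable borel"
    and Z_eq: "\<And>j k i. k \<le> N j \<Longrightarrow> Z j k $ i = z 0 $ i + (\<Sum>l<k. b i (real l * \<delta> j) * \<delta> j + (\<Sum>\<alpha>\<in>UNIV. H i \<alpha> (real l * \<delta> j) * dw j l \<alpha>))"
    and martingale: "\<And>i \<alpha>. (\<lambda>j. Max ((\<lambda>k. \<bar>(\<Sum>l<k. H i \<alpha> (real l * \<delta> j) * dw j l \<alpha>) - J i \<alpha> (real k * \<delta> j)\<bar>) ` {..N j})) \<longlonglongrightarrow> 0"
    and quadratic: "\<And>\<alpha>. (\<lambda>j. \<Sum>k<N j. (dw j k \<alpha>)\<^sup>2) \<longlonglongrightarrow> T"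
begin

text \<open>Grid values whose step functions converge boundedly to \<open>h\<close>. The notion is
  stable under sums, products and continuous functions of the scheme, and implies convergence of
  Riemann sums; so the limit of each compound expression can be read off termwise.\<close>

definition limit_of :: "(nat \<Rightarrow> nat \<Rightarrow> real) \<Rightarrow> (real \<Rightarrow> real) \<Rightarrow> bool" where
  "limit_of a h \<longleftrightarrow> (\<forall>s. 0 < s \<and> s \<le> T \<longrightarrow> (\<lambda>j. a j (gidx (\<delta> j) s)) \<longlonglongrightarrow> h s) \<and>
    (\<exists>C. eventually (\<lambda>j. \<forall>k<N j. \<bar>a j k\<bar> \<le> C) sequentially) \<and> (\<exists>C. \<forall>s\<in>{0..T}. \<bar>h s\<bar> \<le> C) \<and>
    (\<lambda>s. h s * indicator {0..T} s) \<in> borel_measurable borel"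

lemma limit_ofE:
  assumes "limit_of a h"
  obtains C K where "eventually (\<lambda>j. \<forall>k<N j. \<bar>a j k\<bar> \<le> C) sequentially" "\<And>s. s \<in> {0..T} \<Longrightarrow> \<bar>h s\<bar> \<le> K"
proof -
  have "\<exists>C. eventually (\<lambda>j. \<forall>k<N j. \<bar>a j k\<bar> \<le> C) sequentially" "\<exists>K. \<forall>s\<in>{0..T}. \<bar>h s\<bar> \<le> K"
    using assms by (simp_all only: limit_of_def)
  then show ?thesis using that by (elim exE) blast
qed

lemma c_nonneg: "0 \<le> c"
  using b(2)[of 0 undefined] T by (auto intro: order_trans[OF abs_ge_zero])

lemma grid_le: "k \<le> N j \<Longrightarrow> 0 \<le> real k * \<delta> j \<and> real k * \<delta> j \<le> T"
  using \<delta>(1)[of j] unfolding N[of j, symmetric] by (auto intro!: mult_right_mono mult_nonneg_nonneg less_imp_le)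

lemma N_eventually: "eventually (\<lambda>j. T \<le> real (N j) * \<delta> j) sequentially"
  by (simp add: N)

lemma limit_of_riemann:
  assumes "limit_of a h"
  shows "set_integrable lborel {0..T} h"
    "\<exists>err. err \<longlonglongrightarrow> 0 \<and> (\<forall>j. \<forall>k\<le>N j. \<bar>(\<Sum>l<k. a j l * \<delta> j) - (LBINT s:{0..real k * \<delta> j}. h s)\<bar> \<le> err j)"
    "(\<lambda>j. \<Sum>k<N j. a j k * \<delta> j) \<longlonglongrightarrow> (LBINT s:{0..T}. h s)"
proof -
  obtain C1 C2 where C: "eventually (\<lambda>j. \<forall>k<N j. \<bar>a j k\<bar> \<le> C1) sequentially" "\<And>s. s \<in> {0..T} \<Longrightarrow> \<bar>h s\<bar> \<le> C2"
    by (rule limit_ofE[OF assms]) blast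
  define C where "C = max C1 C2"
  have lim: "\<And>s. 0 < s \<Longrightarrow> s \<le> T \<Longrightarrow> (\<lambda>j. a j (gidx (\<delta> j) s)) \<longlonglongrightarrow> h s"
    and hm: "(\<lambda>s. h s * indicator {0..T} s) \<in> borel_measurable borel"
    using assms by (auto simp: limit_of_def)
  have bd: "eventually (\<lambda>j. \<forall>k<N j. real k * \<delta> j < T \<longrightarrow> \<bar>a j k\<bar> \<le> C) sequentially"
    using C(1) by eventually_elim (auto simp: C_def)
  have hb: "\<bar>h s\<bar> \<le> C" if "0 < s" "s \<le> T" for s using C(2)[of s] that by (auto simp: C_def)
  note ctx = \<delta> N_eventually lim bd hb hm
  show "set_integrable lborel {0..T} h" by (rule set_integrable_limit[OF ctx])
  define err where "err j = (LBINT s:{0..T}. \<bar>step_fun (N j) (\<delta> j) (a j) s - h s\<bar>)" for j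
  have e0: "err \<longlonglongrightarrow> 0" unfolding err_def[abs_def] by (rule step_fun_tendsto_L1[OF ctx])
  have e: "\<bar>(\<Sum>l<k. a j l * \<delta> j) - (LBINT s:{0..real k * \<delta> j}. h s)\<bar> \<le> err j" if "k \<le> N j" for j k
    unfolding err_def by (rule riemann_sum_error[OF ctx N[symmetric] that])
  show "\<exists>err. err \<longlonglongrightarrow> 0 \<and> (\<forall>j. \<forall>k\<le>N j. \<bar>(\<Sum>l<k. a j l * \<delta> j) - (LBINT s:{0..real k * \<delta> j}. h s)\<bar> \<le> err j)"
    using e0 e by blast
  have "(\<lambda>j. (\<Sum>k<N j. a j k * \<delta> j) - (LBINT s:{0..T}. h s)) \<longlonglongrightarrow> 0"
    by (rule Lim_null_comparison[OF _ e0]) (use e[OF order_refl] N in simp)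
  then show "(\<lambda>j. \<Sum>k<N j. a j k * \<delta> j) \<longlonglongrightarrow> (LBINT s:{0..T}. h s)" by (simp add: LIM_zero_iff)
qed

lemma limit_of_mult:
  assumes "limit_of a h" "limit_of a' h'"
  shows "limit_of (\<lambda>j k. a j k * a' j k) (\<lambda>s. h s * h' s)"
proof -
  obtain C K where C1: "eventually (\<lambda>j. \<forall>k<N j. \<bar>a j k\<bar> \<le> C) sequentially" "\<And>s. s \<in> {0..T} \<Longrightarrow> \<bar>h s\<bar> \<le> K"
    by (rule limit_ofE[OF assms(1)]) blast
  obtain C' K' where C2: "eventually (\<lambda>j. \<forall>k<N j. \<bar>a' j k\<bar> \<le> C') sequentially" "\<And>s. s \<in> {0..T} \<Longrightarrow> \<bar>h' s\<bar> \<le> K'"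
    by (rule limit_ofE[OF assms(2)]) blast
  note C = C1(1) C2(1) C1(2) C2(2)
  have pr: "\<bar>x * y\<bar> \<le> \<bar>p\<bar> * \<bar>q\<bar>" if "\<bar>x\<bar> \<le> p" "\<bar>y\<bar> \<le> q" for x y p q :: real
    unfolding abs_mult using that by (intro mult_mono) auto
  have "eventually (\<lambda>j. \<forall>k<N j. \<bar>a j k * a' j k\<bar> \<le> \<bar>C\<bar> * \<bar>C'\<bar>) sequentially"
    using C(1,2) by eventually_elim (auto intro: pr)
  moreover have "\<forall>s\<in>{0..T}. \<bar>h s * h' s\<bar> \<le> \<bar>K\<bar> * \<bar>K'\<bar>" using C(3,4) by (auto intro: pr)
  moreover have "(\<lambda>s. h s * h' s * indicator {0..T} s) = (\<lambda>s. (h s * indicator {0..T} s) * (h' s * indicator {0..T} s))"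
    by (auto simp: indicator_def fun_eq_iff)
  ultimately show ?thesis
    using assms unfolding limit_of_def by (auto intro: tendsto_mult)
qed

lemma limit_of_sum:
  assumes "finite I" "\<And>i. i \<in> I \<Longrightarrow> limit_of (a i) (h i)"
  shows "limit_of (\<lambda>j k. \<Sum>i\<in>I. a i j k) (\<lambda>s. \<Sum>i\<in>I. h i s)"
  using assms
proof (induction I)
  case empty
  show ?case by (auto simp: limit_of_def)
next
  case (insert x I)
  have 1: "limit_of (a x) (h x)" and 2: "limit_of (\<lambda>j k. \<Sum>i\<in>I. a i j k) (\<lambda>s. \<Sum>i\<in>I. h i s)" using insert by auto
  have "limit_of (\<lambda>j k. a x j k + (\<Sum>i\<in>I. a i j k)) (\<lambda>s. h x s + (\<Sum>i\<in>I. h i s))"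
  proof -
    obtain C K where C1: "eventually (\<lambda>j. \<forall>k<N j. \<bar>a x j k\<bar> \<le> C) sequentially" "\<And>s. s \<in> {0..T} \<Longrightarrow> \<bar>h x s\<bar> \<le> K"
      by (rule limit_ofE[OF 1]) blast
    obtain C' K' where C2: "eventually (\<lambda>j. \<forall>k<N j. \<bar>\<Sum>i\<in>I. a i j k\<bar> \<le> C') sequentially" "\<And>s. s \<in> {0..T} \<Longrightarrow> \<bar>\<Sum>i\<in>I. h i s\<bar> \<le> K'"
      by (rule limit_ofE[OF 2]) blast
    note C = C1(1) C2(1) C1(2) C2(2)
    have "eventually (\<lambda>j. \<forall>k<N j. \<bar>a x j k + (\<Sum>i\<in>I. a i j k)\<bar> \<le> C + C') sequentially"
      using C(1,2) by eventually_elim (auto intro: order_trans[OF abs_triangle_ineq add_mono])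
    moreover have "\<forall>s\<in>{0..T}. \<bar>h x s + (\<Sum>i\<in>I. h i s)\<bar> \<le> K + K'"
      using C(3,4) by (auto intro: order_trans[OF abs_triangle_ineq add_mono])
    moreover have "(\<lambda>s. (h x s + (\<Sum>i\<in>I. h i s)) * indicator {0..T} s) \<in> borel_measurable borel"
      unfolding distrib_right using 1 2 by (intro borel_measurable_add) (auto simp: limit_of_def)
    ultimately show ?thesis
      using 1 2 unfolding limit_of_def by (auto intro: tendsto_add)
  qed
  then show ?case using insert by simp
qed

lemma limit_of_grid:
  assumes "\<And>s. 0 < s \<Longrightarrow> s \<le> T \<Longrightarrow> (h \<longlongrightarrow> h s) (at_left s)" "\<And>s. 0 \<le> s \<Longrightarrow> s \<le> T \<Longrightarrow> \<bar>h s\<bar> \<le> C"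
    "(\<lambda>s. h s * indicator {0..T} s) \<in> borel_measurable borel"
  shows "limit_of (\<lambda>j k. h (real k * \<delta> j)) h"
  unfolding limit_of_def
proof (intro conjI allI impI assms(3))
  show "(\<lambda>j. h (real (gidx (\<delta> j) s) * \<delta> j)) \<longlonglongrightarrow> h s" if "0 < s \<and> s \<le> T" for s
    using that by (intro filterlim_compose[OF assms(1) gidx_at_left[OF \<delta>]]) auto
  show "\<exists>C. eventually (\<lambda>j. \<forall>k<N j. \<bar>h (real k * \<delta> j)\<bar> \<le> C) sequentially"
    using assms(2) grid_le by (intro exI[of _ C] always_eventually) (auto simp: less_imp_le)
  show "\<exists>C. \<forall>s\<in>{0..T}. \<bar>h s\<bar> \<le> C" using assms(2) by (intro exI[of _ C]) auto
qed

lemma limit_of_b: "limit_of (\<lambda>j k. b i (real k * \<delta> j)) (b i)"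
  by (rule limit_of_grid[OF b])

lemma limit_of_H: "limit_of (\<lambda>j k. H i \<alpha> (real k * \<delta> j)) (H i \<alpha>)"
  by (rule limit_of_grid[OF H])

text \<open>The equation for \<open>z\<close> and the one for \<open>Z\<close> involve the same
  coefficients, so their difference is a Riemann sum error plus the error in
  \<open>martingale\<close>, both uniform in the grid index.\<close>

lemma Z_close: "\<exists>err. err \<longlonglongrightarrow> 0 \<and> (\<forall>j. \<forall>k\<le>N j. norm (Z j k - z (real k * \<delta> j)) \<le> err j)"
proof -
  obtain eb where eb: "\<And>i. eb i \<longlonglongrightarrow> 0"
    "\<And>i j k. k \<le> N j \<Longrightarrow> \<bar>(\<Sum>l<k. b i (real l * \<delta> j) * \<delta> j) - (LBINT s:{0..real k * \<delta> j}. b i s)\<bar> \<le> eb i j"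
    using limit_of_riemann(2)[OF limit_of_b] by metis
  define eJ where "eJ i \<alpha> j = Max ((\<lambda>k. \<bar>(\<Sum>l<k. H i \<alpha> (real l * \<delta> j) * dw j l \<alpha>) - J i \<alpha> (real k * \<delta> j)\<bar>) ` {..N j})" for i \<alpha> j
  have eJ: "\<bar>(\<Sum>l<k. H i \<alpha> (real l * \<delta> j) * dw j l \<alpha>) - J i \<alpha> (real k * \<delta> j)\<bar> \<le> eJ i \<alpha> j" if "k \<le> N j" for i \<alpha> j k
    unfolding eJ_def using that by (intro Max_ge) auto
  define err where "err j = (\<Sum>i\<in>UNIV. eb i j + (\<Sum>\<alpha>\<in>UNIV. eJ i \<alpha> j))" for j
  have "err \<longlonglongrightarrow> (\<Sum>i\<in>(UNIV :: 'n set). 0 + (\<Sum>\<alpha>\<in>(UNIV :: 'm set). 0))"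
    unfolding err_def[abs_def] using eb(1) martingale by (intro tendsto_sum tendsto_add) (auto simp: eJ_def[abs_def])
  then have "err \<longlonglongrightarrow> 0" by simp
  moreover have "norm (Z j k - z (real k * \<delta> j)) \<le> err j" if k: "k \<le> N j" for j k
  proof -
    have "\<bar>(Z j k - z (real k * \<delta> j)) $ i\<bar> \<le> eb i j + (\<Sum>\<alpha>\<in>UNIV. eJ i \<alpha> j)" for i
    proof -
      have "(Z j k - z (real k * \<delta> j)) $ i = ((\<Sum>l<k. b i (real l * \<delta> j) * \<delta> j) - (LBINT s:{0..real k * \<delta> j}. b i s))
        + (\<Sum>\<alpha>\<in>UNIV. (\<Sum>l<k. H i \<alpha> (real l * \<delta> j) * dw j l \<alpha>) - J i \<alpha> (real k * \<delta> j))"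
        using grid_le[OF k] z_eq[of "real k * \<delta> j" i] Z_eq[OF k, of i] sum.swap[of "\<lambda>l \<alpha>. H i \<alpha> (real l * \<delta> j) * dw j l \<alpha>" UNIV "{..<k}"]
        by (simp add: sum.distrib sum_subtractf)
      also have "\<bar>\<dots>\<bar> \<le> eb i j + (\<Sum>\<alpha>\<in>UNIV. eJ i \<alpha> j)"
        by (intro order_trans[OF abs_triangle_ineq] add_mono eb(2) k order_trans[OF sum_abs] sum_mono eJ)
      finally show ?thesis .
    qed
    then show ?thesis unfolding err_def
      by (intro order_trans[OF norm_le_l1_cart] sum_mono)
  qed
  ultimately show ?thesis by blast
qed

definition tube :: "real \<Rightarrow> (real^'n) set" where
  "tube \<rho> = (\<Union>x\<in>z ` {0..T}. cball x \<rho>)"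

lemma compact_tube: "compact (tube \<rho>)"
  unfolding tube_def by (intro compact_minkowski_sum_cball compact_continuous_image z(1) compact_Icc)

lemma tube_subset: "\<exists>\<rho>>0. tube \<rho> \<subseteq> M"
proof -
  have "compact (z ` {0..T})" by (intro compact_continuous_image z(1) compact_Icc)
  moreover have "z ` {0..T} \<subseteq> M" using z(2) by auto
  ultimately show ?thesis using compact_subset_open_imp_cball_epsilon_subset[OF _ M] unfolding tube_def by metis
qed

lemma Z_eventually_in_tube:
  assumes "0 < \<rho>"
  shows "eventually (\<lambda>j. \<forall>k\<le>N j. Z j k \<in> tube \<rho>) sequentially"
proof -
  obtain err where err: "err \<longlonglongrightarrow> 0" "\<And>j k. k \<le> N j \<Longrightarrow> norm (Z j k - z (real k * \<delta> j)) \<le> err j"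
    using Z_close by blast
  have "eventually (\<lambda>j. err j < \<rho>) sequentially" by (rule order_tendstoD(2)[OF err(1) assms])
  then show ?thesis
  proof eventually_elim
    case (elim j)
    show ?case
    proof (intro allI impI)
      fix k assume k: "k \<le> N j"
      then have "dist (z (real k * \<delta> j)) (Z j k) \<le> \<rho>"
        using err(2)[OF k] elim by (simp add: dist_norm norm_minus_commute)
      then show "Z j k \<in> tube \<rho>" using grid_le[OF k] by (auto simp: tube_def)
    qed
  qed
qed

lemma Z_eventually_in_M: "eventually (\<lambda>j. \<forall>k\<le>N j. Z j k \<in> M) sequentially"
proof -
  obtain \<rho> where "0 < \<rho>" "tube \<rho> \<subseteq> M" using tube_subset by blast
  with Z_eventually_in_tube[of \<rho>] show ?thesis by (auto elim!: eventually_mono)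
qed

lemma limit_of_Z:
  assumes g: "continuous_on M g"
  shows "limit_of (\<lambda>j k. g (Z j k)) (\<lambda>s. g (z s))"
  unfolding limit_of_def
proof (intro conjI allI impI)
  obtain err where err: "err \<longlonglongrightarrow> 0" "\<And>j k. k \<le> N j \<Longrightarrow> norm (Z j k - z (real k * \<delta> j)) \<le> err j"
    using Z_close by blast
  obtain \<rho> where \<rho>: "0 < \<rho>" "tube \<rho> \<subseteq> M" using tube_subset by blast
  have "compact (g ` tube \<rho>)" by (intro compact_continuous_image continuous_on_subset[OF g \<rho>(2)] compact_tube)
  then obtain C where C: "\<And>x. x \<in> tube \<rho> \<Longrightarrow> \<bar>g x\<bar> \<le> C"
    using compact_imp_bounded by (force simp: bounded_real)
  show "\<exists>C. eventually (\<lambda>j. \<forall>k<N j. \<bar>g (Z j k)\<bar> \<le> C) sequentially"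
    using Z_eventually_in_tube[OF \<rho>(1)] C by (intro exI[of _ C]) (auto elim!: eventually_mono)
  have "z s \<in> tube \<rho>" if "s \<in> {0..T}" for s using that \<rho>(1) by (auto simp: tube_def intro!: bexI[of _ s])
  then show "\<exists>C. \<forall>s\<in>{0..T}. \<bar>g (z s)\<bar> \<le> C" using C by blast
  have "continuous_on {0..T} (\<lambda>s. g (z s))"
    by (rule continuous_on_compose2[OF g z(1)]) (use z(2) in auto)
  from borel_measurable_continuous_on_indicator[OF _ this]
  show "(\<lambda>s. g (z s) * indicator {0..T} s) \<in> borel_measurable borel" by (simp add: mult.commute)
  fix s assume s: "0 < s \<and> s \<le> T"
  let ?k = "\<lambda>j. gidx (\<delta> j) s"
  have k: "?k j < N j" for j
    using step_fun_gidx(2)[OF \<delta>(1), of s "N j" j] s N[of j] by simp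
  have "filterlim (\<lambda>j. real (?k j) * \<delta> j) (at_left s) sequentially" by (rule gidx_at_left[OF \<delta>]) (use s in simp)
  then have lim: "(\<lambda>j. real (?k j) * \<delta> j) \<longlonglongrightarrow> s" by (simp add: filterlim_at)
  have "(\<lambda>j. z (real (?k j) * \<delta> j)) \<longlonglongrightarrow> z s"
    by (rule continuous_on_tendsto_compose[OF z(1) lim]) (use s grid_le k in \<open>auto simp: less_imp_le\<close>)
  moreover have "(\<lambda>j. Z j (?k j) - z (real (?k j) * \<delta> j)) \<longlonglongrightarrow> 0"
    by (rule Lim_null_comparison[OF _ err(1)]) (use err(2) k in \<open>auto simp: less_imp_le\<close>)
  ultimately have "(\<lambda>j. Z j (?k j)) \<longlonglongrightarrow> z s" using tendsto_add by fastforce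
  moreover have "isCont g (z s)" using g M z(2)[of s] s by (auto simp: continuous_on_eq_continuous_at)
  ultimately show "(\<lambda>j. g (Z j (?k j))) \<longlonglongrightarrow> g (z s)" by (rule isCont_tendsto_compose[rotated])
qed

section \<open>Second-order expansion along the scheme\<close>

definition step :: "nat \<Rightarrow> nat \<Rightarrow> real^'n" where
  "step j k = Z j (Suc k) - Z j k"

definition mart :: "nat \<Rightarrow> nat \<Rightarrow> 'n \<Rightarrow> real" where
  "mart j k i = (\<Sum>\<alpha>\<in>UNIV. H i \<alpha> (real k * \<delta> j) * dw j k \<alpha>)"

text \<open>Up to the factor \<open>c\<close> this dominates every component of a step and of its
  martingale part, and by \<open>quadratic\<close> its squares have bounded sums.\<close>

definition size :: "nat \<Rightarrow> nat \<Rightarrow> real" where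
  "size j k = \<delta> j + (\<Sum>\<alpha>\<in>UNIV. \<bar>dw j k \<alpha>\<bar>)"

lemma step_nth: "k < N j \<Longrightarrow> step j k $ i = b i (real k * \<delta> j) * \<delta> j + mart j k i"
  by (simp add: step_def mart_def Z_eq)

lemma size_nonneg: "0 \<le> size j k"
  using \<delta>(1)[of j] by (auto simp: size_def intro!: add_nonneg_nonneg sum_nonneg less_imp_le)

lemma mart_bound: "k < N j \<Longrightarrow> \<bar>mart j k i\<bar> \<le> c * size j k"
proof -
  assume k: "k < N j"
  have "\<bar>mart j k i\<bar> \<le> (\<Sum>\<alpha>\<in>UNIV. c * \<bar>dw j k \<alpha>\<bar>)"
    unfolding mart_def using H(2) grid_le[of k j] k
    by (intro order_trans[OF sum_abs] sum_mono) (auto simp: abs_mult intro!: mult_right_mono)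
  also have "\<dots> \<le> c * size j k"
    unfolding size_def sum_distrib_left[symmetric] using c_nonneg \<delta>(1)[of j] by (intro mult_left_mono) auto
  finally show ?thesis .
qed

lemma step_bound: "k < N j \<Longrightarrow> \<bar>step j k $ i\<bar> \<le> c * size j k"
proof -
  assume k: "k < N j"
  have "\<bar>step j k $ i\<bar> \<le> \<bar>b i (real k * \<delta> j) * \<delta> j\<bar> + (\<Sum>\<alpha>\<in>UNIV. c * \<bar>dw j k \<alpha>\<bar>)"
    unfolding step_nth[OF k] mart_def using H(2) grid_le[of k j] k
    by (intro order_trans[OF abs_triangle_ineq] add_left_mono order_trans[OF sum_abs] sum_mono)
      (auto simp: abs_mult intro!: mult_right_mono)
  also have "\<bar>b i (real k * \<delta> j) * \<delta> j\<bar> \<le> c * \<delta> j"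
    using b(2)[of "real k * \<delta> j" i] grid_le[of k j] k \<delta>(1)[of j] by (auto simp: abs_mult intro!: mult_right_mono)
  finally show ?thesis by (simp add: size_def distrib_left sum_distrib_left)
qed

text \<open>Single Brownian increments are not estimated; smallness is inherited from uniform
  continuity of \<open>z\<close>, one third of \<rho> going to its increment and one third to the
  distance from the scheme at each end of the step.\<close>

lemma steps_small:
  assumes "0 < \<rho>"
  shows "eventually (\<lambda>j. \<forall>k<N j. norm (step j k) \<le> \<rho>) sequentially"
proof -
  obtain err where err: "err \<longlonglongrightarrow> 0" "\<And>j k. k \<le> N j \<Longrightarrow> norm (Z j k - z (real k * \<delta> j)) \<le> err j"
    using Z_close by blast
  have "uniformly_continuous_on {0..T} z" by (intro compact_uniformly_continuous z(1) compact_Icc)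
  then obtain \<eta> where \<eta>: "0 < \<eta>" "\<And>s t. s \<in> {0..T} \<Longrightarrow> t \<in> {0..T} \<Longrightarrow> dist t s < \<eta> \<Longrightarrow> dist (z t) (z s) < \<rho>/3"
    using assms unfolding uniformly_continuous_on_def by (metis divide_pos_pos zero_less_numeral)
  have "eventually (\<lambda>j. err j < \<rho>/3) sequentially" "eventually (\<lambda>j. \<delta> j < \<eta>) sequentially"
    using order_tendstoD(2)[OF err(1), of "\<rho>/3"] order_tendstoD(2)[OF \<delta>(2) \<eta>(1)] assms by auto
  then show ?thesis
  proof eventually_elim
    case (elim j)
    show ?case
    proof (intro allI impI)
      fix k assume k: "k < N j"
      let ?s = "real k * \<delta> j" and ?t = "real (Suc k) * \<delta> j"
      have "dist ?t ?s < \<eta>" using elim(2) \<delta>(1)[of j] by (simp add: dist_real_def algebra_simps)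
      moreover have "?s \<in> {0..T}" "?t \<in> {0..T}" using grid_le[of k j] grid_le[of "Suc k" j] k by auto
      ultimately have d: "dist (z ?t) (z ?s) < \<rho>/3" using \<eta>(2) by blast
      have e: "norm (Z j (Suc k) - z ?t) \<le> \<rho>/3" "norm (Z j k - z ?s) \<le> \<rho>/3"
        using err(2)[of "Suc k" j] err(2)[of k j] k elim(1) by auto
      have "norm (step j k) = norm ((Z j (Suc k) - z ?t) + (z ?t - z ?s) - (Z j k - z ?s))" by (simp add: step_def)
      also have "\<dots> \<le> norm (Z j (Suc k) - z ?t) + norm (z ?t - z ?s) + norm (Z j k - z ?s)"
        by (intro order_trans[OF norm_triangle_ineq4] add_right_mono norm_triangle_ineq)
      also have "\<dots> \<le> \<rho>" using d e by (simp add: dist_norm)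
      finally show "norm (step j k) \<le> \<rho>" .
    qed
  qed
qed

lemma size_sum_bounded: "\<exists>B. eventually (\<lambda>j. (\<Sum>k<N j. (size j k)\<^sup>2) \<le> B) sequentially"
proof -
  define m where "m = real CARD('m)"
  \<comment> \<open>Bounds the sum of squared sizes; \<open>real (N j) * \<delta> j = T\<close>
    turns the sum of squared mesh widths into \<open>T * \<delta> j\<close>, and Cauchy-Schwarz over
    the components produces the factor \<open>m\<close>.\<close>
  define R where "R j = 2 * T * \<delta> j + 2 * m * (\<Sum>\<alpha>\<in>UNIV. \<Sum>k<N j. (dw j k \<alpha>)\<^sup>2)" for j
  have "R \<longlonglongrightarrow> 2 * T * 0 + 2 * m * (\<Sum>\<alpha>\<in>(UNIV :: 'm set). T)"
    unfolding R_def[abs_def] by (intro tendsto_intros \<delta>(2) quadratic)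
  then have ev: "eventually (\<lambda>j. R j < 2 * T * 0 + 2 * m * (\<Sum>\<alpha>\<in>(UNIV :: 'm set). T) + 1) sequentially"
    by (rule order_tendstoD(2)) simp
  have "(size j k)\<^sup>2 \<le> 2 * (\<delta> j)\<^sup>2 + 2 * (m * (\<Sum>\<alpha>\<in>UNIV. (dw j k \<alpha>)\<^sup>2))" for j k
  proof -
    have "(x + y)\<^sup>2 \<le> 2 * x\<^sup>2 + 2 * y\<^sup>2" for x y :: real
      using sum_squares_bound[of x y] by (simp add: power2_sum)
    then have "(size j k)\<^sup>2 \<le> 2 * (\<delta> j)\<^sup>2 + 2 * (\<Sum>\<alpha>\<in>UNIV. \<bar>dw j k \<alpha>\<bar>)\<^sup>2" unfolding size_def .
    moreover have "(\<Sum>\<alpha>\<in>UNIV. \<bar>dw j k \<alpha>\<bar>)\<^sup>2 \<le> m * (\<Sum>\<alpha>\<in>UNIV. (dw j k \<alpha>)\<^sup>2)"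
      using Cauchy_Schwarz_ineq_sum[of "\<lambda>_. 1" "\<lambda>\<alpha>. \<bar>dw j k \<alpha>\<bar>" UNIV] by (simp add: m_def)
    ultimately show ?thesis by linarith
  qed
  then have "(\<Sum>k<N j. (size j k)\<^sup>2) \<le> (\<Sum>k<N j. 2 * (\<delta> j)\<^sup>2 + 2 * (m * (\<Sum>\<alpha>\<in>UNIV. (dw j k \<alpha>)\<^sup>2)))" for j
    by (rule sum_mono)
  also have "(\<Sum>k<N j. 2 * (\<delta> j)\<^sup>2 + 2 * (m * (\<Sum>\<alpha>\<in>UNIV. (dw j k \<alpha>)\<^sup>2))) = R j" for j
  proof -
    have "(\<Sum>k<N j. 2 * (\<delta> j)\<^sup>2) = 2 * (real (N j) * \<delta> j) * \<delta> j" by (simp add: power2_eq_square)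
    moreover have "(\<Sum>k<N j. 2 * (m * (\<Sum>\<alpha>\<in>UNIV. (dw j k \<alpha>)\<^sup>2))) = 2 * m * (\<Sum>\<alpha>\<in>UNIV. \<Sum>k<N j. (dw j k \<alpha>)\<^sup>2)"
      by (simp add: sum_distrib_left[symmetric] sum.swap[of _ UNIV])
    ultimately show ?thesis by (simp add: R_def N sum.distrib)
  qed
  finally have le: "(\<Sum>k<N j. (size j k)\<^sup>2) \<le> R j" for j .
  show ?thesis
    by (rule exI, rule eventually_mono[OF ev]) (rule order_trans[OF le less_imp_le])
qed

lemma second_derivative_oscillation:
  assumes "0 < \<epsilon>"
  shows "eventually (\<lambda>j. \<forall>k<N j. \<forall>t. 0 \<le> t \<and> t \<le> 1 \<longrightarrow> Z j k + t *\<^sub>R step j k \<in> M \<and>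
    \<bar>partial i (partial p f) (Z j k + t *\<^sub>R step j k) - partial i (partial p f) (Z j k)\<bar> \<le> \<epsilon>) sequentially"
proof -
  let ?g = "partial i (partial p f)"
  obtain \<rho> where \<rho>: "0 < \<rho>" "tube \<rho> \<subseteq> M" using tube_subset by blast
  have "continuous_on (tube \<rho>) ?g"
    by (intro continuous_on_subset[OF smooth_on_continuous_on \<rho>(2)] smooth_on_partial f)
  then have "uniformly_continuous_on (tube \<rho>) ?g" by (intro compact_uniformly_continuous compact_tube)
  then obtain \<eta> where \<eta>: "0 < \<eta>" "\<And>x y. x \<in> tube \<rho> \<Longrightarrow> y \<in> tube \<rho> \<Longrightarrow> dist y x < \<eta> \<Longrightarrow> dist (?g y) (?g x) < \<epsilon>"
    using assms unfolding uniformly_continuous_on_def by metis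
  \<comment> \<open>Half of the tube radius is spent on the distance of the scheme from the path,
    the other half on the step.\<close>
  define \<rho>' where "\<rho>' = min (\<rho>/2) (\<eta>/2)"
  have \<rho>': "0 < \<rho>'" using \<rho> \<eta> by (simp add: \<rho>'_def)
  have "0 < \<rho>/2" using \<rho>(1) by simp
  from Z_eventually_in_tube[OF this] steps_small[OF \<rho>'] show ?thesis
  proof eventually_elim
    case (elim j)
    show ?case
    proof (intro allI impI)
      fix k t assume k: "k < N j" and t: "0 \<le> t \<and> t \<le> (1 :: real)"
      have "Z j k \<in> tube (\<rho>/2)" using elim k by auto
      then obtain s where s: "s \<in> {0..T}" "dist (z s) (Z j k) \<le> \<rho>/2" by (auto simp: tube_def)
      have n: "norm (t *\<^sub>R step j k) \<le> \<rho>'"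
        using elim(2) k t mult_left_le_one_le[of "norm (step j k)" t] by (force intro: order_trans)
      have "dist (z s) (Z j k + t *\<^sub>R step j k) \<le> dist (z s) (Z j k) + norm (t *\<^sub>R step j k)"
        using dist_triangle[of "z s" "Z j k + t *\<^sub>R step j k" "Z j k"] by (simp add: dist_norm)
      also have "\<dots> \<le> \<rho>" using s n by (simp add: \<rho>'_def)
      finally have in1: "Z j k + t *\<^sub>R step j k \<in> tube \<rho>" using s by (auto simp: tube_def)
      have in0: "Z j k \<in> tube \<rho>" using s \<rho>(1) by (auto simp: tube_def intro!: bexI[of _ s])
      have "dist (Z j k + t *\<^sub>R step j k) (Z j k) < \<eta>" using n \<eta>(1) by (simp add: dist_norm \<rho>'_def)
      from \<eta>(2)[OF in0 in1 this] have "\<bar>?g (Z j k + t *\<^sub>R step j k) - ?g (Z j k)\<bar> \<le> \<epsilon>" by (simp add: dist_real_def)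
      then show "Z j k + t *\<^sub>R step j k \<in> M \<and> \<bar>?g (Z j k + t *\<^sub>R step j k) - ?g (Z j k)\<bar> \<le> \<epsilon>"
        using in1 \<rho>(2) by auto
    qed
  qed
qed

definition first :: "nat \<Rightarrow> nat \<Rightarrow> real" where
  "first j k = (\<Sum>i\<in>UNIV. step j k $ i * partial i f (Z j k))"

definition second :: "nat \<Rightarrow> nat \<Rightarrow> real" where
  "second j k = (\<Sum>i\<in>UNIV. \<Sum>p\<in>UNIV. step j k $ i * step j k $ p * partial i (partial p f) (Z j k))"

text \<open>Each remainder is at most a small \<epsilon> times the squared size, up to a constant,
  and the squared sizes have bounded sums.\<close>

lemma taylor_remainder_sum:
  "(\<lambda>j. \<Sum>k<N j. f (Z j (Suc k)) - f (Z j k) - first j k - 1/2 * second j k) \<longlonglongrightarrow> 0"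
proof (rule LIMSEQ_I)
  fix e :: real assume e: "0 < e"
  obtain B where B: "eventually (\<lambda>j. (\<Sum>k<N j. (size j k)\<^sup>2) \<le> B) sequentially" using size_sum_bounded by blast
  define n where "n = real CARD('n)"
  \<comment> \<open>The added 1 keeps \<open>K\<close> positive, so that division by it is
    possible.\<close>
  define K where "K = 1/2 * (n * c)\<^sup>2 * \<bar>B\<bar> + 1"
  have K: "0 < K" by (auto simp: K_def intro!: add_nonneg_pos mult_nonneg_nonneg)
  define \<epsilon> where "\<epsilon> = e / (2 * K)"
  have \<epsilon>: "0 < \<epsilon>" "\<epsilon> * K < e" using e K by (auto simp: \<epsilon>_def)
  have "eventually (\<lambda>j. \<forall>i p. \<forall>k<N j. \<forall>t. 0 \<le> t \<and> t \<le> 1 \<longrightarrow> Z j k + t *\<^sub>R step j k \<in> M \<and>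
    \<bar>partial i (partial p f) (Z j k + t *\<^sub>R step j k) - partial i (partial p f) (Z j k)\<bar> \<le> \<epsilon>) sequentially"
    by (intro eventually_all_finite second_derivative_oscillation \<epsilon>)
  with B have "eventually (\<lambda>j. norm (\<Sum>k<N j. f (Z j (Suc k)) - f (Z j k) - first j k - 1/2 * second j k) < e) sequentially"
  proof eventually_elim
    case (elim j)
    have "\<bar>f (Z j (Suc k)) - f (Z j k) - first j k - 1/2 * second j k\<bar> \<le> 1/2 * \<epsilon> * (n * c)\<^sup>2 * (size j k)\<^sup>2" if k: "k < N j" for k
    proof -
      have "\<bar>f (Z j k + step j k) - f (Z j k) - (\<Sum>i\<in>UNIV. step j k $ i * partial i f (Z j k))
         - 1/2 * (\<Sum>i\<in>UNIV. \<Sum>p\<in>UNIV. step j k $ i * step j k $ p * partial i (partial p f) (Z j k))\<bar>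
        \<le> 1/2 * \<epsilon> * (\<Sum>i\<in>UNIV. \<bar>step j k $ i\<bar>)\<^sup>2"
        by (rule taylor_second_order[OF f]) (use elim(2) k in blast)+
      also have "(\<Sum>i\<in>UNIV. \<bar>step j k $ i\<bar>) \<le> (\<Sum>i\<in>(UNIV :: 'n set). c * size j k)"
        by (intro sum_mono step_bound k)
      then have "(\<Sum>i\<in>UNIV. \<bar>step j k $ i\<bar>)\<^sup>2 \<le> (n * c)\<^sup>2 * (size j k)\<^sup>2"
        unfolding power_mult_distrib[symmetric] by (intro power_mono) (auto simp: n_def sum_nonneg)
      then have "1/2 * \<epsilon> * (\<Sum>i\<in>UNIV. \<bar>step j k $ i\<bar>)\<^sup>2 \<le> 1/2 * \<epsilon> * ((n * c)\<^sup>2 * (size j k)\<^sup>2)"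
        using \<epsilon> by (intro mult_left_mono) auto
      finally show ?thesis by (simp add: first_def second_def step_def)
    qed
    then have "\<bar>\<Sum>k<N j. f (Z j (Suc k)) - f (Z j k) - first j k - 1/2 * second j k\<bar> \<le> (\<Sum>k<N j. 1/2 * \<epsilon> * (n * c)\<^sup>2 * (size j k)\<^sup>2)"
      by (intro order_trans[OF sum_abs] sum_mono) auto
    also have "\<dots> = \<epsilon> * (1/2 * (n * c)\<^sup>2 * (\<Sum>k<N j. (size j k)\<^sup>2))" by (simp add: sum_distrib_left mult_ac)
    also have "\<dots> \<le> \<epsilon> * K"
      unfolding K_def using elim(1) \<epsilon> by (intro mult_left_mono) (auto intro!: mult_left_mono order_trans[OF mult_left_mono] add_increasing2)
    also have "\<dots> < e" by (rule \<epsilon>)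
    finally show ?case by simp
  qed
  then show "\<exists>no. \<forall>n\<ge>no. norm ((\<Sum>k<N n. f (Z n (Suc k)) - f (Z n k) - first n k - 1/2 * second n k) - 0) < e"
    by (simp add: eventually_sequentially)
qed

text \<open>The coefficient of \<open>dw j k \<alpha> * dw j k \<beta>\<close> in
  \<open>second\<close> after the drift part of the step is dropped.\<close>

definition G :: "nat \<Rightarrow> 'm \<Rightarrow> 'm \<Rightarrow> nat \<Rightarrow> real" where
  "G j \<alpha> \<beta> k = (\<Sum>i\<in>UNIV. \<Sum>p\<in>UNIV. partial i (partial p f) (Z j k) * (H i \<alpha> (real k * \<delta> j) * H p \<beta> (real k * \<delta> j)))"

lemma limit_of_G:
  "limit_of (\<lambda>j k. G j \<alpha> \<beta> k) (\<lambda>s. \<Sum>i\<in>UNIV. \<Sum>p\<in>UNIV. partial i (partial p f) (z s) * (H i \<alpha> s * H p \<beta> s))"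
  unfolding G_def
  by (intro limit_of_sum limit_of_mult limit_of_Z limit_of_H smooth_on_continuous_on smooth_on_partial f finite)

text \<open>Every term containing the drift is at most a constant times mesh width times size. The
  arithmetic-geometric mean inequality for \<open>sqrt (\<delta> j)\<close> and
  \<open>size j k\<close> bounds this by \<open>sqrt (\<delta> j)\<close> times a quantity with
  bounded sums.\<close>

lemma second_minus_quadratic:
  "(\<lambda>j. \<Sum>k<N j. second j k - (\<Sum>\<alpha>\<in>UNIV. \<Sum>\<beta>\<in>UNIV. G j \<alpha> \<beta> k * (dw j k \<alpha> * dw j k \<beta>))) \<longlonglongrightarrow> 0"
proof -
  obtain B where B: "eventually (\<lambda>j. (\<Sum>k<N j. (size j k)\<^sup>2) \<le> B) sequentially" using size_sum_bounded by blast
  have ex: "\<exists>C. eventually (\<lambda>j. \<forall>k<N j. \<bar>partial i (partial p f) (Z j k)\<bar> \<le> C) sequentially" for i p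
    using limit_of_Z[OF smooth_on_continuous_on[OF smooth_on_partial[OF smooth_on_partial[OF f]]], of i p]
    by (simp add: limit_of_def)
  define C0 where "C0 i p = (SOME C. eventually (\<lambda>j. \<forall>k<N j. \<bar>partial i (partial p f) (Z j k)\<bar> \<le> C) sequentially)" for i p
  have C0: "eventually (\<lambda>j. \<forall>k<N j. \<bar>partial i (partial p f) (Z j k)\<bar> \<le> C0 i p) sequentially" for i p
    unfolding C0_def by (rule someI_ex[OF ex])
  define C where "C = (\<Sum>i\<in>UNIV. \<Sum>p\<in>UNIV. \<bar>C0 i p\<bar>)"
  have "eventually (\<lambda>j. \<forall>i p. \<forall>k<N j. \<bar>partial i (partial p f) (Z j k)\<bar> \<le> C0 i p) sequentially"
    by (intro eventually_all_finite C0)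
  with B have "eventually (\<lambda>j. norm (\<Sum>k<N j. second j k - (\<Sum>\<alpha>\<in>UNIV. \<Sum>\<beta>\<in>UNIV. G j \<alpha> \<beta> k * (dw j k \<alpha> * dw j k \<beta>)))
      \<le> C * (c\<^sup>2 * (sqrt (\<delta> j) * (T + B)))) sequentially"
  proof eventually_elim
    case (elim j)
    have dpos: "0 < \<delta> j" by (rule \<delta>(1))
    have "\<bar>second j k - (\<Sum>\<alpha>\<in>UNIV. \<Sum>\<beta>\<in>UNIV. G j \<alpha> \<beta> k * (dw j k \<alpha> * dw j k \<beta>))\<bar>
        \<le> C * (c\<^sup>2 * (sqrt (\<delta> j) * (\<delta> j + (size j k)\<^sup>2)))" if k: "k < N j" for k
    proof -
      have "(\<Sum>\<alpha>\<in>UNIV. \<Sum>\<beta>\<in>UNIV. G j \<alpha> \<beta> k * (dw j k \<alpha> * dw j k \<beta>))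
        = (\<Sum>i\<in>UNIV. \<Sum>p\<in>UNIV. mart j k i * mart j k p * partial i (partial p f) (Z j k))"
      proof -
        let ?t = "\<lambda>\<alpha> \<beta> i p. partial i (partial p f) (Z j k) * (H i \<alpha> (real k * \<delta> j) * H p \<beta> (real k * \<delta> j)) * (dw j k \<alpha> * dw j k \<beta>)"
        have "(\<Sum>\<alpha>\<in>UNIV. \<Sum>\<beta>\<in>UNIV. G j \<alpha> \<beta> k * (dw j k \<alpha> * dw j k \<beta>)) = (\<Sum>\<alpha>\<in>UNIV. \<Sum>\<beta>\<in>UNIV. \<Sum>i\<in>UNIV. \<Sum>p\<in>UNIV. ?t \<alpha> \<beta> i p)"
          by (simp add: G_def sum_distrib_right)
        also have "\<dots> = (\<Sum>\<alpha>\<in>UNIV. \<Sum>i\<in>UNIV. \<Sum>\<beta>\<in>UNIV. \<Sum>p\<in>UNIV. ?t \<alpha> \<beta> i p)"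
          by (intro sum.cong refl sum.swap)
        also have "\<dots> = (\<Sum>i\<in>UNIV. \<Sum>\<alpha>\<in>UNIV. \<Sum>\<beta>\<in>UNIV. \<Sum>p\<in>UNIV. ?t \<alpha> \<beta> i p)" by (rule sum.swap)
        also have "\<dots> = (\<Sum>i\<in>UNIV. \<Sum>\<alpha>\<in>UNIV. \<Sum>p\<in>UNIV. \<Sum>\<beta>\<in>UNIV. ?t \<alpha> \<beta> i p)"
          by (intro sum.cong refl sum.swap)
        also have "\<dots> = (\<Sum>i\<in>UNIV. \<Sum>p\<in>UNIV. \<Sum>\<alpha>\<in>UNIV. \<Sum>\<beta>\<in>UNIV. ?t \<alpha> \<beta> i p)"
          by (intro sum.cong refl sum.swap)
        also have "\<dots> = (\<Sum>i\<in>UNIV. \<Sum>p\<in>UNIV. mart j k i * mart j k p * partial i (partial p f) (Z j k))"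
          unfolding mart_def unfolding sum_product unfolding sum_distrib_right by (intro sum.cong refl) (simp add: mult_ac)
        finally show ?thesis .
      qed
      then have eq: "second j k - (\<Sum>\<alpha>\<in>UNIV. \<Sum>\<beta>\<in>UNIV. G j \<alpha> \<beta> k * (dw j k \<alpha> * dw j k \<beta>))
        = (\<Sum>i\<in>UNIV. \<Sum>p\<in>UNIV. (step j k $ i * step j k $ p - mart j k i * mart j k p) * partial i (partial p f) (Z j k))"
        by (simp add: second_def sum_subtractf left_diff_distrib)
      have "\<bar>\<Sum>i\<in>UNIV. \<Sum>p\<in>UNIV. (step j k $ i * step j k $ p - mart j k i * mart j k p) * partial i (partial p f) (Z j k)\<bar>
        \<le> (\<Sum>i\<in>UNIV. \<Sum>p\<in>UNIV. (c\<^sup>2 * (sqrt (\<delta> j) * (\<delta> j + (size j k)\<^sup>2))) * \<bar>C0 i p\<bar>)"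
      proof (intro order_trans[OF sum_abs] sum_mono)
        fix i p
        have se: "step j k $ i * step j k $ p - mart j k i * mart j k p
          = (b i (real k * \<delta> j) * \<delta> j) * step j k $ p + mart j k i * (b p (real k * \<delta> j) * \<delta> j)"
          unfolding step_nth[OF k] by (simp add: algebra_simps)
        have sb: "\<bar>(b i (real k * \<delta> j) * \<delta> j) * step j k $ p + mart j k i * (b p (real k * \<delta> j) * \<delta> j)\<bar>
          \<le> (c * \<delta> j) * (c * size j k) + (c * size j k) * (c * \<delta> j)"
        proof -
          have bb: "\<bar>b i (real k * \<delta> j) * \<delta> j\<bar> \<le> c * \<delta> j" for i
            using b(2)[of "real k * \<delta> j" i] grid_le[of k j] k dpos by (auto simp: abs_mult intro!: mult_right_mono)
          have "0 \<le> c * \<delta> j" "0 \<le> c * size j k" using c_nonneg dpos size_nonneg by auto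
          then show ?thesis
            by (intro order_trans[OF abs_triangle_ineq] add_mono; unfold abs_mult[of "_ * \<delta> j"] abs_mult[of "mart j k i"])
              (intro mult_mono bb step_bound[OF k] mart_bound[OF k]; simp)+
        qed
        have sc: "(c * \<delta> j) * (c * size j k) + (c * size j k) * (c * \<delta> j) = c\<^sup>2 * (2 * (\<delta> j * size j k))"
          by (simp add: power2_eq_square)
        have sd: "c\<^sup>2 * (2 * (\<delta> j * size j k)) \<le> c\<^sup>2 * (sqrt (\<delta> j) * (\<delta> j + (size j k)\<^sup>2))"
        proof (rule mult_left_mono)
          have "2 * (sqrt (\<delta> j) * size j k) \<le> (sqrt (\<delta> j))\<^sup>2 + (size j k)\<^sup>2"
            using sum_squares_bound[of "sqrt (\<delta> j)" "size j k"] by (simp add: mult.assoc)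
          then have "sqrt (\<delta> j) * (2 * (sqrt (\<delta> j) * size j k)) \<le> sqrt (\<delta> j) * (\<delta> j + (size j k)\<^sup>2)"
            using dpos by (intro mult_left_mono) auto
          moreover have "sqrt (\<delta> j) * (2 * (sqrt (\<delta> j) * size j k)) = 2 * (\<delta> j * size j k)"
          proof -
            have "sqrt (\<delta> j) * (2 * (sqrt (\<delta> j) * size j k)) = 2 * ((sqrt (\<delta> j) * sqrt (\<delta> j)) * size j k)" by simp
            then show ?thesis using dpos by simp
          qed
          ultimately show "2 * (\<delta> j * size j k) \<le> sqrt (\<delta> j) * (\<delta> j + (size j k)\<^sup>2)" by simp
        qed simp
        have 1: "\<bar>step j k $ i * step j k $ p - mart j k i * mart j k p\<bar> \<le> c\<^sup>2 * (sqrt (\<delta> j) * (\<delta> j + (size j k)\<^sup>2))"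
          unfolding se by (rule order_trans[OF sb[unfolded sc] sd])
        have 2: "\<bar>partial i (partial p f) (Z j k)\<bar> \<le> \<bar>C0 i p\<bar>" using elim(2) k by (force intro: order_trans)
        show "\<bar>(step j k $ i * step j k $ p - mart j k i * mart j k p) * partial i (partial p f) (Z j k)\<bar>
          \<le> c\<^sup>2 * (sqrt (\<delta> j) * (\<delta> j + (size j k)\<^sup>2)) * \<bar>C0 i p\<bar>"
          unfolding abs_mult using 1 2 by (intro mult_mono) auto
      qed
      also have "\<dots> = C * (c\<^sup>2 * (sqrt (\<delta> j) * (\<delta> j + (size j k)\<^sup>2)))"
        by (simp add: C_def sum_distrib_left[symmetric] sum_distrib_right[symmetric] mult_ac)
      finally show ?thesis unfolding eq .
    qed
    then have "norm (\<Sum>k<N j. second j k - (\<Sum>\<alpha>\<in>UNIV. \<Sum>\<beta>\<in>UNIV. G j \<alpha> \<beta> k * (dw j k \<alpha> * dw j k \<beta>)))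
      \<le> (\<Sum>k<N j. C * (c\<^sup>2 * (sqrt (\<delta> j) * (\<delta> j + (size j k)\<^sup>2))))"
      by (intro order_trans[OF norm_sum] sum_mono) auto
    also have "\<dots> = C * (c\<^sup>2 * (sqrt (\<delta> j) * (T + (\<Sum>k<N j. (size j k)\<^sup>2))))"
      by (simp add: sum_distrib_left[symmetric] sum.distrib N)
    also have "\<dots> \<le> C * (c\<^sup>2 * (sqrt (\<delta> j) * (T + B)))"
      using elim(1) dpos by (intro mult_left_mono) (auto simp: C_def intro!: sum_nonneg)
    finally show ?case .
  qed
  moreover have "(\<lambda>j. C * (c\<^sup>2 * (sqrt (\<delta> j) * (T + B)))) \<longlonglongrightarrow> C * (c\<^sup>2 * (sqrt 0 * (T + B)))"
    by (intro tendsto_intros \<delta>(2))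
  then have "(\<lambda>j. C * (c\<^sup>2 * (sqrt (\<delta> j) * (T + B)))) \<longlonglongrightarrow> 0" by simp
  ultimately show ?thesis by (rule Lim_null_comparison)
qed

text \<open>The telescoping sum of \<open>f\<close> along the scheme, solved for the terms linear in
  \<open>dw\<close>. The hypothesis \<open>quad\<close> keeps the truncation and the guard for
  \<open>M\<close> because only such weights admit a moment bound; on a fixed path both are
  eventually inactive.\<close>

lemma euler_ito:
  assumes cl: "filterlim cl at_top sequentially"
    and quad: "\<And>\<alpha> \<beta>. (\<lambda>j. \<Sum>k<N j. clip (cl j) (if Z j k \<in> M then G j \<alpha> \<beta> k else 0) * (dw j k \<alpha> * dw j k \<beta> - (if \<alpha> = \<beta> then \<delta> j else 0))) \<longlonglongrightarrow> 0"
  shows "(\<lambda>j. \<Sum>\<alpha>\<in>UNIV. \<Sum>k<N j. (\<Sum>i\<in>UNIV. partial i f (Z j k) * H i \<alpha> (real k * \<delta> j)) * dw j k \<alpha>)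
    \<longlonglongrightarrow> f (z T) - f (z 0) - (LBINT s:{0..T}. 1/2 * (\<Sum>\<alpha>\<in>UNIV. \<Sum>i\<in>UNIV. \<Sum>p\<in>UNIV. partial i (partial p f) (z s) * (H i \<alpha> s * H p \<alpha> s))
        + (\<Sum>i\<in>UNIV. partial i f (z s) * b i s))"
proof -
  let ?Q = "\<lambda>s. \<Sum>\<alpha>\<in>UNIV. \<Sum>i\<in>UNIV. \<Sum>p\<in>UNIV. partial i (partial p f) (z s) * (H i \<alpha> s * H p \<alpha> s)"
  let ?D = "\<lambda>s. \<Sum>i\<in>UNIV. partial i f (z s) * b i s"
  \<comment> \<open>The weights are eventually bounded along the path while the level
    \<open>cl\<close> tends to infinity, and the scheme eventually stays in
    \<open>M\<close>.\<close>
  have quad': "(\<lambda>j. \<Sum>k<N j. G j \<alpha> \<beta> k * (dw j k \<alpha> * dw j k \<beta> - (if \<alpha> = \<beta> then \<delta> j else 0))) \<longlonglongrightarrow> 0" for \<alpha> \<beta>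
  proof -
    obtain C where C: "eventually (\<lambda>j. \<forall>k<N j. \<bar>G j \<alpha> \<beta> k\<bar> \<le> C) sequentially"
      using limit_of_G[of \<alpha> \<beta>] by (auto simp: limit_of_def)
    have "eventually (\<lambda>j. C \<le> cl j) sequentially" using cl by (auto simp: filterlim_at_top)
    with C Z_eventually_in_M
    have "eventually (\<lambda>j. (\<Sum>k<N j. clip (cl j) (if Z j k \<in> M then G j \<alpha> \<beta> k else 0) * (dw j k \<alpha> * dw j k \<beta> - (if \<alpha> = \<beta> then \<delta> j else 0)))
      = (\<Sum>k<N j. G j \<alpha> \<beta> k * (dw j k \<alpha> * dw j k \<beta> - (if \<alpha> = \<beta> then \<delta> j else 0)))) sequentially"
    proof eventually_elim
      case (elim j)
      show ?case
      proof (rule sum.cong[OF refl])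
        fix k assume "k \<in> {..<N j}"
        then have k: "k < N j" by simp
        then have "Z j k \<in> M" "\<bar>G j \<alpha> \<beta> k\<bar> \<le> cl j" using elim by (auto intro: order_trans)
        then show "clip (cl j) (if Z j k \<in> M then G j \<alpha> \<beta> k else 0) * (dw j k \<alpha> * dw j k \<beta> - (if \<alpha> = \<beta> then \<delta> j else 0))
          = G j \<alpha> \<beta> k * (dw j k \<alpha> * dw j k \<beta> - (if \<alpha> = \<beta> then \<delta> j else 0))" by (simp add: clip_eq)
      qed
    qed
    from Lim_transform_eventually[OF quad this] show ?thesis .
  qed
  have Q: "limit_of (\<lambda>j k. \<Sum>\<alpha>\<in>UNIV. G j \<alpha> \<alpha> k) ?Q"
    by (intro limit_of_sum limit_of_G finite)
  have D: "limit_of (\<lambda>j k. \<Sum>i\<in>UNIV. partial i f (Z j k) * b i (real k * \<delta> j)) ?D"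
    by (intro limit_of_sum limit_of_mult limit_of_Z limit_of_b smooth_on_continuous_on smooth_on_partial f finite)
  have sec: "(\<lambda>j. \<Sum>k<N j. second j k) \<longlonglongrightarrow> (LBINT s:{0..T}. ?Q s)"
  proof -
    have "(\<lambda>j. (\<Sum>k<N j. second j k - (\<Sum>\<alpha>\<in>UNIV. \<Sum>\<beta>\<in>UNIV. G j \<alpha> \<beta> k * (dw j k \<alpha> * dw j k \<beta>)))
        + (\<Sum>\<alpha>\<in>UNIV. \<Sum>\<beta>\<in>UNIV. \<Sum>k<N j. G j \<alpha> \<beta> k * (dw j k \<alpha> * dw j k \<beta> - (if \<alpha> = \<beta> then \<delta> j else 0)))
        + (\<Sum>k<N j. (\<Sum>\<alpha>\<in>UNIV. G j \<alpha> \<alpha> k) * \<delta> j)) \<longlonglongrightarrow> 0 + (\<Sum>\<alpha>\<in>(UNIV :: 'm set). \<Sum>\<beta>\<in>(UNIV :: 'm set). 0) + (LBINT s:{0..T}. ?Q s)"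
      by (intro tendsto_add tendsto_sum second_minus_quadratic quad' limit_of_riemann(3)[OF Q])
    moreover have "(\<Sum>k<N j. second j k - (\<Sum>\<alpha>\<in>UNIV. \<Sum>\<beta>\<in>UNIV. G j \<alpha> \<beta> k * (dw j k \<alpha> * dw j k \<beta>)))
        + (\<Sum>\<alpha>\<in>UNIV. \<Sum>\<beta>\<in>UNIV. \<Sum>k<N j. G j \<alpha> \<beta> k * (dw j k \<alpha> * dw j k \<beta> - (if \<alpha> = \<beta> then \<delta> j else 0)))
        + (\<Sum>k<N j. (\<Sum>\<alpha>\<in>UNIV. G j \<alpha> \<alpha> k) * \<delta> j) = (\<Sum>k<N j. second j k)" for j
    proof -
      have "(\<Sum>\<alpha>\<in>UNIV. \<Sum>\<beta>\<in>UNIV. \<Sum>k<N j. G j \<alpha> \<beta> k * (dw j k \<alpha> * dw j k \<beta> - (if \<alpha> = \<beta> then \<delta> j else 0)))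
        = (\<Sum>\<alpha>\<in>UNIV. \<Sum>k<N j. \<Sum>\<beta>\<in>UNIV. G j \<alpha> \<beta> k * (dw j k \<alpha> * dw j k \<beta> - (if \<alpha> = \<beta> then \<delta> j else 0)))"
        by (intro sum.cong refl sum.swap)
      also have "\<dots> = (\<Sum>k<N j. \<Sum>\<alpha>\<in>UNIV. \<Sum>\<beta>\<in>UNIV. G j \<alpha> \<beta> k * (dw j k \<alpha> * dw j k \<beta> - (if \<alpha> = \<beta> then \<delta> j else 0)))"
        by (rule sum.swap)
      also have "\<dots> = (\<Sum>k<N j. (\<Sum>\<alpha>\<in>UNIV. \<Sum>\<beta>\<in>UNIV. G j \<alpha> \<beta> k * (dw j k \<alpha> * dw j k \<beta>)) - (\<Sum>\<alpha>\<in>UNIV. G j \<alpha> \<alpha> k) * \<delta> j)"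
      proof (rule sum.cong[OF refl])
        fix k
        have "(\<Sum>\<beta>\<in>UNIV. G j \<alpha> \<beta> k * (dw j k \<alpha> * dw j k \<beta> - (if \<alpha> = \<beta> then \<delta> j else 0)))
          = (\<Sum>\<beta>\<in>UNIV. G j \<alpha> \<beta> k * (dw j k \<alpha> * dw j k \<beta>)) - G j \<alpha> \<alpha> k * \<delta> j" for \<alpha>
        proof -
          have "(\<Sum>\<beta>\<in>UNIV. G j \<alpha> \<beta> k * (if \<alpha> = \<beta> then \<delta> j else 0)) = (\<Sum>\<beta>\<in>UNIV. if \<alpha> = \<beta> then G j \<alpha> \<alpha> k * \<delta> j else 0)"
            by (intro sum.cong) auto
          then show ?thesis by (simp only: right_diff_distrib sum_subtractf) simp
        qed
        then show "(\<Sum>\<alpha>\<in>UNIV. \<Sum>\<beta>\<in>UNIV. G j \<alpha> \<beta> k * (dw j k \<alpha> * dw j k \<beta> - (if \<alpha> = \<beta> then \<delta> j else 0)))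
          = (\<Sum>\<alpha>\<in>UNIV. \<Sum>\<beta>\<in>UNIV. G j \<alpha> \<beta> k * (dw j k \<alpha> * dw j k \<beta>)) - (\<Sum>\<alpha>\<in>UNIV. G j \<alpha> \<alpha> k) * \<delta> j"
          by (simp only: sum_subtractf sum_distrib_right)
      qed
      finally show ?thesis by (simp add: sum_subtractf)
    qed
    ultimately show ?thesis by simp
  qed
  obtain err where err: "err \<longlonglongrightarrow> 0" "\<And>j k. k \<le> N j \<Longrightarrow> norm (Z j k - z (real k * \<delta> j)) \<le> err j"
    using Z_close by blast
  have "(\<lambda>j. Z j (N j) - z T) \<longlonglongrightarrow> 0"
    by (rule Lim_null_comparison[OF _ err(1)]) (use err(2)[OF order_refl] N in simp)
  then have "(\<lambda>j. Z j (N j)) \<longlonglongrightarrow> z T" by (simp add: LIM_zero_iff)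
  moreover have "isCont f (z T)"
    using smooth_on_continuous_on[OF f] M z(2)[of T] T by (auto simp: continuous_on_eq_continuous_at)
  ultimately have fT: "(\<lambda>j. f (Z j (N j))) \<longlonglongrightarrow> f (z T)" by (rule isCont_tendsto_compose[rotated])
  have Z0: "Z j 0 = z 0" for j by (simp add: vec_eq_iff Z_eq)
  \<comment> \<open>An exact identity for every \<open>j\<close>: \<open>first\<close> is split into
    drift and martingale part, and the increments of \<open>f\<close> telescope.\<close>
  have id: "(\<Sum>\<alpha>\<in>UNIV. \<Sum>k<N j. (\<Sum>i\<in>UNIV. partial i f (Z j k) * H i \<alpha> (real k * \<delta> j)) * dw j k \<alpha>)
    = f (Z j (N j)) - f (z 0) - (\<Sum>k<N j. f (Z j (Suc k)) - f (Z j k) - first j k - 1/2 * second j k)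
      - 1/2 * (\<Sum>k<N j. second j k) - (\<Sum>k<N j. (\<Sum>i\<in>UNIV. partial i f (Z j k) * b i (real k * \<delta> j)) * \<delta> j)" for j
  proof -
    have "first j k = (\<Sum>i\<in>UNIV. partial i f (Z j k) * b i (real k * \<delta> j)) * \<delta> j
       + (\<Sum>\<alpha>\<in>UNIV. (\<Sum>i\<in>UNIV. partial i f (Z j k) * H i \<alpha> (real k * \<delta> j)) * dw j k \<alpha>)" if k: "k < N j" for k
    proof -
      have "first j k = (\<Sum>i\<in>UNIV. partial i f (Z j k) * b i (real k * \<delta> j)) * \<delta> j + (\<Sum>i\<in>UNIV. mart j k i * partial i f (Z j k))"
        unfolding first_def step_nth[OF k] distrib_right sum.distrib sum_distrib_right by (simp add: mult_ac)
      also have "(\<Sum>i\<in>UNIV. mart j k i * partial i f (Z j k)) = (\<Sum>i\<in>UNIV. \<Sum>\<alpha>\<in>UNIV. partial i f (Z j k) * H i \<alpha> (real k * \<delta> j) * dw j k \<alpha>)"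
        by (simp add: mart_def sum_distrib_left mult_ac)
      also have "\<dots> = (\<Sum>\<alpha>\<in>UNIV. (\<Sum>i\<in>UNIV. partial i f (Z j k) * H i \<alpha> (real k * \<delta> j)) * dw j k \<alpha>)"
        by (subst sum.swap) (simp add: sum_distrib_right)
      finally show ?thesis .
    qed
    then have "(\<Sum>k<N j. first j k) = (\<Sum>k<N j. (\<Sum>i\<in>UNIV. partial i f (Z j k) * b i (real k * \<delta> j)) * \<delta> j)
      + (\<Sum>k<N j. \<Sum>\<alpha>\<in>UNIV. (\<Sum>i\<in>UNIV. partial i f (Z j k) * H i \<alpha> (real k * \<delta> j)) * dw j k \<alpha>)"
      by (simp add: sum.distrib[symmetric])
    moreover have "(\<Sum>k<N j. \<Sum>\<alpha>\<in>UNIV. (\<Sum>i\<in>UNIV. partial i f (Z j k) * H i \<alpha> (real k * \<delta> j)) * dw j k \<alpha>)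
      = (\<Sum>\<alpha>\<in>UNIV. \<Sum>k<N j. (\<Sum>i\<in>UNIV. partial i f (Z j k) * H i \<alpha> (real k * \<delta> j)) * dw j k \<alpha>)" by (rule sum.swap)
    moreover have "(\<Sum>k<N j. f (Z j (Suc k)) - f (Z j k) - first j k - 1/2 * second j k)
      = f (Z j (N j)) - f (z 0) - (\<Sum>k<N j. first j k) - 1/2 * (\<Sum>k<N j. second j k)"
      using sum_lessThan_telescope[of "\<lambda>k. f (Z j k)" "N j"] by (simp only: sum_subtractf sum_distrib_left Z0)
    ultimately show ?thesis by linarith
  qed
  have int: "(LBINT s:{0..T}. 1/2 * ?Q s + ?D s) = 1/2 * (LBINT s:{0..T}. ?Q s) + (LBINT s:{0..T}. ?D s)"
    using set_integral_add(2)[OF set_integrable_mult_right[OF limit_of_riemann(1)[OF Q], of "1/2"] limit_of_riemann(1)[OF D]]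
    by (simp add: set_integral_mult_right)
  have "(\<lambda>j. f (Z j (N j)) - f (z 0) - (\<Sum>k<N j. f (Z j (Suc k)) - f (Z j k) - first j k - 1/2 * second j k)
      - 1/2 * (\<Sum>k<N j. second j k) - (\<Sum>k<N j. (\<Sum>i\<in>UNIV. partial i f (Z j k) * b i (real k * \<delta> j)) * \<delta> j))
    \<longlonglongrightarrow> f (z T) - f (z 0) - 0 - 1/2 * (LBINT s:{0..T}. ?Q s) - (LBINT s:{0..T}. ?D s)"
    by (intro tendsto_intros fT taylor_remainder_sum sec limit_of_riemann(3)[OF D])
  then show ?thesis unfolding id int by (simp add: algebra_simps)
qed

end

section \<open>Ito's formula\<close>

definition (in prob_space) vanishes_in_prob :: "(nat \<Rightarrow> 'a \<Rightarrow> real) \<Rightarrow> bool" where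
  "vanishes_in_prob X \<longleftrightarrow> (\<forall>n. X n \<in> borel_measurable M) \<and>
     (\<forall>\<epsilon>>0. (\<lambda>n. prob {\<omega>\<in>space M. \<epsilon> < \<bar>X n \<omega>\<bar>}) \<longlonglongrightarrow> 0)"

lemma (in prob_space) vanishes_in_prob_sum:
  assumes I: "finite I" and X: "\<And>i. i \<in> I \<Longrightarrow> vanishes_in_prob (X i)"
  shows "vanishes_in_prob (\<lambda>n \<omega>. \<Sum>i\<in>I. \<bar>X i n \<omega>\<bar>)"
  unfolding vanishes_in_prob_def
proof (intro conjI allI impI)
  have [measurable]: "X i n \<in> borel_measurable M" if "i \<in> I" for i n using X[OF that] by (simp add: vanishes_in_prob_def)
  show "(\<lambda>\<omega>. \<Sum>i\<in>I. \<bar>X i n \<omega>\<bar>) \<in> borel_measurable M" for n by (intro borel_measurable_sum) measurable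
  fix \<epsilon> :: real assume \<epsilon>: "0 < \<epsilon>"
  \<comment> \<open>If no summand exceeds this share, the sum does not exceed \<epsilon>; the added
    1 also covers empty \<open>I\<close>.\<close>
  define e where "e = \<epsilon> / (real (card I) + 1)"
  have e: "0 < e" using \<epsilon> by (simp add: e_def)
  have "(\<lambda>n. \<Sum>i\<in>I. prob {\<omega>\<in>space M. e < \<bar>X i n \<omega>\<bar>}) \<longlonglongrightarrow> (\<Sum>i\<in>I. 0)"
    using X e by (intro tendsto_sum) (auto simp: vanishes_in_prob_def)
  then have lim: "(\<lambda>n. \<Sum>i\<in>I. prob {\<omega>\<in>space M. e < \<bar>X i n \<omega>\<bar>}) \<longlonglongrightarrow> 0" by simp
  have "prob {\<omega>\<in>space M. \<epsilon> < \<bar>\<Sum>i\<in>I. \<bar>X i n \<omega>\<bar>\<bar>} \<le> (\<Sum>i\<in>I. prob {\<omega>\<in>space M. e < \<bar>X i n \<omega>\<bar>})" for n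
  proof -
    have m: "{\<omega>\<in>space M. e < \<bar>X i n \<omega>\<bar>} \<in> events" if "i \<in> I" for i using that by measurable
    have "{\<omega>\<in>space M. \<epsilon> < \<bar>\<Sum>i\<in>I. \<bar>X i n \<omega>\<bar>\<bar>} \<subseteq> (\<Union>i\<in>I. {\<omega>\<in>space M. e < \<bar>X i n \<omega>\<bar>})"
    proof (rule subsetI, rule ccontr)
      fix \<omega> assume \<omega>: "\<omega> \<in> {\<omega>\<in>space M. \<epsilon> < \<bar>\<Sum>i\<in>I. \<bar>X i n \<omega>\<bar>\<bar>}" "\<omega> \<notin> (\<Union>i\<in>I. {\<omega>\<in>space M. e < \<bar>X i n \<omega>\<bar>})"
      then have "(\<Sum>i\<in>I. \<bar>X i n \<omega>\<bar>) \<le> (\<Sum>i\<in>I. e)" by (intro sum_mono) force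
      also have "\<dots> \<le> \<epsilon>" using \<epsilon> by (simp add: e_def field_simps)
      finally show False using \<omega>(1) by (simp add: sum_nonneg)
    qed
    then have "prob {\<omega>\<in>space M. \<epsilon> < \<bar>\<Sum>i\<in>I. \<bar>X i n \<omega>\<bar>\<bar>} \<le> prob (\<Union>i\<in>I. {\<omega>\<in>space M. e < \<bar>X i n \<omega>\<bar>})"
      using I m by (intro finite_measure_mono) auto
    also have "\<dots> \<le> (\<Sum>i\<in>I. prob {\<omega>\<in>space M. e < \<bar>X i n \<omega>\<bar>})"
      using I m by (intro finite_measure_subadditive_finite) auto
    finally show ?thesis .
  qed
  then show "(\<lambda>n. prob {\<omega>\<in>space M. \<epsilon> < \<bar>\<Sum>i\<in>I. \<bar>X i n \<omega>\<bar>\<bar>}) \<longlonglongrightarrow> 0"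
    by (intro Lim_null_comparison[OF _ lim]) (simp add: measure_nonneg)
qed

text \<open>A subsequence for the sum of the absolute values works for all members of the family at
  once.\<close>

lemma (in prob_space) vanishes_in_prob_subsequence:
  assumes I: "finite I" and X: "\<And>i. i \<in> I \<Longrightarrow> vanishes_in_prob (X i)"
  obtains r where "strict_mono r" "AE \<omega> in M. \<forall>i\<in>I. (\<lambda>n. X i (r n) \<omega>) \<longlonglongrightarrow> 0"
proof -
  let ?S = "\<lambda>n \<omega>. \<Sum>i\<in>I. \<bar>X i n \<omega>\<bar>"
  have S: "vanishes_in_prob ?S" by (rule vanishes_in_prob_sum[OF assms])
  have nn: "0 \<le> ?S n \<omega>" for n \<omega> by (simp add: sum_nonneg)
  obtain r where r: "strict_mono r" "AE \<omega> in M. (\<lambda>n. ?S (r n) \<omega>) \<longlonglongrightarrow> 0"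
  proof (rule AE_subsequence_of_prob[of ?S])
    show "?S n \<in> borel_measurable M" for n using S by (auto simp: vanishes_in_prob_def)
    show "(\<lambda>n. prob {\<omega>\<in>space M. \<epsilon> < ?S n \<omega>}) \<longlonglongrightarrow> 0" if "0 < \<epsilon>" for \<epsilon>
      using S that nn by (simp add: vanishes_in_prob_def)
  qed (use nn in auto)
  have "AE \<omega> in M. \<forall>i\<in>I. (\<lambda>n. X i (r n) \<omega>) \<longlonglongrightarrow> 0"
    using r(2)
  proof eventually_elim
    case (elim \<omega>)
    show ?case
    proof
      fix i assume "i \<in> I"
      then have "norm (X i (r n) \<omega>) \<le> ?S (r n) \<omega>" for n
        using member_le_sum[OF _ _ I, of i "\<lambda>i. \<bar>X i (r n) \<omega>\<bar>"] by auto
      then show "(\<lambda>n. X i (r n) \<omega>) \<longlonglongrightarrow> 0" by (intro Lim_null_comparison[OF _ elim]) simp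
    qed
  qed
  then show ?thesis by (rule that[OF r(1)])
qed

lemma borel_measurable_vecI:
  fixes f :: "'a \<Rightarrow> real^'n"
  assumes "\<And>i. (\<lambda>x. f x $ i) \<in> borel_measurable M"
  shows "f \<in> borel_measurable M"
proof (rule borel_measurable_euclidean_space[THEN iffD2], rule ballI)
  fix b :: "real^'n" assume "b \<in> Basis"
  then obtain i where "b = axis i 1" by (auto simp: Basis_vec_def)
  then show "(\<lambda>x. f x \<bullet> b) \<in> borel_measurable M" using assms[of i] by (simp add: inner_axis)
qed

lemma simple_integral_equidistant:
  assumes "0 < \<delta>" "k \<le> N"
  shows "simple_integral N (\<lambda>k. real k * \<delta>) \<xi> B (real k * \<delta>) \<omega> = (\<Sum>l<k. \<xi> l \<omega> * (B (real (Suc l) * \<delta>) \<omega> - B (real l * \<delta>) \<omega>))"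
proof -
  have m: "min (real l * \<delta>) (real k * \<delta>) = (if l \<le> k then real l * \<delta> else real k * \<delta>)" for l
    using assms(1) by (auto simp: min_def)
  have "simple_integral N (\<lambda>k. real k * \<delta>) \<xi> B (real k * \<delta>) \<omega>
    = (\<Sum>l<N. if l < k then \<xi> l \<omega> * (B (real (Suc l) * \<delta>) \<omega> - B (real l * \<delta>) \<omega>) else 0)"
    unfolding simple_integral_def m
  proof (intro sum.cong refl)
    fix l
    show "\<xi> l \<omega> * (B (if Suc l \<le> k then real (Suc l) * \<delta> else real k * \<delta>) \<omega> - B (if l \<le> k then real l * \<delta> else real k * \<delta>) \<omega>)
      = (if l < k then \<xi> l \<omega> * (B (real (Suc l) * \<delta>) \<omega> - B (real l * \<delta>) \<omega>) else 0)"
      by (cases "l = k") auto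
  qed
  also have "\<dots> = (\<Sum>l<k. \<xi> l \<omega> * (B (real (Suc l) * \<delta>) \<omega> - B (real l * \<delta>) \<omega>))"
    using assms(2) by (intro sum.mono_neutral_cong_right) auto
  finally show ?thesis .
qed

text \<open>Products of increments minus their means are orthogonal, so the second moment of the
  weighted sum is a sum over cells. Each compensated product has second moment at most 8 times the
  squared mesh: 3 from each of two fourth moments and 2 from the compensator. Chebyshev's inequality
  does the rest.\<close>

lemma (in brownian_space) quadratic_variation_bound:
  assumes \<delta>: "0 < \<delta>" and C: "0 \<le> C" and \<epsilon>: "0 < \<epsilon>"
    and g: "\<And>k. k < N \<Longrightarrow> g k \<in> borel_measurable (F (real k * \<delta>))" "\<And>k \<omega>. k < N \<Longrightarrow> \<omega> \<in> space P \<Longrightarrow> \<bar>g k \<omega>\<bar> \<le> C"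
  defines "D \<equiv> \<lambda>k \<alpha> \<omega>. W (real (Suc k) * \<delta>) \<omega> $ \<alpha> - W (real k * \<delta>) \<omega> $ \<alpha>"
  shows "(\<lambda>\<omega>. \<Sum>k<N. g k \<omega> * (D k \<alpha> \<omega> * D k \<beta> \<omega> - (if \<alpha> = \<beta> then \<delta> else 0))) \<in> borel_measurable P"
    "prob {\<omega>\<in>space P. \<epsilon> < \<bar>\<Sum>k<N. g k \<omega> * (D k \<alpha> \<omega> * D k \<beta> \<omega> - (if \<alpha> = \<beta> then \<delta> else 0))\<bar>} \<le> 8 * real N * C\<^sup>2 * \<delta>\<^sup>2 / \<epsilon>\<^sup>2"
proof -
  define e where "e = (if \<alpha> = \<beta> then \<delta> else 0)"
  define q where "q x = x $ \<alpha> * x $ \<beta> - e" for x :: "real^'m"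
  have t: "0 \<le> real k * \<delta>" "real k * \<delta> < real (Suc k) * \<delta>" "real (Suc k) * \<delta> - real k * \<delta> = \<delta>" for k
    using \<delta> by (auto simp: algebra_simps)
  have DD: "D k \<gamma> \<omega> = (W (real (Suc k) * \<delta>) \<omega> - W (real k * \<delta>) \<omega>) $ \<gamma>" for k \<gamma> \<omega> by (simp add: D_def)
  have qD: "q (W (real (Suc k) * \<delta>) \<omega> - W (real k * \<delta>) \<omega>) = D k \<alpha> \<omega> * D k \<beta> \<omega> - e" for k \<omega>
    unfolding q_def DD ..
  note ii = increment_integrable[OF t(1,2), folded DD]
  note i4 = increment_fourth_moment[OF t(1,2), folded DD, unfolded t(3)]
  have mean: "expectation (\<lambda>\<omega>. D k \<alpha> \<omega> * D k \<beta> \<omega> - e) = 0" for k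
  proof (cases "\<alpha> = \<beta>")
    case True
    then show ?thesis
      using increment_second_moment[OF t(1,2), folded DD, unfolded t(3), of k \<alpha>] ii(2)[of k \<alpha> \<beta>]
      by (simp add: e_def power2_eq_square prob_space)
  next
    case False
    then show ?thesis using increment_covariance[OF t(1,2), folded DD, OF False, of k] by (simp add: e_def)
  qed
  have qsq: "integrable P (\<lambda>\<omega>. (D k \<alpha> \<omega> * D k \<beta> \<omega> - e)\<^sup>2)" "expectation (\<lambda>\<omega>. (D k \<alpha> \<omega> * D k \<beta> \<omega> - e)\<^sup>2) \<le> 8 * \<delta>\<^sup>2" for k
  proof -
    have eq: "(D k \<alpha> \<omega> * D k \<beta> \<omega> - e)\<^sup>2 = (D k \<alpha> \<omega> * D k \<beta> \<omega>)\<^sup>2 - 2 * e * (D k \<alpha> \<omega> * D k \<beta> \<omega>) + e\<^sup>2" for \<omega>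
      by (simp add: power2_diff mult_ac)
    show i: "integrable P (\<lambda>\<omega>. (D k \<alpha> \<omega> * D k \<beta> \<omega> - e)\<^sup>2)"
      unfolding eq using ii by (intro Bochner_Integration.integrable_add Bochner_Integration.integrable_diff integrable_mult_right) auto
    have "expectation (\<lambda>\<omega>. (D k \<alpha> \<omega> * D k \<beta> \<omega> - e)\<^sup>2) \<le> expectation (\<lambda>\<omega>. D k \<alpha> \<omega> ^ 4 + D k \<beta> \<omega> ^ 4 + 2 * \<delta>\<^sup>2)"
    proof (rule integral_mono[OF i])
      show "integrable P (\<lambda>\<omega>. D k \<alpha> \<omega> ^ 4 + D k \<beta> \<omega> ^ 4 + 2 * \<delta>\<^sup>2)" using i4(1) by auto
      fix \<omega>
      have a: "(x - y)\<^sup>2 \<le> 2 * x\<^sup>2 + 2 * y\<^sup>2" for x y :: real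
        using sum_squares_bound[of x "- y"] by (simp add: power2_diff)
      have b: "2 * (x * y)\<^sup>2 \<le> x ^ 4 + y ^ 4" for x y :: real
        using sum_squares_bound[of "x\<^sup>2" "y\<^sup>2"] by (simp add: power_mult_distrib mult.assoc flip: power_mult)
      have "e\<^sup>2 \<le> \<delta>\<^sup>2" by (simp add: e_def)
      then show "(D k \<alpha> \<omega> * D k \<beta> \<omega> - e)\<^sup>2 \<le> D k \<alpha> \<omega> ^ 4 + D k \<beta> \<omega> ^ 4 + 2 * \<delta>\<^sup>2"
        using a[of "D k \<alpha> \<omega> * D k \<beta> \<omega>" e] b[of "D k \<alpha> \<omega>" "D k \<beta> \<omega>"] by linarith
    qed
    also have "\<dots> = 8 * \<delta>\<^sup>2" using i4 by (simp add: prob_space)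
    finally show "expectation (\<lambda>\<omega>. (D k \<alpha> \<omega> * D k \<beta> \<omega> - e)\<^sup>2) \<le> 8 * \<delta>\<^sup>2" .
  qed
  define S where "S \<omega> = (\<Sum>k<N. g k \<omega> * (D k \<alpha> \<omega> * D k \<beta> \<omega> - e))" for \<omega>
  have "integrable P (\<lambda>\<omega>. (\<Sum>k<N. g k \<omega> * (\<lambda>_. q) k (W (real (Suc k) * \<delta>) \<omega> - W (real k * \<delta>) \<omega>))\<^sup>2) \<and>
    expectation (\<lambda>\<omega>. (\<Sum>k<N. g k \<omega> * (\<lambda>_. q) k (W (real (Suc k) * \<delta>) \<omega> - W (real k * \<delta>) \<omega>))\<^sup>2)
      = (\<Sum>k<N. expectation (\<lambda>\<omega>. (g k \<omega>)\<^sup>2) * expectation (\<lambda>\<omega>. ((\<lambda>_. q) k (W (real (Suc k) * \<delta>) \<omega> - W (real k * \<delta>) \<omega>))\<^sup>2))"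
  proof (rule orthogonal_sum[where p="\<lambda>k. real k * \<delta>" and c=C])
    show "q \<in> borel_measurable borel" unfolding q_def[abs_def] by measurable
  qed (use t g mean qsq(1) in \<open>auto simp: qD simp del: of_nat_Suc\<close>)
  then have S2: "integrable P (\<lambda>\<omega>. (S \<omega>)\<^sup>2)"
    "expectation (\<lambda>\<omega>. (S \<omega>)\<^sup>2) = (\<Sum>k<N. expectation (\<lambda>\<omega>. (g k \<omega>)\<^sup>2) * expectation (\<lambda>\<omega>. (D k \<alpha> \<omega> * D k \<beta> \<omega> - e)\<^sup>2))"
    unfolding S_def qD by auto
  have "expectation (\<lambda>\<omega>. (S \<omega>)\<^sup>2) \<le> (\<Sum>k<N. C\<^sup>2 * (8 * \<delta>\<^sup>2))"
    unfolding S2(2)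
  proof (intro sum_mono mult_mono qsq(2))
    fix k assume "k \<in> {..<N}"
    then have k: "k < N" by simp
    have b: "(g k \<omega>)\<^sup>2 \<le> C\<^sup>2" if "\<omega> \<in> space P" for \<omega>
      using g(2)[OF k that] C by (simp add: abs_le_square_iff[symmetric])
    have [measurable]: "g k \<in> borel_measurable P" using g(1)[OF k] measurable_F_P by blast
    have "expectation (\<lambda>\<omega>. (g k \<omega>)\<^sup>2) \<le> expectation (\<lambda>\<omega>. C\<^sup>2)"
      by (rule integral_mono[OF integrable_const_bound[where B="C\<^sup>2"]]) (use b in auto)
    then show "expectation (\<lambda>\<omega>. (g k \<omega>)\<^sup>2) \<le> C\<^sup>2" by (simp add: prob_space)
  qed (auto intro!: integral_nonneg_AE)
  then have ES: "expectation (\<lambda>\<omega>. (S \<omega>)\<^sup>2) \<le> 8 * real N * C\<^sup>2 * \<delta>\<^sup>2" by (simp add: mult_ac)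
  have Sm: "S \<in> borel_measurable P"
    unfolding S_def D_def using g(1) measurable_F_P t(1) \<delta>
    by (intro borel_measurable_sum borel_measurable_times borel_measurable_diff W_component_measurable_P borel_measurable_const) auto
  then show "(\<lambda>\<omega>. \<Sum>k<N. g k \<omega> * (D k \<alpha> \<omega> * D k \<beta> \<omega> - (if \<alpha> = \<beta> then \<delta> else 0))) \<in> borel_measurable P"
    by (simp add: S_def[abs_def] e_def)
  have "prob {\<omega>\<in>space P. \<epsilon> < \<bar>S \<omega>\<bar>} \<le> prob {\<omega>\<in>space P. \<epsilon> \<le> \<bar>S \<omega>\<bar>}"
    using Sm by (intro finite_measure_mono) auto
  also have "\<dots> \<le> expectation (\<lambda>\<omega>. (S \<omega>)\<^sup>2) / \<epsilon>\<^sup>2" by (rule second_moment_method[OF Sm S2(1) \<epsilon>])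
  also have "\<dots> \<le> 8 * real N * C\<^sup>2 * \<delta>\<^sup>2 / \<epsilon>\<^sup>2" using ES by (intro divide_right_mono) auto
  finally show "prob {\<omega>\<in>space P. \<epsilon> < \<bar>\<Sum>k<N. g k \<omega> * (D k \<alpha> \<omega> * D k \<beta> \<omega> - (if \<alpha> = \<beta> then \<delta> else 0))\<bar>} \<le> 8 * real N * C\<^sup>2 * \<delta>\<^sup>2 / \<epsilon>\<^sup>2"
    by (simp add: S_def e_def)
qed

text \<open>Data of a solution stopped at \<tau>, free of \<open>option\<close> values:
  \<open>x\<close> is total but meaningful only up to \<tau>. Adaptedness is accordingly stated for
  continuous functions of \<open>x\<close> that are switched off after \<tau>.\<close>

locale ito_process = brownian_space P F W
  for P :: "'w measure" and F and W :: "real \<Rightarrow> 'w \<Rightarrow> real^'m::finite" +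
  fixes M :: "(real^'n) set" and \<mu> :: "real^'n \<Rightarrow> real^'n" and \<sigma> :: "real^'n \<Rightarrow> real^'m^'n"
    and x :: "real \<Rightarrow> 'w \<Rightarrow> real^'n" and \<tau> :: "'w \<Rightarrow> real" and J :: "'n \<Rightarrow> 'm \<Rightarrow> real \<Rightarrow> 'w \<Rightarrow> real"
  assumes M: "open M" and smooth_\<mu>: "smooth_on M \<mu>" and smooth_\<sigma>: "smooth_on M \<sigma>"
    and \<tau>: "\<And>\<omega>. \<omega> \<in> space P \<Longrightarrow> 0 \<le> \<tau> \<omega>"
    and xM: "\<And>\<omega> s. \<omega> \<in> space P \<Longrightarrow> 0 \<le> s \<Longrightarrow> s \<le> \<tau> \<omega> \<Longrightarrow> x s \<omega> \<in> M"
    and x_continuous: "\<And>\<omega>. \<omega> \<in> space P \<Longrightarrow> continuous_on {0..\<tau> \<omega>} (\<lambda>s. x s \<omega>)"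
    and x_adapted: "\<And>(h :: real^'n \<Rightarrow> real) s. continuous_on M h \<Longrightarrow> 0 \<le> s \<Longrightarrow>
      (\<lambda>\<omega>. if s \<le> \<tau> \<omega> then h (x s \<omega>) else 0) \<in> borel_measurable (F s)"
    and J: "\<And>i \<alpha>. has_ito_integral P F (\<lambda>t \<omega>. W t \<omega> $ \<alpha>) (\<lambda>s \<omega>. if s \<le> \<tau> \<omega> then \<sigma> (x s \<omega>) $ i $ \<alpha> else 0) (J i \<alpha>)"
    and solution: "AE \<omega> in P. \<forall>t\<ge>0. \<forall>i. x (min t (\<tau> \<omega>)) \<omega> $ i - x 0 \<omega> $ i =
      (LBINT s:{0..min t (\<tau> \<omega>)}. \<mu> (x s \<omega>) $ i) + (\<Sum>\<alpha>\<in>UNIV. J i \<alpha> t \<omega>)"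
begin

definition cut :: "(real^'n \<Rightarrow> real) \<Rightarrow> real \<Rightarrow> 'w \<Rightarrow> real" where
  "cut h s \<omega> = (if s \<le> \<tau> \<omega> then h (x s \<omega>) else 0)"

text \<open>The condition in \<open>cut\<close> is \<open>s \<le> \<tau> \<omega>\<close> and not
  the strict one, so the value at \<tau> is still that of the path and the jump to 0 occurs on its
  right; this gives left-continuity. Boundedness comes from compactness of
  \<open>{0..\<tau> \<omega>}\<close>.\<close>

lemma cut_regular:
  assumes h: "continuous_on M h"
  shows "regular_process P F (cut h)"
  unfolding regular_process_def
proof (intro conjI allI impI ballI)
  show "cut h s \<in> borel_measurable (F s)" if "0 \<le> s" for s
    unfolding cut_def[abs_def] by (rule x_adapted[OF h that])
  fix \<omega> assume \<omega>: "\<omega> \<in> space P"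
  have hx: "continuous_on {0..\<tau> \<omega>} (\<lambda>s. h (x s \<omega>))"
    by (rule continuous_on_compose2[OF h x_continuous[OF \<omega>]]) (use xM[OF \<omega>] in auto)
  show "((\<lambda>u. cut h u \<omega>) \<longlongrightarrow> cut h s \<omega>) (at_left s)" if s: "0 < s" for s
  proof (cases "s \<le> \<tau> \<omega>")
    case True
    have "((\<lambda>u. h (x u \<omega>)) \<longlongrightarrow> h (x s \<omega>)) (at s within {0..\<tau> \<omega>})"
      using hx s True by (auto simp: continuous_on_def)
    moreover have "at_left s \<le> at s within {0..\<tau> \<omega>}"
    proof -
      have "at s within {..<s} = at s within ({..<s} \<inter> {0<..})" by (rule at_within_nhd[of _ "{0<..}"]) (use s in auto)
      also have "\<dots> \<le> at s within {0..\<tau> \<omega>}" using True by (intro at_le) auto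
      finally show ?thesis .
    qed
    ultimately have "((\<lambda>u. h (x u \<omega>)) \<longlongrightarrow> h (x s \<omega>)) (at_left s)" by (rule filterlim_mono[OF _ order_refl])
    moreover have "eventually (\<lambda>u. h (x u \<omega>) = cut h u \<omega>) (at_left s)"
      using True by (auto simp: eventually_at_filter cut_def)
    ultimately show ?thesis using True by (auto simp: cut_def intro: Lim_transform_eventually)
  next
    case False
    then have "eventually (\<lambda>u. \<tau> \<omega> < u) (at_left s)" by (intro eventually_at_left_real[THEN eventually_mono]) auto
    then have "eventually (\<lambda>u. 0 = cut h u \<omega>) (at_left s)" by (rule eventually_mono) (simp add: cut_def)
    then show ?thesis using False by (auto simp: cut_def intro: Lim_transform_eventually[OF tendsto_const])
  qed
  show "\<exists>c. \<forall>s\<in>{0..T}. \<bar>cut h s \<omega>\<bar> \<le> c" for T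
  proof -
    have "compact ((\<lambda>s. h (x s \<omega>)) ` {0..\<tau> \<omega>})" by (intro compact_continuous_image hx compact_Icc)
    then obtain c where "\<And>s. s \<in> {0..\<tau> \<omega>} \<Longrightarrow> \<bar>h (x s \<omega>)\<bar> \<le> c"
      using compact_imp_bounded by (force simp: bounded_real)
    then show ?thesis by (intro exI[of _ "max c 0"]) (auto simp: cut_def le_max_iff_disj)
  qed
qed

lemma regular_set_integrable:
  assumes H: "regular_process P F H" and \<omega>: "\<omega> \<in> space P"
  shows "set_integrable lborel {0..T} (\<lambda>s. H s \<omega>)"
proof -
  obtain c where c: "\<And>s. s \<in> {0..T} \<Longrightarrow> \<bar>H s \<omega>\<bar> \<le> c" using H \<omega> unfolding regular_process_def by blast
  show ?thesis
    unfolding set_integrable_def real_scaleR_def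
  proof (rule Bochner_Integration.integrable_bound[where f="\<lambda>s. c * indicator {0..T} s"])
    show "integrable lborel (\<lambda>s. c * indicator {0..T} s)"
      by (intro integrable_mult_right integrable_real_indicator) (auto simp: emeasure_lborel_Icc_eq)
    show "(\<lambda>s. indicator {0..T} s * H s \<omega>) \<in> borel_measurable lborel"
      using regular_path_measurable[OF H \<omega>] by (simp add: mult.commute)
    show "AE s in lborel. norm (indicator {0..T} s * H s \<omega>) \<le> norm (c * indicator {0..T} s)"
      using c by (intro AE_I2) (auto simp: indicator_def intro: order_trans[OF _ abs_ge_self])
  qed
qed

lemma integral_cut:
  assumes "\<omega> \<in> space P" "0 \<le> t"
  shows "(LBINT s:{0..t}. cut h s \<omega>) = (LBINT s:{0..min t (\<tau> \<omega>)}. h (x s \<omega>))"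
  unfolding set_lebesgue_integral_def
  by (intro Bochner_Integration.integral_cong) (auto simp: cut_def indicator_def)

lemma continuous_integral_cut:
  assumes h: "continuous_on M h" and \<omega>: "\<omega> \<in> space P"
  shows "continuous_on {0..} (\<lambda>t. LBINT s:{0..t}. cut h s \<omega>)"
proof (rule continuous_on_atLeast_0I)
  fix T :: real
  have "(LBINT s:{0..t}. cut h s \<omega>) = integral {0..t} (\<lambda>s. cut h s \<omega>)" for t
    by (rule set_borel_integral_eq_integral(2)[OF regular_set_integrable[OF cut_regular[OF h] \<omega>]])
  moreover have "continuous_on {0..T} (\<lambda>t. integral {0..t} (\<lambda>s. cut h s \<omega>))"
    by (rule indefinite_integral_continuous_1[OF set_borel_integral_eq_integral(1)[OF regular_set_integrable[OF cut_regular[OF h] \<omega>]]])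
  ultimately show "continuous_on {0..T} (\<lambda>t. LBINT s:{0..t}. cut h s \<omega>)" by simp
qed

end

section \<open>The random Euler scheme on an equidistant grid\<close>

locale euler_scheme = ito_process P F W M \<mu> \<sigma> x \<tau> J
  for P :: "'w measure" and F and W :: "real \<Rightarrow> 'w \<Rightarrow> real^'m::finite"
    and M :: "(real^'n) set" and \<mu> \<sigma> x \<tau> J +
  fixes f :: "real^'n \<Rightarrow> real" and T :: real
  assumes f: "smooth_on M f" and T: "0 < T"
begin

definition \<delta> :: "nat \<Rightarrow> real" where "\<delta> n = T / real (Suc n)"

definition drift :: "'n \<Rightarrow> real \<Rightarrow> 'w \<Rightarrow> real" where "drift i = cut (\<lambda>y. \<mu> y $ i)"

definition diff :: "'n \<Rightarrow> 'm \<Rightarrow> real \<Rightarrow> 'w \<Rightarrow> real" where "diff i \<alpha> = cut (\<lambda>y. \<sigma> y $ i $ \<alpha>)"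

definition dW :: "nat \<Rightarrow> nat \<Rightarrow> 'm \<Rightarrow> 'w \<Rightarrow> real" where
  "dW n k \<alpha> \<omega> = W (real (Suc k) * \<delta> n) \<omega> $ \<alpha> - W (real k * \<delta> n) \<omega> $ \<alpha>"

definition dc :: "nat \<Rightarrow> 'n \<Rightarrow> 'm \<Rightarrow> nat \<Rightarrow> 'w \<Rightarrow> real" where
  "dc n i \<alpha> k \<omega> = clip (real n) (diff i \<alpha> (real k * \<delta> n) \<omega>)"

definition Z :: "nat \<Rightarrow> nat \<Rightarrow> 'w \<Rightarrow> real^'n" where
  "Z n k \<omega> = (\<chi> i. x 0 \<omega> $ i + (\<Sum>l<k. drift i (real l * \<delta> n) \<omega> * \<delta> n + (\<Sum>\<alpha>\<in>UNIV. dc n i \<alpha> l \<omega> * dW n l \<alpha> \<omega>)))"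

text \<open>The scheme can leave \<open>M\<close>, where nothing is known about \<open>f\<close>.
  The extension by zero is Borel on the whole space and coincides with \<open>g\<close> once the
  scheme stays in \<open>M\<close>.\<close>

definition inM :: "(real^'n \<Rightarrow> real) \<Rightarrow> real^'n \<Rightarrow> real" where
  "inM g y = (if y \<in> M then g y else 0)"

text \<open>The weights of the quadratic terms. Truncation at the fourth root of \<open>n\<close>
  makes their squares grow like \<open>sqrt n\<close>, which the variance of order
  \<open>1/n\<close> of the compensated quadratic sums absorbs.\<close>

definition Q :: "nat \<Rightarrow> 'm \<Rightarrow> 'm \<Rightarrow> nat \<Rightarrow> 'w \<Rightarrow> real" where
  "Q n \<alpha> \<beta> k \<omega> = clip (sqrt (sqrt (real n))) (\<Sum>i\<in>UNIV. \<Sum>p\<in>UNIV. inM (partial i (partial p f)) (Z n k \<omega>) * (dc n i \<alpha> k \<omega> * dc n p \<beta> k \<omega>))"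

text \<open>Bounded adapted grid values whose elementary integrals are the first-order terms of the
  expansion; their step processes approximate \<open>cut (h \<alpha>)\<close>.\<close>

definition U :: "nat \<Rightarrow> 'm \<Rightarrow> nat \<Rightarrow> 'w \<Rightarrow> real" where
  "U n \<alpha> k \<omega> = clip (real n) (\<Sum>i\<in>UNIV. inM (partial i f) (Z n k \<omega>) * dc n i \<alpha> k \<omega>)"

definition h :: "'m \<Rightarrow> real^'n \<Rightarrow> real" where
  "h \<alpha> y = (\<Sum>i\<in>UNIV. partial i f y * \<sigma> y $ i $ \<alpha>)"

lemma \<delta>_pos: "0 < \<delta> n"
  using T by (simp add: \<delta>_def)

lemma \<delta>_tendsto: "\<delta> \<longlonglongrightarrow> 0"
  using tendsto_mult[OF tendsto_const[of T] mesh_tendsto_0] by (simp add: \<delta>_def[abs_def])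

lemma \<delta>_N: "real (Suc n) * \<delta> n = T"
  by (simp add: \<delta>_def del: of_nat_Suc)

lemma grid_in: "k \<le> Suc n \<Longrightarrow> real k * \<delta> n \<in> {0..T}"
proof -
  assume "k \<le> Suc n"
  then have "real k * \<delta> n \<le> real (Suc n) * \<delta> n" using \<delta>_pos[of n] by (intro mult_right_mono) auto
  then have "real k * \<delta> n \<le> T" unfolding \<delta>_N .
  then show ?thesis using \<delta>_pos[of n] by simp
qed

lemma continuous_coefficients:
  "continuous_on M (\<lambda>y. \<mu> y $ i)" "continuous_on M (\<lambda>y. \<sigma> y $ i $ \<alpha>)" "continuous_on M (h \<alpha>)"
proof -
  have m: "smooth_on M (\<lambda>y. \<mu> y $ i)" "smooth_on M (\<lambda>y. \<sigma> y $ i $ \<alpha>)" for i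
    by (intro smooth_on_vec_nth M smooth_\<mu> smooth_\<sigma>)+
  then show "continuous_on M (\<lambda>y. \<mu> y $ i)" "continuous_on M (\<lambda>y. \<sigma> y $ i $ \<alpha>)" by (auto intro: smooth_on_continuous_on)
  show "continuous_on M (h \<alpha>)" unfolding h_def[abs_def]
    by (intro smooth_on_continuous_on smooth_on_sum smooth_on_mult smooth_on_partial M f m)
qed

lemma drift_regular: "regular_process P F (drift i)"
  unfolding drift_def by (rule cut_regular[OF continuous_coefficients(1)])

lemma diff_regular: "regular_process P F (diff i \<alpha>)"
  unfolding diff_def by (rule cut_regular[OF continuous_coefficients(2)])

lemma inM_measurable:
  assumes "continuous_on M g"
  shows "inM g \<in> borel_measurable borel"
proof -
  have "(\<lambda>y. indicator M y *\<^sub>R g y) \<in> borel_measurable borel"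
    using M by (intro borel_measurable_continuous_on_indicator assms) auto
  moreover have "inM g = (\<lambda>y. indicator M y *\<^sub>R g y)" by (auto simp: inM_def fun_eq_iff)
  ultimately show ?thesis by simp
qed

lemma dW_measurable: "k < l \<Longrightarrow> dW n k \<alpha> \<in> borel_measurable (F (real l * \<delta> n))"
  unfolding dW_def[abs_def] using \<delta>_pos[of n]
  by (intro borel_measurable_diff W_component_measurable mult_right_mono mult_nonneg_nonneg) auto

lemma grid_measurable:
  assumes "regular_process P F H" "k \<le> l"
  shows "H (real k * \<delta> n) \<in> borel_measurable (F (real l * \<delta> n))"
proof (rule measurable_F_mono)
  show "H (real k * \<delta> n) \<in> borel_measurable (F (real k * \<delta> n))"
    using assms(1) \<delta>_pos[of n] by (simp add: regular_process_def)
  show "real k * \<delta> n \<le> real l * \<delta> n" using assms(2) \<delta>_pos[of n] by (intro mult_right_mono) auto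
qed

lemma dc_measurable: "k \<le> l \<Longrightarrow> dc n i \<alpha> k \<in> borel_measurable (F (real l * \<delta> n))"
  unfolding dc_def[abs_def] by (rule measurable_compose[OF grid_measurable[OF diff_regular] clip_measurable])

lemma x0_measurable: "(\<lambda>\<omega>. x 0 \<omega> $ i) \<in> borel_measurable (F 0)"
proof -
  have "continuous_on M (\<lambda>y :: real^'n. y $ i)" by (intro continuous_intros)
  from x_adapted[OF this order_refl] show ?thesis
    by (rule measurable_cong[THEN iffD1, rotated]) (use \<tau> in auto)
qed

text \<open>Only increments ending by \<open>real k * \<delta> n\<close> enter, so the weights of
  step \<open>k\<close> are independent of the increment \<open>dW n k\<close>.\<close>

lemma Z_measurable: "Z n k \<in> borel_measurable (F (real k * \<delta> n))"
proof (rule borel_measurable_vecI)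
  fix i
  have "(\<lambda>\<omega>. x 0 \<omega> $ i + (\<Sum>l<k. drift i (real l * \<delta> n) \<omega> * \<delta> n + (\<Sum>\<alpha>\<in>UNIV. dc n i \<alpha> l \<omega> * dW n l \<alpha> \<omega>)))
    \<in> borel_measurable (F (real k * \<delta> n))"
    using \<delta>_pos[of n]
    by (intro borel_measurable_add borel_measurable_sum borel_measurable_times borel_measurable_const
        measurable_F_mono[OF x0_measurable] grid_measurable[OF drift_regular] dc_measurable dW_measurable) auto
  then show "(\<lambda>\<omega>. Z n k \<omega> $ i) \<in> borel_measurable (F (real k * \<delta> n))" by (simp add: Z_def)
qed

lemma Q_measurable: "Q n \<alpha> \<beta> k \<in> borel_measurable (F (real k * \<delta> n))"
  unfolding Q_def[abs_def]
  by (intro measurable_compose[OF _ clip_measurable] borel_measurable_sum borel_measurable_times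
      measurable_compose[OF Z_measurable inM_measurable] dc_measurable smooth_on_continuous_on smooth_on_partial f order_refl)

lemma U_measurable: "U n \<alpha> k \<in> borel_measurable (F (real k * \<delta> n))"
  unfolding U_def[abs_def]
  by (intro measurable_compose[OF _ clip_measurable] borel_measurable_sum borel_measurable_times
      measurable_compose[OF Z_measurable inM_measurable] dc_measurable smooth_on_continuous_on smooth_on_partial f order_refl)

lemma U_simple_data: "simple_data P F N (\<lambda>k. real k * \<delta> n) (U n \<alpha>)"
  unfolding simple_data_def
proof (intro conjI allI impI)
  show "real k * \<delta> n \<le> real (Suc k) * \<delta> n" for k using \<delta>_pos[of n] by (simp add: algebra_simps)
  show "\<exists>c. \<forall>\<omega>\<in>space P. \<bar>U n \<alpha> k \<omega>\<bar> \<le> c" for k using clip_bound[of "real n"] by (auto simp: U_def)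
qed (auto intro: U_measurable)

definition martingale_error :: "nat \<Rightarrow> 'n \<Rightarrow> 'm \<Rightarrow> 'w \<Rightarrow> real" where
  "martingale_error n i \<alpha> \<omega> = Max ((\<lambda>k. \<bar>(\<Sum>l<k. dc n i \<alpha> l \<omega> * dW n l \<alpha> \<omega>) - J i \<alpha> (real k * \<delta> n) \<omega>\<bar>) ` {..Suc n})"

text \<open>The sums are simple integrals on the grid, and the maximum runs over a set of times that
  grows with \<open>n\<close>, which \<open>ito_integral_approximation\<close> permits.\<close>

lemma martingale_error_vanishes: "vanishes_in_prob (\<lambda>n. martingale_error n i \<alpha>)"
  unfolding vanishes_in_prob_def
proof (intro conjI allI impI)
  have Jm: "J i \<alpha> t \<in> borel_measurable P" if "0 \<le> t" for t
    using J[of \<alpha> i] that by (simp add: has_ito_integral_def)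
  have "(\<lambda>\<omega>. \<bar>(\<Sum>l<k. dc n i \<alpha> l \<omega> * dW n l \<alpha> \<omega>) - J i \<alpha> (real k * \<delta> n) \<omega>\<bar>) \<in> borel_measurable P" for n k
    using \<delta>_pos[of n] measurable_F_P[OF dc_measurable[OF order_refl]] measurable_F_P[OF dW_measurable[OF lessI]]
    by (intro borel_measurable_abs borel_measurable_diff borel_measurable_sum borel_measurable_times Jm) auto
  then show "martingale_error n i \<alpha> \<in> borel_measurable P" for n
    unfolding martingale_error_def[abs_def] by (intro borel_measurable_Max) auto
  fix \<epsilon> :: real assume \<epsilon>: "0 < \<epsilon>"
  let ?D = "\<lambda>n. (\<lambda>k. real k * \<delta> n) ` {..Suc n}"
  have "(\<lambda>n. prob {\<omega>\<in>space P. \<exists>s\<in>?D n. \<epsilon> < \<bar>simple_integral (Suc n) (\<lambda>k. real k * \<delta> n) (\<lambda>k \<omega>. clip (real n) (diff i \<alpha> (real k * \<delta> n) \<omega>)) (\<lambda>t \<omega>. W t \<omega> $ \<alpha>) s \<omega> - J i \<alpha> s \<omega>\<bar>}) \<longlonglongrightarrow> 0"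
  proof (rule ito_integral_approximation[where T=T])
    show "has_ito_integral P F (\<lambda>t \<omega>. W t \<omega> $ \<alpha>) (diff i \<alpha>) (J i \<alpha>)"
      using J[of \<alpha> i] by (simp add: diff_def cut_def[abs_def])
    show "simple_data P F (Suc n) (\<lambda>k. real k * \<delta> n) (\<lambda>k \<omega>. clip (real n) (diff i \<alpha> (real k * \<delta> n) \<omega>))" for n
      by (rule regular_simple_data[OF diff_regular \<delta>_pos \<delta>_tendsto])
    show "(\<lambda>n. prob {\<omega>\<in>space P. ennreal \<epsilon> < energy T (simple_process (Suc n) (\<lambda>k. real k * \<delta> n)
        (\<lambda>k \<omega>. clip (real n) (diff i \<alpha> (real k * \<delta> n) \<omega>))) (diff i \<alpha>) \<omega>}) \<longlonglongrightarrow> 0" if "0 < \<epsilon>" for \<epsilon>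
      using T by (intro regular_energy_tendsto[OF diff_regular \<delta>_pos \<delta>_tendsto _ _ that]) (auto simp: \<delta>_N simp del: of_nat_Suc)
    show "?D n \<subseteq> {0..T}" for n
      using grid_in by blast
  qed (use T \<epsilon> in auto)
  moreover have "{\<omega>\<in>space P. \<exists>s\<in>?D n. \<epsilon> < \<bar>simple_integral (Suc n) (\<lambda>k. real k * \<delta> n) (\<lambda>k \<omega>. clip (real n) (diff i \<alpha> (real k * \<delta> n) \<omega>)) (\<lambda>t \<omega>. W t \<omega> $ \<alpha>) s \<omega> - J i \<alpha> s \<omega>\<bar>}
    = {\<omega>\<in>space P. \<epsilon> < \<bar>martingale_error n i \<alpha> \<omega>\<bar>}" for n
  proof (rule Collect_cong, rule conj_cong[OF refl])
    fix \<omega>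
    let ?a = "\<lambda>k. \<bar>(\<Sum>l<k. dc n i \<alpha> l \<omega> * dW n l \<alpha> \<omega>) - J i \<alpha> (real k * \<delta> n) \<omega>\<bar>"
    have si: "simple_integral (Suc n) (\<lambda>k. real k * \<delta> n) (\<lambda>k \<omega>. clip (real n) (diff i \<alpha> (real k * \<delta> n) \<omega>)) (\<lambda>t \<omega>. W t \<omega> $ \<alpha>) (real k * \<delta> n) \<omega>
      = (\<Sum>l<k. dc n i \<alpha> l \<omega> * dW n l \<alpha> \<omega>)" if "k \<le> Suc n" for k
      using simple_integral_equidistant[OF \<delta>_pos that] by (simp add: dc_def dW_def)
    have "?a 0 \<in> ?a ` {..Suc n}" by (rule imageI) simp
    then have "?a 0 \<le> martingale_error n i \<alpha> \<omega>" unfolding martingale_error_def by (intro Max_ge) auto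
    then have "0 \<le> martingale_error n i \<alpha> \<omega>" by (rule order_trans[OF abs_ge_zero])
    then have "\<epsilon> < \<bar>martingale_error n i \<alpha> \<omega>\<bar> \<longleftrightarrow> (\<exists>k\<in>{..Suc n}. \<epsilon> < ?a k)"
      by (simp add: martingale_error_def Max_gr_iff)
    also have "\<dots> \<longleftrightarrow> (\<exists>s\<in>?D n. \<epsilon> < \<bar>simple_integral (Suc n) (\<lambda>k. real k * \<delta> n) (\<lambda>k \<omega>. clip (real n) (diff i \<alpha> (real k * \<delta> n) \<omega>)) (\<lambda>t \<omega>. W t \<omega> $ \<alpha>) s \<omega> - J i \<alpha> s \<omega>\<bar>)"
      unfolding Set.bex_simps(7) by (intro bex_cong refl) (simp add: si)
    finally show "(\<exists>s\<in>?D n. \<epsilon> < \<bar>simple_integral (Suc n) (\<lambda>k. real k * \<delta> n) (\<lambda>k \<omega>. clip (real n) (diff i \<alpha> (real k * \<delta> n) \<omega>)) (\<lambda>t \<omega>. W t \<omega> $ \<alpha>) s \<omega> - J i \<alpha> s \<omega>\<bar>)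
      = (\<epsilon> < \<bar>martingale_error n i \<alpha> \<omega>\<bar>)" ..
  qed
  ultimately show "(\<lambda>n. prob {\<omega>\<in>space P. \<epsilon> < \<bar>martingale_error n i \<alpha> \<omega>\<bar>}) \<longlonglongrightarrow> 0" by simp
qed

text \<open>The bound from \<open>quadratic_variation_bound\<close> is of order
  \<open>sqrt n / n\<close>. The summand 1 in the bound on \<open>g\<close> lets the constant weight
  1 be treated too, which yields the quadratic variation itself.\<close>

lemma quadratic_sum_vanishes:
  assumes g: "\<And>n k. g n k \<in> borel_measurable (F (real k * \<delta> n))" "\<And>n k \<omega>. \<bar>g n k \<omega>\<bar> \<le> sqrt (sqrt (real n)) + 1"
  shows "vanishes_in_prob (\<lambda>n \<omega>. \<Sum>k<Suc n. g n k \<omega> * (dW n k \<alpha> \<omega> * dW n k \<beta> \<omega> - (if \<alpha> = \<beta> then \<delta> n else 0)))"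
  unfolding vanishes_in_prob_def
proof (intro conjI allI impI)
  note b = quadratic_variation_bound[OF \<delta>_pos _ _ g(1) g(2), folded dW_def]
  show "(\<lambda>\<omega>. \<Sum>k<Suc n. g n k \<omega> * (dW n k \<alpha> \<omega> * dW n k \<beta> \<omega> - (if \<alpha> = \<beta> then \<delta> n else 0))) \<in> borel_measurable P" for n
    by (rule b(1)[of n 1]) auto
  fix \<epsilon> :: real assume \<epsilon>: "0 < \<epsilon>"
  have "(\<lambda>n. 8 * T\<^sup>2 / \<epsilon>\<^sup>2 * ((sqrt (sqrt (real n)) + 1)\<^sup>2 / real (Suc n))) \<longlonglongrightarrow> 8 * T\<^sup>2 / \<epsilon>\<^sup>2 * 0"
    by (intro tendsto_mult tendsto_const) real_asymp
  then have lim: "(\<lambda>n. 8 * real (Suc n) * (sqrt (sqrt (real n)) + 1)\<^sup>2 * (\<delta> n)\<^sup>2 / \<epsilon>\<^sup>2) \<longlonglongrightarrow> 0"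
    by (simp add: \<delta>_def power_divide power2_eq_square[of "real (Suc _)"] mult_ac del: of_nat_Suc)
  have "prob {\<omega>\<in>space P. \<epsilon> < \<bar>\<Sum>k<Suc n. g n k \<omega> * (dW n k \<alpha> \<omega> * dW n k \<beta> \<omega> - (if \<alpha> = \<beta> then \<delta> n else 0))\<bar>}
     \<le> 8 * real (Suc n) * (sqrt (sqrt (real n)) + 1)\<^sup>2 * (\<delta> n)\<^sup>2 / \<epsilon>\<^sup>2" for n
    by (rule b(2)) (use \<epsilon> in auto)
  then show "(\<lambda>n. prob {\<omega>\<in>space P. \<epsilon> < \<bar>\<Sum>k<Suc n. g n k \<omega> * (dW n k \<alpha> \<omega> * dW n k \<beta> \<omega> - (if \<alpha> = \<beta> then \<delta> n else 0))\<bar>}) \<longlonglongrightarrow> 0"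
    by (intro Lim_null_comparison[OF _ lim]) (simp add: measure_nonneg)
qed

text \<open>The quantity that Ito's formula equates with the sum of the stochastic integrals at time
  \<open>T\<close>.\<close>

definition remainder :: "'w \<Rightarrow> real" where
  "remainder \<omega> = f (x (min T (\<tau> \<omega>)) \<omega>) - f (x 0 \<omega>) - (LBINT s:{0..T}. cut (generator \<mu> \<sigma> f) s \<omega>)"

text \<open>For an \<omega> at which the sequences vanishing in probability converge along
  \<open>r\<close>, the path satisfies the assumptions of \<open>euler_path\<close>; the expansion
  there gives the limit of the first-order sums, and the convergence of their integrands in
  energy.\<close>

lemma pathwise_limit:
  assumes \<omega>: "\<omega> \<in> space P" and r: "strict_mono r"
    and sol: "\<forall>t\<ge>0. \<forall>i. x (min t (\<tau> \<omega>)) \<omega> $ i - x 0 \<omega> $ i =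
      (LBINT s:{0..min t (\<tau> \<omega>)}. \<mu> (x s \<omega>) $ i) + (\<Sum>\<alpha>\<in>UNIV. J i \<alpha> t \<omega>)"
    and mart: "\<And>i \<alpha>. (\<lambda>n. martingale_error (r n) i \<alpha> \<omega>) \<longlonglongrightarrow> 0"
    and quadQ: "\<And>\<alpha> \<beta>. (\<lambda>n. \<Sum>k<Suc (r n). Q (r n) \<alpha> \<beta> k \<omega> * (dW (r n) k \<alpha> \<omega> * dW (r n) k \<beta> \<omega> - (if \<alpha> = \<beta> then \<delta> (r n) else 0))) \<longlonglongrightarrow> 0"
    and quad1: "\<And>\<alpha>. (\<lambda>n. \<Sum>k<Suc (r n). 1 * (dW (r n) k \<alpha> \<omega> * dW (r n) k \<alpha> \<omega> - (if \<alpha> = \<alpha> then \<delta> (r n) else 0))) \<longlonglongrightarrow> 0"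
  shows "(\<lambda>n. energy T (simple_process (Suc (r n)) (\<lambda>k. real k * \<delta> (r n)) (U (r n) \<alpha>)) (cut (h \<alpha>)) \<omega>) \<longlonglongrightarrow> 0"
    and "(\<lambda>n. \<Sum>\<alpha>\<in>UNIV. \<Sum>k<Suc (r n). U (r n) \<alpha> k \<omega> * dW (r n) k \<alpha> \<omega>) \<longlonglongrightarrow> remainder \<omega>"
proof -
  have bd: "\<exists>c. \<forall>s\<in>{0..T}. \<bar>H s \<omega>\<bar> \<le> c" if "regular_process P F H" for H
    using that \<omega> by (auto simp: regular_process_def)
  define cb where "cb i = (SOME c. \<forall>s\<in>{0..T}. \<bar>drift i s \<omega>\<bar> \<le> c)" for i
  define cd where "cd i \<alpha> = (SOME c. \<forall>s\<in>{0..T}. \<bar>diff i \<alpha> s \<omega>\<bar> \<le> c)" for i \<alpha>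
  have cb: "\<bar>drift i s \<omega>\<bar> \<le> cb i" if "s \<in> {0..T}" for i s
    using someI_ex[OF bd[OF drift_regular]] that unfolding cb_def by blast
  have cd: "\<bar>diff i \<alpha> s \<omega>\<bar> \<le> cd i \<alpha>" if "s \<in> {0..T}" for i \<alpha> s
    using someI_ex[OF bd[OF diff_regular]] that unfolding cd_def by blast
  define c where "c = (\<Sum>i\<in>UNIV. \<bar>cb i\<bar>) + (\<Sum>i\<in>UNIV. \<Sum>\<alpha>\<in>UNIV. \<bar>cd i \<alpha>\<bar>)"
  have c1: "\<bar>drift i s \<omega>\<bar> \<le> c" if "s \<in> {0..T}" for i s
  proof -
    have "\<bar>cb i\<bar> \<le> (\<Sum>i\<in>UNIV. \<bar>cb i\<bar>)" by (rule member_le_sum) auto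
    moreover have "0 \<le> (\<Sum>i\<in>UNIV. \<Sum>\<alpha>\<in>UNIV. \<bar>cd i \<alpha>\<bar>)" by (intro sum_nonneg) auto
    ultimately show ?thesis using cb[OF that, of i] unfolding c_def by linarith
  qed
  have c2: "\<bar>diff i \<alpha> s \<omega>\<bar> \<le> c" if "s \<in> {0..T}" for i \<alpha> s
  proof -
    have "\<bar>cd i \<alpha>\<bar> \<le> (\<Sum>\<alpha>\<in>UNIV. \<bar>cd i \<alpha>\<bar>)" by (rule member_le_sum) auto
    also have "\<dots> \<le> (\<Sum>i\<in>UNIV. \<Sum>\<alpha>\<in>UNIV. \<bar>cd i \<alpha>\<bar>)" by (rule member_le_sum[where f="\<lambda>i. \<Sum>\<alpha>\<in>UNIV. \<bar>cd i \<alpha>\<bar>"]) (auto intro: sum_nonneg)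
    finally have "\<bar>cd i \<alpha>\<bar> \<le> (\<Sum>i\<in>UNIV. \<Sum>\<alpha>\<in>UNIV. \<bar>cd i \<alpha>\<bar>)" .
    moreover have "0 \<le> (\<Sum>i\<in>UNIV. \<bar>cb i\<bar>)" by (intro sum_nonneg) auto
    ultimately show ?thesis using cd[OF that, of i \<alpha>] unfolding c_def by linarith
  qed
  obtain j0 where j0: "c \<le> real j0" using real_arch_simple by blast
  \<comment> \<open>Dropping the first \<open>j0\<close> members of the subsequence puts the
    truncation level of \<open>dc\<close> above the bound \<open>c\<close> of this path, so
    \<open>dc\<close> agrees with \<open>diff\<close> on the entire grid.\<close>
  define q where "q j = r (j + j0)" for j
  have qj: "j + j0 \<le> q j" for j unfolding q_def by (rule seq_suble[OF r])
  then have cq: "c \<le> real (q j)" for j using j0 order_trans[OF le_add2 qj[of j]] by (meson of_nat_mono order_trans)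
  have qlim: "filterlim q at_top sequentially"
    by (rule filterlim_at_top_mono[OF filterlim_ident]) (use add_leD1[OF qj] in \<open>auto intro!: always_eventually\<close>)
  have dc: "dc (q j) i \<alpha> k \<omega> = diff i \<alpha> (real k * \<delta> (q j)) \<omega>" if "k \<le> Suc (q j)" for j i \<alpha> k
  proof -
    have "real k * \<delta> (q j) \<in> {0..T}" by (rule grid_in[OF that])
    then show ?thesis unfolding dc_def using c2 cq[of j] by (intro clip_eq) (meson order_trans)
  qed
  interpret E: euler_path M f T c "\<lambda>j. Suc (q j)" "\<lambda>j. \<delta> (q j)" "\<lambda>s. x (min s (\<tau> \<omega>)) \<omega>" "\<lambda>i s. drift i s \<omega>" "\<lambda>i \<alpha> s. diff i \<alpha> s \<omega>"
    "\<lambda>i \<alpha> s. J i \<alpha> s \<omega>" "\<lambda>j k \<alpha>. dW (q j) k \<alpha> \<omega>" "\<lambda>j k. Z (q j) k \<omega>"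
  proof
    show "open M" "smooth_on M f" "0 < T" by (fact M f T)+
    show "0 < \<delta> (q j)" for j by (rule \<delta>_pos)
    show "(\<lambda>j. \<delta> (q j)) \<longlonglongrightarrow> 0" by (rule filterlim_compose[OF \<delta>_tendsto qlim])
    show "real (Suc (q j)) * \<delta> (q j) = T" for j by (rule \<delta>_N)
    show "continuous_on {0..T} (\<lambda>s. x (min s (\<tau> \<omega>)) \<omega>)"
      by (rule continuous_on_compose2[OF x_continuous[OF \<omega>]]) (use \<tau>[OF \<omega>] in \<open>auto intro!: continuous_intros\<close>)
    show "x (min s (\<tau> \<omega>)) \<omega> \<in> M" if "0 \<le> s" for s using xM[OF \<omega>] \<tau>[OF \<omega>] that by auto
    show "x (min s (\<tau> \<omega>)) \<omega> $ i = x (min 0 (\<tau> \<omega>)) \<omega> $ i + (LBINT u:{0..s}. drift i u \<omega>) + (\<Sum>\<alpha>\<in>UNIV. J i \<alpha> s \<omega>)"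
      if "0 \<le> s" for s i
    proof -
      have "min 0 (\<tau> \<omega>) = 0" using \<tau>[OF \<omega>] by simp
      then show ?thesis using sol[rule_format, OF that, of i] by (simp add: drift_def integral_cut[OF \<omega> that])
    qed
    show "((\<lambda>s. drift i s \<omega>) \<longlongrightarrow> drift i s \<omega>) (at_left s)" "((\<lambda>s. diff i \<alpha> s \<omega>) \<longlongrightarrow> diff i \<alpha> s \<omega>) (at_left s)" if "0 < s" for i \<alpha> s
      using drift_regular diff_regular \<omega> that by (auto simp: regular_process_def)
    show "\<bar>drift i s \<omega>\<bar> \<le> c" "\<bar>diff i \<alpha> s \<omega>\<bar> \<le> c" if "0 \<le> s" "s \<le> T" for i \<alpha> s using c1 c2 that by auto
    show "(\<lambda>s. drift i s \<omega> * indicator {0..T} s) \<in> borel_measurable borel" "(\<lambda>s. diff i \<alpha> s \<omega> * indicator {0..T} s) \<in> borel_measurable borel" for i \<alpha>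
      by (intro regular_path_measurable drift_regular diff_regular \<omega>)+
    show "Z (q j) k \<omega> $ i = x (min 0 (\<tau> \<omega>)) \<omega> $ i + (\<Sum>l<k. drift i (real l * \<delta> (q j)) \<omega> * \<delta> (q j)
        + (\<Sum>\<alpha>\<in>UNIV. diff i \<alpha> (real l * \<delta> (q j)) \<omega> * dW (q j) l \<alpha> \<omega>))" if "k \<le> Suc (q j)" for j k i
      using \<tau>[OF \<omega>] that by (auto simp: Z_def dc intro!: sum.cong)
    show "(\<lambda>j. Max ((\<lambda>k. \<bar>(\<Sum>l<k. diff i \<alpha> (real l * \<delta> (q j)) \<omega> * dW (q j) l \<alpha> \<omega>) - J i \<alpha> (real k * \<delta> (q j)) \<omega>\<bar>) ` {..Suc (q j)})) \<longlonglongrightarrow> 0" for i \<alpha>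
    proof -
      have "martingale_error (q j) i \<alpha> \<omega> = Max ((\<lambda>k. \<bar>(\<Sum>l<k. diff i \<alpha> (real l * \<delta> (q j)) \<omega> * dW (q j) l \<alpha> \<omega>) - J i \<alpha> (real k * \<delta> (q j)) \<omega>\<bar>) ` {..Suc (q j)})" for j
        unfolding martingale_error_def by (intro arg_cong[where f=Max] image_cong refl) (auto simp: dc)
      then show ?thesis using LIMSEQ_ignore_initial_segment[where k=j0, OF mart[of i \<alpha>], folded q_def] by simp
    qed
    show "(\<lambda>j. \<Sum>k<Suc (q j). (dW (q j) k \<alpha> \<omega>)\<^sup>2) \<longlonglongrightarrow> T" for \<alpha>
    proof -
      have "(\<Sum>k<Suc (q j). 1 * (dW (q j) k \<alpha> \<omega> * dW (q j) k \<alpha> \<omega> - (if \<alpha> = \<alpha> then \<delta> (q j) else 0)))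
        = (\<Sum>k<Suc (q j). (dW (q j) k \<alpha> \<omega>)\<^sup>2) - T" for j
        using \<delta>_N[of "q j"] by (simp add: sum_subtractf power2_eq_square del: sum.lessThan_Suc of_nat_Suc)
      then show ?thesis using LIMSEQ_ignore_initial_segment[where k=j0, OF quad1[of \<alpha>], folded q_def] by (simp add: LIM_zero_iff)
    qed
  qed
  have Zc: "eventually (\<lambda>j. \<forall>k\<le>Suc (q j). Z (q j) k \<omega> \<in> M) sequentially" by (rule E.Z_eventually_in_M)
  define raw where "raw \<alpha> j k = (\<Sum>i\<in>UNIV. partial i f (Z (q j) k \<omega>) * diff i \<alpha> (real k * \<delta> (q j)) \<omega>)" for \<alpha> j k
  have rawlim: "E.limit_of (raw \<alpha>) (\<lambda>s. \<Sum>i\<in>UNIV. partial i f (x (min s (\<tau> \<omega>)) \<omega>) * diff i \<alpha> s \<omega>)" for \<alpha>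
    unfolding raw_def
    by (intro E.limit_of_sum E.limit_of_mult E.limit_of_Z E.limit_of_H smooth_on_continuous_on smooth_on_partial f finite)
  \<comment> \<open>After \<tau> the derivatives are evaluated at the stopped point, but
    \<open>diff\<close> is 0 there, and so is \<open>cut\<close>.\<close>
  have heq: "(\<Sum>i\<in>UNIV. partial i f (x (min s (\<tau> \<omega>)) \<omega>) * diff i \<alpha> s \<omega>) = cut (h \<alpha>) s \<omega>" for \<alpha> s
    by (auto simp: cut_def h_def diff_def)
  \<comment> \<open>Eventually neither the truncation nor the guard for \<open>M\<close> acts on
    this path.\<close>
  have Ueq: "eventually (\<lambda>j. \<forall>k<Suc (q j). U (q j) \<alpha> k \<omega> = raw \<alpha> j k) sequentially" for \<alpha>
  proof -
    obtain C K where C: "eventually (\<lambda>j. \<forall>k<Suc (q j). \<bar>raw \<alpha> j k\<bar> \<le> C) sequentially"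
      by (rule E.limit_ofE[OF rawlim])
    have "eventually (\<lambda>j. C \<le> real (q j)) sequentially"
      using filterlim_compose[OF filterlim_real_sequentially qlim] by (auto simp: filterlim_at_top)
    with C Zc show ?thesis
    proof eventually_elim
      case (elim j)
      show ?case
      proof (intro allI impI)
        fix k assume k: "k < Suc (q j)"
        have "(\<Sum>i\<in>UNIV. inM (partial i f) (Z (q j) k \<omega>) * dc (q j) i \<alpha> k \<omega>) = raw \<alpha> j k"
          using elim(2) k by (auto simp: raw_def inM_def dc)
        then show "U (q j) \<alpha> k \<omega> = raw \<alpha> j k"
          unfolding U_def using elim(1,3) k by (metis clip_eq order_trans)
      qed
    qed
  qed
  have en: "(\<lambda>j. energy T (simple_process (Suc (q j)) (\<lambda>k. real k * \<delta> (q j)) (U (q j) \<alpha>)) (cut (h \<alpha>)) \<omega>) \<longlonglongrightarrow> 0" for \<alpha>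
  proof -
    obtain C K where C: "eventually (\<lambda>j. \<forall>k<Suc (q j). \<bar>raw \<alpha> j k\<bar> \<le> C) sequentially" and K: "\<And>s. s \<in> {0..T} \<Longrightarrow> \<bar>cut (h \<alpha>) s \<omega>\<bar> \<le> K"
      by (rule E.limit_ofE[OF rawlim[of \<alpha>, unfolded heq]]) blast
    have "(\<lambda>j. \<integral>\<^sup>+ s\<in>{0..T}. ennreal ((step_fun (Suc (q j)) (\<delta> (q j)) (\<lambda>k. U (q j) \<alpha> k \<omega>) s - cut (h \<alpha>) s \<omega>)\<^sup>2) \<partial>lborel) \<longlonglongrightarrow> 0"
    proof (rule step_fun_tendsto_L2[where c="max C K", OF E.\<delta> E.N_eventually])
      fix s assume s: "0 < s" "s \<le> T"
      have g: "gidx (\<delta> (q j)) s < Suc (q j)" for j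
        by (rule step_fun_gidx(2)[OF \<delta>_pos s(1)]) (use s \<delta>_N in simp)
      have "(\<lambda>j. raw \<alpha> j (gidx (\<delta> (q j)) s)) \<longlonglongrightarrow> cut (h \<alpha>) s \<omega>"
        using rawlim[of \<alpha>] s unfolding E.limit_of_def heq by blast
      moreover have "eventually (\<lambda>j. raw \<alpha> j (gidx (\<delta> (q j)) s) = U (q j) \<alpha> (gidx (\<delta> (q j)) s) \<omega>) sequentially"
        using Ueq[of \<alpha>] by eventually_elim (use g in auto)
      ultimately show "(\<lambda>j. U (q j) \<alpha> (gidx (\<delta> (q j)) s) \<omega>) \<longlonglongrightarrow> cut (h \<alpha>) s \<omega>" by (rule Lim_transform_eventually)
      show "\<bar>cut (h \<alpha>) s \<omega>\<bar> \<le> max C K" using K[of s] s by auto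
    next
      show "eventually (\<lambda>j. \<forall>k<Suc (q j). real k * \<delta> (q j) < T \<longrightarrow> \<bar>U (q j) \<alpha> k \<omega>\<bar> \<le> max C K) sequentially"
        using C Ueq[of \<alpha>] by eventually_elim auto
    qed (rule regular_path_measurable[OF cut_regular[OF continuous_coefficients(3)] \<omega>])
    then show ?thesis by (simp add: energy_def simple_process_eq_step_fun del: sum.lessThan_Suc)
  qed
  \<comment> \<open>Undoes the shift by \<open>j0\<close> between \<open>q\<close> and
    \<open>r\<close>.\<close>
  then show "(\<lambda>n. energy T (simple_process (Suc (r n)) (\<lambda>k. real k * \<delta> (r n)) (U (r n) \<alpha>)) (cut (h \<alpha>)) \<omega>) \<longlonglongrightarrow> 0"
    unfolding q_def by (rule LIMSEQ_offset)
  have "(\<lambda>j. \<Sum>\<alpha>\<in>UNIV. \<Sum>k<Suc (q j). (\<Sum>i\<in>UNIV. partial i f (Z (q j) k \<omega>) * diff i \<alpha> (real k * \<delta> (q j)) \<omega>) * dW (q j) k \<alpha> \<omega>)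
    \<longlonglongrightarrow> f (x (min T (\<tau> \<omega>)) \<omega>) - f (x (min 0 (\<tau> \<omega>)) \<omega>) - (LBINT s:{0..T}. 1/2 * (\<Sum>\<alpha>\<in>UNIV. \<Sum>i\<in>UNIV. \<Sum>p\<in>UNIV.
        partial i (partial p f) (x (min s (\<tau> \<omega>)) \<omega>) * (diff i \<alpha> s \<omega> * diff p \<alpha> s \<omega>))
        + (\<Sum>i\<in>UNIV. partial i f (x (min s (\<tau> \<omega>)) \<omega>) * drift i s \<omega>))"
  proof (rule E.euler_ito[where cl="\<lambda>j. sqrt (sqrt (real (q j)))"])
    show "filterlim (\<lambda>j. sqrt (sqrt (real (q j)))) at_top sequentially"
      by (intro filterlim_compose[OF sqrt_at_top] filterlim_compose[OF filterlim_real_sequentially qlim])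
    fix \<alpha> \<beta>
    have "Q (q j) \<alpha> \<beta> k \<omega> = clip (sqrt (sqrt (real (q j)))) (if Z (q j) k \<omega> \<in> M then E.G j \<alpha> \<beta> k else 0)" if "k < Suc (q j)" for j k
      using that by (auto simp: Q_def E.G_def inM_def dc)
    then have eq: "(\<Sum>k<Suc (q j). clip (sqrt (sqrt (real (q j)))) (if Z (q j) k \<omega> \<in> M then E.G j \<alpha> \<beta> k else 0) *
        (dW (q j) k \<alpha> \<omega> * dW (q j) k \<beta> \<omega> - (if \<alpha> = \<beta> then \<delta> (q j) else 0)))
      = (\<Sum>k<Suc (q j). Q (q j) \<alpha> \<beta> k \<omega> * (dW (q j) k \<alpha> \<omega> * dW (q j) k \<beta> \<omega> - (if \<alpha> = \<beta> then \<delta> (q j) else 0)))" for j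
      by (intro sum.cong refl) simp
    show "(\<lambda>j. \<Sum>k<Suc (q j). clip (sqrt (sqrt (real (q j)))) (if Z (q j) k \<omega> \<in> M then E.G j \<alpha> \<beta> k else 0) *
        (dW (q j) k \<alpha> \<omega> * dW (q j) k \<beta> \<omega> - (if \<alpha> = \<beta> then \<delta> (q j) else 0))) \<longlonglongrightarrow> 0"
      unfolding eq by (rule LIMSEQ_ignore_initial_segment[where k=j0, OF quadQ[of \<alpha> \<beta>], folded q_def])
  qed
  moreover have "f (x (min T (\<tau> \<omega>)) \<omega>) - f (x (min 0 (\<tau> \<omega>)) \<omega>) - (LBINT s:{0..T}. 1/2 * (\<Sum>\<alpha>\<in>UNIV. \<Sum>i\<in>UNIV. \<Sum>p\<in>UNIV.
        partial i (partial p f) (x (min s (\<tau> \<omega>)) \<omega>) * (diff i \<alpha> s \<omega> * diff p \<alpha> s \<omega>))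
        + (\<Sum>i\<in>UNIV. partial i f (x (min s (\<tau> \<omega>)) \<omega>) * drift i s \<omega>)) = remainder \<omega>"
  proof -
    have "1/2 * (\<Sum>\<alpha>\<in>UNIV. \<Sum>i\<in>UNIV. \<Sum>p\<in>UNIV. partial i (partial p f) (x (min s (\<tau> \<omega>)) \<omega>) * (diff i \<alpha> s \<omega> * diff p \<alpha> s \<omega>))
        + (\<Sum>i\<in>UNIV. partial i f (x (min s (\<tau> \<omega>)) \<omega>) * drift i s \<omega>) = cut (generator \<mu> \<sigma> f) s \<omega>" for s
      by (auto simp: cut_def generator_def diff_def drift_def mult_ac)
    moreover have "min 0 (\<tau> \<omega>) = 0" using \<tau>[OF \<omega>] by simp
    ultimately show ?thesis by (simp add: remainder_def)
  qed
  ultimately have "(\<lambda>j. \<Sum>\<alpha>\<in>UNIV. \<Sum>k<Suc (q j). raw \<alpha> j k * dW (q j) k \<alpha> \<omega>) \<longlonglongrightarrow> remainder \<omega>"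
    by (simp add: raw_def del: sum.lessThan_Suc)
  moreover have "eventually (\<lambda>j. (\<Sum>\<alpha>\<in>UNIV. \<Sum>k<Suc (q j). raw \<alpha> j k * dW (q j) k \<alpha> \<omega>) = (\<Sum>\<alpha>\<in>UNIV. \<Sum>k<Suc (q j). U (q j) \<alpha> k \<omega> * dW (q j) k \<alpha> \<omega>)) sequentially"
  proof -
    have "eventually (\<lambda>j. \<forall>\<alpha>. \<forall>k<Suc (q j). U (q j) \<alpha> k \<omega> = raw \<alpha> j k) sequentially"
      by (intro eventually_all_finite Ueq)
    then show ?thesis
      by eventually_elim (auto intro!: sum.cong simp del: sum.lessThan_Suc)
  qed
  ultimately have "(\<lambda>j. \<Sum>\<alpha>\<in>UNIV. \<Sum>k<Suc (q j). U (q j) \<alpha> k \<omega> * dW (q j) k \<alpha> \<omega>) \<longlonglongrightarrow> remainder \<omega>"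
    by (rule Lim_transform_eventually)
  then show "(\<lambda>n. \<Sum>\<alpha>\<in>UNIV. \<Sum>k<Suc (r n). U (r n) \<alpha> k \<omega> * dW (r n) k \<alpha> \<omega>) \<longlonglongrightarrow> remainder \<omega>"
    unfolding q_def by (rule LIMSEQ_offset)
qed

text \<open>The first-order sums converge almost surely to \<open>remainder\<close> along one
  subsequence. They are also simple integrals of processes approximating
  \<open>cut (h \<alpha>)\<close>, hence close in probability to the given integrals
  \<open>K\<close>, and almost surely so along a further subsequence.\<close>

lemma ito_at_time:
  assumes K: "\<And>\<alpha>. has_ito_integral P F (\<lambda>t \<omega>. W t \<omega> $ \<alpha>) (cut (h \<alpha>)) (K \<alpha>)"
  shows "AE \<omega> in P. remainder \<omega> = (\<Sum>\<alpha>\<in>UNIV. K \<alpha> T \<omega>)"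
proof -
  \<comment> \<open>A finite sum type gathers the three kinds of error into one family, so that a
    single subsequence serves all of them.\<close>
  define X where "X v n \<omega> = (case v of
      Inl (i, \<alpha>) \<Rightarrow> martingale_error n i \<alpha> \<omega>
    | Inr (Inl (\<alpha>, \<beta>)) \<Rightarrow> \<Sum>k<Suc n. Q n \<alpha> \<beta> k \<omega> * (dW n k \<alpha> \<omega> * dW n k \<beta> \<omega> - (if \<alpha> = \<beta> then \<delta> n else 0))
    | Inr (Inr \<alpha>) \<Rightarrow> \<Sum>k<Suc n. 1 * (dW n k \<alpha> \<omega> * dW n k \<alpha> \<omega> - (if \<alpha> = \<alpha> then \<delta> n else 0)))" for v :: "('n \<times> 'm) + (('m \<times> 'm) + 'm)" and n \<omega>
  have "vanishes_in_prob (X v)" for v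
  proof -
    have Qb: "\<bar>Q n \<alpha> \<beta> k \<omega>\<bar> \<le> sqrt (sqrt (real n)) + 1" for n \<alpha> \<beta> k \<omega>
      unfolding Q_def by (rule order_trans[OF clip_bound]) auto
    consider i \<alpha> where "v = Inl (i, \<alpha>)" | \<alpha> \<beta> where "v = Inr (Inl (\<alpha>, \<beta>))" | \<alpha> where "v = Inr (Inr \<alpha>)"
      by (metis sum.exhaust surj_pair)
    then show ?thesis
    proof cases
      case 1
      then show ?thesis using martingale_error_vanishes by (simp add: X_def[abs_def])
    next
      case 2
      then show ?thesis
        using quadratic_sum_vanishes[OF Q_measurable Qb] by (simp add: X_def[abs_def] del: sum.lessThan_Suc)
    next
      case 3
      then show ?thesis
        using quadratic_sum_vanishes[of "\<lambda>_ _ _. 1" \<alpha> \<alpha>] by (simp add: X_def[abs_def] del: sum.lessThan_Suc)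
    qed
  qed
  then obtain r where r: "strict_mono r" "AE \<omega> in P. \<forall>v\<in>UNIV. (\<lambda>n. X v (r n) \<omega>) \<longlonglongrightarrow> 0"
    using vanishes_in_prob_subsequence[of UNIV X] by auto
  let ?S = "\<lambda>n \<alpha>. simple_process (Suc (r n)) (\<lambda>k. real k * \<delta> (r n)) (U (r n) \<alpha>)"
  have lims: "AE \<omega> in P. (\<forall>\<alpha>. (\<lambda>n. energy T (?S n \<alpha>) (cut (h \<alpha>)) \<omega>) \<longlonglongrightarrow> 0) \<and>
      (\<lambda>n. \<Sum>\<alpha>\<in>UNIV. \<Sum>k<Suc (r n). U (r n) \<alpha> k \<omega> * dW (r n) k \<alpha> \<omega>) \<longlonglongrightarrow> remainder \<omega>"
    using AE_space r(2) solution
  proof eventually_elim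
    case (elim \<omega>)
    have 1: "(\<lambda>n. martingale_error (r n) i \<alpha> \<omega>) \<longlonglongrightarrow> 0" for i \<alpha>
      using elim(2)[THEN bspec, of "Inl (i, \<alpha>)"] by (simp add: X_def)
    have 2: "(\<lambda>n. \<Sum>k<Suc (r n). Q (r n) \<alpha> \<beta> k \<omega> * (dW (r n) k \<alpha> \<omega> * dW (r n) k \<beta> \<omega> - (if \<alpha> = \<beta> then \<delta> (r n) else 0))) \<longlonglongrightarrow> 0" for \<alpha> \<beta>
      using elim(2)[THEN bspec, of "Inr (Inl (\<alpha>, \<beta>))"] by (simp add: X_def del: sum.lessThan_Suc)
    have 3: "(\<lambda>n. \<Sum>k<Suc (r n). 1 * (dW (r n) k \<alpha> \<omega> * dW (r n) k \<alpha> \<omega> - (if \<alpha> = \<alpha> then \<delta> (r n) else 0))) \<longlonglongrightarrow> 0" for \<alpha>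
      using elim(2)[THEN bspec, of "Inr (Inr \<alpha>)"] by (simp add: X_def del: sum.lessThan_Suc)
    show ?case using pathwise_limit[OF elim(1) r(1) elim(3) 1 2 3] by blast
  qed
  define D where "D \<alpha> n \<omega> = (\<Sum>k<Suc (r n). U (r n) \<alpha> k \<omega> * dW (r n) k \<alpha> \<omega>) - K \<alpha> T \<omega>" for \<alpha> n \<omega>
  have si: "simple_integral (Suc (r n)) (\<lambda>k. real k * \<delta> (r n)) (U (r n) \<alpha>) (\<lambda>t \<omega>. W t \<omega> $ \<alpha>) T \<omega> = (\<Sum>k<Suc (r n). U (r n) \<alpha> k \<omega> * dW (r n) k \<alpha> \<omega>)" for n \<alpha> \<omega>
    using simple_integral_equidistant[OF \<delta>_pos order_refl, of "Suc (r n)" "r n" "U (r n) \<alpha>" "\<lambda>t \<omega>. W t \<omega> $ \<alpha>" \<omega>]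
    by (simp only: \<delta>_N dW_def)
  have "vanishes_in_prob (D \<alpha>)" for \<alpha>
    unfolding vanishes_in_prob_def
  proof (intro conjI allI impI)
    have "K \<alpha> T \<in> borel_measurable P" using K[of \<alpha>] T by (simp add: has_ito_integral_def)
    moreover have "(\<lambda>\<omega>. \<Sum>k<Suc (r n). U (r n) \<alpha> k \<omega> * dW (r n) k \<alpha> \<omega>) \<in> borel_measurable P" for n
      unfolding si[symmetric] by (rule simple_integral_measurable[OF U_simple_data]) (use T in simp)
    ultimately show "D \<alpha> n \<in> borel_measurable P" for n unfolding D_def[abs_def] by (intro borel_measurable_diff)
    fix \<epsilon> :: real assume \<epsilon>: "0 < \<epsilon>"
    have "(\<lambda>n. prob {\<omega>\<in>space P. \<exists>s\<in>{T}. \<epsilon> < \<bar>simple_integral (Suc (r n)) (\<lambda>k. real k * \<delta> (r n)) (U (r n) \<alpha>) (\<lambda>t \<omega>. W t \<omega> $ \<alpha>) s \<omega> - K \<alpha> s \<omega>\<bar>}) \<longlonglongrightarrow> 0"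
    proof (rule ito_integral_approximation[OF K U_simple_data, where T=T])
      fix \<epsilon> :: real assume \<epsilon>: "0 < \<epsilon>"
      show "(\<lambda>n. prob {\<omega>\<in>space P. ennreal \<epsilon> < energy T (?S n \<alpha>) (cut (h \<alpha>)) \<omega>}) \<longlonglongrightarrow> 0"
      proof (rule prob_tendsto_0_of_AE)
        show "{\<omega>\<in>space P. ennreal \<epsilon> < energy T (?S n \<alpha>) (cut (h \<alpha>)) \<omega>} \<in> events" for n
          using energy_measurable[OF progressive_simple[OF U_simple_data] regular_progressive[OF cut_regular[OF continuous_coefficients(3)]] less_imp_le[OF T]]
          by measurable
        show "AE \<omega> in P. eventually (\<lambda>n. \<omega> \<notin> {\<omega>\<in>space P. ennreal \<epsilon> < energy T (?S n \<alpha>) (cut (h \<alpha>)) \<omega>}) sequentially"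
          using lims
        proof eventually_elim
          case (elim \<omega>)
          then have "(\<lambda>n. energy T (?S n \<alpha>) (cut (h \<alpha>)) \<omega>) \<longlonglongrightarrow> 0" by blast
          then have "eventually (\<lambda>n. energy T (?S n \<alpha>) (cut (h \<alpha>)) \<omega> < ennreal \<epsilon>) sequentially"
            using \<epsilon> by (intro order_tendstoD(2)) auto
          then show ?case by (rule eventually_mono) auto
        qed
      qed
    qed (use T \<epsilon> in auto)
    then show "(\<lambda>n. prob {\<omega>\<in>space P. \<epsilon> < \<bar>D \<alpha> n \<omega>\<bar>}) \<longlonglongrightarrow> 0" by (simp add: si D_def del: sum.lessThan_Suc)
  qed
  \<comment> \<open>This second subsequence is taken inside \<open>r\<close>, so the limits already
    obtained along \<open>r\<close> persist.\<close>
  then obtain r' where r': "strict_mono r'" "AE \<omega> in P. \<forall>\<alpha>\<in>UNIV. (\<lambda>n. D \<alpha> (r' n) \<omega>) \<longlonglongrightarrow> 0"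
    using vanishes_in_prob_subsequence[of UNIV D] by auto
  from lims r'(2) show ?thesis
  proof eventually_elim
    case (elim \<omega>)
    let ?A = "\<lambda>n. \<Sum>\<alpha>\<in>UNIV. \<Sum>k<Suc (r n). U (r n) \<alpha> k \<omega> * dW (r n) k \<alpha> \<omega>"
    have "(\<lambda>n. ?A (r' n)) \<longlonglongrightarrow> remainder \<omega>"
      using LIMSEQ_subseq_LIMSEQ[OF conjunct2[OF elim(1)] r'(1)] by (simp add: o_def del: sum.lessThan_Suc)
    moreover have "(\<lambda>n. (\<Sum>\<alpha>\<in>UNIV. D \<alpha> (r' n) \<omega>) + (\<Sum>\<alpha>\<in>UNIV. K \<alpha> T \<omega>)) \<longlonglongrightarrow> (\<Sum>\<alpha>\<in>(UNIV :: 'm set). 0) + (\<Sum>\<alpha>\<in>UNIV. K \<alpha> T \<omega>)"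
      using elim(2) by (intro tendsto_add tendsto_sum tendsto_const) auto
    moreover have "(\<Sum>\<alpha>\<in>UNIV. D \<alpha> (r' n) \<omega>) + (\<Sum>\<alpha>\<in>UNIV. K \<alpha> T \<omega>) = ?A (r' n)" for n
      by (simp add: D_def sum_subtractf del: sum.lessThan_Suc)
    ultimately show "remainder \<omega> = (\<Sum>\<alpha>\<in>UNIV. K \<alpha> T \<omega>)"
      using LIMSEQ_unique[of "\<lambda>n. ?A (r' n)" "remainder \<omega>" "\<Sum>\<alpha>\<in>UNIV. K \<alpha> T \<omega>"]
      by (simp del: sum.lessThan_Suc)
  qed
qed

end

context ito_process
begin

text \<open>\<open>ito_at_time\<close> holds outside a null set depending on the time. Countably
  many rational times share one null set, and continuity in time of all terms extends the identity
  to every \<open>t\<close>.\<close>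

lemma ito_formula:
  fixes f :: "real^'n \<Rightarrow> real"
  assumes f: "smooth_on M f"
    and K: "\<And>\<alpha>. has_ito_integral P F (\<lambda>t \<omega>. W t \<omega> $ \<alpha>) (cut (\<lambda>y. \<Sum>i\<in>UNIV. partial i f y * \<sigma> y $ i $ \<alpha>)) (K \<alpha>)"
  shows "AE \<omega> in P. \<forall>t\<ge>0. f (x (min t (\<tau> \<omega>)) \<omega>) - f (x 0 \<omega>)
    = (LBINT s:{0..min t (\<tau> \<omega>)}. generator \<mu> \<sigma> f (x s \<omega>)) + (\<Sum>\<alpha>\<in>UNIV. K \<alpha> t \<omega>)"
proof -
  let ?R = "\<lambda>t \<omega>. f (x (min t (\<tau> \<omega>)) \<omega>) - f (x 0 \<omega>) - (LBINT s:{0..t}. cut (generator \<mu> \<sigma> f) s \<omega>) - (\<Sum>\<alpha>\<in>UNIV. K \<alpha> t \<omega>)"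
  have fixed: "AE \<omega> in P. ?R t \<omega> = 0" if t: "0 < t" for t
  proof -
    interpret euler_scheme P F W M \<mu> \<sigma> x \<tau> J f t by unfold_locales (fact f t)+
    have "h \<alpha> = (\<lambda>y. \<Sum>i\<in>UNIV. partial i f y * \<sigma> y $ i $ \<alpha>)" for \<alpha> by (simp add: h_def[abs_def])
    then have "AE \<omega> in P. remainder \<omega> = (\<Sum>\<alpha>\<in>UNIV. K \<alpha> t \<omega>)" using K by (intro ito_at_time) simp
    then show ?thesis by eventually_elim (simp add: remainder_def)
  qed
  have "AE \<omega> in P. \<forall>t\<in>\<rat>. 0 < t \<longrightarrow> ?R t \<omega> = 0"
    using fixed by (subst AE_ball_countable[OF countable_rat]) (auto intro: AE_I2)
  moreover have "AE \<omega> in P. \<forall>\<alpha>. continuous_on {0..} (\<lambda>t. K \<alpha> t \<omega>)"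
    using K by (subst AE_all_countable) (auto simp: has_ito_integral_def)
  ultimately show ?thesis
    using AE_space
  proof eventually_elim
    case (elim \<omega>)
    have g: "continuous_on M (generator \<mu> \<sigma> f)"
      by (intro smooth_on_continuous_on smooth_on_generator M smooth_\<mu> smooth_\<sigma> f)
    have "continuous_on {0..} (\<lambda>t. x (min t (\<tau> \<omega>)) \<omega>)"
      by (rule continuous_on_compose2[OF x_continuous[OF elim(3)]]) (use \<tau>[OF elim(3)] in \<open>auto intro!: continuous_intros\<close>)
    then have "continuous_on {0..} (\<lambda>t. f (x (min t (\<tau> \<omega>)) \<omega>))"
      by (rule continuous_on_compose2[OF smooth_on_continuous_on[OF f]]) (use xM[OF elim(3)] \<tau>[OF elim(3)] in auto)
    then have c: "continuous_on {0..} (\<lambda>t. \<bar>?R t \<omega>\<bar>)"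
      using elim(2) continuous_integral_cut[OF g elim(3)] by (intro continuous_intros) auto
    show ?case
    proof (intro allI impI)
      fix t :: real assume t: "0 \<le> t"
      \<comment> \<open>The bound \<open>t + 1\<close> leaves rationals to the right of
        \<open>t\<close>, so that \<open>t = 0\<close> is included.\<close>
      have "\<bar>?R t \<omega>\<bar> \<le> 0"
        by (rule le_on_rationals_imp_le[OF c, of "t + 1"]) (use elim(1) t in auto)
      then show "f (x (min t (\<tau> \<omega>)) \<omega>) - f (x 0 \<omega>)
        = (LBINT s:{0..min t (\<tau> \<omega>)}. generator \<mu> \<sigma> f (x s \<omega>)) + (\<Sum>\<alpha>\<in>UNIV. K \<alpha> t \<omega>)"
        using integral_cut[OF elim(3) t] by simp
    qed
  qed
qed

end

section \<open>Reduction of stochastic differential equations\<close>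

text \<open>The derivative of \<open>g\<close> at \<open>x\<close> is linear and vanishes on the
  generators. For reduction vector fields the span is the kernel of the Jacobian, which is the form
  \<open>smooth_factorization\<close> asks for.\<close>

lemma frechet_derivative_span_eq_0:
  fixes g :: "real^'n \<Rightarrow> real"
  assumes g: "g differentiable (at x)" and der: "\<And>i. i \<in> I \<Longrightarrow> derivation (Y i) g x = 0"
    and v: "v \<in> span ((\<lambda>i. Y i x) ` I)"
  shows "frechet_derivative g (at x) v = 0"
proof -
  have lin: "linear (frechet_derivative g (at x))" by (rule linear_frechet_derivative[OF g])
  have "frechet_derivative g (at x) (Y i x) = 0" if "i \<in> I" for i
    using der[OF that] frechet_derivative_partial[OF g] by (simp add: derivation_def)
  then show ?thesis
    using linear_eq_0_on_span[OF lin _ v] by auto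
qed

text \<open>Components may lie in any Euclidean space, so for a matrix the lemma is applied twice,
  to the rows and then to the entries of a row.\<close>

lemma smooth_factorization_vec:
  fixes \<Psi> :: "real^'n \<Rightarrow> real^'p" and g :: "real^'n \<Rightarrow> 'b::euclidean_space^'q"
  assumes M: "open M" and red: "reduction_map M M' \<Psi>"
    and g: "\<And>a. smooth_on M (\<lambda>x. g x $ a)"
    and fac: "\<And>a. \<exists>g'. smooth_on M' g' \<and> (\<forall>x\<in>M. g x $ a = g' (\<Psi> x))"
  shows "\<exists>g'. smooth_on M' g' \<and> (\<forall>x\<in>M. g x = g' (\<Psi> x))"
proof -
  have M': "open M'" using red by (simp add: reduction_map_def)
  obtain g' where g': "\<And>a. smooth_on M' (g' a)" "\<And>a x. x \<in> M \<Longrightarrow> g x $ a = g' a (\<Psi> x)"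
    using fac by metis
  have "smooth_on M' (\<lambda>y. \<chi> a. g' a y)" by (rule smooth_on_vec_lambda[OF M']) (simp add: g'(1))
  moreover have "\<forall>x\<in>M. g x = (\<lambda>y. \<chi> a. g' a y) (\<Psi> x)" using g'(2) by (simp add: vec_eq_iff)
  ultimately show ?thesis by blast
qed

lemma generator_smooth_on_vec:
  fixes f :: "real^'n \<Rightarrow> real^'p"
  assumes "open M" "smooth_on M \<mu>" "smooth_on M \<sigma>" "smooth_on M f"
  shows "smooth_on M (\<lambda>x. generator \<mu> \<sigma> f x $ a)"
proof -
  have "smooth_on M (generator \<mu> \<sigma> (\<lambda>y. f y $ a))"
    by (intro smooth_on_generator smooth_on_vec_nth assms)
  then show ?thesis
    using smooth_on_cong[OF assms(1), of "\<lambda>x. generator \<mu> \<sigma> f x $ a"] generator_vec_nth[OF assms(1,4)] by blast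
qed

lemma reduced_coefficients_exist:
  fixes \<Psi> :: "real^'n \<Rightarrow> real^'p" and \<sigma> :: "real^'n \<Rightarrow> real^'m^'n"
  assumes M: "open M" and sde: "is_SDE M \<mu> \<sigma>" and red: "reduction_map M M' \<Psi>"
    and Y: "reduction_vector_fields M \<Psi> r k Y"
    and symm: "\<And>i. i \<in> {1..k} \<Longrightarrow> quasi_strong_symmetry M \<mu> \<sigma> (Y i) (C i)"
    and deg: "\<And>i x. i \<in> {1..k} \<Longrightarrow> x \<in> M \<Longrightarrow> jacobian \<Psi> (at x) ** \<sigma> x ** C i x = 0"
  shows "\<exists>\<mu>' \<sigma>'. reduced_SDE M M' \<Psi> \<mu> \<sigma> \<mu>' \<sigma>'"
proof -
  have sm: "smooth_on M \<mu>" "smooth_on M \<sigma>" "smooth_on M \<Psi>"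
    using sde red by (auto simp: is_SDE_def reduction_map_def)
  have dif: "\<Psi> differentiable (at x)" if "x \<in> M" for x by (rule smooth_on_differentiable[OF sm(3) that])
  have jac: "jacobian \<Psi> (at x) *v v = frechet_derivative \<Psi> (at x) v" if "x \<in> M" for x v
    unfolding jacobian_def using matrix_vector_mul(2)[OF linear_frechet_derivative[OF dif[OF that]]] by metis
  have span: "v \<in> span ((\<lambda>i. Y i x) ` {1..k})" if "x \<in> M" "frechet_derivative \<Psi> (at x) v = 0" for x v
    using Y that jac[OF that(1)] by (auto simp: reduction_vector_fields_def)
  have Y\<Psi>: "derivation (Y i) (\<lambda>y. \<Psi> y $ a) x = 0" if "i \<in> {1..k}" "x \<in> M" for i x a
  proof -
    have "Y i x \<in> {v. jacobian \<Psi> (at x) *v v = 0}"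
      using Y that span_base[of "Y i x" "(\<lambda>i. Y i x) ` {1..k}"] by (auto simp: reduction_vector_fields_def)
    then have "frechet_derivative \<Psi> (at x) (Y i x) = 0" using jac[OF that(2)] by simp
    then have "derivation (Y i) \<Psi> x = 0"
      using frechet_derivative_partial[OF dif[OF that(2)]] by (simp add: derivation_def)
    then show ?thesis using derivation_vec_nth[OF dif[OF that(2)], of "Y i" a] by simp
  qed
  have sm\<Psi>: "smooth_on M (\<lambda>y. \<Psi> y $ a)" for a by (rule smooth_on_vec_nth[OF M sm(3)])
  have factor: "\<exists>g'. smooth_on M' g' \<and> (\<forall>x\<in>M. g x = g' (\<Psi> x))"
    if g: "smooth_on M g" and der: "\<And>i x. i \<in> {1..k} \<Longrightarrow> x \<in> M \<Longrightarrow> derivation (Y i) g x = 0" for g :: "real^'n \<Rightarrow> real"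
  proof -
    have "frechet_derivative g (at x) v = 0" if "x \<in> M" "frechet_derivative \<Psi> (at x) v = 0" for x v
      by (rule frechet_derivative_span_eq_0[OF smooth_on_differentiable[OF g that(1)] der span[OF that]]) (use that in auto)
    from smooth_factorization[OF M red g this] show ?thesis by metis
  qed
  have drift: "\<exists>\<mu>'. smooth_on M' \<mu>' \<and> (\<forall>x\<in>M. generator \<mu> \<sigma> \<Psi> x = \<mu>' (\<Psi> x))"
  proof (rule smooth_factorization_vec[OF M red])
    fix a
    show "smooth_on M (\<lambda>x. generator \<mu> \<sigma> \<Psi> x $ a)" by (rule generator_smooth_on_vec[OF M sm])
    have "\<exists>g'. smooth_on M' g' \<and> (\<forall>x\<in>M. generator \<mu> \<sigma> (\<lambda>y. \<Psi> y $ a) x = g' (\<Psi> x))"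
      by (rule factor[OF smooth_on_generator[OF M sm(1,2) sm\<Psi>]])
        (rule derivation_generator_eq_0[OF M sde symm sm\<Psi> Y\<Psi>])
    then show "\<exists>g'. smooth_on M' g' \<and> (\<forall>x\<in>M. generator \<mu> \<sigma> \<Psi> x $ a = g' (\<Psi> x))"
      by (simp add: generator_vec_nth[OF M sm(3)])
  qed
  have ent: "(jacobian \<Psi> (at x) ** \<sigma> x) $ a $ \<alpha> = (\<Sum>j\<in>UNIV. partial j (\<lambda>y. \<Psi> y $ a) x * \<sigma> x $ j $ \<alpha>)" if "x \<in> M" for x a \<alpha>
    by (simp add: matrix_matrix_mult_def jacobian_nth partial_vec_nth[OF dif[OF that]])
  have diffusion: "\<exists>\<sigma>'. smooth_on M' \<sigma>' \<and> (\<forall>x\<in>M. jacobian \<Psi> (at x) ** \<sigma> x = \<sigma>' (\<Psi> x))"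
  proof (rule smooth_factorization_vec[OF M red])
    fix a
    have ent_smooth: "smooth_on M (\<lambda>x. \<Sum>j\<in>UNIV. partial j (\<lambda>y. \<Psi> y $ a) x * \<sigma> x $ j $ \<alpha>)" for \<alpha>
      by (intro smooth_on_sum smooth_on_mult smooth_on_partial M sm\<Psi> smooth_on_vec_nth sm(2))
    then have cs: "smooth_on M (\<lambda>x. (jacobian \<Psi> (at x) ** \<sigma> x) $ a $ \<alpha>)" for \<alpha>
      using smooth_on_cong[OF M, of "\<lambda>x. (jacobian \<Psi> (at x) ** \<sigma> x) $ a $ \<alpha>", OF ent] by blast
    then show "smooth_on M (\<lambda>x. (jacobian \<Psi> (at x) ** \<sigma> x) $ a)" by (rule smooth_on_vec_lambda[OF M])
    show "\<exists>g'. smooth_on M' g' \<and> (\<forall>x\<in>M. (jacobian \<Psi> (at x) ** \<sigma> x) $ a = g' (\<Psi> x))"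
    proof (rule smooth_factorization_vec[OF M red])
      fix \<alpha>
      show "smooth_on M (\<lambda>x. (jacobian \<Psi> (at x) ** \<sigma> x) $ a $ \<alpha>)" by (rule cs)
      have "\<exists>g'. smooth_on M' g' \<and> (\<forall>x\<in>M. (\<Sum>j\<in>UNIV. partial j (\<lambda>y. \<Psi> y $ a) x * \<sigma> x $ j $ \<alpha>) = g' (\<Psi> x))"
      proof (rule factor[OF ent_smooth])
        fix i x assume ix: "i \<in> {1..k}" "x \<in> M"
        have "(jacobian \<Psi> (at x) ** (\<sigma> x ** C i x)) $ a $ \<alpha> = 0"
          using deg[OF ix] by (simp add: matrix_mul_assoc)
        then have "(\<Sum>j\<in>UNIV. partial j (\<lambda>y. \<Psi> y $ a) x * (\<Sum>\<beta>\<in>UNIV. \<sigma> x $ j $ \<beta> * C i x $ \<beta> $ \<alpha>)) = 0"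
          by (simp add: matrix_matrix_mult_def jacobian_nth partial_vec_nth[OF dif[OF ix(2)]])
        then show "derivation (Y i) (\<lambda>x. \<Sum>j\<in>UNIV. partial j (\<lambda>y. \<Psi> y $ a) x * \<sigma> x $ j $ \<alpha>) x = 0"
          using derivation_diffusion_eq_0[OF M sde symm[OF ix(1)] sm\<Psi> Y\<Psi>[OF ix(1)] ix(2)] by simp
      qed
      then show "\<exists>g'. smooth_on M' g' \<and> (\<forall>x\<in>M. (jacobian \<Psi> (at x) ** \<sigma> x) $ a $ \<alpha> = g' (\<Psi> x))"
        by (simp add: ent)
    qed
  qed
  show ?thesis using drift diffusion unfolding reduced_SDE_def is_SDE_def by metis
qed

section \<open>Transport of processes along the reduction map\<close>

lemma explosion_time_map_process: "explosion_time (map_process \<Psi> X) \<omega> = explosion_time X \<omega>"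
  by (simp add: explosion_time_def map_process_def)

lemma explosion_time_lessD:
  assumes "process_on P M X" "\<omega> \<in> space P" "0 \<le> s" "ereal s < explosion_time X \<omega>"
  obtains y where "X s \<omega> = Some y" "y \<in> M"
proof -
  have "X s \<omega> \<noteq> None" using assms by (auto simp: process_on_def)
  then show ?thesis using that assms by (auto simp: process_on_def)
qed

lemma process_on_map:
  assumes X: "process_on P M X" and \<Psi>: "continuous_on M \<Psi>" "\<Psi> ` M \<subseteq> M'"
  shows "process_on P M' (map_process \<Psi> X)"
  unfolding process_on_def explosion_time_map_process
proof (intro ballI conjI allI impI)
  fix \<omega> assume \<omega>: "\<omega> \<in> space P"
  show "map_process \<Psi> X t \<omega> = None \<longleftrightarrow> explosion_time X \<omega> \<le> ereal t" if "0 \<le> t" for t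
    using X \<omega> that by (auto simp: process_on_def map_process_def)
  show "y \<in> M'" if "0 \<le> t" "map_process \<Psi> X t \<omega> = Some y" for t y
    using X \<omega> that \<Psi>(2) by (auto simp: process_on_def map_process_def)
  let ?A = "{t. 0 \<le> t \<and> ereal t < explosion_time X \<omega>}"
  have "continuous_on ?A (\<lambda>t. \<Psi> (the (X t \<omega>)))"
  proof (rule continuous_on_compose2[OF \<Psi>(1)])
    show "continuous_on ?A (\<lambda>t. the (X t \<omega>))" using X \<omega> by (auto simp: process_on_def)
    show "(\<lambda>t. the (X t \<omega>)) ` ?A \<subseteq> M" using explosion_time_lessD[OF X \<omega>] by force
  qed
  then show "continuous_on ?A (\<lambda>t. the (map_process \<Psi> X t \<omega>))"
  proof (rule continuous_on_eq)
    fix t assume "t \<in> ?A"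
    then obtain y where "X t \<omega> = Some y" using explosion_time_lessD[OF X \<omega>, of t] by auto
    then show "\<Psi> (the (X t \<omega>)) = the (map_process \<Psi> X t \<omega>)" by (simp add: map_process_def)
  qed
qed

text \<open>\<Psi> is known to be Borel on \<open>M\<close> only. As the process takes its values in
  \<open>M\<close> before explosion, intersecting preimages with the open set \<open>M\<close>
  changes no event.\<close>

lemma adapted_to_map:
  fixes \<Psi> :: "real^'n \<Rightarrow> real^'p"
  assumes X: "process_on P M X" "adapted_to P F X" and M: "open M" and \<Psi>: "continuous_on M \<Psi>"
  shows "adapted_to P F (map_process \<Psi> X)"
  unfolding adapted_to_def
proof (intro allI impI ballI)
  fix t :: real and B assume t: "0 \<le> t" and B: "B \<in> sets (borel :: (real^'p) measure)"
  have "\<Psi> \<in> borel_measurable (restrict_space borel M)" by (rule borel_measurable_continuous_on_restrict[OF \<Psi>])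
  from measurable_sets[OF this B] have "\<Psi> -` B \<inter> M \<in> sets borel"
    using M by (simp add: space_restrict_space sets_restrict_space_iff)
  then have "{\<omega>\<in>space P. X t \<omega> \<in> Some ` (\<Psi> -` B \<inter> M)} \<in> sets (F t)" using X(2) t by (auto simp: adapted_to_def)
  moreover have "{\<omega>\<in>space P. X t \<omega> \<in> Some ` (\<Psi> -` B \<inter> M)} = {\<omega>\<in>space P. map_process \<Psi> X t \<omega> \<in> Some ` B}"
    using X(1) t by (auto simp: map_process_def process_on_def)
  ultimately show "{\<omega>\<in>space P. map_process \<Psi> X t \<omega> \<in> Some ` B} \<in> sets (F t)" by simp
qed

text \<open>The definition looks at the integrand only at nonnegative times and on
  \<open>space P\<close>. The equality is available just there, because \<sigma>' is tied to
  \<sigma> on values of the process.\<close>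

lemma has_ito_integral_cong:
  assumes "has_ito_integral P F B H I" and eq: "\<And>s \<omega>. \<omega> \<in> space P \<Longrightarrow> 0 \<le> s \<Longrightarrow> H' s \<omega> = H s \<omega>"
    and sp: "\<And>t. space (F t) = space P"
  shows "has_ito_integral P F B H' I"
proof -
  have "progressive F H' \<longleftrightarrow> progressive F H"
    unfolding progressive_def
    by (intro all_cong measurable_cong) (auto simp: space_pair_measure space_restrict_space sp eq)
  moreover have "(\<integral>\<^sup>+ s\<in>{0..T}. ennreal ((H' s \<omega>)\<^sup>2) \<partial>lborel) = (\<integral>\<^sup>+ s\<in>{0..T}. ennreal ((H s \<omega>)\<^sup>2) \<partial>lborel)"
    "(\<integral>\<^sup>+ s\<in>{0..T}. ennreal ((S s \<omega> - H' s \<omega>)\<^sup>2) \<partial>lborel) = (\<integral>\<^sup>+ s\<in>{0..T}. ennreal ((S s \<omega> - H s \<omega>)\<^sup>2) \<partial>lborel)"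
    if "\<omega> \<in> space P" for T \<omega> and S :: "real \<Rightarrow> 'a \<Rightarrow> real"
    using eq[OF that] by (auto intro!: nn_integral_cong simp: indicator_def)
  ultimately show ?thesis
    using assms(1) unfolding has_ito_integral_def by (simp cong: AE_cong_simp conj_cong)
qed

text \<open>Ito's formula for the components of \<Psi>: by the two identities of
  \<open>reduced_SDE\<close>, the drift L \<Psi> and the diffusion \<nabla>\<Psi> \<sigma> along X
  are \<mu>' and \<sigma>' along \<Psi>(X). The integrals of the new integrands have to be produced,
  which the regularity of stopped continuous coefficients allows.\<close>

lemma solution_reduces:
  fixes \<Psi> :: "real^'n \<Rightarrow> real^'p" and \<sigma> :: "real^'n \<Rightarrow> real^'m^'n" and P :: "'w measure"
  assumes M: "open M" and sde: "is_SDE M \<mu> \<sigma>" and red: "reduction_map M M' \<Psi>"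
    and rs: "reduced_SDE M M' \<Psi> \<mu> \<sigma> \<mu>' \<sigma>'" and sol: "solves_SDE_until M \<mu> \<sigma> P F X W \<tau>"
  shows "solves_SDE_until M' \<mu>' \<sigma>' P F (map_process \<Psi> X) W \<tau>"
proof -
  have sm: "smooth_on M \<mu>" "smooth_on M \<sigma>" "smooth_on M \<Psi>" and im: "\<Psi> ` M = M'"
    using sde red by (auto simp: is_SDE_def reduction_map_def)
  have \<Psi>c: "continuous_on M \<Psi>" by (rule smooth_on_continuous_on[OF sm(3)])
  have fp: "filtered_prob_space P F" and X: "process_on P M X" and ad: "adapted_to P F X" and bm: "brownian_motion P F W"
    and st: "stopping_time F \<tau>" and \<tau>: "\<And>\<omega>. \<omega> \<in> space P \<Longrightarrow> 0 \<le> \<tau> \<omega>" "\<And>\<omega>. \<omega> \<in> space P \<Longrightarrow> ereal (\<tau> \<omega>) < explosion_time X \<omega>"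
    using sol by (auto simp: solves_SDE_until_def)
  obtain J where J: "\<And>i \<alpha>. has_ito_integral P F (\<lambda>t \<omega>. W t \<omega> $ \<alpha>) (\<lambda>s \<omega>. if s \<le> \<tau> \<omega> then \<sigma> (the (X s \<omega>)) $ i $ \<alpha> else 0) (J i \<alpha>)"
    and eqn: "AE \<omega> in P. \<forall>t\<ge>0. \<forall>i. the (X (min t (\<tau> \<omega>)) \<omega>) $ i - the (X 0 \<omega>) $ i =
             (LBINT s:{0..min t (\<tau> \<omega>)}. \<mu> (the (X s \<omega>)) $ i) + (\<Sum>\<alpha>\<in>UNIV. J i \<alpha> t \<omega>)"
    using sol unfolding solves_SDE_until_def by blast
  have before: "ereal s < explosion_time X \<omega>" if "\<omega> \<in> space P" "s \<le> \<tau> \<omega>" for \<omega> s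
    using \<tau>(2)[OF that(1)] that(2) by (metis ereal_less_eq(3) le_less_trans)
  have val: "\<exists>y. X s \<omega> = Some y \<and> y \<in> M" if "\<omega> \<in> space P" "0 \<le> s" "s \<le> \<tau> \<omega>" for \<omega> s
    using explosion_time_lessD[OF X that(1,2) before[OF that(1,3)]] by blast
  interpret prob_space P using fp by (simp add: filtered_prob_space_def)
  interpret B: brownian_space P F W by unfold_locales (fact fp bm)+
  interpret I: ito_process P F W M \<mu> \<sigma> "\<lambda>s \<omega>. the (X s \<omega>)" \<tau> J
  proof
    show "open M" "smooth_on M \<mu>" "smooth_on M \<sigma>" by (fact M sm)+
    fix \<omega> assume \<omega>: "\<omega> \<in> space P"
    show "0 \<le> \<tau> \<omega>" by (rule \<tau>(1)[OF \<omega>])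
    show "the (X s \<omega>) \<in> M" if "0 \<le> s" "s \<le> \<tau> \<omega>" for s using val[OF \<omega> that] by auto
    show "continuous_on {0..\<tau> \<omega>} (\<lambda>s. the (X s \<omega>))"
    proof (rule continuous_on_subset)
      show "continuous_on {t. 0 \<le> t \<and> ereal t < explosion_time X \<omega>} (\<lambda>t. the (X t \<omega>))"
        using X \<omega> by (auto simp: process_on_def)
    qed (use before[OF \<omega>] in auto)
  next
    fix h :: "real^'n \<Rightarrow> real" and s :: real assume h: "continuous_on M h" and s: "0 \<le> s"
    show "(\<lambda>\<omega>. if s \<le> \<tau> \<omega> then h (the (X s \<omega>)) else 0) \<in> borel_measurable (F s)"
    proof (rule measurableI)
      fix A :: "real set" assume A: "A \<in> sets borel"
      have "h \<in> borel_measurable (restrict_space borel M)" by (rule borel_measurable_continuous_on_restrict[OF h])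
      from measurable_sets[OF this A] have "h -` A \<inter> M \<in> sets borel"
        using M by (simp add: space_restrict_space sets_restrict_space_iff)
      then have 1: "{\<omega>\<in>space P. X s \<omega> \<in> Some ` (h -` A \<inter> M)} \<in> sets (F s)" using ad s by (auto simp: adapted_to_def)
      \<comment> \<open>The complement, \<tau> strictly before \<open>s\<close>, is a countable
        union of events at earlier times. These times may be negative, where the filtration is
        defined too, and no right-continuity of it enters.\<close>
      have 2: "{\<omega>\<in>space P. s \<le> \<tau> \<omega>} \<in> sets (F s)"
      proof -
        have "{\<omega>\<in>space P. \<tau> \<omega> \<le> s - 1 / real (Suc n)} \<in> sets (F s)" for n
        proof -
          have "{\<omega>\<in>space (F (s - 1 / real (Suc n))). \<tau> \<omega> \<le> s - 1 / real (Suc n)} \<in> sets (F (s - 1 / real (Suc n)))"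
            using stopping_timeD[OF st] by (simp add: pred_def)
          then show ?thesis using B.sets_F_mono[of "s - 1 / real (Suc n)" s] by auto
        qed
        then have "space (F s) - (\<Union>n. {\<omega>\<in>space P. \<tau> \<omega> \<le> s - 1 / real (Suc n)}) \<in> sets (F s)"
          by (intro sets.compl_sets sets.countable_UN) auto
        moreover have "space (F s) - (\<Union>n. {\<omega>\<in>space P. \<tau> \<omega> \<le> s - 1 / real (Suc n)}) = {\<omega>\<in>space P. s \<le> \<tau> \<omega>}"
        proof -
          have "s \<le> \<tau> \<omega> \<longleftrightarrow> (\<forall>n. \<not> \<tau> \<omega> \<le> s - 1 / real (Suc n))" for \<omega>
          proof
            assume a: "\<forall>n. \<not> \<tau> \<omega> \<le> s - 1 / real (Suc n)"
            show "s \<le> \<tau> \<omega>"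
            proof (rule ccontr)
              assume "\<not> s \<le> \<tau> \<omega>"
              then obtain n where "inverse (real (Suc n)) < s - \<tau> \<omega>" using reals_Archimedean[of "s - \<tau> \<omega>"] by auto
              then show False using a[rule_format, of n] by (simp add: inverse_eq_divide)
            qed
          next
            assume a: "s \<le> \<tau> \<omega>"
            have "0 < 1 / real (Suc n)" for n by simp
            then show "\<forall>n. \<not> \<tau> \<omega> \<le> s - 1 / real (Suc n)" using a by (smt (verit))
          qed
          then show ?thesis by auto
        qed
        ultimately show ?thesis by simp
      qed
      \<comment> \<open>After \<tau> the function has the value 0, so these \<omega> belong to the
        preimage exactly when \<open>0 \<in> A\<close>.\<close>
      have "(\<lambda>\<omega>. if s \<le> \<tau> \<omega> then h (the (X s \<omega>)) else 0) -` A \<inter> space (F s)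
        = ({\<omega>\<in>space P. s \<le> \<tau> \<omega>} \<inter> {\<omega>\<in>space P. X s \<omega> \<in> Some ` (h -` A \<inter> M)})
          \<union> (if 0 \<in> A then space (F s) - {\<omega>\<in>space P. s \<le> \<tau> \<omega>} else {})"
        using val[OF _ s] by (auto simp: image_iff split: if_splits) force+
      also have "\<dots> \<in> sets (F s)" using sets.Int[OF 2 1] sets.Diff[OF sets.top 2] by (simp add: sets.Un)
      finally show "(\<lambda>\<omega>. if s \<le> \<tau> \<omega> then h (the (X s \<omega>)) else 0) -` A \<inter> space (F s) \<in> sets (F s)" .
    qed simp
  next
    show "has_ito_integral P F (\<lambda>t \<omega>. W t \<omega> $ \<alpha>) (\<lambda>s \<omega>. if s \<le> \<tau> \<omega> then \<sigma> (the (X s \<omega>)) $ i $ \<alpha> else 0) (J i \<alpha>)" for i \<alpha>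
      by (rule J)
    show "AE \<omega> in P. \<forall>t\<ge>0. \<forall>i. the (X (min t (\<tau> \<omega>)) \<omega>) $ i - the (X 0 \<omega>) $ i =
             (LBINT s:{0..min t (\<tau> \<omega>)}. \<mu> (the (X s \<omega>)) $ i) + (\<Sum>\<alpha>\<in>UNIV. J i \<alpha> t \<omega>)" by (rule eqn)
  qed
  let ?f = "\<lambda>a y. \<Psi> y $ a"
  let ?h = "\<lambda>a \<alpha> y. \<Sum>i\<in>UNIV. partial i (?f a) y * \<sigma> y $ i $ \<alpha>"
  let ?H = "\<lambda>a \<alpha> s \<omega>. if s \<le> \<tau> \<omega> then \<sigma>' (the (map_process \<Psi> X s \<omega>)) $ a $ \<alpha> else 0"
  have f: "smooth_on M (?f a)" for a by (rule smooth_on_vec_nth[OF M sm(3)])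
  have hc: "continuous_on M (?h a \<alpha>)" for a \<alpha>
    by (intro smooth_on_continuous_on smooth_on_sum smooth_on_mult smooth_on_partial M f smooth_on_vec_nth sm(2))
  have h: "?h a \<alpha> y = \<sigma>' (\<Psi> y) $ a $ \<alpha>" if "y \<in> M" for a \<alpha> y
  proof -
    have "jacobian \<Psi> (at y) ** \<sigma> y = \<sigma>' (\<Psi> y)" using rs that by (simp add: reduced_SDE_def)
    then have "(jacobian \<Psi> (at y) ** \<sigma> y) $ a $ \<alpha> = \<sigma>' (\<Psi> y) $ a $ \<alpha>" by simp
    then show ?thesis
      by (simp add: matrix_matrix_mult_def jacobian_nth partial_vec_nth[OF smooth_on_differentiable[OF sm(3) that]])
  qed
  have Hcut: "?H a \<alpha> s \<omega> = I.cut (?h a \<alpha>) s \<omega>" if "\<omega> \<in> space P" "0 \<le> s" for a \<alpha> s \<omega>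
    using val[OF that] h by (auto simp: I.cut_def map_process_def)
  have regular: "regular_process P F (I.cut (?h a \<alpha>))" for a \<alpha> by (rule I.cut_regular[OF hc])
  have ex: "\<exists>K. has_ito_integral P F (\<lambda>t \<omega>. W t \<omega> $ \<alpha>) (I.cut (?h a \<alpha>)) K" for a \<alpha>
    by (rule B.regular_ito_integral_exists[OF regular])
  define K where "K a \<alpha> = (SOME K. has_ito_integral P F (\<lambda>t \<omega>. W t \<omega> $ \<alpha>) (I.cut (?h a \<alpha>)) K)" for a \<alpha>
  have K: "has_ito_integral P F (\<lambda>t \<omega>. W t \<omega> $ \<alpha>) (I.cut (?h a \<alpha>)) (K a \<alpha>)" for a \<alpha>
    unfolding K_def by (rule someI_ex[OF ex])
  have K': "has_ito_integral P F (\<lambda>t \<omega>. W t \<omega> $ \<alpha>) (?H a \<alpha>) (K a \<alpha>)" for a \<alpha>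
    by (rule has_ito_integral_cong[OF K]) (simp_all only: Hcut B.space_F)
  have gen: "generator \<mu> \<sigma> (?f a) y = \<mu>' (\<Psi> y) $ a" if "y \<in> M" for a y
    using rs that generator_vec_nth[OF M sm(3) that, of \<mu> \<sigma> a] by (simp add: reduced_SDE_def)
  have "AE \<omega> in P. \<forall>a. \<forall>t\<ge>0. ?f a (the (X (min t (\<tau> \<omega>)) \<omega>)) - ?f a (the (X 0 \<omega>))
    = (LBINT s:{0..min t (\<tau> \<omega>)}. generator \<mu> \<sigma> (?f a) (the (X s \<omega>))) + (\<Sum>\<alpha>\<in>UNIV. K a \<alpha> t \<omega>)"
    by (subst AE_all_countable) (auto intro!: I.ito_formula f K)
  then have "AE \<omega> in P. \<forall>t\<ge>0. \<forall>a. the (map_process \<Psi> X (min t (\<tau> \<omega>)) \<omega>) $ a - the (map_process \<Psi> X 0 \<omega>) $ a =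
             (LBINT s:{0..min t (\<tau> \<omega>)}. \<mu>' (the (map_process \<Psi> X s \<omega>)) $ a) + (\<Sum>\<alpha>\<in>UNIV. K a \<alpha> t \<omega>)"
    using AE_space
  proof eventually_elim
    case (elim \<omega>)
    have m: "the (map_process \<Psi> X s \<omega>) = \<Psi> (the (X s \<omega>))" "the (X s \<omega>) \<in> M" if "0 \<le> s" "s \<le> \<tau> \<omega>" for s
      using val[OF elim(2) that] by (auto simp: map_process_def)
    show ?case
    proof (intro allI impI)
      fix t :: real and a assume t: "0 \<le> t"
      have "(LBINT s:{0..min t (\<tau> \<omega>)}. generator \<mu> \<sigma> (?f a) (the (X s \<omega>)))
        = (LBINT s:{0..min t (\<tau> \<omega>)}. \<mu>' (the (map_process \<Psi> X s \<omega>)) $ a)"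
        by (rule set_lebesgue_integral_cong) (auto simp: m gen)
      then show "the (map_process \<Psi> X (min t (\<tau> \<omega>)) \<omega>) $ a - the (map_process \<Psi> X 0 \<omega>) $ a =
             (LBINT s:{0..min t (\<tau> \<omega>)}. \<mu>' (the (map_process \<Psi> X s \<omega>)) $ a) + (\<Sum>\<alpha>\<in>UNIV. K a \<alpha> t \<omega>)"
        using elim(1)[rule_format, OF t, of a] m(1)[of "min t (\<tau> \<omega>)"] m(1)[of 0] \<tau>(1)[OF elim(2)] t by simp
    qed
  qed
  moreover have "process_on P M' (map_process \<Psi> X)" by (rule process_on_map[OF X \<Psi>c]) (simp add: im)
  moreover have "adapted_to P F (map_process \<Psi> X)" by (rule adapted_to_map[OF X ad M \<Psi>c])
  ultimately show ?thesis
    unfolding solves_SDE_until_def using fp bm st \<tau> K'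
    by (intro conjI ballI exI[of _ K] allI) (simp_all add: explosion_time_map_process)
qed

theorem theorem4p1:
  fixes M :: "(real^'n) set" and M' :: "(real^'p) set"
    and \<mu> :: "real^'n \<Rightarrow> real^'n" and \<sigma> :: "real^'n \<Rightarrow> real^'m^'n"
    and \<Psi> :: "real^'n \<Rightarrow> real^'p"
    and Y :: "nat \<Rightarrow> real^'n \<Rightarrow> real^'n" and C :: "nat \<Rightarrow> real^'n \<Rightarrow> real^'m^'m"
    and r k :: nat
  assumes "open M"
    and "is_SDE M \<mu> \<sigma>"
    and "CARD('p) + r = CARD('n)"
    and "reduction_map M M' \<Psi>"
    and "reduction_vector_fields M \<Psi> r k Y"
    and "\<And>i. i \<in> {1..k} \<Longrightarrow> quasi_strong_symmetry M \<mu> \<sigma> (Y i) (C i)"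
    and "\<And>i x. i \<in> {1..k} \<Longrightarrow> x \<in> M \<Longrightarrow> jacobian \<Psi> (at x) ** \<sigma> x ** C i x = 0"
  shows "\<exists>\<mu>' \<sigma>'. reduced_SDE M M' \<Psi> \<mu> \<sigma> \<mu>' \<sigma>' \<and>
     (\<forall>\<mu>'' \<sigma>''. reduced_SDE M M' \<Psi> \<mu> \<sigma> \<mu>'' \<sigma>'' \<longrightarrow> (\<forall>y\<in>M'. \<mu>'' y = \<mu>' y \<and> \<sigma>'' y = \<sigma>' y)) \<and>
     (\<forall>(P :: 'w measure) F X W \<tau>.
        solves_SDE_until M \<mu> \<sigma> P F X W \<tau> \<longrightarrow>
        solves_SDE_until M' \<mu>' \<sigma>' P F (map_process \<Psi> X) W \<tau>)"
proof -
  obtain \<mu>' \<sigma>' where red: "reduced_SDE M M' \<Psi> \<mu> \<sigma> \<mu>' \<sigma>'"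
    using reduced_coefficients_exist[OF assms(1,2,4,5,6,7)] by blast
  \<comment> \<open>\<Psi> maps onto \<open>M'\<close>, so the two identities determine both
    coefficients at every point of \<open>M'\<close>; outside \<open>M'\<close> the total functions
    remain free.\<close>
  have "\<mu>'' y = \<mu>' y \<and> \<sigma>'' y = \<sigma>' y" if "reduced_SDE M M' \<Psi> \<mu> \<sigma> \<mu>'' \<sigma>''" "y \<in> M'" for \<mu>'' \<sigma>'' y
  proof -
    obtain x where "x \<in> M" "y = \<Psi> x" using assms(4) \<open>y \<in> M'\<close> by (auto simp: reduction_map_def)
    then show ?thesis using red that(1) by (simp add: reduced_SDE_def)
  qed
  then show ?thesis using red solution_reduces[OF assms(1,2,4) red] by blast
qed

end
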